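(* Let $\mathcal{T}^h=\{S\}$ be a family of polytopal partitions of $\Omega\subset\mathbb{R}^d$, $d\in\{2,3\}$, into $S$-elements, let $\mathbb{S}_k^h$ be the SBFEM space based on $\mathcal{T}^h$, and let $\mathcal{V}_k^{h,FE}$ be the finite element space based on the conglomerate meshes $\mathcal{P}^h$. Suppose the same trace interpolant $\mathcal{I}_k^h$ is used in the definitions of the SBFEM interpolant $\Pi_k^h$ and of the finite element interpolant $\mathcal{F}_k^{h,FE}$, and that the exact solution $u\in H^1(\Omega)$ of the model problem $\Delta u=0$ in $\Omega$, $u=u_D$ on $\partial\Omega$, is sufficiently regular for these interpolants to make sense. If $u^h\in\mathbb{S}_k^h$ is the associated Galerkin SBFEM approximation, i.e. $$\int_\Omega\nabla u^h\cdot\nabla v\,d\Omega=0\quad\forall v\in\mathbb{S}_k^h\cap H^1_0(\Omega),\qquad u^h|_{\partial\Omega}=\mathcal{I}_k^hu_D|_{\partial\Omega},$$ then $$|u-u^h|_{H^1(\Omega)}\le|u-\mathcal{F}_k^{h,FE}u|_{H^1(\Omega)},$$ where $|w|_{H^1(\Omega)}=\|\nabla w\|_{L^2(\Omega)}$.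
   Context: **Meshes.** $\mathcal{T}^h=\{S\}$ is a conformal partition of $\Omega$ into $S$-elements. An $S$-element is a convex polytope with flat facets and with a point $\mathbf O=\mathbf O_S\in S$ (scaling center) from which every point of its boundary is directly visible. Its scaled boundary $\Gamma^S$ is the union of its facets $L$ (segments if $d=2$; triangles or quadrilaterals if $d=3$), and it is conformally partitioned into sectors $K$, each having $\mathbf O$ as a vertex and one facet $L\subset\Gamma^S$ opposite to $\mathbf O$. The sectors are affine triangles, pyramids or tetrahedra, all of the same type. $\mathcal{E}^h$ is the set of all facets, $\Gamma^h=\bigcup_{L\in\mathcal{E}^h}L$ is the mesh skeleton, $h$ is the characteristic size of the facets, and $\mathcal{P}^h$ (the conglomerate mesh) is the partition of $\Omega$ by all sectors of all $S\in\mathcal{T}^h$. **Trace spaces.** $V_k(L)$ is the space of polynomials of total degree at most $k$ if $L$ is a segment or triangle, and the (mapped) space of polynomials of degree at most $k$ in each coordinate if $L$ is a quadrilateral. $\Lambda_k(\Gamma^h)=\{\alpha\in C^0(\Gamma^h):\alpha|_L\in V_k(L)\ \forall L\in\mathcal{E}^h\}$, and $\Lambda_k(\Gamma^S)$ is defined likewise on $\Gamma^S$. **Duffy and SBFEM spaces.** Points of $S$ are written $\mathbf x=\mathbf O+\xi(\mathbf x_b-\mathbf O)$, $\xi\in[0,1]$, $\mathbf x_b\in\Gamma^S$. $\mathcal{D}_k(S)$ is the function space consisting of the $\phi\in H^1(S)$ obtained by radial extension, $\phi(\mathbf x)=\rho(\xi)\alpha(\mathbf x_b)$, with $\alpha\in\Lambda_k(\Gamma^S)$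 and $\rho$ a radial function on $[0,1]$, the same in all sectors. $\mathcal{D}_0(S)$ is the class obtained from constant traces, i.e. functions $C\rho(\xi)$, and $\mathcal{D}_0^0(S)\subset\mathcal{D}_0(S)$ is the subspace with $\rho(1)=0$. $\mathbb{S}_k(S)$ is the set of $\phi\in\mathcal{D}_k(S)$ with $\int_S\nabla\phi\cdot\nabla\psi\,dS=0$ for all $\psi\in\mathcal{D}_0^0(S)$ with $\psi(\mathbf O)=0$. Finally $\mathbb{S}_k^h=\{w\in H^1(\Omega):w|_S\in\mathbb{S}_k(S)\ \forall S\in\mathcal{T}^h\}$. **Finite element space.** For triangular or tetrahedral $\mathcal{P}^h$, $\mathcal{V}_k^{h,FE}=\{w\in H^1(\Omega):w|_K\in\mathbb{P}_k(K)\ \forall K\in\mathcal{P}^h\}$, with $\mathbb{P}_k(K)$ the polynomials of degree at most $k$. For pyramidal $\mathcal{P}^h$, $\mathcal{V}_k^{h,FE}=\{w\in H^1(\Omega):w|_K\in\mathcal{U}^{(0),k}(K)\ \forall K\in\mathcal{P}^h\}$, where $\mathcal{U}^{(0),k}(K)$ is the $H^1$-conforming rational space of Nigam and Phillips. On the reference pyramid $\check K$ with apex $(0,0,1)$ and base vertices $(0,0,0),(1,0,0),(1,1,0),(0,1,0)$, let $S_\infty(x,y,z)=\left(\frac{x}{1+z},\frac{y}{1+z},\frac{z}{1+z}\right)$ map $\{0\le x,y\le1,\ z\ge0\}\cup\{\infty\}$ onto $\check K$, with $S_\infty(\infty)$ the apex. Then $\mathcal{U}^{(0),k}(\check K)$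 consists of the functions $u\circ S_\infty^{-1}$, with $u$ in the space spanned by $\frac{z^k}{(1+z)^k}$ and all $\frac{q}{(1+z)^k}$, $q$ a polynomial of degree at most $k$ in $x$, $k$ in $y$ and $k-1$ in $z$, whose restrictions to the triangular faces of $\check K$ are polynomials of degree at most $k$; it is transported to $K$ by the affine map of $\check K$ onto $K$ sending the apex to the scaling center. One has $\mathbb{P}_k(K)\subset\mathcal{U}^{(0),k}(K)$, with traces in $\mathbb{P}_k$ on triangular faces and in $V_k(L)$ on the quadrilateral face. **Interpolants.** The trace interpolant $\mathcal{I}_k^h$ maps sufficiently smooth functions $w$ to $\mathcal{I}_k^hw\in\Lambda_k(\Gamma^h)$. It is defined facet by facet, depends only on the restriction of $w$ to the facets, follows any of the interpolation strategies used for the finite element spaces $\mathcal{V}_k^{h,FE}$, and satisfies $\mathcal{I}_k^hw=w|_{\Gamma^h}$ if $w\in H^1(\Omega)$ and $w|_S\in\mathcal{D}_k(S)$ for all $S$. The finite element interpolant $\mathcal{F}_k^{h,FE}w\in\mathcal{V}_k^{h,FE}$ extends its trace interpolant to the interior of the elements of $\mathcal{P}^h$; using the same trace interpolant means $(\mathcal{F}_k^{h,FE}w)|_{\Gamma^h}=\mathcal{I}_k^hw$. The SBFEM interpolant $\Pi_k^hw\in\mathbb{S}_k^h$ is defined elementwise: $\Pi_k^hw|_S\in\mathcal{D}_k(S)$ satisfies $\int_S\nabla(\Pi_k^hw)\cdot\nabla v\,dS=0$ for all $v\in\mathcal{D}_0^0(S)$ and $\Pi_k^hw|_{\Gamma^S}=\mathcal{I}_k^hw|_{\Gamma^S}$.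 *)

theory Defs
  imports "HOL-Analysis.Analysis"
begin

text \<open>Sobolev spaces on an open set \<open>U\<close>. Their elements are represented by functions on the whole
  space, of which only the values almost everywhere in \<open>U\<close> matter. Test functions are of class
  \<open>C\<^sup>1\<close> with compact support in \<open>U\<close> (the convention of Brezis' textbook; it gives the same spaces
  as infinitely differentiable ones).\<close>

definition L2 :: "(real^'n) set \<Rightarrow> (real^'n \<Rightarrow> 'b::euclidean_space) set" where
  "L2 U = {f \<in> borel_measurable (lebesgue_on U). integrable (lebesgue_on U) (\<lambda>x. (norm (f x))\<^sup>2)}"

definition test_function :: "(real^'n) set \<Rightarrow> (real^'n \<Rightarrow> real) \<Rightarrow> (real^'n \<Rightarrow> real^'n) \<Rightarrow> bool" where
  "test_function U \<phi> D \<longleftrightarrow>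
     (\<forall>x. GDERIV \<phi> x :> D x) \<and> continuous_on UNIV D \<and>
     compact (closure {x. \<phi> x \<noteq> 0}) \<and> closure {x. \<phi> x \<noteq> 0} \<subseteq> U"

definition weak_gradient :: "(real^'n) set \<Rightarrow> (real^'n \<Rightarrow> real) \<Rightarrow> (real^'n \<Rightarrow> real^'n) \<Rightarrow> bool" where
  "weak_gradient U w g \<longleftrightarrow>
     (\<forall>\<phi> D i. test_function U \<phi> D \<longrightarrow>
        (LINT x|lebesgue_on U. w x * D x $ i) = - (LINT x|lebesgue_on U. g x $ i * \<phi> x))"

definition H1 :: "(real^'n) set \<Rightarrow> (real^'n \<Rightarrow> real) set" where
  "H1 U = {w \<in> L2 U. \<exists>g \<in> L2 U. weak_gradient U w g}"

definition grad :: "(real^'n) set \<Rightarrow> (real^'n \<Rightarrow> real) \<Rightarrow> real^'n \<Rightarrow> real^'n" where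
  "grad U w = (SOME g. g \<in> L2 U \<and> weak_gradient U w g)"

definition dirichlet_form :: "(real^'n) set \<Rightarrow> (real^'n \<Rightarrow> real) \<Rightarrow> (real^'n \<Rightarrow> real) \<Rightarrow> real" where
  "dirichlet_form U w v = (LINT x|lebesgue_on U. grad U w x \<bullet> grad U v x)"

definition H1_seminorm :: "(real^'n) set \<Rightarrow> (real^'n \<Rightarrow> real) \<Rightarrow> real" where
  "H1_seminorm U w = sqrt (LINT x|lebesgue_on U. (norm (grad U w x))\<^sup>2)"

definition H1_norm :: "(real^'n) set \<Rightarrow> (real^'n \<Rightarrow> real) \<Rightarrow> real" where
  "H1_norm U w = sqrt ((LINT x|lebesgue_on U. (w x)\<^sup>2) + (H1_seminorm U w)\<^sup>2)"

definition H10 :: "(real^'n) set \<Rightarrow> (real^'n \<Rightarrow> real) set" where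
  "H10 U = {w \<in> H1 U. \<forall>\<epsilon>>0. \<exists>\<phi> D. test_function U \<phi> D \<and> H1_norm U (\<lambda>x. w x - \<phi> x) < \<epsilon>}"

text \<open>\<open>g\<close> is the trace on \<open>\<Gamma> \<subseteq> closure \<Omega>\<close> of the class of \<open>w\<close>: some representative of \<open>w\<close> is continuous
  up to \<open>\<Gamma>\<close> and equals \<open>g\<close> there. Continuity is required only near \<open>\<Gamma>\<close> because radial functions may
  be singular at the scaling centers.\<close>

definition has_trace ::
    "(real^'n) set \<Rightarrow> (real^'n) set \<Rightarrow> (real^'n \<Rightarrow> real) \<Rightarrow> (real^'n \<Rightarrow> real) \<Rightarrow> bool" where
  "has_trace \<Omega> \<Gamma> w g \<longleftrightarrow>
     (\<exists>v N. (AE x in lebesgue_on \<Omega>. v x = w x) \<and> open N \<and> \<Gamma> \<subseteq> N \<and>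
        continuous_on (N \<inter> closure \<Omega>) v \<and> (\<forall>x\<in>\<Gamma>. v x = g x))"

definition poly_space :: "('n::finite \<Rightarrow> nat) set \<Rightarrow> (real^'n \<Rightarrow> real) set" where
  "poly_space A = {\<lambda>x. \<Sum>e\<in>A. c e * (\<Prod>i\<in>UNIV. x $ i ^ e i) | c. True}"

definition Pk :: "nat \<Rightarrow> (real^'n \<Rightarrow> real) set" where
  "Pk k = poly_space {e. (\<Sum>i\<in>UNIV. e i) \<le> k}"

datatype sector_type = Simplicial | Pyramidal

text \<open>The facets of an element are the flat pieces \<open>L\<close> that make up its scaled boundary. They may be
  the facets of the polytope, or subdivide them conformally.\<close>

record ('n::finite) S_element =
  body :: "(real^'n) set"
  center :: "real^'n"
  facets :: "(real^'n) set set"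

text \<open>An affine pyramid has a parallelogram as base, so quadrilateral facets are affine images of
  the unit square.\<close>

definition parallelogram :: "real^'n \<Rightarrow> real^'n \<Rightarrow> real^'n \<Rightarrow> (real^'n) set \<Rightarrow> bool" where
  "parallelogram a e f L \<longleftrightarrow>
     e \<noteq> f \<and> independent {e, f} \<and> L = (\<lambda>s::real^2. a + s $ 1 *\<^sub>R e + s $ 2 *\<^sub>R f) ` cbox 0 1"

definition facet_shape :: "sector_type \<Rightarrow> (real^'n) set \<Rightarrow> bool" where
  "facet_shape \<tau> L = (case \<tau> of
      Simplicial \<Rightarrow> (int CARD('n) - 1) simplex L
    | Pyramidal \<Rightarrow> CARD('n) = 3 \<and> (\<exists>a e f. parallelogram a e f L))"

definition conforming_facets :: "(real^'n) set set \<Rightarrow> bool" where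
  "conforming_facets E \<longleftrightarrow> (\<forall>L\<in>E. \<forall>L'\<in>E. (L \<inter> L') face_of L \<and> (L \<inter> L') face_of L')"

definition is_S_element :: "sector_type \<Rightarrow> 'n::finite S_element \<Rightarrow> bool" where
  "is_S_element \<tau> S \<longleftrightarrow>
     polytope (body S) \<and> interior (body S) \<noteq> {} \<and>
     center S \<in> body S \<and>
     (\<forall>x\<in>frontier (body S). open_segment (center S) x \<subseteq> interior (body S)) \<and>
     finite (facets S) \<and> \<Union>(facets S) = frontier (body S) \<and>
     (\<forall>L\<in>facets S. facet_shape \<tau> L) \<and> conforming_facets (facets S)"

definition sector :: "'n::finite S_element \<Rightarrow> (real^'n) set \<Rightarrow> (real^'n) set" where
  "sector S L = convex hull (insert (center S) L)"

definition mesh_facets :: "'n::finite S_element set \<Rightarrow> (real^'n) set set" where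
  "mesh_facets T = (\<Union>S\<in>T. facets S)"

definition skeleton :: "'n::finite S_element set \<Rightarrow> (real^'n) set" where
  "skeleton T = \<Union>(mesh_facets T)"

definition S_mesh :: "(real^'n) set \<Rightarrow> sector_type \<Rightarrow> 'n::finite S_element set \<Rightarrow> bool" where
  "S_mesh \<Omega> \<tau> T \<longleftrightarrow>
     finite T \<and> (\<forall>S\<in>T. is_S_element \<tau> S) \<and>
     (\<forall>S\<in>T. \<forall>S'\<in>T. S \<noteq> S' \<longrightarrow> interior (body S) \<inter> interior (body S') = {}) \<and>
     \<Omega> = interior (\<Union>S\<in>T. body S) \<and>
     conforming_facets (mesh_facets T)"

definition Vk :: "sector_type \<Rightarrow> nat \<Rightarrow> (real^'n) set \<Rightarrow> (real^'n \<Rightarrow> real) set" where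
  "Vk \<tau> k L = (case \<tau> of
      Simplicial \<Rightarrow> {\<alpha>. \<exists>p\<in>Pk k. \<forall>x\<in>L. \<alpha> x = p x}
    | Pyramidal \<Rightarrow> {\<alpha>. \<exists>a e f. parallelogram a e f L \<and>
        (\<exists>q\<in>poly_space {m. \<forall>i. m i \<le> k}.
           \<forall>s\<in>cbox (0::real^2) 1. \<alpha> (a + s $ 1 *\<^sub>R e + s $ 2 *\<^sub>R f) = q s)})"

definition Lambda :: "sector_type \<Rightarrow> nat \<Rightarrow> (real^'n) set set \<Rightarrow> (real^'n \<Rightarrow> real) set" where
  "Lambda \<tau> k E = {\<alpha>. continuous_on (\<Union>E) \<alpha> \<and> (\<forall>L\<in>E. \<alpha> \<in> Vk \<tau> k L)}"

definition duffy_point :: "'n::finite S_element \<Rightarrow> real \<Rightarrow> real^'n \<Rightarrow> real^'n" where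
  "duffy_point S \<xi> b = center S + \<xi> *\<^sub>R (b - center S)"

text \<open>The Duffy space is a linear space, so its elements are finite sums of radial extensions
  \<open>\<rho>(\<xi>) \<alpha>(b)\<close>. Square integrability of the gradient makes \<open>\<rho>\<close> continuous on \<open>(0,1]\<close> after a change on
  a null set; this choice is fixed so that \<open>\<rho> 1\<close> has a meaning. No condition is imposed at \<open>\<xi> = 0\<close>.\<close>

definition duffy_space ::
    "sector_type \<Rightarrow> nat \<Rightarrow> 'n::finite S_element \<Rightarrow> (real^'n \<Rightarrow> real) set" where
  "duffy_space \<tau> k S = {\<phi> \<in> H1 (interior (body S)).
     \<exists>(n::nat) \<rho> \<alpha> \<psi>.
       (\<forall>i<n. continuous_on {0<..1::real} (\<rho> i) \<and> \<alpha> i \<in> Lambda \<tau> k (facets S)) \<and>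
       (AE x in lebesgue_on (body S). \<phi> x = \<psi> x) \<and>
       (\<forall>\<xi>\<in>{0<..1}. \<forall>b\<in>\<Union>(facets S). \<psi> (duffy_point S \<xi> b) = (\<Sum>i<n. \<rho> i \<xi> * \<alpha> i b))}"

definition radial_form ::
    "'n::finite S_element \<Rightarrow> real \<Rightarrow> (real \<Rightarrow> real) \<Rightarrow> (real^'n \<Rightarrow> real) \<Rightarrow> bool" where
  "radial_form S C \<rho> \<phi> \<longleftrightarrow>
     \<phi> \<in> H1 (interior (body S)) \<and> continuous_on {0<..1} \<rho> \<and>
     (\<exists>\<psi>. (AE x in lebesgue_on (body S). \<phi> x = \<psi> x) \<and>
        (\<forall>\<xi>\<in>{0<..1}. \<forall>b\<in>\<Union>(facets S). \<psi> (duffy_point S \<xi> b) = C * \<rho> \<xi>))"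

definition D00 :: "'n::finite S_element \<Rightarrow> (real^'n \<Rightarrow> real) set" where
  "D00 S = {\<phi>. \<exists>C \<rho>. radial_form S C \<rho> \<phi> \<and> \<rho> 1 = 0}"

text \<open>The functions of \<open>D00 S\<close> that are continuous at the scaling center and vanish there.\<close>

definition D00_center :: "'n::finite S_element \<Rightarrow> (real^'n \<Rightarrow> real) set" where
  "D00_center S =
     {\<phi>. \<exists>C \<rho>. radial_form S C \<rho> \<phi> \<and> \<rho> 1 = 0 \<and> ((\<lambda>\<xi>. C * \<rho> \<xi>) \<longlongrightarrow> 0) (at_right 0)}"

definition SBFEM_local ::
    "sector_type \<Rightarrow> nat \<Rightarrow> 'n::finite S_element \<Rightarrow> (real^'n \<Rightarrow> real) set" where
  "SBFEM_local \<tau> k S =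
     {\<phi> \<in> duffy_space \<tau> k S. \<forall>\<psi>\<in>D00_center S. dirichlet_form (interior (body S)) \<phi> \<psi> = 0}"

definition SBFEM_space ::
    "(real^'n) set \<Rightarrow> sector_type \<Rightarrow> nat \<Rightarrow> 'n::finite S_element set \<Rightarrow> (real^'n \<Rightarrow> real) set" where
  "SBFEM_space \<Omega> \<tau> k T = {w \<in> H1 \<Omega>. \<forall>S\<in>T. w \<in> SBFEM_local \<tau> k S}"

definition ref_pyramid :: "(real^3) set" where
  "ref_pyramid = convex hull
     {vector [0,0,1], vector [0,0,0], vector [1,0,0], vector [1,1,0], vector [0,1,0]}"

definition S_infty :: "real^3 \<Rightarrow> real^3" where
  "S_infty s = vector [s $ 1 / (1 + s $ 3), s $ 2 / (1 + s $ 3), s $ 3 / (1 + s $ 3)]"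

text \<open>The value at the apex is the limit for \<open>z \<rightarrow> \<infinity>\<close>, to which only \<open>z\<^sup>k / (1 + z)\<^sup>k\<close> contributes. The
  triangular faces are the facets that contain the apex.\<close>

definition ref_pyramid_space :: "nat \<Rightarrow> (real^3 \<Rightarrow> real) set" where
  "ref_pyramid_space k = {u. \<exists>c. \<exists>q\<in>poly_space {m. m 1 \<le> k \<and> m 2 \<le> k \<and> m 3 \<le> k - 1}.
     (\<forall>s. 0 \<le> s $ 1 \<and> s $ 1 \<le> 1 \<and> 0 \<le> s $ 2 \<and> s $ 2 \<le> 1 \<and> 0 \<le> s $ 3 \<longrightarrow>
        u (S_infty s) = c * (s $ 3 ^ k / (1 + s $ 3) ^ k) + q s / (1 + s $ 3) ^ k) \<and>
     u (vector [0,0,1]) = c \<and>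
     (\<forall>F. F facet_of ref_pyramid \<and> vector [0,0,1] \<in> F \<longrightarrow> (\<exists>p\<in>Pk k. \<forall>x\<in>F. u x = p x))}"

definition FE_local ::
    "sector_type \<Rightarrow> nat \<Rightarrow> 'n::finite S_element \<Rightarrow> (real^'n) set \<Rightarrow> (real^'n \<Rightarrow> real) set" where
  "FE_local \<tau> k S L = (case \<tau> of
      Simplicial \<Rightarrow> {w. \<exists>p\<in>Pk k. AE x in lebesgue_on (sector S L). w x = p x}
    | Pyramidal \<Rightarrow> {w. \<exists>a e f. parallelogram a e f L \<and>
        (\<exists>u\<in>ref_pyramid_space k. \<exists>v.
           (\<forall>p\<in>ref_pyramid.
              v (a + p $ 1 *\<^sub>R e + p $ 2 *\<^sub>R f + p $ 3 *\<^sub>R (center S - a)) = u p) \<and>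
           (AE x in lebesgue_on (sector S L). w x = v x))})"

definition FE_space ::
    "(real^'n) set \<Rightarrow> sector_type \<Rightarrow> nat \<Rightarrow> 'n::finite S_element set \<Rightarrow> (real^'n \<Rightarrow> real) set" where
  "FE_space \<Omega> \<tau> k T = {w \<in> H1 \<Omega>. \<forall>S\<in>T. \<forall>L\<in>facets S. w \<in> FE_local \<tau> k S L}"

text \<open>A trace interpolant is given facet by facet: \<open>I L g\<close> is the interpolant on \<open>L\<close> and depends only
  on the values of \<open>g\<close> on \<open>L\<close>. \<open>Dom\<close> contains the skeleton traces of the functions that are smooth
  enough to be interpolated.\<close>

definition glue ::
    "'n::finite S_element set \<Rightarrow> ((real^'n) set \<Rightarrow> (real^'n \<Rightarrow> real) \<Rightarrow> real^'n \<Rightarrow> real) \<Rightarrow>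
     (real^'n \<Rightarrow> real) \<Rightarrow> real^'n \<Rightarrow> real" where
  "glue T I g x = I (SOME L. L \<in> mesh_facets T \<and> x \<in> L) g x"

definition trace_interpolant ::
    "(real^'n) set \<Rightarrow> sector_type \<Rightarrow> nat \<Rightarrow> 'n::finite S_element set \<Rightarrow> (real^'n \<Rightarrow> real) set \<Rightarrow>
     ((real^'n) set \<Rightarrow> (real^'n \<Rightarrow> real) \<Rightarrow> real^'n \<Rightarrow> real) \<Rightarrow> bool" where
  "trace_interpolant \<Omega> \<tau> k T Dom I \<longleftrightarrow>
     (\<forall>L\<in>mesh_facets T. \<forall>g g'. (\<forall>x\<in>L. g x = g' x) \<longrightarrow> (\<forall>x\<in>L. I L g x = I L g' x)) \<and>
     (\<forall>g\<in>Dom. glue T I g \<in> Lambda \<tau> k (mesh_facets T) \<and>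
        (\<forall>L\<in>mesh_facets T. \<forall>x\<in>L. glue T I g x = I L g x)) \<and>
     (\<forall>w\<in>H1 \<Omega>. \<forall>g. (\<forall>S\<in>T. w \<in> duffy_space \<tau> k S) \<and> has_trace \<Omega> (skeleton T) w g \<longrightarrow>
        g \<in> Dom \<and> (\<forall>x\<in>skeleton T. glue T I g x = g x))"

definition FE_interpolant ::
    "(real^'n) set \<Rightarrow> sector_type \<Rightarrow> nat \<Rightarrow> 'n::finite S_element set \<Rightarrow> (real^'n \<Rightarrow> real) set \<Rightarrow>
     ((real^'n) set \<Rightarrow> (real^'n \<Rightarrow> real) \<Rightarrow> real^'n \<Rightarrow> real) \<Rightarrow>
     ((real^'n \<Rightarrow> real) \<Rightarrow> real^'n \<Rightarrow> real) \<Rightarrow> bool" where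
  "FE_interpolant \<Omega> \<tau> k T Dom I F \<longleftrightarrow>
     (\<forall>w\<in>H1 \<Omega>. \<forall>g\<in>Dom. has_trace \<Omega> (skeleton T) w g \<longrightarrow>
        F w \<in> FE_space \<Omega> \<tau> k T \<and> has_trace \<Omega> (skeleton T) (F w) (glue T I g))"

definition SBFEM_interpolant ::
    "(real^'n) set \<Rightarrow> sector_type \<Rightarrow> nat \<Rightarrow> 'n::finite S_element set \<Rightarrow> (real^'n \<Rightarrow> real) set \<Rightarrow>
     ((real^'n) set \<Rightarrow> (real^'n \<Rightarrow> real) \<Rightarrow> real^'n \<Rightarrow> real) \<Rightarrow>
     ((real^'n \<Rightarrow> real) \<Rightarrow> real^'n \<Rightarrow> real) \<Rightarrow> bool" where
  "SBFEM_interpolant \<Omega> \<tau> k T Dom I PiS \<longleftrightarrow>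
     (\<forall>w\<in>H1 \<Omega>. \<forall>g\<in>Dom. has_trace \<Omega> (skeleton T) w g \<longrightarrow>
        PiS w \<in> SBFEM_space \<Omega> \<tau> k T \<and> has_trace \<Omega> (skeleton T) (PiS w) (glue T I g) \<and>
        (\<forall>S\<in>T. PiS w \<in> duffy_space \<tau> k S \<and>
           (\<forall>v\<in>D00 S. dirichlet_form (interior (body S)) (PiS w) v = 0)))"

definition model_solution ::
    "(real^'n) set \<Rightarrow> (real^'n \<Rightarrow> real) \<Rightarrow> (real^'n \<Rightarrow> real) \<Rightarrow> bool" where
  "model_solution \<Omega> u\<^sub>D u \<longleftrightarrow>
     u \<in> H1 \<Omega> \<and> (\<forall>v\<in>H10 \<Omega>. dirichlet_form \<Omega> u v = 0) \<and> has_trace \<Omega> (frontier \<Omega>) u u\<^sub>D"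

text \<open>As \<open>u\<^sub>D\<close> is given on the boundary only, its interpolant is taken on the boundary facets.\<close>

definition galerkin_SBFEM ::
    "(real^'n) set \<Rightarrow> sector_type \<Rightarrow> nat \<Rightarrow> 'n::finite S_element set \<Rightarrow>
     ((real^'n) set \<Rightarrow> (real^'n \<Rightarrow> real) \<Rightarrow> real^'n \<Rightarrow> real) \<Rightarrow>
     (real^'n \<Rightarrow> real) \<Rightarrow> (real^'n \<Rightarrow> real) \<Rightarrow> bool" where
  "galerkin_SBFEM \<Omega> \<tau> k T I u\<^sub>D uh \<longleftrightarrow>
     uh \<in> SBFEM_space \<Omega> \<tau> k T \<and>
     (\<forall>v\<in>SBFEM_space \<Omega> \<tau> k T \<inter> H10 \<Omega>. dirichlet_form \<Omega> uh v = 0) \<and>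
     (\<exists>g. has_trace \<Omega> (frontier \<Omega>) uh g \<and>
        (\<forall>L\<in>mesh_facets T. L \<subseteq> frontier \<Omega> \<longrightarrow> (\<forall>x\<in>L. g x = I L u\<^sub>D x)))"

end

theory Submission
  imports Defs
begin

text \<open>In every sector a finite element function \<open>w\<close> is a polynomial \<open>\<Sum>j\<le>k. \<xi>\<^sup>j \<beta>\<^sub>j(b)\<close> in the radial variable,
  with a constant \<open>\<beta>\<^sub>0\<close>, and continuity across the facets makes the \<open>\<beta>\<^sub>j\<close> of the sectors of an element
  fit together; so \<open>w\<close> belongs to the Duffy spaces. Its gradient is a sum of terms \<open>\<xi>\<^sup>j h\<^sub>j(b)\<close> and that of
  a radial function is a multiple of \<open>\<nabla>\<xi>\<close>. Subtracting from \<open>w\<close> a combination \<open>P\<close> of the radial functions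
  \<open>\<xi>\<^sup>j - 1\<close> on each element makes the mean of \<open>h\<^sub>j \<bullet> \<nabla>\<xi>\<close> over the element zero; a coefficient
  that is homogeneous of degree zero and has mean zero is orthogonal to every radial function, hence \<open>w - P\<close>
  is orthogonal to the radial functions and lies in the SBFEM space.

  For \<open>w = F u\<close>, both \<open>P\<close> and \<open>w - P - uh\<close> lie in \<open>H10 \<Omega>\<close>. Orthogonality of \<open>\<nabla>u\<close> and \<open>\<nabla>uh\<close> to
  \<open>\<nabla>(w - P - uh)\<close> gives the best approximation property of \<open>uh\<close> against \<open>w - P\<close>, and orthogonality
  of \<open>\<nabla>u\<close> and \<open>\<nabla>(w - P)\<close> to \<open>\<nabla>P\<close> shows that passing from \<open>w\<close> to \<open>w - P\<close> does not increase the error.\<close>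

section \<open>Square integrable functions\<close>

text \<open>The radial functions to be tested against are known only through a continuous profile on
  \<open>{0<..1}\<close> and some square integrable weak gradient, while the coefficients
  \<open>h\<^sub>j\<close> jump from one sector to the next, so neither side can be differentiated
  classically. Both are therefore handled by group actions: translations parallel to a piece show
  that the gradient of a radial function points along \<open>nrm L\<close>, and dilations about the
  center control its component along the rays. The constancy of \<open>\<beta>\<^sub>0\<close>, the
  value at the scaling center, matters because the tangential derivative of a function of b carries
  a factor 1/\<xi>; all other terms bring a power of \<xi> that cancels it. Traces are values of
  continuous representatives, so membership in \<open>H10\<close> has to be proved by truncation and
  mollification. The Galerkin boundary data are given facet by facet, which calls for the fact that
  the boundary of \<Omega> is covered by the mesh facets lying in it.\<close>

definition square_integrable :: "'a measure \<Rightarrow> ('a \<Rightarrow> 'b::euclidean_space) set" where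
  "square_integrable M = {f \<in> borel_measurable M. integrable M (\<lambda>x. (norm (f x))\<^sup>2)}"

text \<open>The square is kept in place of the norm: expansions stay polynomial, and the triangle
  inequality is used in the form with factors 2.\<close>

definition sqnorm :: "'a measure \<Rightarrow> ('a \<Rightarrow> 'b::euclidean_space) \<Rightarrow> real" where
  "sqnorm M f = (LINT x|M. (norm (f x))\<^sup>2)"

lemma L2_eq: "L2 U = square_integrable (lebesgue_on U)"
  by (simp add: L2_def square_integrable_def)

lemma square_integrable_measurable: "f \<in> square_integrable M \<Longrightarrow> f \<in> borel_measurable M"
  by (simp add: square_integrable_def)

lemma square_integrable_norm: "f \<in> square_integrable M \<Longrightarrow> integrable M (\<lambda>x. (norm (f x))\<^sup>2)"
  by (simp add: square_integrable_def)

lemma square_integrable_bound: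
  assumes "f \<in> square_integrable M" "g \<in> borel_measurable M" "AE x in M. norm (g x) \<le> C * norm (f x)"
  shows "g \<in> square_integrable M"
proof -
  have "integrable M (\<lambda>x. C\<^sup>2 * (norm (f x))\<^sup>2)"
    using square_integrable_norm[OF assms(1)] by simp
  then have "integrable M (\<lambda>x. (norm (g x))\<^sup>2)"
  proof (rule Bochner_Integration.integrable_bound)
    show "(\<lambda>x. (norm (g x))\<^sup>2) \<in> borel_measurable M"
      using assms(2) by measurable
    show "AE x in M. norm ((norm (g x))\<^sup>2) \<le> norm (C\<^sup>2 * (norm (f x))\<^sup>2)"
      using assms(3)
    proof eventually_elim
      case (elim x)
      then have "(norm (g x))\<^sup>2 \<le> (C * norm (f x))\<^sup>2"
        by (intro power_mono) auto
      then show ?case by (simp add: power_mult_distrib)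
    qed
  qed
  then show ?thesis using assms(2) by (simp add: square_integrable_def)
qed

lemma square_integrable_inner:
  assumes "f \<in> square_integrable M" "g \<in> square_integrable M"
  shows "integrable M (\<lambda>x. f x \<bullet> g x)"
proof (rule Bochner_Integration.integrable_bound)
  show "integrable M (\<lambda>x. (norm (f x))\<^sup>2 + (norm (g x))\<^sup>2)"
    using assms by (simp add: square_integrable_norm)
  show "(\<lambda>x. f x \<bullet> g x) \<in> borel_measurable M"
    using assms[THEN square_integrable_measurable] by measurable
  show "AE x in M. norm (f x \<bullet> g x) \<le> norm ((norm (f x))\<^sup>2 + (norm (g x))\<^sup>2)"
  proof (rule AE_I2)
    fix x
    have "\<bar>f x \<bullet> g x\<bar> \<le> norm (f x) * norm (g x)" by (rule Cauchy_Schwarz_ineq2)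
    also have "\<dots> \<le> (norm (f x))\<^sup>2 + (norm (g x))\<^sup>2"
      using sum_squares_bound[of "norm (f x)" "norm (g x)"]
        mult_nonneg_nonneg[OF norm_ge_zero[of "f x"] norm_ge_zero[of "g x"]] by linarith
    finally show "norm (f x \<bullet> g x) \<le> norm ((norm (f x))\<^sup>2 + (norm (g x))\<^sup>2)" by simp
  qed
qed

lemma square_integrable_mult:
  fixes f g :: "'a \<Rightarrow> real"
  assumes "f \<in> square_integrable M" "g \<in> square_integrable M"
  shows "integrable M (\<lambda>x. f x * g x)"
  using square_integrable_inner[OF assms] by simp

lemma square_integrable_add:
  assumes "f \<in> square_integrable M" "g \<in> square_integrable M"
  shows "(\<lambda>x. f x + g x) \<in> square_integrable M"
proof -
  have "(norm (f x + g x))\<^sup>2 = (norm (f x))\<^sup>2 + 2 * (f x \<bullet> g x) + (norm (g x))\<^sup>2" for x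
    by (simp add: power2_norm_eq_inner inner_add inner_commute)
  moreover have "(\<lambda>x. f x + g x) \<in> borel_measurable M"
    using assms[THEN square_integrable_measurable] by measurable
  ultimately show ?thesis
    using assms square_integrable_inner[OF assms] by (simp add: square_integrable_def)
qed

lemma square_integrable_scaleR:
  assumes "f \<in> square_integrable M"
  shows "(\<lambda>x. c *\<^sub>R f x) \<in> square_integrable M"
proof (rule square_integrable_bound[OF assms, where C = "\<bar>c\<bar>"])
  show "(\<lambda>x. c *\<^sub>R f x) \<in> borel_measurable M"
    using square_integrable_measurable[OF assms] by measurable
qed simp

lemma square_integrable_diff:
  assumes "f \<in> square_integrable M" "g \<in> square_integrable M"
  shows "(\<lambda>x. f x - g x) \<in> square_integrable M"
  using square_integrable_add[OF assms(1) square_integrable_scaleR[OF assms(2), of "-1"]] by simp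

lemma square_integrable_zero: "(\<lambda>x. 0) \<in> square_integrable M"
  by (simp add: square_integrable_def)

lemma square_integrable_sum:
  assumes "\<And>i. i \<in> A \<Longrightarrow> f i \<in> square_integrable M"
  shows "(\<lambda>x. \<Sum>i\<in>A. f i x) \<in> square_integrable M"
  using assms
proof (induction A rule: infinite_finite_induct)
  case (insert i A)
  then show ?case
    using square_integrable_add[of "f i" M "\<lambda>x. \<Sum>i\<in>A. f i x"] by simp
qed (simp_all add: square_integrable_zero)

lemma square_integrable_nth:
  fixes f :: "'a \<Rightarrow> real^'n"
  assumes "f \<in> square_integrable M"
  shows "(\<lambda>x. f x $ i) \<in> square_integrable M"
proof (rule square_integrable_bound[OF assms, where C = 1])
  have "(\<lambda>x. f x \<bullet> axis i 1) \<in> borel_measurable M"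
    using square_integrable_measurable[OF assms] by measurable
  then show "(\<lambda>x. f x $ i) \<in> borel_measurable M"
    by (simp add: inner_axis)
qed (simp add: component_le_norm_cart)

lemma square_integrable_vec:
  fixes f :: "'a \<Rightarrow> real^'n"
  assumes "\<And>i. (\<lambda>x. f x $ i) \<in> square_integrable M"
  shows "f \<in> square_integrable M"
proof -
  have eq: "f = (\<lambda>x. \<Sum>i\<in>UNIV. f x $ i *\<^sub>R axis i 1)"
    by (auto simp: fun_eq_iff vec_eq_iff axis_def if_distrib cong: if_cong)
  have "(\<lambda>x. \<Sum>i\<in>UNIV. f x $ i *\<^sub>R (axis i 1 :: real^'n)) \<in> borel_measurable M"
    by (rule borel_measurable_sum, rule borel_measurable_scaleR[OF square_integrable_measurable[OF assms]
          borel_measurable_const])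
  then have m: "f \<in> borel_measurable M" by (subst eq)
  have "integrable M (\<lambda>x. \<Sum>i\<in>UNIV. (norm (f x $ i))\<^sup>2)"
    using square_integrable_norm[OF assms] by (intro Bochner_Integration.integrable_sum)
  moreover have "(\<lambda>x. \<Sum>i\<in>UNIV. (norm (f x $ i))\<^sup>2) = (\<lambda>x. (norm (f x))\<^sup>2)"
    unfolding power2_norm_eq_inner inner_vec_def by simp
  ultimately show ?thesis
    using m by (simp add: square_integrable_def)
qed

lemma square_integrable_bounded_mult:
  fixes h :: "'a \<Rightarrow> real"
  assumes "f \<in> square_integrable M" "h \<in> borel_measurable M" "AE x in M. \<bar>h x\<bar> \<le> C"
  shows "(\<lambda>x. h x *\<^sub>R f x) \<in> square_integrable M"
proof (rule square_integrable_bound[OF assms(1), where C = C])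
  show "(\<lambda>x. h x *\<^sub>R f x) \<in> borel_measurable M"
    using square_integrable_measurable[OF assms(1)] assms(2) by measurable
  show "AE x in M. norm (h x *\<^sub>R f x) \<le> C * norm (f x)"
    using assms(3) by eventually_elim (simp add: mult_right_mono)
qed

lemma square_integrable_bounded:
  assumes "finite_measure M" "f \<in> borel_measurable M" "AE x in M. norm (f x) \<le> C"
  shows "f \<in> square_integrable M"
proof -
  interpret finite_measure M by fact
  have "(\<lambda>x. 1::real) \<in> square_integrable M" by (simp add: square_integrable_def)
  from square_integrable_bound[OF this assms(2), of C] assms(3) show ?thesis by simp
qed

lemma square_integrable_imp_integrable:
  assumes "finite_measure M" "f \<in> square_integrable M"
  shows "integrable M f"
proof -
  interpret finite_measure M by fact
  have "integrable M (\<lambda>x. (norm (f x))\<^sup>2 + 1)"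
    using square_integrable_norm[OF assms(2)] by simp
  then show ?thesis
  proof (rule Bochner_Integration.integrable_bound)
    show "AE x in M. norm (f x) \<le> norm ((norm (f x))\<^sup>2 + 1)"
    proof (rule AE_I2)
      fix x
      have "2 * norm (f x) * 1 \<le> (norm (f x))\<^sup>2 + 1\<^sup>2" by (rule sum_squares_bound)
      then show "norm (f x) \<le> norm ((norm (f x))\<^sup>2 + 1)"
        using norm_ge_zero[of "f x"] zero_le_power2[of "norm (f x)"] by (simp add: abs_if)
    qed
  qed (rule square_integrable_measurable[OF assms(2)])
qed

lemma square_integrable_AE_cong:
  assumes "f \<in> square_integrable M" "g \<in> borel_measurable M" "AE x in M. g x = f x"
  shows "g \<in> square_integrable M"
  by (rule square_integrable_bound[OF assms(1,2), where C = 1]) (use assms(3) in auto)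

section \<open>Squared norms, Cauchy-Schwarz and limits in square mean\<close>

lemma sqnorm_nonneg: "sqnorm M f \<ge> 0"
  by (simp add: sqnorm_def)

lemma sqnorm_AE_cong:
  assumes "f \<in> borel_measurable M" "g \<in> borel_measurable M" "AE x in M. f x = g x"
  shows "sqnorm M f = sqnorm M g"
  unfolding sqnorm_def
proof (rule integral_cong_AE)
  show "(\<lambda>x. (norm (f x))\<^sup>2) \<in> borel_measurable M" using assms(1) by measurable
  show "(\<lambda>x. (norm (g x))\<^sup>2) \<in> borel_measurable M" using assms(2) by measurable
  show "AE x in M. (norm (f x))\<^sup>2 = (norm (g x))\<^sup>2" using assms(3) by eventually_elim simp
qed

lemma sqnorm_add:
  assumes "f \<in> square_integrable M" "g \<in> square_integrable M"
  shows "sqnorm M (\<lambda>x. f x + g x) = sqnorm M f + 2 * (LINT x|M. f x \<bullet> g x) + sqnorm M g"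
proof -
  have "(norm (f x + g x))\<^sup>2 = (norm (f x))\<^sup>2 + 2 * (f x \<bullet> g x) + (norm (g x))\<^sup>2" for x
    by (simp add: power2_norm_eq_inner inner_add inner_commute)
  then show ?thesis
    using assms square_integrable_inner[OF assms] by (simp add: sqnorm_def square_integrable_norm)
qed

lemma sqnorm_scaleR: "sqnorm M (\<lambda>x. c *\<^sub>R f x) = c\<^sup>2 * sqnorm M f"
  by (simp add: sqnorm_def power_mult_distrib)

lemma sqnorm_mono:
  assumes "f \<in> square_integrable M" "g \<in> square_integrable M" "AE x in M. norm (f x) \<le> norm (g x)"
  shows "sqnorm M f \<le> sqnorm M g"
  unfolding sqnorm_def
proof (rule integral_mono_AE[OF square_integrable_norm[OF assms(1)] square_integrable_norm[OF assms(2)]])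
  show "AE x in M. (norm (f x))\<^sup>2 \<le> (norm (g x))\<^sup>2"
    using assms(3) by eventually_elim (simp add: power_mono)
qed

lemma sqnorm_add_le:
  assumes "f \<in> square_integrable M" "g \<in> square_integrable M"
  shows "sqnorm M (\<lambda>x. f x + g x) \<le> 2 * sqnorm M f + 2 * sqnorm M g"
proof -
  have "sqnorm M (\<lambda>x. f x - g x) = sqnorm M f - 2 * (LINT x|M. f x \<bullet> g x) + sqnorm M g"
    using sqnorm_add[OF assms(1) square_integrable_scaleR[OF assms(2), of "-1"]]
      sqnorm_scaleR[of M "-1" g] by simp
  then show ?thesis
    using sqnorm_add[OF assms] sqnorm_nonneg[of M "\<lambda>x. f x - g x"] by simp
qed

lemma sqnorm_triangle_le:
  assumes "f \<in> square_integrable M" "g \<in> square_integrable M" "h \<in> square_integrable M"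
  shows "sqnorm M (\<lambda>x. f x - h x) \<le> 2 * sqnorm M (\<lambda>x. f x - g x) + 2 * sqnorm M (\<lambda>x. g x - h x)"
  using sqnorm_add_le[OF square_integrable_diff[OF assms(1,2)] square_integrable_diff[OF assms(2,3)]]
  by simp

text \<open>The quadratic in t given by \<open>sqnorm\<close> of f + t g is nonnegative, so its
  discriminant is not positive.\<close>

lemma Cauchy_Schwarz_integral:
  assumes "f \<in> square_integrable M" "g \<in> square_integrable M"
  shows "\<bar>LINT x|M. f x \<bullet> g x\<bar> \<le> sqrt (sqnorm M f) * sqrt (sqnorm M g)"
proof -
  define a b c where "a = sqnorm M f" and "b = (LINT x|M. f x \<bullet> g x)" and "c = sqnorm M g"
  have pos: "0 \<le> a + 2 * t * b + t\<^sup>2 * c" for t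
    using sqnorm_add[OF assms(1) square_integrable_scaleR[OF assms(2), of t]]
      sqnorm_nonneg[of M "\<lambda>x. f x + t *\<^sub>R g x"] sqnorm_scaleR[of M t g]
    by (simp add: a_def b_def c_def)
  have "a \<ge> 0" "c \<ge> 0" by (auto simp: a_def c_def sqnorm_nonneg)
  have "b\<^sup>2 \<le> a * c"
  proof (cases "c = 0")
    case True
    have "b = 0"
    proof (rule ccontr)
      assume "b \<noteq> 0"
      \<comment> \<open>Without a quadratic term the expression is affine in t, and this t gives it
        the value -1.\<close>
      then have "a + 2 * (- (a + 1) / (2 * b)) * b = -1" by (simp add: field_simps)
      then show False using pos[of "- (a + 1) / (2 * b)"] True by simp
    qed
    then show ?thesis using True by simp
  next
    case False
    then have "c > 0" using \<open>c \<ge> 0\<close> by simp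
    \<comment> \<open>The minimiser t = -b/c.\<close>
    have "0 \<le> c * (a + 2 * (- b / c) * b + (- b / c)\<^sup>2 * c)"
      using pos[of "- b / c"] \<open>c > 0\<close> by simp
    also have "\<dots> = a * c - b\<^sup>2"
      using \<open>c > 0\<close> by (simp add: field_simps power2_eq_square)
    finally show ?thesis by simp
  qed
  then have "sqrt (b\<^sup>2) \<le> sqrt (a * c)" by (rule real_sqrt_le_mono)
  then show ?thesis by (simp add: a_def b_def c_def real_sqrt_mult)
qed

text \<open>Passing to the limit in a weak formulation: one factor converges in square mean, the
  other is fixed.\<close>

lemma sqnorm_tendsto_inner:
  assumes "\<And>n. f n \<in> square_integrable M" "f' \<in> square_integrable M" "g \<in> square_integrable M"
    and "(\<lambda>n. sqnorm M (\<lambda>x. f n x - f' x)) \<longlonglongrightarrow> 0"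
  shows "(\<lambda>n. LINT x|M. f n x \<bullet> g x) \<longlonglongrightarrow> (LINT x|M. f' x \<bullet> g x)"
proof (rule LIM_zero_cancel, rule Lim_null_comparison)
  show "\<forall>\<^sub>F n in sequentially. norm ((LINT x|M. f n x \<bullet> g x) - (LINT x|M. f' x \<bullet> g x))
      \<le> sqrt (sqnorm M (\<lambda>x. f n x - f' x)) * sqrt (sqnorm M g)"
  proof (rule always_eventually, rule allI)
    fix n
    have "(LINT x|M. f n x \<bullet> g x) - (LINT x|M. f' x \<bullet> g x) = (LINT x|M. (f n x - f' x) \<bullet> g x)"
      using square_integrable_inner[OF assms(1)[of n] assms(3)] square_integrable_inner[OF assms(2,3)]
      by (simp add: inner_diff_left)
    then show "norm ((LINT x|M. f n x \<bullet> g x) - (LINT x|M. f' x \<bullet> g x))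
        \<le> sqrt (sqnorm M (\<lambda>x. f n x - f' x)) * sqrt (sqnorm M g)"
      using Cauchy_Schwarz_integral[OF square_integrable_diff[OF assms(1)[of n] assms(2)] assms(3)] by simp
  qed
  have "(\<lambda>n. sqrt (sqnorm M (\<lambda>x. f n x - f' x)) * sqrt (sqnorm M g)) \<longlonglongrightarrow> sqrt 0 * sqrt (sqnorm M g)"
    by (intro tendsto_intros assms(4))
  then show "(\<lambda>n. sqrt (sqnorm M (\<lambda>x. f n x - f' x)) * sqrt (sqnorm M g)) \<longlonglongrightarrow> 0" by simp
qed

lemma sqnorm_zero_imp_AE:
  assumes "f \<in> square_integrable M" "sqnorm M f = 0"
  shows "AE x in M. f x = 0"
proof -
  have "AE x in M. (norm (f x))\<^sup>2 = 0"
    using integral_nonneg_eq_0_iff_AE[OF square_integrable_norm[OF assms(1)]] assms(2)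
    by (simp add: sqnorm_def)
  then show ?thesis by simp
qed

text \<open>Integrals over \<open>V\<close> become integrals of the extension by zero, because
  mollification, translations and dilations act on the whole space.\<close>

lemma lebesgue_on_integrable_iff:
  fixes f :: "'a::euclidean_space \<Rightarrow> 'b::euclidean_space"
  assumes "V \<in> sets lebesgue"
  shows "integrable (lebesgue_on V) f \<longleftrightarrow> integrable lebesgue (\<lambda>x. if x \<in> V then f x else 0)"
proof -
  have *: "(\<lambda>x. indicator V x *\<^sub>R f x) = (\<lambda>x. if x \<in> V then f x else 0)" by (auto simp: indicator_def)
  show ?thesis using assms by (subst integrable_restrict_space) (simp_all add: *)
qed

lemma lebesgue_on_integral:
  fixes f :: "'a::euclidean_space \<Rightarrow> 'b::euclidean_space"
  assumes "V \<in> sets lebesgue"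
  shows "integral\<^sup>L (lebesgue_on V) f = (LINT x|lebesgue. (if x \<in> V then f x else 0))"
proof -
  have *: "(\<lambda>x. indicator V x *\<^sub>R f x) = (\<lambda>x. if x \<in> V then f x else 0)" by (auto simp: indicator_def)
  show ?thesis using assms by (subst integral_restrict_space) (simp_all add: *)
qed

lemma square_integrable_restrict:
  fixes f :: "'a::euclidean_space \<Rightarrow> 'b::euclidean_space"
  assumes "V \<in> sets lebesgue"
  shows "f \<in> square_integrable (lebesgue_on V) \<longleftrightarrow> (\<lambda>x. (if x \<in> V then f x else 0)) \<in> square_integrable lebesgue"
proof -
  have "(\<lambda>x. (norm (if x \<in> V then f x else 0))\<^sup>2) = (\<lambda>x. if x \<in> V then (norm (f x))\<^sup>2 else 0)" by auto
  then show ?thesis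
    by (simp add: square_integrable_def borel_measurable_if[OF assms] lebesgue_on_integrable_iff[OF assms])
qed

lemma sqnorm_restrict:
  fixes f :: "'a::euclidean_space \<Rightarrow> 'b::euclidean_space"
  assumes "V \<in> sets lebesgue"
  shows "sqnorm (lebesgue_on V) f = sqnorm lebesgue (\<lambda>x. if x \<in> V then f x else 0)"
proof -
  have "(\<lambda>x. (norm (if x \<in> V then f x else 0))\<^sup>2) = (\<lambda>x. if x \<in> V then (norm (f x))\<^sup>2 else 0)" by auto
  then show ?thesis
    by (simp add: sqnorm_def lebesgue_on_integral[OF assms])
qed

section \<open>Mollification\<close>

text \<open>Specialises the affine change of variables to a homothety, with the same factor
  \<open>c\<close> in every coordinate.\<close>

lemma lebesgue_scale_eq:
  fixes t :: "'a::euclidean_space"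
  assumes "c \<noteq> 0"
  shows "lebesgue = density (distr lebesgue lebesgue (\<lambda>x. t + c *\<^sub>R x)) (\<lambda>_. ennreal (\<bar>c\<bar> ^ DIM('a)))"
    and "(\<lambda>x. t + c *\<^sub>R x) \<in> lebesgue \<rightarrow>\<^sub>M lebesgue"
proof -
  have *: "(\<Sum>j\<in>Basis. (c * (x \<bullet> j)) *\<^sub>R j) = c *\<^sub>R x" for x :: 'a
    by (simp add: scaleR_scaleR[symmetric] scaleR_sum_right[symmetric] euclidean_representation
        del: scaleR_scaleR)
  show "lebesgue = density (distr lebesgue lebesgue (\<lambda>x. t + c *\<^sub>R x)) (\<lambda>_. ennreal (\<bar>c\<bar> ^ DIM('a)))"
    using lebesgue_affine_euclidean[where c="\<lambda>_::'a. c" and t=t] assms unfolding * by simp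
  show "(\<lambda>x. t + c *\<^sub>R x) \<in> lebesgue \<rightarrow>\<^sub>M lebesgue"
    using lebesgue_affine_measurable[where c="\<lambda>_::'a. c" and t=t] assms unfolding * by simp
qed

lemma lebesgue_integrable_affine:
  fixes t :: "'a::euclidean_space" and f :: "'a \<Rightarrow> 'b::euclidean_space"
  assumes "c \<noteq> 0" "integrable lebesgue f"
  shows "integrable lebesgue (\<lambda>x. f (t + c *\<^sub>R x))"
proof -
  have T: "(\<lambda>x. t + c *\<^sub>R x) \<in> lebesgue \<rightarrow>\<^sub>M lebesgue" by (rule lebesgue_scale_eq[OF assms(1)])
  have m: "f \<in> borel_measurable lebesgue" using assms(2) by auto
  have "integrable (density (distr lebesgue lebesgue (\<lambda>x. t + c *\<^sub>R x)) (\<lambda>_. ennreal (\<bar>c\<bar> ^ DIM('a)))) f"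
    using assms(2) lebesgue_scale_eq(1)[OF assms(1), of t] by simp
  then have "integrable (distr lebesgue lebesgue (\<lambda>x. t + c *\<^sub>R x)) (\<lambda>x. (\<bar>c\<bar> ^ DIM('a)) *\<^sub>R f x)"
    by (subst (asm) integrable_density) (use m in auto)
  \<comment> \<open>The density is a nonzero constant and is divided out again.\<close>
  from integrable_scaleR_right[OF this, of "inverse (\<bar>c\<bar> ^ DIM('a))"]
  have "integrable (distr lebesgue lebesgue (\<lambda>x. t + c *\<^sub>R x)) f"
    using assms(1) by simp
  then show ?thesis
    by (subst (asm) integrable_distr_eq[OF T m])
qed

lemma lebesgue_integral_affine:
  fixes t :: "'a::euclidean_space" and f :: "'a \<Rightarrow> 'b::euclidean_space"
  assumes "c \<noteq> 0" "f \<in> borel_measurable lebesgue"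
  shows "integral\<^sup>L lebesgue f = \<bar>c\<bar> ^ DIM('a) *\<^sub>R (LINT x|lebesgue. f (t + c *\<^sub>R x))"
proof -
  have T: "(\<lambda>x. t + c *\<^sub>R x) \<in> lebesgue \<rightarrow>\<^sub>M lebesgue" by (rule lebesgue_scale_eq[OF assms(1)])
  have "integral\<^sup>L lebesgue f = integral\<^sup>L (density (distr lebesgue lebesgue (\<lambda>x. t + c *\<^sub>R x)) (\<lambda>_. ennreal (\<bar>c\<bar> ^ DIM('a)))) f"
    using lebesgue_scale_eq(1)[OF assms(1), of t] by simp
  also have "\<dots> = \<bar>c\<bar> ^ DIM('a) *\<^sub>R (LINT x|lebesgue. f (t + c *\<^sub>R x))"
    by (subst integral_density) (use assms(2) T in \<open>auto simp: integral_distr[OF T assms(2)]\<close>)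
  finally show ?thesis .
qed

lemma lebesgue_integral_translation:
  fixes t :: "'a::euclidean_space" and f :: "'a \<Rightarrow> 'b::euclidean_space"
  assumes "f \<in> borel_measurable lebesgue"
  shows "(LINT x|lebesgue. f (x + t)) = integral\<^sup>L lebesgue f"
  using lebesgue_integral_affine[of 1 f t] assms by (simp add: add.commute)

lemma continuous_imp_lebesgue_measurable:
  fixes f :: "'a::euclidean_space \<Rightarrow> 'b::euclidean_space"
  shows "continuous_on UNIV f \<Longrightarrow> f \<in> borel_measurable lebesgue"
  using continuous_imp_measurable_on_sets_lebesgue[of UNIV f] by simp

lemma bounded_support_integrable:
  fixes f :: "'a::euclidean_space \<Rightarrow> 'b::euclidean_space"
  assumes "f \<in> borel_measurable lebesgue" "\<And>x. norm (f x) \<le> C" "\<And>x. x \<notin> cball a R \<Longrightarrow> f x = 0"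
  shows "integrable lebesgue f" "f \<in> square_integrable lebesgue"
    "sqnorm lebesgue f \<le> C\<^sup>2 * measure lebesgue (cball a R)"
proof -
  have fin: "emeasure lebesgue (cball a R) < \<infinity>"
    using emeasure_lborel_cball_finite[of a R] by simp
  have C: "C \<ge> 0" using order_trans[OF norm_ge_zero assms(2)] .
  show "integrable lebesgue f"
  proof (rule Bochner_Integration.integrable_bound)
    show "integrable lebesgue (\<lambda>x. C * indicator (cball a R) x)"
      using fin by (intro integrable_mult_right integrable_real_indicator) auto
    show "AE x in lebesgue. norm (f x) \<le> norm (C * indicator (cball a R) x)"
      using assms(2,3) C by (intro AE_I2) (auto simp: indicator_def)
  qed fact
  have le: "(norm (f x))\<^sup>2 \<le> C\<^sup>2 * indicator (cball a R) x" for x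
    using assms(2)[of x] assms(3)[of x] C by (auto simp: indicator_def intro!: power_mono)
  have i: "integrable lebesgue (\<lambda>x. C\<^sup>2 * indicator (cball a R) x)"
    using fin by (intro integrable_mult_right integrable_real_indicator) auto
  have *: "integrable lebesgue (\<lambda>x. (norm (f x))\<^sup>2)"
  proof (rule Bochner_Integration.integrable_bound[OF i])
    show "(\<lambda>x. (norm (f x))\<^sup>2) \<in> borel_measurable lebesgue" using assms(1) by measurable
  qed (use le in auto)
  then show "f \<in> square_integrable lebesgue" using assms(1) by (simp add: square_integrable_def)
  show "sqnorm lebesgue f \<le> C\<^sup>2 * measure lebesgue (cball a R)"
    using integral_mono[OF * i] le by (simp add: sqnorm_def)
qed

section \<open>Gradients, Lipschitz bounds and uniform differentiability\<close>

lemma GDERIV_unique: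
  assumes "GDERIV f x :> a" "GDERIV f x :> b"
  shows "a = b"
proof -
  have "(\<lambda>h. h \<bullet> a) = (\<lambda>h. h \<bullet> b)"
    using assms has_derivative_unique unfolding gderiv_def by blast
  then have "(a - b) \<bullet> a = (a - b) \<bullet> b" by metis
  then have "(a - b) \<bullet> (a - b) = 0" by (simp add: inner_diff_right)
  then show ?thesis by simp
qed

lemma GDERIV_isCont: "GDERIV f x :> a \<Longrightarrow> isCont f x"
  unfolding gderiv_def by (rule has_derivative_continuous)

lemma GDERIV_continuous_on: "(\<And>x. GDERIV f x :> D x) \<Longrightarrow> continuous_on A f"
  by (meson GDERIV_isCont continuous_at_imp_continuous_on)

lemma GDERIV_shift_scale:
  assumes "GDERIV f (a + c *\<^sub>R x) :> D"
  shows "GDERIV (\<lambda>x. f (a + c *\<^sub>R x)) x :> c *\<^sub>R D"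
proof -
  have "((\<lambda>x. a + c *\<^sub>R x) has_derivative (\<lambda>h. c *\<^sub>R h)) (at x)"
    by (auto intro!: derivative_eq_intros)
  from has_derivative_compose[OF this assms[unfolded gderiv_def]] show ?thesis
    by (simp add: gderiv_def)
qed

lemma GDERIV_along_line:
  assumes "GDERIV f x :> D"
  shows "((\<lambda>t. f (x + t *\<^sub>R v)) has_real_derivative (v \<bullet> D)) (at 0)"
proof -
  have "((\<lambda>t::real. x + t *\<^sub>R v) has_derivative (\<lambda>t. t *\<^sub>R v)) (at 0)"
    by (auto intro!: derivative_eq_intros)
  moreover have "(f has_derivative (\<lambda>h. h \<bullet> D)) (at (x + 0 *\<^sub>R v))"
    using assms by (simp add: gderiv_def)
  ultimately have "((\<lambda>t. f (x + t *\<^sub>R v)) has_derivative (\<lambda>t. (t *\<^sub>R v) \<bullet> D)) (at 0)"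
    by (rule has_derivative_compose)
  then show ?thesis
    by (simp add: has_field_derivative_def mult.commute[of _ "v \<bullet> D"])
qed

text \<open>The limit is taken along the step sizes 1/(n+1), since dominated convergence will be
  applied to these quotients.\<close>

lemma GDERIV_difference_quotient:
  assumes "GDERIV f x :> D"
  shows "(\<lambda>n. (f (x + (1 / real (Suc n)) *\<^sub>R v) - f x) / (1 / real (Suc n))) \<longlonglongrightarrow> v \<bullet> D"
proof -
  have "((\<lambda>t. (f (x + t *\<^sub>R v) - f x) / t) \<longlongrightarrow> v \<bullet> D) (at 0)"
    using GDERIV_along_line[OF assms, of v] by (simp add: DERIV_def)
  moreover have "filterlim (\<lambda>n. 1 / real (Suc n)) (at 0) sequentially"
    unfolding filterlim_at using LIMSEQ_inverse_real_of_nat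
    by (auto simp: field_simps inverse_eq_divide)
  ultimately show ?thesis by (rule filterlim_compose)
qed

lemma bounded_gradient_Lipschitz:
  assumes "\<And>x. GDERIV f x :> D x" "\<And>x. norm (D x) \<le> C"
  shows "\<bar>f x - f y\<bar> \<le> C * norm (x - y)"
proof -
  have "norm (f x - f y) \<le> C * norm (x - y)"
  proof (rule differentiable_bound[where S = UNIV and f' = "\<lambda>z h. h \<bullet> D z"])
    show "(f has_derivative (\<lambda>h. h \<bullet> D z)) (at z within UNIV)" for z
      using assms(1)[of z] by (simp add: gderiv_def)
    show "onorm (\<lambda>h. h \<bullet> D z) \<le> C" for z
    proof (rule onorm_bound)
      show "0 \<le> C" using order_trans[OF norm_ge_zero assms(2)] .
      show "norm (h \<bullet> D z) \<le> C * norm h" for h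
        using Cauchy_Schwarz_ineq2[of h "D z"] mult_right_mono[OF assms(2)[of z] norm_ge_zero[of h]]
        by (simp add: mult.commute)
    qed
  qed auto
  then show ?thesis by simp
qed

lemma compact_support_bounded:
  fixes f :: "'a::euclidean_space \<Rightarrow> 'b::real_normed_vector"
  assumes "continuous_on UNIV f" "\<And>x. x \<notin> cball 0 R \<Longrightarrow> f x = 0"
  obtains C where "C > 0" "\<And>x. norm (f x) \<le> C"
proof -
  have "compact (f ` cball 0 R)"
    by (rule compact_continuous_image) (use assms(1) continuous_on_subset in auto)
  then obtain C where C: "C > 0" "\<And>y. y \<in> f ` cball 0 R \<Longrightarrow> norm y \<le> C"
    using compact_imp_bounded bounded_pos by metis
  then have "norm (f x) \<le> C" for x using assms(2)[of x] C by (cases "x \<in> cball 0 R") auto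
  then show ?thesis using that C(1) by blast
qed

lemma compact_support_uniformly_continuous:
  fixes f :: "'a::euclidean_space \<Rightarrow> 'b::real_normed_vector"
  assumes "continuous_on UNIV f" "\<And>x. x \<notin> cball 0 R \<Longrightarrow> f x = 0" "e > 0"
  obtains d where "d > 0" "\<And>x y. norm (x - y) < d \<Longrightarrow> norm (f x - f y) < e"
proof -
  \<comment> \<open>The ball is enlarged by 1: of two points closer than 1, either both are in the
    larger ball or neither is in the smaller one.\<close>
  have "uniformly_continuous_on (cball 0 (R + 1)) f"
    by (rule compact_uniformly_continuous) (use assms(1) continuous_on_subset in auto)
  then obtain d where d: "d > 0"
    "\<And>x y. x \<in> cball 0 (R + 1) \<Longrightarrow> y \<in> cball 0 (R + 1) \<Longrightarrow> dist x y < d \<Longrightarrow> dist (f x) (f y) < e"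
    using assms(3) unfolding uniformly_continuous_on_def by metis
  have "norm (f x - f y) < e" if "norm (x - y) < min d 1" for x y
  proof (cases "x \<in> cball 0 (R + 1) \<and> y \<in> cball 0 (R + 1)")
    case True
    then show ?thesis using d(2)[of x y] that by (simp add: dist_norm)
  next
    case False
    have "norm x \<le> norm y + norm (x - y)" "norm y \<le> norm x + norm (x - y)"
      using norm_triangle_sub[of x y] norm_triangle_sub[of y x] by (auto simp: norm_minus_commute)
    then have "x \<notin> cball 0 R" "y \<notin> cball 0 R" using False that by auto
    then show ?thesis using assms(2,3) by simp
  qed
  then show ?thesis using that[of "min d 1"] d(1) by auto
qed

text \<open>The mean value inequality for \<open>f\<close> minus its linearisation at x turns
  uniform continuity of \<open>D\<close> into a remainder estimate uniform in x, which is what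
  differentiating a convolution under the integral requires.\<close>

lemma uniform_differentiability:
  fixes f :: "'a::euclidean_space \<Rightarrow> real"
  assumes "\<And>x. GDERIV f x :> D x" "continuous_on UNIV D" "\<And>x. x \<notin> cball 0 R \<Longrightarrow> D x = 0" "e > 0"
  obtains d where "d > 0" "\<And>x h. norm h < d \<Longrightarrow> \<bar>f (x + h) - f x - h \<bullet> D x\<bar> \<le> e * norm h"
proof -
  obtain d where d: "d > 0" "\<And>x y. norm (x - y) < d \<Longrightarrow> norm (D x - D y) < e"
    using compact_support_uniformly_continuous[OF assms(2,3,4)] by blast
  have "\<bar>f (x + h) - f x - h \<bullet> D x\<bar> \<le> e * norm h" if h: "norm h < d" for x h
  proof -
    define g where "g y = f y - y \<bullet> D x" for y
    have "norm (g (x + h) - g x) \<le> e * norm ((x + h) - x)"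
    proof (rule differentiable_bound[where S = "ball x d" and f' = "\<lambda>z h. h \<bullet> (D z - D x)"])
      show "(g has_derivative (\<lambda>h. h \<bullet> (D z - D x))) (at z within ball x d)" for z
      proof -
        have "(f has_derivative (\<lambda>h. h \<bullet> D z)) (at z within ball x d)"
          using assms(1)[of z] unfolding gderiv_def by (rule has_derivative_at_withinI)
        then show ?thesis unfolding g_def inner_diff_right
          by (intro has_derivative_diff) (auto intro!: derivative_eq_intros)
      qed
      show "onorm (\<lambda>h. h \<bullet> (D z - D x)) \<le> e" if "z \<in> ball x d" for z
      proof (rule onorm_bound)
        have "norm (D z - D x) < e" using d(2)[of z x] that by (simp add: dist_norm norm_minus_commute)
        then show "norm (h \<bullet> (D z - D x)) \<le> e * norm h" for h
          using Cauchy_Schwarz_ineq2[of h "D z - D x"]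
            mult_right_mono[of "norm (D z - D x)" e "norm h"]
          by (simp add: mult.commute)
      qed (use assms(4) in simp)
    qed (use h d(1) in \<open>auto simp: dist_norm\<close>)
    then show ?thesis by (simp add: g_def inner_add_left)
  qed
  then show ?thesis using that d(1) by blast
qed

text \<open>Squaring the positive part gives a continuously differentiable kernel, the regularity
  that \<open>test_function\<close> asks for, with an elementary gradient.\<close>

definition bump :: "real \<Rightarrow> 'a::euclidean_space \<Rightarrow> real" where
  "bump r z = (max 0 (r\<^sup>2 - z \<bullet> z))\<^sup>2"

definition mollifier :: "real \<Rightarrow> 'a::euclidean_space \<Rightarrow> real" where
  "mollifier r z = bump r z / integral\<^sup>L lebesgue (bump r :: 'a \<Rightarrow> real)"

definition mollifier_grad :: "real \<Rightarrow> 'a::euclidean_space \<Rightarrow> 'a" where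
  "mollifier_grad r z =
     (- 4 * max 0 (r\<^sup>2 - z \<bullet> z) / integral\<^sup>L lebesgue (bump r :: 'a \<Rightarrow> real)) *\<^sub>R z"

definition mollify :: "real \<Rightarrow> ('a::euclidean_space \<Rightarrow> real) \<Rightarrow> 'a \<Rightarrow> real" where
  "mollify r F x = (LINT y|lebesgue. F y * mollifier r (x - y))"

definition mollify_grad :: "real \<Rightarrow> ('a::euclidean_space \<Rightarrow> real) \<Rightarrow> 'a \<Rightarrow> 'a" where
  "mollify_grad r F x = (LINT y|lebesgue. F y *\<^sub>R mollifier_grad r (x - y))"

lemma DERIV_max_0_square: "((\<lambda>s::real. (max 0 s)\<^sup>2) has_real_derivative 2 * max 0 s) (at s)"
proof (cases "s = 0")
  case True
  have "((\<lambda>h. (max 0 (0 + h))\<^sup>2 / h - 0) \<longlongrightarrow> 0) (at (0::real))"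
  proof (rule Lim_null_comparison[where g = abs])
    show "\<forall>\<^sub>F h in at (0::real). norm ((max 0 (0 + h))\<^sup>2 / h - 0) \<le> \<bar>h\<bar>"
      by (rule always_eventually) (auto simp: max_def power2_eq_square)
    show "(abs \<longlongrightarrow> 0) (at (0::real))" using tendsto_rabs_zero_iff[of "\<lambda>x. x" "at (0::real)"] by simp
  qed
  then show ?thesis using True by (simp add: DERIV_def)
next
  case False
  show ?thesis
  proof (cases "s > 0")
    case True
    have "((\<lambda>s::real. s\<^sup>2) has_real_derivative 2 * max 0 s) (at s)"
      using True by (auto intro!: derivative_eq_intros)
    then show ?thesis
      by (rule has_field_derivative_transform_within_open[where S = "{0<..}"]) (use True in auto)
  next
    case False
    with \<open>s \<noteq> 0\<close> have "s < 0" by simp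
    have "((\<lambda>s::real. 0) has_real_derivative 2 * max 0 s) (at s)"
      using \<open>s < 0\<close> by simp
    then show ?thesis
      by (rule has_field_derivative_transform_within_open[where S = "{..<0}"]) (use \<open>s < 0\<close> in auto)
  qed
qed

lemma bump_GDERIV: "GDERIV (bump r) z :> (- 4 * max 0 (r\<^sup>2 - z \<bullet> z)) *\<^sub>R z"
proof -
  have "GDERIV (\<lambda>z. r\<^sup>2 - z \<bullet> z) z :> (-2) *\<^sub>R z"
    unfolding gderiv_def by (auto intro!: derivative_eq_intros simp: inner_commute)
  from GDERIV_DERIV_compose[OF this DERIV_max_0_square] show ?thesis
    by (simp add: bump_def[abs_def])
qed

lemma bump_nonneg: "bump r z \<ge> 0"
  by (simp add: bump_def)

lemma bump_zero: "norm z \<ge> r \<Longrightarrow> r > 0 \<Longrightarrow> bump r z = 0"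
  using power_mono[of r "norm z" 2] by (simp add: bump_def power2_norm_eq_inner[symmetric])

lemma continuous_bump: "continuous_on UNIV (bump r)"
  by (rule GDERIV_continuous_on[OF bump_GDERIV])

lemma bump_integrable: "r > 0 \<Longrightarrow> integrable lebesgue (bump r :: 'a::euclidean_space \<Rightarrow> real)"
proof -
  assume r: "r > 0"
  have "norm (bump r z) \<le> (r\<^sup>2)\<^sup>2" for z :: 'a
  proof -
    have "max 0 (r\<^sup>2 - z \<bullet> z) \<le> r\<^sup>2" by simp
    then show ?thesis using power_mono[of "max 0 (r\<^sup>2 - z \<bullet> z)" "r\<^sup>2" 2]
      unfolding bump_def real_norm_def by simp
  qed
  then show ?thesis
    using continuous_imp_lebesgue_measurable[OF continuous_bump, of r] bump_zero[OF less_imp_le r]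
    by (intro bounded_support_integrable[where a = 0 and R = r]) (auto simp: not_le)
qed

lemma bump_integral_pos:
  assumes "r > 0"
  shows "integral\<^sup>L lebesgue (bump r :: 'a::euclidean_space \<Rightarrow> real) > 0"
proof -
  have fin: "emeasure lebesgue (ball (0::'a) (r/2)) < \<infinity>"
    using emeasure_lborel_ball_finite[of 0 "r/2"] by simp
  \<comment> \<open>On the ball of radius r/2 the bump is at least (r^2/2)^2.\<close>
  have "0 < (r\<^sup>2 / 2)\<^sup>2 * measure lebesgue (ball (0::'a) (r/2))"
    using assms content_ball_pos[of "r/2" "0::'a"] by (intro mult_pos_pos) auto
  also have "\<dots> = (LINT z|lebesgue. (r\<^sup>2 / 2)\<^sup>2 * indicator (ball (0::'a) (r/2)) z)"
    by simp
  also have "\<dots> \<le> integral\<^sup>L lebesgue (bump r :: 'a \<Rightarrow> real)"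
  proof (rule integral_mono)
    show "integrable lebesgue (\<lambda>z. (r\<^sup>2 / 2)\<^sup>2 * indicator (ball (0::'a) (r/2)) z)"
      using fin by (intro integrable_mult_right integrable_real_indicator) auto
    show "integrable lebesgue (bump r :: 'a \<Rightarrow> real)" by (rule bump_integrable[OF assms])
    fix z :: 'a
    show "(r\<^sup>2 / 2)\<^sup>2 * indicator (ball (0::'a) (r/2)) z \<le> bump r z"
    proof (cases "norm z < r/2")
      case True
      then have "z \<bullet> z \<le> (r/2)\<^sup>2"
        unfolding power2_norm_eq_inner[symmetric] by (intro power_mono) auto
      then have "r\<^sup>2 / 2 \<le> r\<^sup>2 - z \<bullet> z"
        by (simp add: power_divide) (smt (verit) zero_le_power2)
      then have "r\<^sup>2 / 2 \<le> max 0 (r\<^sup>2 - z \<bullet> z)" by linarith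
      then have "(r\<^sup>2 / 2)\<^sup>2 \<le> bump r z" unfolding bump_def by (rule power_mono) simp
      then show ?thesis using True by simp
    qed (simp add: bump_nonneg)
  qed
  finally show ?thesis .
qed

lemma mollifier_GDERIV: "GDERIV (mollifier r) z :> mollifier_grad r z"
proof -
  have "DERIV (\<lambda>s. s / integral\<^sup>L lebesgue (bump r :: 'a \<Rightarrow> real)) s :> 1 / integral\<^sup>L lebesgue (bump r :: 'a \<Rightarrow> real)" for s
    by (rule DERIV_cdivide) simp
  from GDERIV_DERIV_compose[OF bump_GDERIV this] show ?thesis
    by (simp add: mollifier_def[abs_def] mollifier_grad_def)
qed

lemma continuous_mollifier: "continuous_on A (mollifier r)"
  by (rule GDERIV_continuous_on[OF mollifier_GDERIV])

lemma continuous_mollifier_grad: "continuous_on A (mollifier_grad r)"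
  unfolding mollifier_grad_def[abs_def] divide_inverse by (intro continuous_intros)

lemma mollifier_nonneg: "r > 0 \<Longrightarrow> mollifier r z \<ge> 0"
  by (simp add: mollifier_def bump_nonneg bump_integral_pos less_imp_le)

lemma mollifier_zero: "norm z \<ge> r \<Longrightarrow> r > 0 \<Longrightarrow> mollifier r z = 0"
  by (simp add: mollifier_def bump_zero)

lemma mollifier_grad_zero: "norm z \<ge> r \<Longrightarrow> r > 0 \<Longrightarrow> mollifier_grad r z = 0"
  using power_mono[of r "norm z" 2] by (simp add: mollifier_grad_def power2_norm_eq_inner[symmetric])

lemma mollifier_integrable: "r > 0 \<Longrightarrow> integrable lebesgue (\<lambda>y::'a::euclidean_space. mollifier r (x - y))"
  using lebesgue_integrable_affine[of "-1" "mollifier r" x] bump_integrable[of r, where 'a = 'a]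
  by (simp add: mollifier_def[abs_def])

lemma mollifier_integral:
  assumes "r > 0"
  shows "(LINT y|lebesgue. mollifier r (x - y :: 'a::euclidean_space)) = 1"
proof -
  have "integral\<^sup>L lebesgue (mollifier r :: 'a \<Rightarrow> real) = (LINT y|lebesgue. mollifier r (x - y))"
    using lebesgue_integral_affine[of "-1" "mollifier r" x]
      continuous_imp_lebesgue_measurable[OF continuous_mollifier, of r, where 'a = 'a] by simp
  then show ?thesis
    using bump_integral_pos[OF assms, where 'a = 'a] by (simp add: mollifier_def[abs_def])
qed

lemma mollifier_shift_measurable:
  "(\<lambda>y. mollifier r (x - y)) \<in> borel_measurable lebesgue"
  "(\<lambda>y. mollifier_grad r (x - y)) \<in> borel_measurable lebesgue"
proof -
  have c: "continuous_on UNIV (\<lambda>y. x - y)" by (intro continuous_intros)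
  show "(\<lambda>y. mollifier r (x - y)) \<in> borel_measurable lebesgue"
    by (intro continuous_imp_lebesgue_measurable continuous_on_compose2[OF continuous_mollifier[of UNIV] c]) simp
  show "(\<lambda>y. mollifier_grad r (x - y)) \<in> borel_measurable lebesgue"
    by (intro continuous_imp_lebesgue_measurable continuous_on_compose2[OF continuous_mollifier_grad[of UNIV] c]) simp
qed

lemma mollifier_bounded:
  assumes "r > 0"
  obtains C where "C > 0" "\<And>z::'a::euclidean_space. \<bar>mollifier r z\<bar> \<le> C"
proof -
  have "mollifier r z = 0" if "z \<notin> cball 0 r" for z :: 'a
    using mollifier_zero[of r z] that assms by simp
  then obtain C where "C > 0" "\<And>z::'a. norm (mollifier r z) \<le> C"
    using compact_support_bounded[OF continuous_mollifier[of UNIV r]] by blast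
  then show ?thesis by (intro that[of C]) simp_all
qed

lemma mollifier_grad_bounded:
  assumes "r > 0"
  obtains C where "C > 0" "\<And>z::'a::euclidean_space. norm (mollifier_grad r z) \<le> C"
proof -
  have "mollifier_grad r z = 0" if "z \<notin> cball 0 r" for z :: 'a
    using mollifier_grad_zero[of r z] that assms by simp
  then obtain C where "C > 0" "\<And>z::'a. norm (mollifier_grad r z) \<le> C"
    using compact_support_bounded[OF continuous_mollifier_grad[of UNIV r]] by blast
  then show ?thesis by (rule that)
qed

lemma mollify_integrable:
  assumes "r > 0" "integrable lebesgue F"
  shows "integrable lebesgue (\<lambda>y. F y * mollifier r (x - y))"
    and "integrable lebesgue (\<lambda>y. F y *\<^sub>R mollifier_grad r (x - y))"
proof -
  obtain C where "C > 0" and C: "\<And>z::'a. \<bar>mollifier r z\<bar> \<le> C" using mollifier_bounded[OF assms(1)] by blast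
  show "integrable lebesgue (\<lambda>y. F y * mollifier r (x - y))"
  proof (rule Bochner_Integration.integrable_bound)
    show "integrable lebesgue (\<lambda>y. C * \<bar>F y\<bar>)" using assms(2) by auto
    show "(\<lambda>y. F y * mollifier r (x - y)) \<in> borel_measurable lebesgue"
      using assms(2) by (intro borel_measurable_times mollifier_shift_measurable) auto
    show "AE y in lebesgue. norm (F y * mollifier r (x - y)) \<le> norm (C * \<bar>F y\<bar>)"
      using C by (intro AE_I2)
        (auto simp: abs_mult mult.commute[of C] intro!: mult_left_mono order_trans[OF C abs_ge_self])
  qed
  obtain C where "C > 0" and C: "\<And>z::'a. norm (mollifier_grad r z) \<le> C" using mollifier_grad_bounded[OF assms(1)] by blast
  show "integrable lebesgue (\<lambda>y. F y *\<^sub>R mollifier_grad r (x - y))"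
  proof (rule Bochner_Integration.integrable_bound)
    show "integrable lebesgue (\<lambda>y. C * \<bar>F y\<bar>)" using assms(2) by auto
    show "(\<lambda>y. F y *\<^sub>R mollifier_grad r (x - y)) \<in> borel_measurable lebesgue"
      using assms(2) by (intro borel_measurable_scaleR mollifier_shift_measurable) auto
    show "AE y in lebesgue. norm (F y *\<^sub>R mollifier_grad r (x - y)) \<le> norm (C * \<bar>F y\<bar>)"
      using C by (intro AE_I2)
        (auto simp: abs_mult mult.commute[of C] intro!: mult_left_mono order_trans[OF C abs_ge_self])
  qed
qed

text \<open>The remainder of the mollifier is uniformly small and is integrated against |F|.\<close>

lemma mollify_GDERIV:
  assumes "r > 0" "integrable lebesgue F"
  shows "GDERIV (mollify r F) x :> mollify_grad r F x"
  unfolding gderiv_def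
proof -
  define c where "c = (LINT y|lebesgue. \<bar>F y\<bar>)"
  have c: "c \<ge> 0" by (simp add: c_def)
  have lim: "\<exists>d>0. \<forall>h. norm h < d \<longrightarrow>
      \<bar>mollify r F (x + h) - mollify r F x - h \<bullet> mollify_grad r F x\<bar> \<le> e * norm h" if "e > 0" for e
  proof -
    \<comment> \<open>Adding 1 avoids a division by zero when \<open>F\<close> vanishes almost
      everywhere.\<close>
    have "e / (c + 1) > 0" using that c by simp
    moreover have "mollifier_grad r z = 0" if "z \<notin> cball 0 r" for z :: 'a
      using mollifier_grad_zero[of r z] that assms by simp
    ultimately obtain d where d: "d > 0"
      "\<And>z h. norm h < d \<Longrightarrow> \<bar>mollifier r (z + h) - mollifier r z - h \<bullet> mollifier_grad r (z::'a)\<bar> \<le> e / (c + 1) * norm h"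
      using uniform_differentiability[OF mollifier_GDERIV continuous_mollifier_grad, of r r "e / (c + 1)"] by metis
    have "\<bar>mollify r F (x + h) - mollify r F x - h \<bullet> mollify_grad r F x\<bar> \<le> e * norm h" if h: "norm h < d" for h
    proof -
      have eq: "h \<bullet> mollify_grad r F x = (LINT y|lebesgue. F y * (h \<bullet> mollifier_grad r (x - y)))"
        using integral_inner_right[OF mollify_integrable(2)[OF assms, of x], of h]
        by (simp add: mollify_grad_def)
      have ig: "integrable lebesgue (\<lambda>y. F y * (h \<bullet> mollifier_grad r (x - y)))"
        using integrable_inner_right[OF mollify_integrable(2)[OF assms, of x], of h] by simp
      have "mollify r F (x + h) - mollify r F x - h \<bullet> mollify_grad r F x
          = (LINT y|lebesgue. F y * (mollifier r ((x - y) + h) - mollifier r (x - y) - h \<bullet> mollifier_grad r (x - y)))"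
        unfolding eq mollify_def using mollify_integrable(1)[OF assms, of x] mollify_integrable(1)[OF assms, of "x + h"] ig
        by (simp add: right_diff_distrib add_diff_eq diff_add_eq)
      also have "\<bar>\<dots>\<bar> \<le> (LINT y|lebesgue. \<bar>F y\<bar> * (e / (c + 1) * norm h))"
      proof (rule order_trans[OF integral_abs_bound], rule integral_mono_AE')
        show "integrable lebesgue (\<lambda>y. \<bar>F y\<bar> * (e / (c + 1) * norm h))"
          using assms(2) by (intro integrable_mult_left integrable_abs)
        show "AE y in lebesgue. \<bar>F y * (mollifier r ((x - y) + h) - mollifier r (x - y) - h \<bullet> mollifier_grad r (x - y))\<bar>
            \<le> \<bar>F y\<bar> * (e / (c + 1) * norm h)"
          unfolding abs_mult by (intro AE_I2 mult_left_mono d(2)[OF h] abs_ge_zero)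
        show "AE y in lebesgue. 0 \<le> \<bar>F y\<bar> * (e / (c + 1) * norm h)"
          using \<open>e > 0\<close> c by (intro AE_I2 mult_nonneg_nonneg) auto
      qed
      also have "\<dots> = c * (e / (c + 1) * norm h)" by (simp add: c_def)
      also have "\<dots> = (c / (c + 1)) * (e * norm h)" by simp
      also have "\<dots> \<le> 1 * (e * norm h)"
        using c \<open>e > 0\<close> by (intro mult_right_mono) auto
      finally show ?thesis by simp
    qed
    then show ?thesis using d(1) by blast
  qed
  show "(mollify r F has_derivative (\<lambda>h. h \<bullet> mollify_grad r F x)) (at x)"
    unfolding has_derivative_at_alt
  proof (intro conjI allI impI)
    show "bounded_linear (\<lambda>h. h \<bullet> mollify_grad r F x)" by (rule bounded_linear_inner_left)
    fix e :: real assume "e > 0"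
    from lim[OF this] obtain d where d: "d > 0" "\<forall>h. norm h < d \<longrightarrow>
      \<bar>mollify r F (x + h) - mollify r F x - h \<bullet> mollify_grad r F x\<bar> \<le> e * norm h" by blast
    then show "\<exists>d>0. \<forall>y. norm (y - x) < d \<longrightarrow>
        norm (mollify r F y - mollify r F x - (y - x) \<bullet> mollify_grad r F x) \<le> e * norm (y - x)"
    proof (intro exI[of _ d] conjI allI impI)
      fix y assume "norm (y - x) < d"
      then show "norm (mollify r F y - mollify r F x - (y - x) \<bullet> mollify_grad r F x) \<le> e * norm (y - x)"
        using d(2)[rule_format, of "y - x"] by simp
    qed (rule d(1))
  qed
qed

lemma mollify_continuous:
  "r > 0 \<Longrightarrow> integrable lebesgue F \<Longrightarrow> continuous_on A (mollify r F)"
  by (rule GDERIV_continuous_on[OF mollify_GDERIV])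

lemma mollify_diff:
  assumes "r > 0" "integrable lebesgue F" "integrable lebesgue G"
  shows "mollify r (\<lambda>x. F x - G x) x = mollify r F x - mollify r G x"
  unfolding mollify_def
  using mollify_integrable(1)[OF assms(1,2)] mollify_integrable(1)[OF assms(1,3)]
  by (simp add: left_diff_distrib)

text \<open>Jensen's inequality for the probability density \<open>mollifier r (x - y)\<close> in y,
  obtained from Cauchy-Schwarz by splitting the density into two square roots.\<close>

lemma mollify_square_le:
  assumes "r > 0" "integrable lebesgue F" "F \<in> square_integrable lebesgue"
  shows "(mollify r F x)\<^sup>2 \<le> (LINT y|lebesgue. (F y)\<^sup>2 * mollifier r (x - y))"
    and "integrable lebesgue (\<lambda>y. (F y)\<^sup>2 * mollifier r (x - y))"
proof -
  obtain C where "C > 0" and C: "\<And>z::'a. \<bar>mollifier r z\<bar> \<le> C" using mollifier_bounded[OF assms(1)] by blast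
  define f g where "f y = sqrt (mollifier r (x - y)) *\<^sub>R F y" and "g y = sqrt (mollifier r (x - y))" for y
  have m: "g \<in> borel_measurable lebesgue"
    using mollifier_shift_measurable(1)[of r x] unfolding g_def[abs_def] by measurable
  have nn: "mollifier r z \<ge> 0" for z :: 'a by (rule mollifier_nonneg[OF assms(1)])
  have f: "f \<in> square_integrable lebesgue"
    unfolding f_def
  proof (rule square_integrable_bounded_mult[OF assms(3)])
    show "(\<lambda>y. sqrt (mollifier r (x - y))) \<in> borel_measurable lebesgue" using m by (simp add: g_def[abs_def])
    show "AE y in lebesgue. \<bar>sqrt (mollifier r (x - y))\<bar> \<le> sqrt C"
      using C nn by (auto intro!: real_sqrt_le_mono order_trans[OF abs_ge_self])
  qed
  have f2: "(norm (f y))\<^sup>2 = (F y)\<^sup>2 * mollifier r (x - y)" for y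
    using nn by (simp add: f_def power_mult_distrib)
  have g2: "(norm (g y))\<^sup>2 = mollifier r (x - y)" for y
    using nn by (simp add: g_def)
  have g: "g \<in> square_integrable lebesgue"
    using m mollifier_integrable[OF assms(1), of x] by (simp add: square_integrable_def g2 del: real_norm_def)
  show "integrable lebesgue (\<lambda>y. (F y)\<^sup>2 * mollifier r (x - y))"
    using square_integrable_norm[OF f] by (simp add: f2 del: real_norm_def)
  have "f y \<bullet> g y = F y * mollifier r (x - y)" for y
    using nn[of "x - y"] by (simp add: f_def g_def)
  then have "\<bar>mollify r F x\<bar> = \<bar>LINT y|lebesgue. f y \<bullet> g y\<bar>"
    by (simp add: mollify_def)
  also have "\<dots> \<le> sqrt (sqnorm lebesgue f) * sqrt (sqnorm lebesgue g)"
    by (rule Cauchy_Schwarz_integral[OF f g])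
  also have "\<dots> = sqrt (sqnorm lebesgue f)"
    by (simp add: sqnorm_def g2 mollifier_integral[OF assms(1)] del: real_norm_def)
  finally have "\<bar>mollify r F x\<bar>\<^sup>2 \<le> (sqrt (sqnorm lebesgue f))\<^sup>2" by (rule power_mono) simp
  then show "(mollify r F x)\<^sup>2 \<le> (LINT y|lebesgue. (F y)\<^sup>2 * mollifier r (x - y))"
    using sqnorm_nonneg[of lebesgue f] by (simp add: sqnorm_def f2 del: real_norm_def)
qed

text \<open>The preceding pointwise bound is integrated over x and the integrals are exchanged;
  being even, the kernel has mass one in x as well.\<close>

lemma mollify_contraction:
  fixes F :: "'a::euclidean_space \<Rightarrow> real"
  assumes "r > 0" "integrable lebesgue F" "F \<in> square_integrable lebesgue"
  shows "mollify r F \<in> square_integrable lebesgue" "sqnorm lebesgue (mollify r F) \<le> sqnorm lebesgue F"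
proof -
  \<comment> \<open>A Borel representative: the integrals are exchanged for Borel measures, while
    \<open>F\<close> is only measurable for the completion.\<close>
  obtain F' where F'[measurable]: "F' \<in> borel_measurable borel" and ae: "AE x in lborel. F x = F' x"
    using completion_ex_borel_measurable_real[of F lborel] assms(2) by auto
  have [measurable]: "(mollifier r :: 'a \<Rightarrow> real) \<in> borel_measurable borel"
    by (intro borel_measurable_continuous_onI continuous_mollifier)
  have ae': "AE x in lebesgue. F x = F' x" using ae by (rule AE_completion)
  have F'l: "F' \<in> borel_measurable lebesgue" using F' by (simp add: measurable_completion)
  have Fm: "F \<in> borel_measurable lebesgue" using assms(2) by auto
  have sq': "integrable lebesgue (\<lambda>x. (F x)\<^sup>2)" using square_integrable_norm[OF assms(3)] by simp
  have mcont: "mollify r F \<in> borel_measurable lebesgue"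
    by (intro continuous_imp_lebesgue_measurable mollify_continuous assms)
  have "(\<integral>\<^sup>+x. ennreal ((mollify r F x)\<^sup>2) \<partial>lebesgue)
      \<le> (\<integral>\<^sup>+x. (\<integral>\<^sup>+y. ennreal ((F' y)\<^sup>2 * mollifier r (x - y)) \<partial>lborel) \<partial>lebesgue)"
  proof (rule nn_integral_mono)
    fix x
    have "(mollify r F x)\<^sup>2 \<le> (LINT y|lebesgue. (F y)\<^sup>2 * mollifier r (x - y))"
      by (rule mollify_square_le[OF assms])
    then have "ennreal ((mollify r F x)\<^sup>2) \<le> ennreal (LINT y|lebesgue. (F y)\<^sup>2 * mollifier r (x - y))"
      by (rule ennreal_leI)
    also have "\<dots> = (\<integral>\<^sup>+y. ennreal ((F y)\<^sup>2 * mollifier r (x - y)) \<partial>lebesgue)"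
      by (rule nn_integral_eq_integral[symmetric], rule mollify_square_le[OF assms])
         (simp add: mollifier_nonneg[OF assms(1)])
    also have "\<dots> = (\<integral>\<^sup>+y. ennreal ((F' y)\<^sup>2 * mollifier r (x - y)) \<partial>lebesgue)"
      by (rule nn_integral_cong_AE) (use ae' in eventually_elim, simp)
    also have "\<dots> = (\<integral>\<^sup>+y. ennreal ((F' y)\<^sup>2 * mollifier r (x - y)) \<partial>lborel)"
      by (rule nn_integral_completion) measurable
    finally show "ennreal ((mollify r F x)\<^sup>2) \<le> (\<integral>\<^sup>+y. ennreal ((F' y)\<^sup>2 * mollifier r (x - y)) \<partial>lborel)" .
  qed
  also have "\<dots> = (\<integral>\<^sup>+x. (\<integral>\<^sup>+y. ennreal ((F' y)\<^sup>2 * mollifier r (x - y)) \<partial>lborel) \<partial>lborel)"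
    by (rule nn_integral_completion) measurable
  also have "\<dots> = (\<integral>\<^sup>+y. (\<integral>\<^sup>+x. ennreal ((F' y)\<^sup>2 * mollifier r (x - y)) \<partial>lborel) \<partial>lborel)"
    by (rule lborel_pair.Fubini') measurable
  also have "\<dots> = (\<integral>\<^sup>+y. ennreal ((F' y)\<^sup>2) \<partial>lborel)"
  proof (rule nn_integral_cong)
    fix y :: 'a
    have m: "(\<lambda>x. ennreal (mollifier r (x - y))) \<in> borel_measurable borel" by measurable
    have "mollifier r (x - y) = mollifier r (y - x)" for x
    proof -
      have "(x - y) \<bullet> (x - y) = (y - x) \<bullet> (y - x)" by (metis inner_minus_left inner_minus_right minus_diff_eq minus_minus)
      then show ?thesis by (simp add: mollifier_def bump_def)
    qed
    then have "(\<integral>\<^sup>+x. ennreal (mollifier r (x - y)) \<partial>lborel) = (\<integral>\<^sup>+x. ennreal (mollifier r (y - x)) \<partial>lborel)"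
      by simp
    also have "\<dots> = (\<integral>\<^sup>+x. ennreal (mollifier r (y - x)) \<partial>lebesgue)"
      by (rule nn_integral_completion[symmetric]) measurable
    also have "\<dots> = ennreal (LINT x|lebesgue. mollifier r (y - x))"
      by (rule nn_integral_eq_integral[OF mollifier_integrable[OF assms(1)]])
         (simp add: mollifier_nonneg[OF assms(1)])
    finally have 1: "(\<integral>\<^sup>+x. ennreal (mollifier r (x - y)) \<partial>lborel) = 1"
      by (simp add: mollifier_integral[OF assms(1)])
    have "(\<integral>\<^sup>+x. ennreal ((F' y)\<^sup>2 * mollifier r (x - y)) \<partial>lborel)
        = (\<integral>\<^sup>+x. ennreal ((F' y)\<^sup>2) * ennreal (mollifier r (x - y)) \<partial>lborel)"
      by (simp add: ennreal_mult mollifier_nonneg[OF assms(1)])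
    also have "\<dots> = ennreal ((F' y)\<^sup>2)"
      using 1 m by (subst nn_integral_cmult) auto
    finally show "(\<integral>\<^sup>+x. ennreal ((F' y)\<^sup>2 * mollifier r (x - y)) \<partial>lborel) = ennreal ((F' y)\<^sup>2)" .
  qed
  also have "\<dots> = (\<integral>\<^sup>+y. ennreal ((F' y)\<^sup>2) \<partial>lebesgue)"
    by (rule nn_integral_completion[symmetric]) measurable
  also have "\<dots> = (\<integral>\<^sup>+y. ennreal ((F y)\<^sup>2) \<partial>lebesgue)"
    by (rule nn_integral_cong_AE) (use ae' in eventually_elim, simp)
  also have "\<dots> = ennreal (LINT y|lebesgue. (F y)\<^sup>2)"
    by (rule nn_integral_eq_integral[OF sq']) simp
  finally have le: "(\<integral>\<^sup>+x. ennreal ((mollify r F x)\<^sup>2) \<partial>lebesgue) \<le> ennreal (sqnorm lebesgue F)"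
    by (simp add: sqnorm_def)
  then have int: "integrable lebesgue (\<lambda>x. (mollify r F x)\<^sup>2)"
    using mcont by (intro integrableI_bounded) (auto intro: le_less_trans)
  then show "mollify r F \<in> square_integrable lebesgue"
    using mcont by (simp add: square_integrable_def)
  have "(\<integral>\<^sup>+x. ennreal ((mollify r F x)\<^sup>2) \<partial>lebesgue) = ennreal (sqnorm lebesgue (mollify r F))"
    using nn_integral_eq_integral[OF int] by (simp add: sqnorm_def)
  with le show "sqnorm lebesgue (mollify r F) \<le> sqnorm lebesgue F"
    using sqnorm_nonneg[of lebesgue F] by simp
qed

section \<open>Density of continuous functions and convergence of mollifications\<close>

lemma truncation_tendsto:
  fixes F :: "'a::euclidean_space \<Rightarrow> real"
  assumes "F \<in> square_integrable lebesgue"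
  shows "(\<lambda>M. sqnorm lebesgue (\<lambda>x. max (- real M) (min (real M) (F x)) - F x)) \<longlonglongrightarrow> 0"
proof -
  have m[measurable]: "F \<in> borel_measurable lebesgue" by (rule square_integrable_measurable[OF assms])
  have "(\<lambda>M. LINT x|lebesgue. (max (- real M) (min (real M) (F x)) - F x)\<^sup>2) \<longlonglongrightarrow> (LINT x::'a|lebesgue. 0)"
  proof (rule integral_dominated_convergence[where w = "\<lambda>x. (F x)\<^sup>2"])
    show "integrable lebesgue (\<lambda>x. (F x)\<^sup>2)" using square_integrable_norm[OF assms] by simp
    show "AE x in lebesgue. (\<lambda>M. (max (- real M) (min (real M) (F x)) - F x)\<^sup>2) \<longlonglongrightarrow> 0"
    proof (rule AE_I2, rule tendsto_eventually)
      fix x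
      show "\<forall>\<^sub>F M in sequentially. (max (- real M) (min (real M) (F x)) - F x)\<^sup>2 = 0"
        using eventually_ge_at_top[of "nat \<lceil>\<bar>F x\<bar>\<rceil>"]
        by eventually_elim (auto simp: max_def min_def; linarith)
    qed
    show "AE x in lebesgue. norm ((max (- real M) (min (real M) (F x)) - F x)\<^sup>2) \<le> (F x)\<^sup>2" for M
    proof (rule AE_I2)
      fix x
      have "\<bar>max (- real M) (min (real M) (F x)) - F x\<bar> \<le> \<bar>F x\<bar>" by (auto simp: max_def min_def)
      then show "norm ((max (- real M) (min (real M) (F x)) - F x)\<^sup>2) \<le> (F x)\<^sup>2"
        by (simp add: abs_le_square_iff)
    qed
  qed measurable
  then show ?thesis by (simp add: sqnorm_def)
qed

text \<open>Continuous functions converging almost everywhere to \<open>F\<close> come without a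
  common bound. Truncating their values at M and multiplying by the plateau function
  \<open>cut\<close> supplies the dominating function.\<close>

lemma continuous_dense:
  fixes F :: "'a::euclidean_space \<Rightarrow> real"
  assumes F: "F \<in> square_integrable lebesgue" and R: "\<And>x. x \<notin> cball 0 R \<Longrightarrow> F x = 0" and "e > 0"
  obtains g where "continuous_on UNIV g" "\<And>x. x \<notin> cball 0 (R + 1) \<Longrightarrow> g x = 0"
    "g \<in> square_integrable lebesgue" "sqnorm lebesgue (\<lambda>x. F x - g x) < e"
proof -
  define trunc where "trunc M s = max (- real M) (min (real M) s)" for M s
  have m: "F \<in> borel_measurable lebesgue" by (rule square_integrable_measurable[OF F])
  have "\<forall>\<^sub>F M in sequentially. sqnorm lebesgue (\<lambda>x. trunc M (F x) - F x) < e / 4"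
    using order_tendstoD(2)[OF truncation_tendsto[OF F], of "e/4"] \<open>e > 0\<close> by (simp add: trunc_def)
  then obtain M where M: "sqnorm lebesgue (\<lambda>x. trunc M (F x) - F x) < e / 4"
    using eventually_happens trivial_limit_sequentially by blast
  obtain N g where "negligible N" and gc: "\<And>n. continuous_on UNIV (g n)"
    and gl: "\<And>x. x \<notin> N \<Longrightarrow> (\<lambda>n. g n x) \<longlonglongrightarrow> F x"
    using lebesgue_measurable_imp_measurable_on[OF m, of UNIV] unfolding measurable_on_def by auto
  define cut where "cut x = max 0 (min 1 (R + 1 - norm (x::'a)))" for x
  define h where "h n x = cut x * trunc M (g n x)" for n x
  have tc: "continuous_on UNIV (trunc M)" unfolding trunc_def[abs_def] by (intro continuous_intros)
  have hc: "continuous_on UNIV (h n)" for n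
  proof -
    have "continuous_on UNIV (\<lambda>x. trunc M (g n x))" by (rule continuous_on_compose2[OF tc gc]) simp
    then show ?thesis unfolding h_def[abs_def] cut_def by (intro continuous_intros)
  qed
  have h0: "h n x = 0" if "x \<notin> cball 0 (R + 1)" for n x
    using that by (simp add: h_def cut_def)
  have hb: "\<bar>h n x\<bar> \<le> real M" for n x
  proof -
    have "\<bar>cut x\<bar> \<le> 1" "\<bar>trunc M (g n x)\<bar> \<le> real M" by (auto simp: cut_def trunc_def)
    then show ?thesis unfolding h_def abs_mult using mult_mono[of "\<bar>cut x\<bar>" 1 "\<bar>trunc M (g n x)\<bar>" "real M"] by simp
  qed
  have hL: "h n \<in> square_integrable lebesgue" for n
    using bounded_support_integrable(2)[OF continuous_imp_lebesgue_measurable[OF hc], of n "real M" 0 "R + 1"] hb h0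
    by simp
  have tL: "(\<lambda>x. trunc M (F x)) \<in> square_integrable lebesgue"
  proof (rule square_integrable_bound[OF F, where C = 1])
    show "(\<lambda>x. trunc M (F x)) \<in> borel_measurable lebesgue" using m unfolding trunc_def by measurable
  qed (auto simp: trunc_def)
  have "(\<lambda>n. LINT x|lebesgue. (h n x - trunc M (F x))\<^sup>2) \<longlonglongrightarrow> (LINT x::'a|lebesgue. 0)"
  proof (rule integral_dominated_convergence[where w = "\<lambda>x. (2 * real M)\<^sup>2 * indicator (cball 0 (R + 1)) x"])
    show "integrable lebesgue (\<lambda>x::'a. (2 * real M)\<^sup>2 * indicator (cball 0 (R + 1)) x)"
      using emeasure_lborel_cball_finite[of "0::'a" "R+1"]
      by (intro integrable_mult_right integrable_real_indicator) auto
    show "(\<lambda>x. (h n x - trunc M (F x))\<^sup>2) \<in> borel_measurable lebesgue" for n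
      using square_integrable_measurable[OF hL[of n]] square_integrable_measurable[OF tL] by measurable
    have "AE x in lebesgue. x \<notin> N"
      using \<open>negligible N\<close> by (auto simp: negligible_iff_null_sets intro: AE_not_in)
    then show "AE x in lebesgue. (\<lambda>n. (h n x - trunc M (F x))\<^sup>2) \<longlonglongrightarrow> 0"
    proof eventually_elim
      case (elim x)
      have "(\<lambda>n. trunc M (g n x)) \<longlonglongrightarrow> trunc M (F x)"
        using continuous_on_tendsto_compose[OF tc gl[OF elim]] by simp
      then have "(\<lambda>n. (h n x - trunc M (F x))\<^sup>2) \<longlonglongrightarrow> (cut x * trunc M (F x) - trunc M (F x))\<^sup>2"
        unfolding h_def by (intro tendsto_intros)
      \<comment> \<open>The plateau function is 1 on the ball of radius R, and \<open>F\<close>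
        vanishes outside that ball.\<close>
      moreover have "cut x * trunc M (F x) = trunc M (F x)"
        using R[of x] by (cases "x \<in> cball 0 R") (auto simp: cut_def trunc_def)
      ultimately show ?case by simp
    qed
    show "AE x in lebesgue. norm ((h n x - trunc M (F x))\<^sup>2) \<le> (2 * real M)\<^sup>2 * indicator (cball 0 (R + 1)) x" for n
    proof (rule AE_I2)
      fix x
      have "\<bar>trunc M (F x)\<bar> \<le> real M" by (auto simp: trunc_def)
      then have "\<bar>h n x - trunc M (F x)\<bar> \<le> 2 * real M" using hb[of n x] by linarith
      then have "\<bar>h n x - trunc M (F x)\<bar>\<^sup>2 \<le> (2 * real M)\<^sup>2" by (rule power_mono) simp
      moreover have "h n x - trunc M (F x) = 0" if "x \<notin> cball 0 (R + 1)"
        using h0[OF that] R[of x] that by (auto simp: trunc_def)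
      ultimately show "norm ((h n x - trunc M (F x))\<^sup>2) \<le> (2 * real M)\<^sup>2 * indicator (cball 0 (R + 1)) x"
        by (auto simp: indicator_def)
    qed
  qed auto
  then have "(\<lambda>n. sqnorm lebesgue (\<lambda>x. h n x - trunc M (F x))) \<longlonglongrightarrow> 0"
    by (simp add: sqnorm_def)
  then have "\<forall>\<^sub>F n in sequentially. sqnorm lebesgue (\<lambda>x. h n x - trunc M (F x)) < e / 4"
    using order_tendstoD(2)[of _ 0 sequentially "e/4"] \<open>e > 0\<close> by simp
  then obtain n where n: "sqnorm lebesgue (\<lambda>x. h n x - trunc M (F x)) < e / 4"
    using eventually_happens trivial_limit_sequentially by blast
  have "sqnorm lebesgue (\<lambda>x. h n x - F x) < e"
    using sqnorm_triangle_le[OF hL[of n] tL F] n M by linarith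
  then have "sqnorm lebesgue (\<lambda>x. F x - h n x) < e"
    by (simp add: sqnorm_def norm_minus_commute power2_commute)
  then show ?thesis using that[of "h n"] hc h0 hL by blast
qed

lemma mollify_approx:
  fixes F :: "'a::euclidean_space \<Rightarrow> real"
  assumes F: "F \<in> square_integrable lebesgue" "integrable lebesgue F"
    and R: "\<And>x. x \<notin> cball 0 R \<Longrightarrow> F x = 0" and "e > 0"
  obtains r0 where "r0 > 0"
    "\<And>r. 0 < r \<Longrightarrow> r < r0 \<Longrightarrow> sqnorm lebesgue (\<lambda>x. mollify r F x - F x) < e"
proof -
  \<comment> \<open>Two uses of the triangle inequality with factors 2 weigh the three pieces by 2,
    4 and 4, and 10/16 < 1.\<close>
  have e': "e / 16 > 0" using \<open>e > 0\<close> by simp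
  obtain g where g: "continuous_on UNIV g" "\<And>x. x \<notin> cball 0 (R + 1) \<Longrightarrow> g x = 0"
    "g \<in> square_integrable lebesgue" "sqnorm lebesgue (\<lambda>x. F x - g x) < e / 16"
    using continuous_dense[OF F(1) R e'] by blast
  have gi: "integrable lebesgue g"
  proof -
    obtain C where "\<And>x. norm (g x) \<le> C" using compact_support_bounded[OF g(1,2)] by blast
    then show ?thesis
      using bounded_support_integrable(1)[OF continuous_imp_lebesgue_measurable[OF g(1)]] g(2) by metis
  qed
  define c where "c = measure lebesgue (cball (0::'a) (R + 2))"
  \<comment> \<open>A function bounded by b on a ball of measure c has squared norm at most e/16.
    The radius of that ball is R + 2 because \<open>g\<close> lives on radius R + 1 and the kernel
    reaches less than 1 further.\<close>
  define b where "b = sqrt (e / (16 * (c + 1)))"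
  have c: "c \<ge> 0" by (simp add: c_def)
  then have b: "b > 0" using \<open>e > 0\<close> by (simp add: b_def)
  obtain d where d: "d > 0" "\<And>x y. norm (x - y) < d \<Longrightarrow> norm (g x - g y) < b"
    using compact_support_uniformly_continuous[OF g(1,2) b] by blast
  show thesis
  proof (rule that[of "min d 1"])
    show "min d 1 > 0" using d by simp
    fix r :: real assume r: "0 < r" "r < min d 1"
    have mg: "mollify r g x - g x = (LINT y|lebesgue. (g y - g x) * mollifier r (x - y))" for x
    proof -
      have "(LINT y|lebesgue. (g y - g x) * mollifier r (x - y))
          = (LINT y|lebesgue. g y * mollifier r (x - y)) - (LINT y|lebesgue. g x * mollifier r (x - y))"
        unfolding left_diff_distrib
        by (rule Bochner_Integration.integral_diff)
           (intro mollify_integrable(1) r(1) gi integrable_mult_right mollifier_integrable)+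
      then show ?thesis by (simp add: mollify_def mollifier_integral[OF r(1)])
    qed
    have bd: "\<bar>mollify r g x - g x\<bar> \<le> b" for x
    proof -
      have "\<bar>LINT y|lebesgue. (g y - g x) * mollifier r (x - y)\<bar> \<le> (LINT y|lebesgue. b * mollifier r (x - y))"
      proof (rule order_trans[OF integral_abs_bound], rule integral_mono_AE')
        show "integrable lebesgue (\<lambda>y. b * mollifier r (x - y))"
          by (intro integrable_mult_right mollifier_integrable r)
        show "AE y in lebesgue. \<bar>(g y - g x) * mollifier r (x - y)\<bar> \<le> b * mollifier r (x - y)"
        proof (rule AE_I2)
          fix y
          show "\<bar>(g y - g x) * mollifier r (x - y)\<bar> \<le> b * mollifier r (x - y)"
          proof (cases "norm (x - y) < r")
            case True
            then have "\<bar>g y - g x\<bar> \<le> b" using d(2)[of y x] r by (simp add: norm_minus_commute)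
            then show ?thesis using mollifier_nonneg[OF r(1), of "x - y"]
              by (simp add: abs_mult mult_right_mono)
          qed (use mollifier_zero[of r "x - y"] r in simp)
        qed
        show "AE y in lebesgue. 0 \<le> b * mollifier r (x - y)"
          using b by (intro AE_I2) (simp add: mollifier_nonneg[OF r(1)])
      qed
      then show ?thesis unfolding mg using mollifier_integral[OF r(1), of x] by simp
    qed
    have out: "mollify r g x - g x = 0" if "x \<notin> cball 0 (R + 2)" for x
    proof -
      have "(g y - g x) * mollifier r (x - y) = 0" for y
      proof (cases "norm (x - y) < r")
        case True
        have "norm x \<le> norm y + norm (x - y)" using norm_triangle_sub[of x y] by (simp add: norm_minus_commute)
        then have "x \<notin> cball 0 (R + 1)" "y \<notin> cball 0 (R + 1)" using True that r by auto
        then show ?thesis using g(2) by simp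
      qed (use mollifier_zero[of r "x - y"] r in simp)
      then have "(\<lambda>y. (g y - g x) * mollifier r (x - y)) = (\<lambda>y. 0)" by (rule ext)
      then show ?thesis unfolding mg by (simp del: mult_eq_0_iff)
    qed
    have mgL: "mollify r g \<in> square_integrable lebesgue" by (rule mollify_contraction[OF r(1) gi g(3)])
    have "(\<lambda>x. mollify r g x - g x) \<in> borel_measurable lebesgue"
      using square_integrable_measurable[OF square_integrable_diff[OF mgL g(3)]] .
    from bounded_support_integrable(3)[OF this, of b 0 "R + 2"] bd out
    have "sqnorm lebesgue (\<lambda>x. mollify r g x - g x) \<le> b\<^sup>2 * c" by (simp add: c_def)
    also have "\<dots> = (e / 16) * (c / (c + 1))" using c \<open>e > 0\<close> by (simp add: b_def)
    also have "\<dots> \<le> (e / 16) * 1" using c \<open>e > 0\<close> by (intro mult_left_mono) auto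
    finally have 2: "sqnorm lebesgue (\<lambda>x. mollify r g x - g x) \<le> e / 16" by simp
    have mFL: "mollify r F \<in> square_integrable lebesgue" by (rule mollify_contraction[OF r(1) F(2,1)])
    have "sqnorm lebesgue (\<lambda>x. mollify r F x - mollify r g x) = sqnorm lebesgue (mollify r (\<lambda>x. F x - g x))"
      by (simp only: mollify_diff[OF r(1) F(2) gi, symmetric])
    also have "\<dots> \<le> sqnorm lebesgue (\<lambda>x. F x - g x)"
      using F(2) gi square_integrable_diff[OF F(1) g(3)] by (intro mollify_contraction r(1)) auto
    finally have 1: "sqnorm lebesgue (\<lambda>x. mollify r F x - mollify r g x) < e / 16" using g(4) by simp
    have 3: "sqnorm lebesgue (\<lambda>x. g x - F x) < e / 16"
      using g(4) by (simp add: sqnorm_def norm_minus_commute power2_commute)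
    show "sqnorm lebesgue (\<lambda>x. mollify r F x - F x) < e"
      using sqnorm_triangle_le[OF mFL mgL F(1)] sqnorm_triangle_le[OF mgL g(3) F(1)] 1 2 3 \<open>e > 0\<close> by linarith
  qed
qed

lemma mollify_tendsto:
  fixes F :: "'a::euclidean_space \<Rightarrow> real"
  assumes "F \<in> square_integrable lebesgue" "integrable lebesgue F" "\<And>x. x \<notin> cball 0 R \<Longrightarrow> F x = 0"
  shows "(\<lambda>n. sqnorm lebesgue (\<lambda>x. mollify (1 / real (Suc n)) F x - F x)) \<longlonglongrightarrow> 0"
proof (rule LIMSEQ_I)
  fix e :: real assume "e > 0"
  then obtain r0 where r0: "r0 > 0"
    "\<And>r. 0 < r \<Longrightarrow> r < r0 \<Longrightarrow> sqnorm lebesgue (\<lambda>x. mollify r F x - F x) < e"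
    using mollify_approx[OF assms] by blast
  obtain N where N: "1 / real (Suc N) < r0" using r0(1) nat_approx_posE by blast
  show "\<exists>N. \<forall>n\<ge>N. norm (sqnorm lebesgue (\<lambda>x. mollify (1 / real (Suc n)) F x - F x) - 0) < e"
  proof (intro exI allI impI)
    fix n assume "n \<ge> N"
    then have "1 / real (Suc n) \<le> 1 / real (Suc N)" by (simp add: frac_le)
    with N r0(2)[of "1 / real (Suc n)"]
    show "norm (sqnorm lebesgue (\<lambda>x. mollify (1 / real (Suc n)) F x - F x) - 0) < e"
      by (simp add: sqnorm_nonneg)
  qed
qed

section \<open>Weak gradients\<close>

lemma test_functionI:
  assumes "\<And>x. GDERIV \<phi> x :> D x" "continuous_on UNIV D" "compact K" "K \<subseteq> U" "\<And>x. x \<notin> K \<Longrightarrow> \<phi> x = 0"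
  shows "test_function U \<phi> D"
proof -
  have "closure {x. \<phi> x \<noteq> 0} \<subseteq> K"
    by (rule closure_minimal) (use assms(3,5) compact_imp_closed in auto)
  moreover from this have "compact (closure {x. \<phi> x \<noteq> 0})"
    using assms(3) closed_closure compact_Int_closed[of K] by (metis inf.absorb_iff2)
  ultimately show ?thesis unfolding test_function_def using assms by blast
qed

lemma test_functionD:
  assumes "test_function U \<phi> D"
  shows "\<And>x. GDERIV \<phi> x :> D x" "continuous_on UNIV D" "continuous_on UNIV \<phi>"
    "compact (closure {x. \<phi> x \<noteq> 0})" "closure {x. \<phi> x \<noteq> 0} \<subseteq> U"
  using assms GDERIV_continuous_on[of \<phi> D UNIV] unfolding test_function_def by blast+

lemma GDERIV_transform_open:
  assumes "GDERIV f x :> D" "open S" "x \<in> S" "\<And>y. y \<in> S \<Longrightarrow> f y = g y"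
  shows "GDERIV g x :> D"
  using has_derivative_transform_within_open[OF assms(1)[unfolded gderiv_def] assms(2-4)]
  by (simp add: gderiv_def)

lemma test_function_zero:
  assumes "test_function U \<phi> D" "x \<notin> closure {x. \<phi> x \<noteq> 0}"
  shows "\<phi> x = 0" "D x = 0"
proof -
  show "\<phi> x = 0" using assms(2) closure_subset[of "{x. \<phi> x \<noteq> 0}"] by blast
  have "GDERIV \<phi> x :> 0"
    by (rule GDERIV_transform_open[OF GDERIV_const[where k = 0], where S = "- closure {x. \<phi> x \<noteq> 0}"])
       (use assms(2) closure_subset[of "{x. \<phi> x \<noteq> 0}"] in auto)
  with test_functionD(1)[OF assms(1)] show "D x = 0" by (rule GDERIV_unique)
qed

lemma test_function_outside:
  assumes "test_function U \<phi> D" "x \<notin> U"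
  shows "\<phi> x = 0" "D x = 0"
  using test_function_zero[OF assms(1)] test_functionD(5)[OF assms(1)] assms(2) by blast+

lemma test_function_mono: "test_function U \<phi> D \<Longrightarrow> U \<subseteq> V \<Longrightarrow> test_function V \<phi> D"
  unfolding test_function_def by blast

lemma test_function_ball:
  fixes \<phi> :: "real^'n \<Rightarrow> real"
  assumes "test_function U \<phi> D"
  shows "\<exists>R>0. \<forall>x. x \<notin> cball 0 R \<longrightarrow> \<phi> x = 0 \<and> D x = 0"
proof -
  obtain R where R: "R > 0" "\<forall>x\<in>closure {x. \<phi> x \<noteq> 0}. norm x \<le> R"
    using compact_imp_bounded[OF test_functionD(4)[OF assms]] unfolding bounded_pos by blast
  show ?thesis
  proof (intro exI[of _ R] conjI allI impI)
    fix x :: "real^'n" assume "x \<notin> cball 0 R"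
    then have "x \<notin> closure {x. \<phi> x \<noteq> 0}" using R(2) by auto
    then show "\<phi> x = 0" "D x = 0" by (rule test_function_zero[OF assms])+
  qed (rule R(1))
qed

lemma test_function_bounded:
  assumes "test_function U \<phi> D"
  shows "\<exists>C>0. \<forall>x. \<bar>\<phi> x\<bar> \<le> C \<and> norm (D x) \<le> C"
proof -
  obtain R where R: "\<forall>x. x \<notin> cball 0 R \<longrightarrow> \<phi> x = 0 \<and> D x = 0"
    using test_function_ball[OF assms] by blast
  note R = R[rule_format, THEN conjunct1] R[rule_format, THEN conjunct2]
  obtain C1 where C1: "C1 > 0" "\<And>x. norm (\<phi> x) \<le> C1"
    using compact_support_bounded[OF test_functionD(3)[OF assms] R(1)] by blast
  obtain C2 where C2: "C2 > 0" "\<And>x. norm (D x) \<le> C2"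
    using compact_support_bounded[OF test_functionD(2)[OF assms] R(2)] by blast
  have "\<bar>\<phi> x\<bar> \<le> C1 + C2" "norm (D x) \<le> C1 + C2" for x
    using C1(1) C2(1) C1(2)[of x] C2(2)[of x] by auto
  with C1 C2 show ?thesis by (intro exI[of _ "C1 + C2"]) auto
qed

lemma test_function_square_integrable:
  assumes "test_function U \<phi> D"
  shows "\<phi> \<in> square_integrable lebesgue" "D \<in> square_integrable lebesgue"
    "integrable lebesgue \<phi>" "integrable lebesgue D"
proof -
  obtain R where R: "\<forall>x. x \<notin> cball 0 R \<longrightarrow> \<phi> x = 0 \<and> D x = 0"
    using test_function_ball[OF assms] by blast
  note R = R[rule_format, THEN conjunct1] R[rule_format, THEN conjunct2]
  obtain C where C: "\<forall>x. \<bar>\<phi> x\<bar> \<le> C \<and> norm (D x) \<le> C"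
    using test_function_bounded[OF assms] by blast
  note C = C[rule_format, THEN conjunct1] C[rule_format, THEN conjunct2]
  have C': "\<And>x. norm (\<phi> x) \<le> C" using C(1) by simp
  note m = test_functionD(2,3)[OF assms, THEN continuous_imp_lebesgue_measurable]
  show "\<phi> \<in> square_integrable lebesgue" by (rule bounded_support_integrable(2)[OF m(2) C' R(1)])
  show "integrable lebesgue \<phi>" by (rule bounded_support_integrable(1)[OF m(2) C' R(1)])
  show "D \<in> square_integrable lebesgue" by (rule bounded_support_integrable(2)[OF m(1) C(2) R(2)])
  show "integrable lebesgue D" by (rule bounded_support_integrable(1)[OF m(1) C(2) R(2)])
qed

lemma square_integrable_subset:
  fixes f :: "'a::euclidean_space \<Rightarrow> 'b::euclidean_space"
  assumes "f \<in> square_integrable (lebesgue_on U)" "V \<subseteq> U" "U \<in> sets lebesgue" "V \<in> sets lebesgue"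
  shows "f \<in> square_integrable (lebesgue_on V)"
proof -
  have "(\<lambda>x. if x \<in> V then f x else 0) \<in> square_integrable lebesgue"
  proof (rule square_integrable_bound[where C = 1])
    show U: "(\<lambda>x. if x \<in> U then f x else 0) \<in> square_integrable lebesgue"
      using assms(1) by (simp add: square_integrable_restrict[OF assms(3)])
    have "(\<lambda>x. indicator V x *\<^sub>R (if x \<in> U then f x else 0)) \<in> borel_measurable lebesgue"
      using square_integrable_measurable[OF U] assms(4) by measurable
    moreover have "(\<lambda>x. indicator V x *\<^sub>R (if x \<in> U then f x else 0)) = (\<lambda>x. if x \<in> V then f x else 0)"
      using assms(2) by (auto simp: fun_eq_iff indicator_def)
    ultimately show "(\<lambda>x. if x \<in> V then f x else 0) \<in> borel_measurable lebesgue" by simp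
  qed (use assms(2) in auto)
  then show ?thesis by (simp add: square_integrable_restrict[OF assms(4)])
qed

lemma square_integrable_lebesgue_on:
  fixes f :: "'a::euclidean_space \<Rightarrow> 'b::euclidean_space"
  assumes "f \<in> square_integrable lebesgue" "V \<in> sets lebesgue"
  shows "f \<in> square_integrable (lebesgue_on V)"
  using square_integrable_subset[of f UNIV V] assms by (simp add: lebesgue_on_UNIV_eq)

lemma AE_imp_AE_lebesgue_on: "AE x in lebesgue. P x \<Longrightarrow> V \<in> sets lebesgue \<Longrightarrow> AE x in lebesgue_on V. P x"
  by (subst AE_restrict_space_iff) (auto elim: eventually_mono)

lemma AE_lebesgue_on_subset:
  assumes "AE x in lebesgue_on U. P x" "V \<subseteq> U" "U \<in> sets lebesgue" "V \<in> sets lebesgue"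
  shows "AE x in lebesgue_on V. P x"
  using assms by (auto simp: AE_restrict_space_iff elim!: eventually_mono)

lemma finite_measure_bounded_open:
  assumes "open U" "bounded (U :: (real^'n) set)"
  shows "finite_measure (lebesgue_on U)"
  using assms by (simp add: finite_measure_lebesgue_on bounded_set_imp_lmeasurable)

text \<open>An almost everywhere gradient is the limit of continuous difference quotients, and null
  sets do not affect measurability for the completed measure.\<close>

lemma gradient_measurable:
  fixes W :: "real^'n \<Rightarrow> real"
  assumes "continuous_on UNIV W" "AE x in lebesgue. GDERIV W x :> G x"
  shows "(\<lambda>x. G x $ i) \<in> borel_measurable lebesgue"
proof -
  define q where "q n x = (W (x + (1 / real (Suc n)) *\<^sub>R axis i 1) - W x) / (1 / real (Suc n))" for n x
  have "(\<lambda>x. lim (\<lambda>n. q n x)) \<in> borel_measurable lebesgue"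
  proof (rule borel_measurable_lim_metric)
    fix n
    have "continuous_on UNIV (\<lambda>x. W (x + (1 / real (Suc n)) *\<^sub>R axis i 1))"
      by (rule continuous_on_compose2[OF assms(1)]) (auto intro!: continuous_intros)
    then have "continuous_on UNIV (q n)" unfolding q_def
      by (intro continuous_intros assms(1)) auto
    then show "q n \<in> borel_measurable lebesgue" by (rule continuous_imp_lebesgue_measurable)
  qed
  moreover have "AE x in lebesgue. lim (\<lambda>n. q n x) = G x $ i"
    using assms(2)
  proof eventually_elim
    case (elim x)
    show ?case
      using limI[OF GDERIV_difference_quotient[OF elim, of "axis i 1"]]
      by (simp add: q_def inner_axis')
  qed
  ultimately show ?thesis by (rule borel_measurable_AE)
qed

text \<open>Translation invariance gives every difference quotient the integral zero, and the
  Lipschitz constant dominates the passage to the limit. Differentiability is asked for almost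
  everywhere, since the gauge has kinks between sectors.\<close>

lemma integral_gradient_eq_0:
  fixes W :: "real^'n \<Rightarrow> real"
  assumes lip: "\<And>x y. \<bar>W x - W y\<bar> \<le> C * norm (x - y)" and "\<And>x. x \<notin> cball 0 R \<Longrightarrow> W x = 0"
    and ae: "AE x in lebesgue. GDERIV W x :> G x"
  shows "(LINT x|lebesgue. G x $ i) = 0"
proof -
  define q where "q n x = (W (x + (1 / real (Suc n)) *\<^sub>R axis i 1) - W x) / (1 / real (Suc n))" for n x
  have C: "C \<ge> 0" using lip[of "axis i 1" 0] by (simp add: norm_axis_1)
  have cW: "continuous_on UNIV W"
    by (rule lipschitz_on_continuous_on[of C]) (auto simp: lipschitz_on_def C dist_norm dist_real_def lip)
  have cq: "continuous_on UNIV (\<lambda>x. W (x + (1 / real (Suc n)) *\<^sub>R axis i 1))" for n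
    by (rule continuous_on_compose2[OF cW]) (auto intro!: continuous_intros)
  have Wm: "W \<in> borel_measurable lebesgue" by (rule continuous_imp_lebesgue_measurable[OF cW])
  obtain B where "B > 0" "\<And>x. norm (W x) \<le> B" using compact_support_bounded[OF cW assms(2)] by blast
  then have iW: "integrable lebesgue W"
    using bounded_support_integrable(1)[OF Wm] assms(2) by blast
  have "(\<lambda>n. integral\<^sup>L lebesgue (q n)) \<longlonglongrightarrow> (LINT x|lebesgue. G x $ i)"
  \<comment> \<open>The radius is R + 1 because the steps have length at most 1.\<close>
  proof (rule integral_dominated_convergence[where w = "\<lambda>x. C * indicator (cball 0 (R + 1)) x"])
    show "integrable lebesgue (\<lambda>x::real^'n. C * indicator (cball 0 (R + 1)) x)"
      using emeasure_lborel_cball_finite[of "0::real^'n" "R+1"]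
      by (intro integrable_mult_right integrable_real_indicator) auto
    show "(\<lambda>x. G x $ i) \<in> borel_measurable lebesgue" by (rule gradient_measurable[OF cW ae])
    have "continuous_on UNIV (q n)" for n unfolding q_def by (intro continuous_intros cW cq) auto
    then show "q n \<in> borel_measurable lebesgue" for n by (rule continuous_imp_lebesgue_measurable)
    show "AE x in lebesgue. (\<lambda>n. q n x) \<longlonglongrightarrow> G x $ i"
      using ae
    proof eventually_elim
      case (elim x)
      show ?case using GDERIV_difference_quotient[OF elim, of "axis i 1"] by (simp add: q_def inner_axis')
    qed
    show "AE x in lebesgue. norm (q n x) \<le> C * indicator (cball 0 (R + 1)) x" for n
    proof (rule AE_I2)
      fix x :: "real^'n"
      define v where "v = (1 / real (Suc n)) *\<^sub>R (axis i 1 :: real^'n)"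
      have v: "norm v = 1 / real (Suc n)" by (simp add: v_def norm_axis_1)
      then have v1: "norm v \<le> 1" by simp
      show "norm (q n x) \<le> C * indicator (cball 0 (R + 1)) x"
      proof (cases "x \<in> cball 0 (R + 1)")
        case True
        have "\<bar>W (x + v) - W x\<bar> \<le> C * norm v" using lip[of "x + v" x] by simp
        then have "\<bar>W (x + v) - W x\<bar> / (1 / real (Suc n)) \<le> C" by (simp add: v field_simps)
        then show ?thesis using True unfolding q_def v_def[symmetric] by (simp add: abs_mult)
      next
        case False
        have "norm x \<le> norm (x + v) + norm v" by (metis add_diff_cancel_right' norm_triangle_ineq4)
        then have "x + v \<notin> cball 0 R" "x \<notin> cball 0 R" using False v1 by auto
        then have "q n x = 0" using assms(2) unfolding q_def v_def[symmetric] by simp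
        then show ?thesis using C by simp
      qed
    qed
  qed
  moreover have "integral\<^sup>L lebesgue (q n) = 0" for n
  proof -
    have i2: "integrable lebesgue (\<lambda>x. W (x + (1 / real (Suc n)) *\<^sub>R axis i 1))"
      using lebesgue_integrable_affine[of 1 W "(1 / real (Suc n)) *\<^sub>R axis i 1"] iW by (simp add: add.commute)
    have "integral\<^sup>L lebesgue (q n) = ((LINT x|lebesgue. W (x + (1 / real (Suc n)) *\<^sub>R axis i 1)) - integral\<^sup>L lebesgue W) / (1 / real (Suc n))"
      unfolding q_def using Bochner_Integration.integral_diff[OF i2 iW] by (simp only: integral_divide_zero)
    then show ?thesis by (simp add: lebesgue_integral_translation[OF Wm])
  qed
  ultimately have "(\<lambda>n::nat. 0::real) \<longlonglongrightarrow> (LINT x|lebesgue. G x $ i)" by simp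
  then show ?thesis using LIMSEQ_unique tendsto_const by blast
qed

lemma test_function_integral_gradient_eq_0:
  assumes "test_function U \<phi> D"
  shows "(LINT x|lebesgue. D x $ i) = 0"
proof -
  obtain R where R: "\<forall>x. x \<notin> cball 0 R \<longrightarrow> \<phi> x = 0 \<and> D x = 0"
    using test_function_ball[OF assms] by blast
  note R = R[rule_format, THEN conjunct1] R[rule_format, THEN conjunct2]
  obtain C where C: "\<forall>x. \<bar>\<phi> x\<bar> \<le> C \<and> norm (D x) \<le> C"
    using test_function_bounded[OF assms] by blast
  note C = C[rule_format, THEN conjunct1] C[rule_format, THEN conjunct2]
  show ?thesis
    by (rule integral_gradient_eq_0[OF bounded_gradient_Lipschitz[OF test_functionD(1)[OF assms] C(2)] R(1)])
       (auto intro!: AE_I2 test_functionD(1)[OF assms])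
qed

lemma integral_test_function:
  fixes w :: "real^'n \<Rightarrow> real"
  assumes "test_function U \<phi> D" "U \<in> sets lebesgue"
  shows "(LINT x|lebesgue_on U. w x * D x $ i) = (LINT x|lebesgue. w x * D x $ i)"
    and "(LINT x|lebesgue_on U. w x * \<phi> x) = (LINT x|lebesgue. w x * \<phi> x)"
proof -
  have "(\<lambda>x. if x \<in> U then w x * D x $ i else 0) = (\<lambda>x. w x * D x $ i)"
    "(\<lambda>x. if x \<in> U then w x * \<phi> x else 0) = (\<lambda>x. w x * \<phi> x)"
    using test_function_outside[OF assms(1)] by (auto simp: fun_eq_iff)
  then show "(LINT x|lebesgue_on U. w x * D x $ i) = (LINT x|lebesgue. w x * D x $ i)"
    and "(LINT x|lebesgue_on U. w x * \<phi> x) = (LINT x|lebesgue. w x * \<phi> x)"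
    by (simp_all add: lebesgue_on_integral[OF assms(2)])
qed

text \<open>Test functions vanish off \<open>U\<close>, so the integrals may be taken over the whole
  space; in this form two different sets can be compared.\<close>

lemma weak_gradient_iff:
  assumes "U \<in> sets lebesgue"
  shows "weak_gradient U w g \<longleftrightarrow> (\<forall>\<phi> D i. test_function U \<phi> D \<longrightarrow>
     (LINT x|lebesgue. w x * D x $ i) = - (LINT x|lebesgue. g x $ i * \<phi> x))"
  unfolding weak_gradient_def
  by (intro iff_allI imp_cong refl) (simp only: integral_test_function[OF _ assms])

lemma weak_gradient_subset:
  assumes "weak_gradient U w g" "V \<subseteq> U" "U \<in> sets lebesgue" "V \<in> sets lebesgue"
  shows "weak_gradient V w g"
  using assms(1) test_function_mono[OF _ assms(2)]
  unfolding weak_gradient_iff[OF assms(3)] weak_gradient_iff[OF assms(4)] by blast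

text \<open>The product with a test function is Lipschitz with compact support, so its gradient
  integrates to zero; the product rule splits this into the two integrals of the definition.\<close>

lemma weak_gradient_Lipschitz:
  fixes P :: "real^'n \<Rightarrow> real"
  assumes lip: "\<And>x y. \<bar>P x - P y\<bar> \<le> C * norm (x - y)" and bd: "\<And>x. \<bar>P x\<bar> \<le> B"
    and ae: "AE x in lebesgue. GDERIV P x :> G x" and G: "\<And>x. norm (G x) \<le> C" and U: "U \<in> sets lebesgue"
  shows "weak_gradient U P G"
  unfolding weak_gradient_iff[OF U]
proof (intro allI impI)
  fix \<phi> D i assume t: "test_function U \<phi> D"
  obtain R where R: "\<forall>x. x \<notin> cball 0 R \<longrightarrow> \<phi> x = 0 \<and> D x = 0"
    using test_function_ball[OF t] by blast
  note R = R[rule_format, THEN conjunct1] R[rule_format, THEN conjunct2]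
  obtain M where M: "\<forall>x. \<bar>\<phi> x\<bar> \<le> M \<and> norm (D x) \<le> M"
    using test_function_bounded[OF t] by blast
  note M = M[rule_format, THEN conjunct1] M[rule_format, THEN conjunct2]
  have nn: "B \<ge> 0" "M \<ge> 0" "C \<ge> 0"
    using bd[of 0] M(2)[of 0] G[of 0] by (auto intro: order_trans[OF abs_ge_zero] order_trans[OF norm_ge_zero])
  have lip\<phi>: "\<bar>\<phi> x - \<phi> y\<bar> \<le> M * norm (x - y)" for x y
    by (rule bounded_gradient_Lipschitz[OF test_functionD(1)[OF t] M(2)])
  have cP: "continuous_on UNIV P"
    by (rule lipschitz_on_continuous_on[of C]) (auto simp: lipschitz_on_def nn dist_norm dist_real_def lip)
  have Pm: "P \<in> borel_measurable lebesgue" by (rule continuous_imp_lebesgue_measurable[OF cP])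
  have "(LINT x|lebesgue. (P x *\<^sub>R D x + \<phi> x *\<^sub>R G x) $ i) = 0"
  proof (rule integral_gradient_eq_0[where W = "\<lambda>x. P x * \<phi> x" and C = "B * M + M * C" and R = R])
    show "\<bar>P x * \<phi> x - P y * \<phi> y\<bar> \<le> (B * M + M * C) * norm (x - y)" for x y
    proof -
      have "P x * \<phi> x - P y * \<phi> y = P x * (\<phi> x - \<phi> y) + \<phi> y * (P x - P y)" by algebra
      also have "\<bar>\<dots>\<bar> \<le> \<bar>P x\<bar> * \<bar>\<phi> x - \<phi> y\<bar> + \<bar>\<phi> y\<bar> * \<bar>P x - P y\<bar>"
        by (metis abs_mult abs_triangle_ineq)
      also have "\<dots> \<le> B * (M * norm (x - y)) + M * (C * norm (x - y))"
        using bd M lip lip\<phi> nn by (intro add_mono mult_mono) auto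
      finally show ?thesis by (simp add: algebra_simps)
    qed
    show "P x * \<phi> x = 0" if "x \<notin> cball 0 R" for x using R(1)[OF that] by simp
    show "AE x in lebesgue. GDERIV (\<lambda>x. P x * \<phi> x) x :> P x *\<^sub>R D x + \<phi> x *\<^sub>R G x"
      using ae by eventually_elim (rule GDERIV_mult[OF _ test_functionD(1)[OF t]])
  qed
  moreover have "integrable lebesgue (\<lambda>x. P x * D x $ i)"
  proof (rule Bochner_Integration.integrable_bound)
    show "integrable lebesgue (\<lambda>x. B * norm (D x))"
      using test_function_square_integrable(4)[OF t] by auto
    show "(\<lambda>x. P x * D x $ i) \<in> borel_measurable lebesgue"
      using Pm square_integrable_measurable[OF square_integrable_nth[OF test_function_square_integrable(2)[OF t]]]
      by (intro borel_measurable_times)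
    show "AE x in lebesgue. norm (P x * D x $ i) \<le> norm (B * norm (D x))"
      using bd nn by (intro AE_I2) (auto simp: abs_mult intro!: mult_mono component_le_norm_cart)
  qed
  moreover have "integrable lebesgue (\<lambda>x. \<phi> x * G x $ i)"
  proof (rule Bochner_Integration.integrable_bound)
    show "integrable lebesgue (\<lambda>x. C * \<bar>\<phi> x\<bar>)"
      using test_function_square_integrable(3)[OF t] by auto
    show "(\<lambda>x. \<phi> x * G x $ i) \<in> borel_measurable lebesgue"
      using gradient_measurable[OF cP ae] test_function_square_integrable(3)[OF t]
      by (intro borel_measurable_times) auto
    show "AE x in lebesgue. norm (\<phi> x * G x $ i) \<le> norm (C * \<bar>\<phi> x\<bar>)"
    proof (rule AE_I2)
      fix x
      have "\<bar>G x $ i\<bar> \<le> C" using G[of x] component_le_norm_cart[of "G x" i] by linarith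
      then show "norm (\<phi> x * G x $ i) \<le> norm (C * \<bar>\<phi> x\<bar>)"
        using nn by (simp add: abs_mult mult.commute[of C] mult_left_mono)
    qed
  qed
  ultimately show "(LINT x|lebesgue. P x * D x $ i) = - (LINT x|lebesgue. G x $ i * \<phi> x)"
    by (simp add: mult.commute[of "G _ $ i"])
qed

text \<open>Off the support of the test function the product is zero whatever p does there. Its
  gradient is continuous because it is so on the two open sets \<open>U\<close> and the complement
  of the support, which cover the space.\<close>

lemma test_function_mult_C1:
  assumes t: "test_function U \<phi> D" and "open U"
    and p: "\<And>x. x \<in> U \<Longrightarrow> GDERIV p x :> G x" and "continuous_on U G"
  shows "test_function U (\<lambda>x. p x * \<phi> x) (\<lambda>x. if x \<in> U then p x *\<^sub>R D x + \<phi> x *\<^sub>R G x else 0)"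
proof (rule test_functionI)
  let ?K = "closure {x. \<phi> x \<noteq> 0}"
  let ?H = "\<lambda>x. if x \<in> U then p x *\<^sub>R D x + \<phi> x *\<^sub>R G x else 0"
  show "compact ?K" "?K \<subseteq> U" by (rule test_functionD[OF t])+
  show "p x * \<phi> x = 0" if "x \<notin> ?K" for x using test_function_zero[OF t that] by simp
  show "GDERIV (\<lambda>x. p x * \<phi> x) x :> ?H x" for x
  proof (cases "x \<in> U")
    case True
    then show ?thesis using GDERIV_mult[OF p[OF True] test_functionD(1)[OF t]] by simp
  next
    case False
    then have "x \<notin> ?K" using test_functionD(5)[OF t] by blast
    have "GDERIV (\<lambda>x. p x * \<phi> x) x :> 0"
    proof (rule GDERIV_transform_open[OF GDERIV_const[where k = 0], where S = "- ?K"])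
      show "0 = p y * \<phi> y" if "y \<in> - ?K" for y using test_function_zero(1)[OF t, of y] that by simp
    qed (use \<open>x \<notin> ?K\<close> in auto)
    then show ?thesis using False by simp
  qed
  have "continuous_on (U \<union> - ?K) ?H"
  proof (rule continuous_on_open_Un)
    have "continuous_on U p" using p by (meson GDERIV_isCont continuous_at_imp_continuous_on)
    then have "continuous_on U (\<lambda>x. p x *\<^sub>R D x + \<phi> x *\<^sub>R G x)"
      using test_functionD(2,3)[OF t, THEN continuous_on_subset, of U] assms(4)
      by (intro continuous_intros) auto
    then show "continuous_on U ?H" by (rule continuous_on_eq) simp
    show "continuous_on (- ?K) ?H"
    proof (rule continuous_on_eq[OF continuous_on_const[where c = 0]])
      fix x assume "x \<in> - ?K"
      then have "x \<notin> ?K" by simp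
      from test_function_zero[OF t this] show "0 = ?H x" by simp
    qed
    show "open U" by fact
    show "open (- ?K)" by (rule open_Compl[OF closed_closure])
  qed
  moreover have "U \<union> - ?K = UNIV" using test_functionD(5)[OF t] by blast
  ultimately show "continuous_on UNIV ?H" by (simp only:)
qed

text \<open>The same product argument for a function that may be unbounded near the boundary of
  \<open>U\<close>; its values enter only on the compact support of the test function.\<close>

lemma weak_gradient_C1:
  assumes "open U" and p: "\<And>x. x \<in> U \<Longrightarrow> GDERIV p x :> G x" and "continuous_on U G"
  shows "weak_gradient U p G"
  unfolding weak_gradient_def
proof (intro allI impI)
  fix \<phi> D i assume t: "test_function U \<phi> D"
  have Um: "U \<in> sets lebesgue" using assms(1) by simp
  let ?K = "closure {x. \<phi> x \<noteq> 0}"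
  note K = test_functionD(4,5)[OF t]
  have c: "continuous_on ?K (\<lambda>x. p x * D x $ i)" "continuous_on ?K (\<lambda>x. G x $ i * \<phi> x)"
    using continuous_on_subset[OF assms(3) K(2)] test_functionD(2,3)[OF t, THEN continuous_on_subset, of ?K]
      continuous_at_imp_continuous_on[of ?K p] GDERIV_isCont[OF p] K(2)
    by (auto intro!: continuous_intros)
  have ic: "integrable lebesgue (\<lambda>x. if x \<in> U then f x else 0)"
    if "continuous_on ?K f" "\<And>x. x \<notin> ?K \<Longrightarrow> f x = 0" for f :: "_ \<Rightarrow> real"
  proof -
    have "integrable lborel (\<lambda>x. indicator ?K x *\<^sub>R f x)"
      by (rule borel_integrable_compact[OF K(1) that(1)])
    then have "integrable lebesgue (\<lambda>x. indicator ?K x *\<^sub>R f x)"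
      by (subst integrable_completion) auto
    moreover have "(\<lambda>x. indicator ?K x *\<^sub>R f x) = (\<lambda>x. if x \<in> ?K then f x else 0)"
      by (auto simp: indicator_def)
    ultimately have "integrable lebesgue (\<lambda>x. if x \<in> ?K then f x else 0)" by simp
    moreover have "(\<lambda>x. if x \<in> ?K then f x else 0) = (\<lambda>x. if x \<in> U then f x else 0)"
      using that(2) K(2) by (auto simp: fun_eq_iff)
    ultimately show ?thesis by simp
  qed
  have i1: "integrable lebesgue (\<lambda>x. if x \<in> U then p x * D x $ i else 0)"
  proof (rule ic[OF c(1)])
    fix x assume "x \<notin> ?K"
    from test_function_zero(2)[OF t this] show "p x * D x $ i = 0" by simp
  qed
  have i2: "integrable lebesgue (\<lambda>x. if x \<in> U then G x $ i * \<phi> x else 0)"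
  proof (rule ic[OF c(2)])
    fix x assume "x \<notin> ?K"
    from test_function_zero(1)[OF t this] show "G x $ i * \<phi> x = 0" by simp
  qed
  have "0 = (LINT x|lebesgue. (if x \<in> U then p x *\<^sub>R D x + \<phi> x *\<^sub>R G x else 0) $ i)"
    using test_function_integral_gradient_eq_0[OF test_function_mult_C1[OF t assms]] by simp
  also have "\<dots> = (LINT x|lebesgue. (if x \<in> U then p x * D x $ i else 0) + (if x \<in> U then G x $ i * \<phi> x else 0))"
    by (rule Bochner_Integration.integral_cong) (auto simp: mult.commute)
  also have "\<dots> = (LINT x|lebesgue_on U. p x * D x $ i) + (LINT x|lebesgue_on U. G x $ i * \<phi> x)"
    using i1 i2 by (simp add: lebesgue_on_integral[OF Um])
  finally show "(LINT x|lebesgue_on U. p x * D x $ i) = - (LINT x|lebesgue_on U. G x $ i * \<phi> x)" by simp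
qed

lemma mollifier_test_function:
  assumes "cball x r \<subseteq> U" "r > 0"
  shows "test_function U (\<lambda>y. mollifier r (x - y)) (\<lambda>y. - mollifier_grad r (x - y))"
proof (rule test_functionI)
  show "GDERIV (\<lambda>y. mollifier r (x - y)) y :> - mollifier_grad r (x - y)" for y
    using GDERIV_shift_scale[of "mollifier r" x "-1" y "mollifier_grad r (x - y)"] mollifier_GDERIV[of r "x - y"]
    by simp
  have "continuous_on UNIV (\<lambda>y. mollifier_grad r (x - y))"
    by (rule continuous_on_compose2[OF continuous_mollifier_grad[of UNIV]]) (auto intro!: continuous_intros)
  then show "continuous_on UNIV (\<lambda>y. - mollifier_grad r (x - y))" by (rule continuous_on_minus)
  show "mollifier r (x - y) = 0" if "y \<notin> cball x r" for y
    using mollifier_zero[of r "x - y"] that assms(2) by (simp add: dist_norm)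
qed (use assms in auto)

lemma extend_by_zero:
  fixes w :: "real^'n \<Rightarrow> 'b::euclidean_space"
  assumes "open U" "bounded U" "w \<in> square_integrable (lebesgue_on U)"
  shows "(\<lambda>x. if x \<in> U then w x else 0) \<in> square_integrable lebesgue"
    "integrable lebesgue (\<lambda>x. if x \<in> U then w x else 0)"
    "\<exists>R. \<forall>x. x \<notin> cball 0 R \<longrightarrow> (if x \<in> U then w x else 0) = 0"
proof -
  have Um: "U \<in> sets lebesgue" using assms(1) by simp
  show "(\<lambda>x. if x \<in> U then w x else 0) \<in> square_integrable lebesgue"
    using assms(3) by (simp add: square_integrable_restrict[OF Um])
  show "integrable lebesgue (\<lambda>x. if x \<in> U then w x else 0)"
    using square_integrable_imp_integrable[OF finite_measure_bounded_open[OF assms(1,2)] assms(3)]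
    by (simp add: lebesgue_on_integrable_iff[OF Um])
  obtain R where "\<forall>x\<in>U. norm x \<le> R" using assms(2) unfolding bounded_iff by blast
  then have "U \<subseteq> cball 0 R" by auto
  then show "\<exists>R. \<forall>x. x \<notin> cball 0 R \<longrightarrow> (if x \<in> U then w x else 0) = 0"
    by (intro exI[of _ R]) auto
qed

lemma mollify_extend_tendsto:
  fixes w :: "real^'n \<Rightarrow> real"
  assumes "open U" "bounded U" "w \<in> square_integrable (lebesgue_on U)"
  shows "(\<lambda>n. sqnorm lebesgue (\<lambda>x. mollify (1 / real (Suc n)) (\<lambda>x. if x \<in> U then w x else 0) x
      - (if x \<in> U then w x else 0))) \<longlonglongrightarrow> 0"
proof -
  obtain R where R: "\<forall>x. x \<notin> cball 0 R \<longrightarrow> (if x \<in> U then w x else 0) = 0"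
    using extend_by_zero(3)[OF assms] by (elim exE)
  show ?thesis
    by (rule mollify_tendsto[OF extend_by_zero(1)[OF assms] extend_by_zero(2)[OF assms] R[rule_format]])
qed

lemma mollify_restrict:
  assumes "open U"
  shows "mollify r (\<lambda>x. if x \<in> U then w x else 0) x = (LINT y|lebesgue_on U. w y * mollifier r (x - y))"
proof -
  have "U \<in> sets lebesgue" using assms by simp
  then show ?thesis unfolding mollify_def
    by (simp add: lebesgue_on_integral if_distrib[of "\<lambda>t. t * _"] cong: if_cong)
qed

lemma mollify_restrict_eq_0:
  assumes "\<And>\<phi> D. test_function U \<phi> D \<Longrightarrow> (LINT x|lebesgue_on U. g x * \<phi> x) = 0"
    and "cball x r \<subseteq> U" "r > 0" "open U"
  shows "mollify r (\<lambda>x. if x \<in> U then g x else 0) x = 0"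
  using assms(1)[OF mollifier_test_function[OF assms(2,3)]] by (simp add: mollify_restrict[OF assms(4)])

lemma cball_subset_infdist:
  fixes U :: "'a::heine_borel set"
  assumes "infdist x (- U) > r" "r > 0"
  shows "cball x r \<subseteq> U"
proof
  fix y assume y: "y \<in> cball x r"
  show "y \<in> U"
  proof (rule ccontr)
    assume "y \<notin> U"
    then have "infdist x (- U) \<le> dist x y" by (intro infdist_le) simp
    then show False using assms y by simp
  qed
qed

text \<open>Fundamental lemma of the calculus of variations. Mollifiers centred well inside
  \<open>U\<close> are test functions, so the mollifications of \<open>g\<close> vanish there, and
  they converge to \<open>g\<close> in square mean.\<close>

lemma integral_test_functions_eq_0_imp_AE:
  fixes g :: "real^'n \<Rightarrow> real"
  assumes U: "open U" "bounded U" and g: "g \<in> square_integrable (lebesgue_on U)"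
    and 0: "\<And>\<phi> D. test_function U \<phi> D \<Longrightarrow> (LINT x|lebesgue_on U. g x * \<phi> x) = 0"
  shows "AE x in lebesgue_on U. g x = 0"
proof -
  define G where "G x = (if x \<in> U then g x else 0)" for x
  \<comment> \<open>Closed balls of radius 1/(m+1) about these points stay in \<open>U\<close>, and
    the sets exhaust \<open>U\<close>.\<close>
  define V where "V m = {x. infdist x (- U) > 1 / real (Suc m)}" for m
  have G: "G \<in> square_integrable lebesgue" using extend_by_zero(1)[OF U g] by (simp add: G_def[abs_def])
  have Gi: "integrable lebesgue G" using extend_by_zero(2)[OF U g] by (simp add: G_def[abs_def])
  have Vo: "open (V m)" for m
    unfolding V_def by (rule open_Collect_less) (auto intro!: continuous_intros)
  have lim: "(\<lambda>n. sqnorm lebesgue (\<lambda>x. mollify (1 / real (Suc n)) G x - G x)) \<longlonglongrightarrow> 0"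
    using mollify_extend_tendsto[OF U g] by (simp add: G_def[abs_def])
  have zero: "mollify (1 / real (Suc n)) G x = 0" if "x \<in> V m" "n \<ge> m" for n m x
  proof -
    have "1 / real (Suc n) \<le> 1 / real (Suc m)" using that(2) by (simp add: frac_le)
    then have "infdist x (- U) > 1 / real (Suc n)" using that(1) unfolding V_def by simp
    then have "cball x (1 / real (Suc n)) \<subseteq> U" by (rule cball_subset_infdist) simp
    from mollify_restrict_eq_0[OF 0 this _ U(1)] show ?thesis by (simp add: G_def[abs_def])
  qed
  have "AE x in lebesgue. x \<in> V m \<longrightarrow> G x = 0" for m
  proof -
    have Vm: "V m \<in> sets lebesgue" using Vo by simp
    have sV: "(\<lambda>x. if x \<in> V m then G x else 0) \<in> square_integrable lebesgue"
      using square_integrable_lebesgue_on[OF G Vm] by (simp add: square_integrable_restrict[OF Vm])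
    have "sqnorm lebesgue (\<lambda>x. if x \<in> V m then G x else 0) \<le> sqnorm lebesgue (\<lambda>x. mollify (1 / real (Suc n)) G x - G x)"
      if "n \<ge> m" for n
    proof (rule sqnorm_mono[OF sV])
      show "(\<lambda>x. mollify (1 / real (Suc n)) G x - G x) \<in> square_integrable lebesgue"
        by (intro square_integrable_diff mollify_contraction G Gi) simp
      show "AE x in lebesgue. norm (if x \<in> V m then G x else 0) \<le> norm (mollify (1 / real (Suc n)) G x - G x)"
        using zero[OF _ that] by (intro AE_I2) auto
    qed
    then have "sqnorm lebesgue (\<lambda>x. if x \<in> V m then G x else 0) \<le> 0"
      by (intro LIMSEQ_le[OF tendsto_const lim]) blast
    then have "sqnorm lebesgue (\<lambda>x. if x \<in> V m then G x else 0) = 0"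
      using sqnorm_nonneg[of lebesgue "\<lambda>x. if x \<in> V m then G x else 0"] by linarith
    from sqnorm_zero_imp_AE[OF sV this] show ?thesis by eventually_elim (simp split: if_splits)
  qed
  then have "AE x in lebesgue. \<forall>m. x \<in> V m \<longrightarrow> G x = 0" unfolding AE_all_countable by blast
  then have "AE x in lebesgue. x \<in> U \<longrightarrow> g x = 0"
  proof eventually_elim
    case (elim x)
    show ?case
    proof
      assume x: "x \<in> U"
      \<comment> \<open>The distance to an empty complement would be 0 by convention, so the
        complement has to be nonempty.\<close>
      have "U \<noteq> UNIV" using U(2) not_bounded_UNIV by blast
      then have "infdist x (- U) > 0" using x U(1) by (intro infdist_pos_not_in_closed) auto
      then obtain m where "1 / real (Suc m) < infdist x (- U)" using nat_approx_posE by blast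
      then have "x \<in> V m" by (simp add: V_def)
      then have "G x = 0" using elim by blast
      then show "g x = 0" using x by (simp add: G_def)
    qed
  qed
  then show ?thesis using U(1) by (simp add: AE_restrict_space_iff)
qed

lemma integrable_mult_test_function:
  fixes w :: "real^'n \<Rightarrow> real"
  assumes "test_function V \<phi> D" "w \<in> square_integrable (lebesgue_on U)" "U \<in> sets lebesgue"
  shows "integrable (lebesgue_on U) (\<lambda>x. w x * \<phi> x)" "integrable (lebesgue_on U) (\<lambda>x. w x * D x $ i)"
  by (intro square_integrable_mult assms square_integrable_nth square_integrable_lebesgue_on
      test_function_square_integrable[OF assms(1)])+

section \<open>Linearity, uniqueness and the chosen gradient\<close>

lemma weak_gradient_lincomb:
  fixes w w' :: "real^'n \<Rightarrow> real"
  assumes "w \<in> L2 U" "g \<in> L2 U" "weak_gradient U w g" "w' \<in> L2 U" "g' \<in> L2 U" "weak_gradient U w' g'"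
    and "U \<in> sets lebesgue"
  shows "weak_gradient U (\<lambda>x. a * w x + b * w' x) (\<lambda>x. a *\<^sub>R g x + b *\<^sub>R g' x)"
  unfolding weak_gradient_def
proof (intro allI impI)
  fix \<phi> D i assume t: "test_function U \<phi> D"
  note s = assms(1,2,4,5)[unfolded L2_eq]
  note I = integrable_mult_test_function(2)[OF t s(1) assms(7), of i] integrable_mult_test_function(2)[OF t s(3) assms(7), of i]
    integrable_mult_test_function(1)[OF t square_integrable_nth[OF s(2)] assms(7), of i]
    integrable_mult_test_function(1)[OF t square_integrable_nth[OF s(4)] assms(7), of i]
  have "(LINT x|lebesgue_on U. (a * w x + b * w' x) * D x $ i)
      = (LINT x|lebesgue_on U. a * (w x * D x $ i) + b * (w' x * D x $ i))"
    by (simp add: algebra_simps)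
  also have "\<dots> = a * (LINT x|lebesgue_on U. w x * D x $ i) + b * (LINT x|lebesgue_on U. w' x * D x $ i)"
    using I by simp
  also have "\<dots> = - (a * (LINT x|lebesgue_on U. g x $ i * \<phi> x) + b * (LINT x|lebesgue_on U. g' x $ i * \<phi> x))"
    using assms(3,6) t unfolding weak_gradient_def by simp
  also have "\<dots> = - (LINT x|lebesgue_on U. a * (g x $ i * \<phi> x) + b * (g' x $ i * \<phi> x))"
    using I by simp
  also have "\<dots> = - (LINT x|lebesgue_on U. (a *\<^sub>R g x + b *\<^sub>R g' x) $ i * \<phi> x)"
    by (simp add: algebra_simps)
  finally show "(LINT x|lebesgue_on U. (a * w x + b * w' x) * D x $ i)
      = - (LINT x|lebesgue_on U. (a *\<^sub>R g x + b *\<^sub>R g' x) $ i * \<phi> x)" .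
qed

lemma weak_gradient_diff:
  fixes w w' :: "real^'n \<Rightarrow> real"
  assumes "w \<in> L2 U" "g \<in> L2 U" "weak_gradient U w g" "w' \<in> L2 U" "g' \<in> L2 U" "weak_gradient U w' g'"
    and "U \<in> sets lebesgue"
  shows "weak_gradient U (\<lambda>x. w x - w' x) (\<lambda>x. g x - g' x)"
  using weak_gradient_lincomb[OF assms, of 1 "-1"] by simp

lemma weak_gradient_sum:
  fixes w :: "'i \<Rightarrow> real^'n \<Rightarrow> real"
  assumes "\<And>i. i \<in> A \<Longrightarrow> w i \<in> L2 U" "\<And>i. i \<in> A \<Longrightarrow> g i \<in> L2 U"
    "\<And>i. i \<in> A \<Longrightarrow> weak_gradient U (w i) (g i)" and U: "U \<in> sets lebesgue"
  shows "weak_gradient U (\<lambda>x. \<Sum>i\<in>A. w i x) (\<lambda>x. \<Sum>i\<in>A. g i x)"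
  using assms(1-3)
proof (induction A rule: infinite_finite_induct)
  case (insert i A)
  have "weak_gradient U (\<lambda>x. 1 * w i x + 1 * (\<Sum>i\<in>A. w i x)) (\<lambda>x. 1 *\<^sub>R g i x + 1 *\<^sub>R (\<Sum>i\<in>A. g i x))"
  proof (rule weak_gradient_lincomb)
    show "(\<lambda>x. \<Sum>i\<in>A. w i x) \<in> L2 U" "(\<lambda>x. \<Sum>i\<in>A. g i x) \<in> L2 U"
      using insert.prems unfolding L2_eq by (auto intro!: square_integrable_sum)
    show "weak_gradient U (\<lambda>x. \<Sum>i\<in>A. w i x) (\<lambda>x. \<Sum>i\<in>A. g i x)"
      by (rule insert.IH) (use insert.prems in auto)
  qed (use insert.prems U in auto)
  then show ?case using insert.hyps by simp
qed (simp_all add: weak_gradient_def)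

lemma weak_gradient_cong_AE:
  fixes w w' :: "real^'n \<Rightarrow> real"
  assumes "weak_gradient U w g" "w \<in> L2 U" "w' \<in> L2 U" "g \<in> L2 U" "g' \<in> L2 U"
    and "AE x in lebesgue_on U. w x = w' x" "AE x in lebesgue_on U. g x = g' x" and U: "U \<in> sets lebesgue"
  shows "weak_gradient U w' g'"
  unfolding weak_gradient_def
proof (intro allI impI)
  fix \<phi> D i assume t: "test_function U \<phi> D"
  note s = assms(2-5)[unfolded L2_eq]
  have "(LINT x|lebesgue_on U. w' x * D x $ i) = (LINT x|lebesgue_on U. w x * D x $ i)"
  proof (rule integral_cong_AE)
    show "AE x in lebesgue_on U. w' x * D x $ i = w x * D x $ i" using assms(6) by eventually_elim simp
  qed (use integrable_mult_test_function(2)[OF t s(2) U, of i] integrable_mult_test_function(2)[OF t s(1) U, of i] in auto)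
  moreover have "(LINT x|lebesgue_on U. g' x $ i * \<phi> x) = (LINT x|lebesgue_on U. g x $ i * \<phi> x)"
  proof (rule integral_cong_AE)
    show "AE x in lebesgue_on U. g' x $ i * \<phi> x = g x $ i * \<phi> x" using assms(7) by eventually_elim simp
  qed (use integrable_mult_test_function(1)[OF t square_integrable_nth[OF s(4)] U, of i]
      integrable_mult_test_function(1)[OF t square_integrable_nth[OF s(3)] U, of i] in auto)
  ultimately show "(LINT x|lebesgue_on U. w' x * D x $ i) = - (LINT x|lebesgue_on U. g' x $ i * \<phi> x)"
    using assms(1) t unfolding weak_gradient_def by simp
qed

lemma weak_gradient_unique:
  assumes U: "open U" "bounded U"
    and "g \<in> L2 U" "weak_gradient U w g" "g' \<in> L2 U" "weak_gradient U w g'"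
  shows "AE x in lebesgue_on U. g x = g' x"
proof -
  have Um: "U \<in> sets lebesgue" using U by simp
  note s = assms(3,5)[unfolded L2_eq]
  have "AE x in lebesgue_on U. g x $ i - g' x $ i = 0" for i
  proof (rule integral_test_functions_eq_0_imp_AE[OF U])
    show "(\<lambda>x. g x $ i - g' x $ i) \<in> square_integrable (lebesgue_on U)"
      by (intro square_integrable_diff square_integrable_nth s)
    fix \<phi> D assume t: "test_function U \<phi> D"
    have "(LINT x|lebesgue_on U. g x $ i * \<phi> x) = (LINT x|lebesgue_on U. g' x $ i * \<phi> x)"
      using assms(4,6) t unfolding weak_gradient_def by fastforce
    then show "(LINT x|lebesgue_on U. (g x $ i - g' x $ i) * \<phi> x) = 0"
      using integrable_mult_test_function(1)[OF t square_integrable_nth[OF s(1)] Um, of i]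
        integrable_mult_test_function(1)[OF t square_integrable_nth[OF s(2)] Um, of i]
      by (simp add: left_diff_distrib)
  qed
  then have "AE x in lebesgue_on U. \<forall>i. g x $ i - g' x $ i = 0" by (simp add: AE_all_countable)
  then show ?thesis by eventually_elim (simp add: vec_eq_iff)
qed

lemma H1_grad:
  assumes "w \<in> H1 U"
  shows "w \<in> L2 U" "grad U w \<in> L2 U" "weak_gradient U w (grad U w)"
proof -
  have "\<exists>g. g \<in> L2 U \<and> weak_gradient U w g" using assms by (auto simp: H1_def)
  from someI_ex[OF this] show "grad U w \<in> L2 U" "weak_gradient U w (grad U w)"
    by (simp_all add: grad_def)
  show "w \<in> L2 U" using assms by (simp add: H1_def)
qed

lemma H1I: "w \<in> L2 U \<Longrightarrow> g \<in> L2 U \<Longrightarrow> weak_gradient U w g \<Longrightarrow> w \<in> H1 U"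
  by (auto simp: H1_def)

text \<open>\<open>grad\<close> is a choice among weak gradients; this lets any explicit weak
  gradient stand in for it.\<close>

lemma grad_AE_eq:
  assumes "open U" "bounded U" "w \<in> L2 U" "g \<in> L2 U" "weak_gradient U w g"
  shows "AE x in lebesgue_on U. grad U w x = g x"
  by (rule weak_gradient_unique[OF assms(1,2) H1_grad(2,3)[OF H1I[OF assms(3-5)]] assms(4,5)])

lemma L2_measurable: "g \<in> L2 U \<Longrightarrow> g \<in> borel_measurable (lebesgue_on U)"
  by (simp add: L2_def)

lemma dirichlet_form_eq:
  assumes "open U" "bounded U" "w \<in> L2 U" "g \<in> L2 U" "weak_gradient U w g"
    and "w' \<in> L2 U" "g' \<in> L2 U" "weak_gradient U w' g'"
  shows "dirichlet_form U w w' = (LINT x|lebesgue_on U. g x \<bullet> g' x)"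
proof -
  note [measurable] = L2_measurable[OF H1_grad(2)[OF H1I[OF assms(3-5)]]]
    L2_measurable[OF H1_grad(2)[OF H1I[OF assms(6-8)]]] L2_measurable[OF assms(4)] L2_measurable[OF assms(7)]
  show ?thesis unfolding dirichlet_form_def
  proof (rule integral_cong_AE)
    show "AE x in lebesgue_on U. grad U w x \<bullet> grad U w' x = g x \<bullet> g' x"
      using grad_AE_eq[OF assms(1-5)] grad_AE_eq[OF assms(1,2,6-8)] by eventually_elim simp
  qed measurable
qed

lemma H1_seminorm_eq:
  assumes "open U" "bounded U" "w \<in> L2 U" "g \<in> L2 U" "weak_gradient U w g"
  shows "H1_seminorm U w = sqrt (sqnorm (lebesgue_on U) g)"
  unfolding H1_seminorm_def sqnorm_def[symmetric]
  using sqnorm_AE_cong[OF L2_measurable[OF H1_grad(2)[OF H1I[OF assms(3-5)]]] L2_measurable[OF assms(4)]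
      grad_AE_eq[OF assms]] by simp

lemma test_function_weak_gradient:
  assumes "test_function U \<phi> D" "V \<in> sets lebesgue"
  shows "\<phi> \<in> L2 V" "D \<in> L2 V" "weak_gradient V \<phi> D"
proof -
  show "\<phi> \<in> L2 V" "D \<in> L2 V"
    unfolding L2_eq by (intro square_integrable_lebesgue_on test_function_square_integrable[OF assms(1)] assms(2))+
  have "weak_gradient UNIV \<phi> D"
    by (rule weak_gradient_C1[OF open_UNIV test_functionD(1,2)[OF assms(1)]])
  then show "weak_gradient V \<phi> D" by (rule weak_gradient_subset) (use assms(2) in auto)
qed

lemma H1_norm_diff_test_function:
  assumes "open U" "bounded U" "w \<in> L2 U" "g \<in> L2 U" "weak_gradient U w g" "test_function U \<phi> D"
  shows "H1_norm U (\<lambda>x. w x - \<phi> x)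
    = sqrt (sqnorm (lebesgue_on U) (\<lambda>x. w x - \<phi> x) + sqnorm (lebesgue_on U) (\<lambda>x. g x - D x))"
proof -
  have Um: "U \<in> sets lebesgue" using assms(1) by simp
  note t = test_function_weak_gradient[OF assms(6) Um]
  have d: "(\<lambda>x. w x - \<phi> x) \<in> L2 U" "(\<lambda>x. g x - D x) \<in> L2 U"
    using assms(3,4) t(1,2) unfolding L2_eq by (auto intro: square_integrable_diff)
  have "H1_seminorm U (\<lambda>x. w x - \<phi> x) = sqrt (sqnorm (lebesgue_on U) (\<lambda>x. g x - D x))"
    by (rule H1_seminorm_eq[OF assms(1,2) d weak_gradient_diff[OF assms(3-5) t Um]])
  then show ?thesis
    using sqnorm_nonneg[of "lebesgue_on U" "\<lambda>x. g x - D x"] by (simp add: H1_norm_def sqnorm_def)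
qed

text \<open>Trades the norm built on the chosen gradient for a condition on an explicit pair of
  function and gradient.\<close>

lemma H10_iff:
  assumes "open U" "bounded U" "w \<in> L2 U" "g \<in> L2 U" "weak_gradient U w g"
  shows "w \<in> H10 U \<longleftrightarrow> (\<forall>e>0. \<exists>\<phi> D. test_function U \<phi> D \<and>
     sqnorm (lebesgue_on U) (\<lambda>x. w x - \<phi> x) + sqnorm (lebesgue_on U) (\<lambda>x. g x - D x) < e)"
    (is "_ \<longleftrightarrow> (\<forall>e>0. \<exists>\<phi> D. _ \<and> ?s \<phi> D < e)")
proof -
  have nn: "?s \<phi> D \<ge> 0" for \<phi> D by (simp add: sqnorm_nonneg)
  have N: "H1_norm U (\<lambda>x. w x - \<phi> x) = sqrt (?s \<phi> D)" if "test_function U \<phi> D" for \<phi> D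
    by (rule H1_norm_diff_test_function[OF assms that])
  have w: "w \<in> H1 U" by (rule H1I[OF assms(3-5)])
  show ?thesis
  proof
    assume H: "w \<in> H10 U"
    show "\<forall>e>0. \<exists>\<phi> D. test_function U \<phi> D \<and> ?s \<phi> D < e"
    proof (intro allI impI)
      fix e :: real assume "e > 0"
      then have "sqrt e > 0" by simp
      then obtain \<phi> D where t: "test_function U \<phi> D" "H1_norm U (\<lambda>x. w x - \<phi> x) < sqrt e"
        using H unfolding H10_def by blast
      then have "?s \<phi> D < e" using N[OF t(1)] by simp
      then show "\<exists>\<phi> D. test_function U \<phi> D \<and> ?s \<phi> D < e" using t(1) by blast
    qed
  next
    assume H: "\<forall>e>0. \<exists>\<phi> D. test_function U \<phi> D \<and> ?s \<phi> D < e"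
    show "w \<in> H10 U" unfolding H10_def
    proof (intro CollectI conjI w allI impI)
      fix e :: real assume e: "e > 0"
      then have "e\<^sup>2 > 0" by simp
      then obtain \<phi> D where t: "test_function U \<phi> D" "?s \<phi> D < e\<^sup>2"
        using H by blast
      then have "sqrt (?s \<phi> D) < sqrt (e\<^sup>2)" by (intro real_sqrt_less_mono)
      then have "H1_norm U (\<lambda>x. w x - \<phi> x) < e" using N[OF t(1)] e by simp
      then show "\<exists>\<phi> D. test_function U \<phi> D \<and> H1_norm U (\<lambda>x. w x - \<phi> x) < e" using t(1) by blast
    qed
  qed
qed

section \<open>Functions with zero trace\<close>

lemma compact_subset_open_cball:
  fixes K :: "'a::heine_borel set"
  assumes "compact K" "open U" "K \<subseteq> U"
  obtains d where "d > 0" "\<And>x y. x \<in> K \<Longrightarrow> dist x y < d \<Longrightarrow> y \<in> U"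
proof -
  have "K \<inter> - U = {}" using assms(3) by blast
  then obtain d where d: "d > 0" "\<forall>x\<in>K. \<forall>y\<in>- U. d \<le> dist x y"
    using separate_compact_closed[OF assms(1), of "- U"] assms(2) by (auto simp: closed_Compl)
  show thesis
  proof (rule that[OF d(1)])
    fix x y assume "x \<in> K" "dist x y < d"
    then show "y \<in> U" using d(2) by (meson ComplI linorder_not_le)
  qed
qed

text \<open>The y-gradient of the kernel is minus its x-gradient, and as a function of y the kernel
  is a test function of \<open>U\<close> as long as the ball stays inside.\<close>

lemma mollify_grad_weak_gradient:
  fixes w :: "real^'n \<Rightarrow> real"
  assumes U: "open U" "bounded U" and w: "w \<in> L2 U" "weak_gradient U w g"
    and r: "cball x r \<subseteq> U" "r > 0"
  shows "mollify_grad r (\<lambda>x. if x \<in> U then w x else 0) x $ i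
    = mollify r (\<lambda>x. if x \<in> U then g x $ i else 0) x"
proof -
  have Um: "U \<in> sets lebesgue" using U by simp
  define W where "W x = (if x \<in> U then w x else 0)" for x
  have Wi: "integrable lebesgue W"
    using extend_by_zero(2)[OF U w(1)[unfolded L2_eq]] by (simp add: W_def[abs_def])
  have "mollify_grad r W x $ i = (LINT y|lebesgue. W y *\<^sub>R mollifier_grad r (x - y)) \<bullet> axis i 1"
    by (simp add: mollify_grad_def inner_axis)
  also have "\<dots> = (LINT y|lebesgue. (W y *\<^sub>R mollifier_grad r (x - y)) \<bullet> axis i 1)"
    by (rule integral_inner_left[symmetric]) (rule mollify_integrable(2)[OF r(2) Wi])
  also have "\<dots> = (LINT y|lebesgue. (if y \<in> U then w y * mollifier_grad r (x - y) $ i else 0))"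
    by (rule Bochner_Integration.integral_cong) (auto simp: W_def inner_axis)
  also have "\<dots> = (LINT y|lebesgue_on U. w y * mollifier_grad r (x - y) $ i)"
    by (rule lebesgue_on_integral[OF Um, symmetric])
  also have "\<dots> = - (LINT y|lebesgue_on U. w y * (- mollifier_grad r (x - y)) $ i)"
    by simp
  also have "\<dots> = (LINT y|lebesgue_on U. g y $ i * mollifier r (x - y))"
    using w(2)[unfolded weak_gradient_def, rule_format, OF mollifier_test_function[OF r], of i] by simp
  also have "\<dots> = mollify r (\<lambda>x. if x \<in> U then g x $ i else 0) x"
    by (simp add: mollify_restrict[OF U(1)])
  finally show ?thesis by (simp add: W_def[abs_def])
qed

lemma mollify_grad_continuous:
  assumes "r > 0" "integrable lebesgue F"
  shows "continuous_on UNIV (mollify_grad r F :: real^'n \<Rightarrow> real^'n)"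
proof (rule continuous_at_imp_continuous_on, intro ballI)
  fix x :: "real^'n"
  define c where "c = (LINT y|lebesgue. \<bar>F y\<bar>)"
  have c: "c \<ge> 0" by (simp add: c_def)
  show "isCont (mollify_grad r F) x"
    unfolding isCont_def LIM_def
  proof (intro allI impI)
    fix e :: real assume "e > 0"
    then have e': "e / (c + 1) > 0" using c by simp
    have z: "mollifier_grad r z = 0" if "z \<notin> cball 0 r" for z :: "real^'n"
      using mollifier_grad_zero[of r z] that assms by simp
    obtain d where d: "d > 0" "\<And>x y. norm (x - y) < d \<Longrightarrow> norm (mollifier_grad r x - mollifier_grad r (y::real^'n)) < e / (c + 1)"
      using compact_support_uniformly_continuous[OF continuous_mollifier_grad z e'] by blast
    have "norm (mollify_grad r F y - mollify_grad r F x) < e" if "norm (y - x) < d" for y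
    proof -
      have "mollify_grad r F y - mollify_grad r F x
          = (LINT z|lebesgue. F z *\<^sub>R (mollifier_grad r (y - z) - mollifier_grad r (x - z)))"
        unfolding mollify_grad_def scaleR_diff_right
        by (rule Bochner_Integration.integral_diff[symmetric]) (rule mollify_integrable(2)[OF assms])+
      also have "norm \<dots> \<le> (LINT z|lebesgue. \<bar>F z\<bar> * (e / (c + 1)))"
      proof (rule order_trans[OF integral_norm_bound], rule integral_mono_AE')
        show "integrable lebesgue (\<lambda>z. \<bar>F z\<bar> * (e / (c + 1)))"
          using assms(2) by (intro integrable_mult_left integrable_abs)
        show "AE z in lebesgue. norm (F z *\<^sub>R (mollifier_grad r (y - z) - mollifier_grad r (x - z))) \<le> \<bar>F z\<bar> * (e / (c + 1))"
          unfolding norm_scaleR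
          by (intro AE_I2 mult_left_mono less_imp_le[OF d(2)] abs_ge_zero) (use that in simp)
        show "AE z in lebesgue. 0 \<le> \<bar>F z\<bar> * (e / (c + 1))"
          using e' by (intro AE_I2 mult_nonneg_nonneg) auto
      qed
      also have "\<dots> = c * (e / (c + 1))" by (simp add: c_def)
      also have "\<dots> < e" using c \<open>e > 0\<close> by (simp add: field_simps)
      finally show ?thesis .
    qed
    then show "\<exists>d>0. \<forall>y. y \<noteq> x \<and> dist y x < d \<longrightarrow> dist (mollify_grad r F y) (mollify_grad r F x) < e"
      using d(1) by (auto simp: dist_norm)
  qed
qed

lemma integral_mult_tendsto_0:
  fixes f :: "nat \<Rightarrow> 'a \<Rightarrow> real"
  assumes "\<And>n. f n \<in> square_integrable M" "k \<in> square_integrable M" "(\<lambda>n. sqnorm M (f n)) \<longlonglongrightarrow> 0"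
  shows "(\<lambda>n. LINT x|M. f n x * k x) \<longlonglongrightarrow> 0"
  using sqnorm_tendsto_inner[of f M "\<lambda>x. 0" k] assms by (simp add: square_integrable_zero)

lemma sqnorm_tendsto_0_bound:
  fixes f :: "nat \<Rightarrow> 'a \<Rightarrow> 'b::euclidean_space" and k :: "nat \<Rightarrow> 'a \<Rightarrow> 'c::euclidean_space"
  assumes "\<And>n. k n \<in> square_integrable M" "(\<lambda>n. sqnorm M (k n)) \<longlonglongrightarrow> 0"
    "\<And>n. f n \<in> borel_measurable M" "\<And>n x. norm (f n x) \<le> C * norm (k n x)"
  shows "\<And>n. f n \<in> square_integrable M" "(\<lambda>n. sqnorm M (f n)) \<longlonglongrightarrow> 0"
proof -
  show f: "f n \<in> square_integrable M" for n
    by (rule square_integrable_bound[OF assms(1) assms(3)]) (use assms(4) in auto)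
  show "(\<lambda>n. sqnorm M (f n)) \<longlonglongrightarrow> 0"
  proof (rule Lim_null_comparison)
    show "\<forall>\<^sub>F n in sequentially. norm (sqnorm M (f n)) \<le> C\<^sup>2 * sqnorm M (k n)"
    proof (rule always_eventually, rule allI)
      fix n
      have "sqnorm M (f n) \<le> sqnorm M (\<lambda>x. C *\<^sub>R k n x)"
      proof (rule sqnorm_mono[OF f square_integrable_scaleR[OF assms(1)]])
        have "norm (f n x) \<le> norm (C *\<^sub>R k n x)" for x
          using assms(4)[of n x] mult_right_mono[OF abs_ge_self[of C] norm_ge_zero[of "k n x"]] by simp
        then show "AE x in M. norm (f n x) \<le> norm (C *\<^sub>R k n x)" by simp
      qed
      then show "norm (sqnorm M (f n)) \<le> C\<^sup>2 * sqnorm M (k n)" by (simp add: sqnorm_scaleR sqnorm_nonneg)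
    qed
    show "(\<lambda>n. C\<^sup>2 * sqnorm M (k n)) \<longlonglongrightarrow> 0" using tendsto_mult_right_zero[OF assms(2)] .
  qed
qed

text \<open>The classical chain rule holds for the mollified functions, whose gradients near the
  support of the test function are the mollified weak gradients; the bounds on \<open>h'\<close>
  carry both sides to the limit.\<close>

lemma weak_gradient_chain:
  fixes w :: "real^'n \<Rightarrow> real"
  assumes U: "open U" "bounded U" and w: "w \<in> L2 U" "g \<in> L2 U" "weak_gradient U w g"
    and h: "\<And>s. (h has_real_derivative h' s) (at s)" "h 0 = 0"
      "\<And>s. \<bar>h' s\<bar> \<le> A" "\<And>s t. \<bar>h' s - h' t\<bar> \<le> L * \<bar>s - t\<bar>"
  shows "weak_gradient U (\<lambda>x. h (w x)) (\<lambda>x. h' (w x) *\<^sub>R g x)"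
  unfolding weak_gradient_def
proof (intro allI impI)
  fix \<phi> D i assume t: "test_function U \<phi> D"
  have Um: "U \<in> sets lebesgue" using U by simp
  define W G where "W x = (if x \<in> U then w x else 0)" and "G x = (if x \<in> U then g x $ i else 0)" for x
  define \<rho> where "\<rho> n = 1 / real (Suc n)" for n
  have \<rho>: "\<rho> n > 0" for n by (simp add: \<rho>_def)
  have gi: "(\<lambda>x. g x $ i) \<in> square_integrable (lebesgue_on U)"
    using w(2) unfolding L2_eq by (rule square_integrable_nth)
  have W: "W \<in> square_integrable lebesgue" "integrable lebesgue W"
    using extend_by_zero(1,2)[OF U w(1)[unfolded L2_eq]] by (simp_all add: W_def[abs_def])
  have G: "G \<in> square_integrable lebesgue" "integrable lebesgue G"
    using extend_by_zero(1,2)[OF U gi] by (simp_all add: G_def[abs_def])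
  define wn Gn where "wn n = mollify (\<rho> n) W" and "Gn n = mollify (\<rho> n) G" for n
  have wn: "wn n \<in> square_integrable lebesgue" "continuous_on UNIV (wn n)" for n
    unfolding wn_def by (rule mollify_contraction[OF \<rho> W(2,1)], rule mollify_continuous[OF \<rho> W(2)])
  have Gn: "Gn n \<in> square_integrable lebesgue" "continuous_on UNIV (Gn n)" for n
    unfolding Gn_def by (rule mollify_contraction[OF \<rho> G(2,1)], rule mollify_continuous[OF \<rho> G(2)])
  have limW: "(\<lambda>n. sqnorm lebesgue (\<lambda>x. wn n x - W x)) \<longlonglongrightarrow> 0"
    using mollify_extend_tendsto[OF U w(1)[unfolded L2_eq]] by (simp add: W_def[abs_def] wn_def \<rho>_def)
  have limG: "(\<lambda>n. sqnorm lebesgue (\<lambda>x. Gn n x - G x)) \<longlonglongrightarrow> 0"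
    using mollify_extend_tendsto[OF U gi] by (simp add: G_def[abs_def] Gn_def \<rho>_def)
  have ch: "continuous_on UNIV h" by (rule DERIV_continuous_on) (rule has_field_derivative_at_within[OF h(1)])
  have L: "L \<ge> 0" using h(4)[of 1 0] abs_ge_zero[of "h' 1 - h' 0"] by simp
  have ch': "continuous_on UNIV h'"
    by (rule lipschitz_on_continuous_on[of L]) (auto simp: lipschitz_on_def L dist_real_def h(4))
  have hl: "\<bar>h s - h t\<bar> \<le> A * \<bar>s - t\<bar>" for s t
    using field_differentiable_bound[of UNIV h h' A s t] h(1,3) by simp
  have hm: "h \<in> borel_measurable borel" "h' \<in> borel_measurable borel"
    using ch ch' by (auto intro: borel_measurable_continuous_onI)
  note Wm[measurable] = square_integrable_measurable[OF W(1)] square_integrable_measurable[OF G(1)]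
    square_integrable_measurable[OF wn(1)] square_integrable_measurable[OF Gn(1)] hm
  note \<phi>s = test_function_square_integrable(1)[OF t]
  note Ds = square_integrable_nth[OF test_function_square_integrable(2)[OF t], of i]
  have hW: "(\<lambda>x. h (W x)) \<in> square_integrable lebesgue"
    by (rule square_integrable_bound[OF W(1), where C = A]) (use hl[of _ 0] h(2) in auto)
  have hwn: "(\<lambda>x. h (wn n x)) \<in> square_integrable lebesgue" for n
    by (rule square_integrable_bound[OF wn(1), where C = A]) (use hl[of _ 0] h(2) in auto)
  have lim1: "(\<lambda>n. LINT x|lebesgue. h (wn n x) * D x $ i) \<longlonglongrightarrow> (LINT x|lebesgue. h (W x) * D x $ i)"
  proof -
    have "(\<lambda>n. sqnorm lebesgue (\<lambda>x. h (wn n x) - h (W x))) \<longlonglongrightarrow> 0"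
      by (rule sqnorm_tendsto_0_bound(2)[OF square_integrable_diff[OF wn(1) W(1)] limW, where C = A])
         (use hl in auto)
    from sqnorm_tendsto_inner[OF hwn hW Ds this] show ?thesis by simp
  qed
  define C where "C x = h' (W x) * G x" for x
  have bd: "AE x in lebesgue. \<bar>h' (W x)\<bar> \<le> A" "AE x in lebesgue. \<bar>h' (wn n x)\<bar> \<le> A" for n
    using h(3) by auto
  have CL: "C \<in> square_integrable lebesgue"
    unfolding C_def[abs_def] using square_integrable_bounded_mult[OF G(1) _ bd(1)] by simp
  have CnL: "(\<lambda>x. h' (wn n x) * Gn n x) \<in> square_integrable lebesgue" for n
    using square_integrable_bounded_mult[OF Gn(1)[of n] _ bd(2)[of n]] by simp
  have lim2: "(\<lambda>n. LINT x|lebesgue. (h' (wn n x) * Gn n x) * \<phi> x) \<longlonglongrightarrow> (LINT x|lebesgue. C x * \<phi> x)"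
  proof -
    obtain B where "\<forall>x. \<bar>\<phi> x\<bar> \<le> B \<and> norm (D x) \<le> B" using test_function_bounded[OF t] by (elim exE conjE)
    then have B: "AE x in lebesgue. \<bar>\<phi> x\<bar> \<le> B" by simp
    have G\<phi>: "(\<lambda>x. G x * \<phi> x) \<in> square_integrable lebesgue"
      using square_integrable_bounded_mult[OF G(1) square_integrable_measurable[OF \<phi>s] B]
      by (simp add: mult.commute)
    have d1: "(\<lambda>x. h' (wn n x) * (Gn n x - G x)) \<in> square_integrable lebesgue" for n
      using square_integrable_bounded_mult[OF square_integrable_diff[OF Gn(1)[of n] G(1)] _ bd(2)[of n]] by simp
    have d2: "(\<lambda>x. h' (wn n x) - h' (W x)) \<in> square_integrable lebesgue" for n
      by (rule sqnorm_tendsto_0_bound(1)[OF square_integrable_diff[OF wn(1) W(1)] limW, where C = L])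
         (use h(4) in auto)
    \<comment> \<open>The difference h'(wn) Gn - h'(W) G is split as h'(wn) (Gn - G) + (h'(wn) -
      h'(W)) G. The first part uses the bound \<open>A\<close>; in the second the bounded test
      function is put with \<open>G\<close>, so that both factors are square integrable.\<close>
    have "(\<lambda>n. LINT x|lebesgue. (h' (wn n x) * (Gn n x - G x)) * \<phi> x) \<longlonglongrightarrow> 0"
    proof (rule integral_mult_tendsto_0[OF d1 \<phi>s])
      show "(\<lambda>n. sqnorm lebesgue (\<lambda>x. h' (wn n x) * (Gn n x - G x))) \<longlonglongrightarrow> 0"
        by (rule sqnorm_tendsto_0_bound(2)[OF square_integrable_diff[OF Gn(1) G(1)] limG, where C = A])
           (use h(3) in \<open>auto simp: abs_mult intro!: mult_right_mono\<close>)
    qed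
    moreover have "(\<lambda>n. LINT x|lebesgue. (h' (wn n x) - h' (W x)) * (G x * \<phi> x)) \<longlonglongrightarrow> 0"
    proof (rule integral_mult_tendsto_0[OF d2 G\<phi>])
      show "(\<lambda>n. sqnorm lebesgue (\<lambda>x. h' (wn n x) - h' (W x))) \<longlonglongrightarrow> 0"
        by (rule sqnorm_tendsto_0_bound(2)[OF square_integrable_diff[OF wn(1) W(1)] limW, where C = L])
           (use h(4) in auto)
    qed
    ultimately have "(\<lambda>n. (LINT x|lebesgue. (h' (wn n x) * (Gn n x - G x)) * \<phi> x)
        + (LINT x|lebesgue. (h' (wn n x) - h' (W x)) * (G x * \<phi> x))) \<longlonglongrightarrow> 0"
      using tendsto_add by fastforce
    moreover have "(LINT x|lebesgue. (h' (wn n x) * (Gn n x - G x)) * \<phi> x)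
        + (LINT x|lebesgue. (h' (wn n x) - h' (W x)) * (G x * \<phi> x))
        = (LINT x|lebesgue. (h' (wn n x) * Gn n x) * \<phi> x) - (LINT x|lebesgue. C x * \<phi> x)" for n
      using square_integrable_mult[OF d1[of n] \<phi>s] square_integrable_mult[OF d2[of n] G\<phi>]
        square_integrable_mult[OF CL \<phi>s] square_integrable_mult[OF CnL[of n] \<phi>s]
      by (subst Bochner_Integration.integral_add[symmetric], simp, simp,
          subst Bochner_Integration.integral_diff[symmetric], simp, simp)
         (rule Bochner_Integration.integral_cong, auto simp: C_def algebra_simps)
    ultimately show ?thesis by (simp add: LIM_zero_iff)
  qed
  \<comment> \<open>Once the radius is below the distance of the support from the complement of
    \<open>U\<close>, mollifying commutes with the weak gradient on the support.\<close>
  obtain d where d: "d > 0" "\<And>x y. x \<in> closure {x. \<phi> x \<noteq> 0} \<Longrightarrow> dist x y < d \<Longrightarrow> y \<in> U"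
    using compact_subset_open_cball[OF test_functionD(4)[OF t] U(1) test_functionD(5)[OF t]] by blast
  have eq: "(LINT x|lebesgue. h (wn n x) * D x $ i) = - (LINT x|lebesgue. (h' (wn n x) * Gn n x) * \<phi> x)"
    if n: "\<rho> n < d" for n
  proof -
    have gd: "GDERIV (\<lambda>x. h (wn n x)) x :> h' (wn n x) *\<^sub>R mollify_grad (\<rho> n) W x" for x
      unfolding wn_def by (rule GDERIV_DERIV_compose[OF mollify_GDERIV[OF \<rho> W(2)] h(1)])
    have "continuous_on UNIV (\<lambda>x. h' (wn n x))"
      by (rule continuous_on_compose2[OF ch' wn(2)]) simp
    then have "continuous_on U (\<lambda>x. h' (wn n x) *\<^sub>R mollify_grad (\<rho> n) W x)"
      by (intro continuous_on_subset[OF continuous_on_scaleR[OF _ mollify_grad_continuous[OF \<rho> W(2)]]]) auto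
    from weak_gradient_C1[OF U(1) gd this] t
    have "(LINT x|lebesgue. h (wn n x) * D x $ i)
        = - (LINT x|lebesgue. (h' (wn n x) *\<^sub>R mollify_grad (\<rho> n) W x) $ i * \<phi> x)"
      unfolding weak_gradient_iff[OF Um] by blast
    also have "(\<lambda>x. (h' (wn n x) *\<^sub>R mollify_grad (\<rho> n) W x) $ i * \<phi> x) = (\<lambda>x. (h' (wn n x) * Gn n x) * \<phi> x)"
    proof (rule ext)
      fix x
      show "(h' (wn n x) *\<^sub>R mollify_grad (\<rho> n) W x) $ i * \<phi> x = (h' (wn n x) * Gn n x) * \<phi> x"
      proof (cases "x \<in> closure {x. \<phi> x \<noteq> 0}")
        case True
        have "cball x (\<rho> n) \<subseteq> U" using d(2)[OF True] n by auto
        from mollify_grad_weak_gradient[OF U w(1,3) this \<rho>, of i]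
        have "mollify_grad (\<rho> n) W x $ i = Gn n x"
          by (simp add: W_def[abs_def] G_def[abs_def] Gn_def)
        then show ?thesis by simp
      next
        case False
        from test_function_zero(1)[OF t False] show ?thesis by simp
      qed
    qed
    finally show ?thesis .
  qed
  have "\<forall>\<^sub>F n in sequentially. (LINT x|lebesgue. h (wn n x) * D x $ i) = - (LINT x|lebesgue. (h' (wn n x) * Gn n x) * \<phi> x)"
  proof -
    have "\<rho> \<longlonglongrightarrow> 0" unfolding \<rho>_def[abs_def] using LIMSEQ_inverse_real_of_nat by (simp add: inverse_eq_divide)
    then have "\<forall>\<^sub>F n in sequentially. \<rho> n < d" using order_tendstoD(2)[of \<rho> 0] d(1) by blast
    then show ?thesis by eventually_elim (rule eq)
  qed
  then have "(\<lambda>n. - (LINT x|lebesgue. (h' (wn n x) * Gn n x) * \<phi> x)) \<longlonglongrightarrow> (LINT x|lebesgue. h (W x) * D x $ i)"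
    using lim1 by (simp add: tendsto_cong)
  with tendsto_minus[OF lim2] have "(LINT x|lebesgue. h (W x) * D x $ i) = - (LINT x|lebesgue. C x * \<phi> x)"
    using LIMSEQ_unique by blast
  moreover have "(\<lambda>x. h (W x) * D x $ i) = (\<lambda>x. if x \<in> U then h (w x) * D x $ i else 0)"
    "(\<lambda>x. C x * \<phi> x) = (\<lambda>x. if x \<in> U then (h' (w x) *\<^sub>R g x) $ i * \<phi> x else 0)"
    by (auto simp: W_def G_def C_def h(2))
  ultimately show "(LINT x|lebesgue_on U. h (w x) * D x $ i) = - (LINT x|lebesgue_on U. (h' (w x) *\<^sub>R g x) $ i * \<phi> x)"
    by (simp only: lebesgue_on_integral[OF Um])
qed

text \<open>The weak gradient is a closed operator: both sides of its definition are continuous in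
  square mean.\<close>

lemma weak_gradient_limit:
  fixes w :: "nat \<Rightarrow> real^'n \<Rightarrow> real"
  assumes U: "U \<in> sets lebesgue" and "\<And>n. w n \<in> L2 U" "\<And>n. g n \<in> L2 U" "\<And>n. weak_gradient U (w n) (g n)"
    and "w' \<in> L2 U" "g' \<in> L2 U"
    and "(\<lambda>n. sqnorm (lebesgue_on U) (\<lambda>x. w n x - w' x)) \<longlonglongrightarrow> 0"
    and "(\<lambda>n. sqnorm (lebesgue_on U) (\<lambda>x. g n x - g' x)) \<longlonglongrightarrow> 0"
  shows "weak_gradient U w' g'"
  unfolding weak_gradient_def
proof (intro allI impI)
  fix \<phi> D i assume t: "test_function U \<phi> D"
  note \<phi>s = square_integrable_lebesgue_on[OF test_function_square_integrable(1)[OF t] U]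
  note Ds = square_integrable_lebesgue_on[OF square_integrable_nth[OF test_function_square_integrable(2)[OF t], of i] U]
  note s = assms(2,3,5,6)[unfolded L2_eq]
  have 1: "(\<lambda>n. LINT x|lebesgue_on U. w n x * D x $ i) \<longlonglongrightarrow> (LINT x|lebesgue_on U. w' x * D x $ i)"
    using sqnorm_tendsto_inner[OF s(1,3) Ds assms(7)] by simp
  have "(\<lambda>n. sqnorm (lebesgue_on U) (\<lambda>x. g n x $ i - g' x $ i)) \<longlonglongrightarrow> 0"
  proof (rule sqnorm_tendsto_0_bound(2)[OF square_integrable_diff[OF s(2,4)] assms(8), where C = 1])
    show "(\<lambda>x. g n x $ i - g' x $ i) \<in> borel_measurable (lebesgue_on U)" for n
      by (intro borel_measurable_diff square_integrable_measurable square_integrable_nth s)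
    show "norm (g n x $ i - g' x $ i) \<le> 1 * norm (g n x - g' x)" for n x
      using component_le_norm_cart[of "g n x - g' x" i] by simp
  qed
  from sqnorm_tendsto_inner[OF square_integrable_nth[OF s(2)] square_integrable_nth[OF s(4)] \<phi>s this]
  have 2: "(\<lambda>n. LINT x|lebesgue_on U. g n x $ i * \<phi> x) \<longlonglongrightarrow> (LINT x|lebesgue_on U. g' x $ i * \<phi> x)" by simp
  have "(LINT x|lebesgue_on U. w n x * D x $ i) = - (LINT x|lebesgue_on U. g n x $ i * \<phi> x)" for n
    using assms(4)[of n] t unfolding weak_gradient_def by blast
  then show "(LINT x|lebesgue_on U. w' x * D x $ i) = - (LINT x|lebesgue_on U. g' x $ i * \<phi> x)"
    using LIMSEQ_unique[OF 1] tendsto_minus[OF 2] by simp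
qed

text \<open>With \<open>0 / 0 = 0\<close> this is a \<open>C\<^sup>1\<close> truncation at height \<open>\<epsilon>\<close>, zero on \<open>[-\<epsilon>, \<epsilon>]\<close>.\<close>

definition cutoff :: "real \<Rightarrow> real \<Rightarrow> real" where
  "cutoff \<epsilon> s = (max 0 (\<bar>s\<bar> - \<epsilon>))\<^sup>2 / s"

text \<open>For s > \<epsilon> the truncation is s - 2 \<epsilon> + \<epsilon>^2 / s, and this is
  its derivative; the maximum makes the formula vanish for |s| \<le> \<epsilon>.\<close>

definition cutoff' :: "real \<Rightarrow> real \<Rightarrow> real" where
  "cutoff' \<epsilon> s = 1 - (\<epsilon> / max \<bar>s\<bar> \<epsilon>)\<^sup>2"

text \<open>The quotient rule covers s > 0, oddness transfers it to s < 0, and near 0 the function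
  vanishes identically.\<close>

lemma cutoff_DERIV:
  assumes "\<epsilon> > 0"
  shows "(cutoff \<epsilon> has_real_derivative cutoff' \<epsilon> s) (at s)"
proof -
  have pos: "(cutoff \<epsilon> has_real_derivative cutoff' \<epsilon> s) (at s)" if "s > 0" for s
  proof -
    have "((\<lambda>s. (max 0 (s - \<epsilon>))\<^sup>2) has_real_derivative 2 * max 0 (s - \<epsilon>) * 1) (at s)"
      by (rule DERIV_chain2[OF DERIV_max_0_square]) (auto intro!: derivative_eq_intros)
    then have "((\<lambda>s. (max 0 (s - \<epsilon>))\<^sup>2 / s) has_real_derivative
        (2 * max 0 (s - \<epsilon>) * 1 * s - (max 0 (s - \<epsilon>))\<^sup>2 * 1) / (s * s)) (at s)"
      by (rule DERIV_divide) (use that in auto)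
    moreover have "(2 * max 0 (s - \<epsilon>) * 1 * s - (max 0 (s - \<epsilon>))\<^sup>2 * 1) / (s * s) = cutoff' \<epsilon> s"
    proof (cases "s \<ge> \<epsilon>")
      case True
      then show ?thesis using that assms
        by (simp add: cutoff'_def max_def field_simps power2_eq_square)
    next
      case False
      then show ?thesis using that assms by (simp add: cutoff'_def max_def)
    qed
    ultimately have "((\<lambda>s. (max 0 (s - \<epsilon>))\<^sup>2 / s) has_real_derivative cutoff' \<epsilon> s) (at s)" by simp
    then show ?thesis
      by (rule has_field_derivative_transform_within_open[where S = "{0<..}"]) (use that in \<open>auto simp: cutoff_def\<close>)
  qed
  have odd: "cutoff \<epsilon> s = - cutoff \<epsilon> (- s)" for s by (simp add: cutoff_def)
  consider "s > 0" | "s < 0" | "s = 0" by linarith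
  then show ?thesis
  proof cases
    case 1
    then show ?thesis by (rule pos)
  next
    case 2
    have d: "((\<lambda>s::real. - s) has_real_derivative -1) (at s)" by (auto intro!: derivative_eq_intros)
    have p: "- s > 0" using 2 by simp
    have "((\<lambda>s. - cutoff \<epsilon> (- s)) has_real_derivative - (cutoff' \<epsilon> (- s) * (-1))) (at s)"
      by (rule DERIV_minus[OF DERIV_chain2[where f = "cutoff \<epsilon>" and g = "\<lambda>s. - s" and x = s, OF pos[OF p] d]])
    moreover have "(\<lambda>s. - cutoff \<epsilon> (- s)) = cutoff \<epsilon>" by (rule ext) (rule odd[symmetric])
    ultimately show ?thesis by (simp add: cutoff'_def)
  next
    case 3
    have "((\<lambda>s::real. 0) has_real_derivative cutoff' \<epsilon> s) (at s)"
      using 3 assms by (simp add: cutoff'_def)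
    then show ?thesis
      by (rule has_field_derivative_transform_within_open[where S = "{-\<epsilon><..<\<epsilon>}"])
         (use 3 assms in \<open>auto simp: cutoff_def\<close>)
  qed
qed

lemma cutoff_zero: "\<bar>s\<bar> \<le> \<epsilon> \<Longrightarrow> cutoff \<epsilon> s = 0"
  by (simp add: cutoff_def)

lemma cutoff'_zero: "\<bar>s\<bar> \<le> \<epsilon> \<Longrightarrow> \<epsilon> > 0 \<Longrightarrow> cutoff' \<epsilon> s = 0"
  by (simp add: cutoff'_def max_def)

lemma cutoff'_bounds:
  assumes "\<epsilon> > 0"
  shows "0 \<le> cutoff' \<epsilon> s" "cutoff' \<epsilon> s \<le> 1"
proof -
  have "\<epsilon> / max \<bar>s\<bar> \<epsilon> \<le> 1" "0 \<le> \<epsilon> / max \<bar>s\<bar> \<epsilon>" using assms by (auto simp: divide_le_eq)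
  then have "(\<epsilon> / max \<bar>s\<bar> \<epsilon>)\<^sup>2 \<le> 1" by (simp add: power_le_one)
  then show "0 \<le> cutoff' \<epsilon> s" "cutoff' \<epsilon> s \<le> 1" by (simp_all add: cutoff'_def)
qed

lemma cutoff'_Lipschitz:
  assumes "\<epsilon> > 0"
  shows "\<bar>cutoff' \<epsilon> s - cutoff' \<epsilon> t\<bar> \<le> 2 / \<epsilon> * \<bar>s - t\<bar>"
proof -
  define a b where "a = max \<bar>s\<bar> \<epsilon>" and "b = max \<bar>t\<bar> \<epsilon>"
  have ab: "a \<ge> \<epsilon>" "b \<ge> \<epsilon>" "\<bar>a - b\<bar> \<le> \<bar>s - t\<bar>" by (auto simp: a_def b_def max_def)
  have r: "0 \<le> \<epsilon> / a" "\<epsilon> / a \<le> 1" "0 \<le> \<epsilon> / b" "\<epsilon> / b \<le> 1" using ab assms by auto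
  have "cutoff' \<epsilon> s - cutoff' \<epsilon> t = (\<epsilon> / b)\<^sup>2 - (\<epsilon> / a)\<^sup>2" by (simp add: cutoff'_def a_def b_def)
  also have "\<dots> = (\<epsilon> / b + \<epsilon> / a) * (\<epsilon> / b - \<epsilon> / a)" by (simp add: power2_eq_square algebra_simps)
  also have "\<epsilon> / b - \<epsilon> / a = (\<epsilon> / b) * (\<epsilon> / a) * ((a - b) / \<epsilon>)"
    using ab assms by (simp add: field_simps)
  finally have "\<bar>cutoff' \<epsilon> s - cutoff' \<epsilon> t\<bar> = (\<epsilon> / b + \<epsilon> / a) * ((\<epsilon> / b) * (\<epsilon> / a) * (\<bar>a - b\<bar> / \<epsilon>))"
    using r assms ab by (simp add: abs_mult)
  also have "\<dots> \<le> 2 * (1 * 1 * (\<bar>s - t\<bar> / \<epsilon>))"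
  proof -
    have 1: "\<epsilon> / b + \<epsilon> / a \<le> 2" using r by linarith
    have 2: "(\<epsilon> / b) * (\<epsilon> / a) \<le> 1 * 1" using r by (intro mult_mono) auto
    have 3: "\<bar>a - b\<bar> / \<epsilon> \<le> \<bar>s - t\<bar> / \<epsilon>" using ab assms by (simp add: divide_right_mono)
    have 4: "0 \<le> \<bar>a - b\<bar> / \<epsilon>" using assms by simp
    have 5: "0 \<le> (\<epsilon> / b) * (\<epsilon> / a)" by (rule mult_nonneg_nonneg[OF r(3,1)])
    have 6: "(\<epsilon> / b) * (\<epsilon> / a) * (\<bar>a - b\<bar> / \<epsilon>) \<le> 1 * 1 * (\<bar>s - t\<bar> / \<epsilon>)"
      by (rule mult_mono[OF 2 3 _ 4]) simp
    show ?thesis by (rule mult_mono[OF 1 6 _ mult_nonneg_nonneg[OF 5 4]]) simp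
  qed
  finally show ?thesis by simp
qed

lemma cutoff_approx:
  assumes "\<epsilon> > 0"
  shows "\<bar>cutoff \<epsilon> s - s\<bar> \<le> 2 * \<epsilon>"
proof (cases "\<bar>s\<bar> \<le> \<epsilon>")
  case True
  then show ?thesis using cutoff_zero[OF True] assms by simp
next
  case False
  then have s: "s \<noteq> 0" "\<bar>s\<bar> > \<epsilon>" using assms by auto
  have "\<bar>cutoff \<epsilon> s - s\<bar> = \<bar>((\<bar>s\<bar> - \<epsilon>)\<^sup>2 - s\<^sup>2) / s\<bar>"
    using s by (simp add: cutoff_def diff_divide_distrib power2_eq_square)
  also have "(\<bar>s\<bar> - \<epsilon>)\<^sup>2 - s\<^sup>2 = \<epsilon> * (\<epsilon> - 2 * \<bar>s\<bar>)"
    by (simp add: power2_eq_square algebra_simps abs_mult_self_eq)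
  also have "\<bar>\<epsilon> * (\<epsilon> - 2 * \<bar>s\<bar>) / s\<bar> = \<epsilon> * (2 * \<bar>s\<bar> - \<epsilon>) / \<bar>s\<bar>"
    using s assms by (simp add: abs_mult)
  also have "\<dots> \<le> 2 * \<epsilon>" using s assms by (simp add: field_simps)
  finally show ?thesis .
qed

text \<open>At a radius small compared with the distance of \<open>K\<close> from the complement of
  \<open>U\<close>, mollifications are test functions, and they converge to \<open>w\<close>
  together with their gradients.\<close>

lemma compact_support_H10_approx:
  fixes w :: "real^'n \<Rightarrow> real"
  assumes U: "open U" "bounded U" and w: "w \<in> L2 U" "g \<in> L2 U" "weak_gradient U w g"
    and K: "compact K" "K \<subseteq> U" "\<And>x. x \<notin> K \<Longrightarrow> w x = 0" "\<And>x. x \<notin> K \<Longrightarrow> g x = 0" and "e > 0"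
  shows "\<exists>\<phi> D. test_function U \<phi> D \<and>
     sqnorm (lebesgue_on U) (\<lambda>x. w x - \<phi> x) + sqnorm (lebesgue_on U) (\<lambda>x. g x - D x) < e"
proof -
  have Um: "U \<in> sets lebesgue" using U by simp
  define W where "W x = (if x \<in> U then w x else 0)" for x
  define G where "G i x = (if x \<in> U then g x $ i else 0)" for i x
  define \<rho> where "\<rho> n = 1 / real (Suc n)" for n
  have \<rho>: "\<rho> n > 0" for n by (simp add: \<rho>_def)
  have gi: "(\<lambda>x. g x $ i) \<in> square_integrable (lebesgue_on U)" for i
    using w(2) unfolding L2_eq by (rule square_integrable_nth)
  have W: "W \<in> square_integrable lebesgue" "integrable lebesgue W"
    using extend_by_zero(1,2)[OF U w(1)[unfolded L2_eq]] by (simp_all add: W_def[abs_def])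
  have G: "G i \<in> square_integrable lebesgue" "integrable lebesgue (G i)" for i
    using extend_by_zero(1,2)[OF U gi[of i]] by (simp_all add: G_def[abs_def])
  have limW: "(\<lambda>n. sqnorm lebesgue (\<lambda>x. mollify (\<rho> n) W x - W x)) \<longlonglongrightarrow> 0"
    using mollify_extend_tendsto[OF U w(1)[unfolded L2_eq]] by (simp add: W_def[abs_def] \<rho>_def)
  have limG: "(\<lambda>n. sqnorm lebesgue (\<lambda>x. mollify (\<rho> n) (G i) x - G i x)) \<longlonglongrightarrow> 0" for i
    using mollify_extend_tendsto[OF U gi[of i]] by (simp add: G_def[abs_def] \<rho>_def)
  have lim: "(\<lambda>n. sqnorm lebesgue (\<lambda>x. mollify (\<rho> n) W x - W x)
      + (\<Sum>i\<in>UNIV. sqnorm lebesgue (\<lambda>x. mollify (\<rho> n) (G i) x - G i x))) \<longlonglongrightarrow> 0"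
  proof -
    have "(\<lambda>n. \<Sum>i\<in>UNIV. sqnorm lebesgue (\<lambda>x. mollify (\<rho> n) (G i) x - G i x)) \<longlonglongrightarrow> (\<Sum>i\<in>(UNIV::'n set). 0)"
      by (intro tendsto_sum limG)
    from tendsto_add[OF limW this] show ?thesis by simp
  qed
  obtain d where d: "d > 0" "\<And>x y. x \<in> K \<Longrightarrow> dist x y < d \<Longrightarrow> y \<in> U"
    using compact_subset_open_cball[OF K(1) U(1) K(2)] by blast
  have "\<rho> \<longlonglongrightarrow> 0" unfolding \<rho>_def[abs_def] using LIMSEQ_inverse_real_of_nat by (simp add: inverse_eq_divide)
  \<comment> \<open>Half of \<open>d\<close>: the support of the mollification reaches one radius
    beyond \<open>K\<close>, and the gradient formula needs another ball of that radius inside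
    \<open>U\<close>.\<close>
  then have "\<forall>\<^sub>F n in sequentially. \<rho> n < d / 2" using order_tendstoD(2)[of \<rho> 0 sequentially "d / 2"] d(1) by simp
  moreover have "\<forall>\<^sub>F n in sequentially. sqnorm lebesgue (\<lambda>x. mollify (\<rho> n) W x - W x)
      + (\<Sum>i\<in>UNIV. sqnorm lebesgue (\<lambda>x. mollify (\<rho> n) (G i) x - G i x)) < e"
    using order_tendstoD(2)[OF lim] \<open>e > 0\<close> by blast
  ultimately have "\<forall>\<^sub>F n in sequentially. \<rho> n < d / 2 \<and> sqnorm lebesgue (\<lambda>x. mollify (\<rho> n) W x - W x)
      + (\<Sum>i\<in>UNIV. sqnorm lebesgue (\<lambda>x. mollify (\<rho> n) (G i) x - G i x)) < e"
    by (rule eventually_conj)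
  then obtain n where n: "\<rho> n < d / 2" "sqnorm lebesgue (\<lambda>x. mollify (\<rho> n) W x - W x)
      + (\<Sum>i\<in>UNIV. sqnorm lebesgue (\<lambda>x. mollify (\<rho> n) (G i) x - G i x)) < e"
    using eventually_happens trivial_limit_sequentially by blast
  let ?r = "\<rho> n" and ?\<phi> = "mollify (\<rho> n) W" and ?D = "mollify_grad (\<rho> n) W"
  define K' where "K' = {x + y | x y. x \<in> K \<and> y \<in> cball 0 ?r}"
  have K': "compact K'" unfolding K'_def using K(1) by (rule compact_sums) simp
  have out: "F y = 0 \<or> norm (x - y) \<ge> ?r" if "x \<notin> K'" "\<And>y. y \<notin> K \<Longrightarrow> F y = 0" for x y and F :: "real^'n \<Rightarrow> real"
  proof (rule ccontr)
    assume "\<not> ?thesis"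
    then have "F y \<noteq> 0" "norm (x - y) < ?r" by auto
    then have "y \<in> K" "x - y \<in> cball 0 ?r" using that(2)[of y] by (blast, simp)
    then have "y + (x - y) \<in> K'" unfolding K'_def by blast
    then show False using that(1) by simp
  qed
  have mz: "mollify ?r F x = 0" "mollify_grad ?r F x = 0" if "x \<notin> K'" "\<And>y. y \<notin> K \<Longrightarrow> F y = 0"
    for F :: "real^'n \<Rightarrow> real" and x
  proof -
    have "F y * mollifier ?r (x - y) = 0 \<and> F y *\<^sub>R mollifier_grad ?r (x - y) = 0" for y
    proof (cases "F y = 0")
      case False
      then have "norm (x - y) \<ge> ?r" using out[where F = F and x = x and y = y, OF that] by blast
      from mollifier_zero[OF this \<rho>] mollifier_grad_zero[OF this \<rho>] show ?thesis by simp
    qed simp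
    then have "(\<lambda>y. F y * mollifier ?r (x - y)) = (\<lambda>y. 0)" "(\<lambda>y. F y *\<^sub>R mollifier_grad ?r (x - y)) = (\<lambda>y. 0)"
      by (intro ext; blast)+
    then show "mollify ?r F x = 0" "mollify_grad ?r F x = 0"
      unfolding mollify_def mollify_grad_def by (simp_all only: integral_zero)
  qed
  have W0: "W y = 0" "G i y = 0" if "y \<notin> K" for y i using K(3,4)[OF that] by (simp_all add: W_def G_def)
  have t: "test_function U ?\<phi> ?D"
  proof (rule test_functionI)
    show "GDERIV ?\<phi> x :> ?D x" for x by (rule mollify_GDERIV[OF \<rho> W(2)])
    show "continuous_on UNIV ?D" by (rule mollify_grad_continuous[OF \<rho> W(2)])
    show "compact K'" by fact
    show "K' \<subseteq> U"
    proof
      fix z assume "z \<in> K'"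
      then obtain x y where "z = x + y" "x \<in> K" "norm y \<le> ?r" unfolding K'_def by auto
      then show "z \<in> U" using d(2)[of x z] n(1) d(1) by (simp add: dist_norm)
    qed
    show "?\<phi> x = 0" if "x \<notin> K'" for x by (rule mz(1)[OF that W0(1)])
  qed
  have DG: "?D x $ i = mollify ?r (G i) x" for x i
  proof (cases "x \<in> K'")
    case True
    then obtain a b where ab: "x = a + b" "a \<in> K" "norm b \<le> ?r" unfolding K'_def by auto
    have "cball x ?r \<subseteq> U"
    proof
      fix z assume "z \<in> cball x ?r"
      then have "dist a z \<le> ?r + ?r" using ab dist_triangle[of a z x] by (auto simp: dist_norm)
      then show "z \<in> U" using d(2)[OF ab(2), of z] n(1) by simp
    qed
    from mollify_grad_weak_gradient[OF U w(1,3) this \<rho>, of i]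
    show ?thesis by (simp add: W_def[abs_def] G_def[abs_def])
  next
    case False
    show ?thesis using mz(2)[OF False W0(1)] mz(1)[OF False W0(2)[of _ i]] by simp
  qed
  have 1: "sqnorm (lebesgue_on U) (\<lambda>x. w x - ?\<phi> x) \<le> sqnorm lebesgue (\<lambda>x. ?\<phi> x - W x)"
    unfolding sqnorm_restrict[OF Um]
  proof (rule sqnorm_mono)
    show "(\<lambda>x. if x \<in> U then w x - ?\<phi> x else 0) \<in> square_integrable lebesgue"
      using square_integrable_diff[OF w(1)[unfolded L2_eq] square_integrable_lebesgue_on[OF mollify_contraction(1)[OF \<rho> W(2,1)] Um]]
      by (simp add: square_integrable_restrict[OF Um])
    show "(\<lambda>x. ?\<phi> x - W x) \<in> square_integrable lebesgue"
      by (intro square_integrable_diff W mollify_contraction(1)[OF \<rho>])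
  qed (auto simp: W_def)
  have Gs: "(\<lambda>x. ?D x $ i - G i x) \<in> square_integrable lebesgue" for i
    unfolding DG by (intro square_integrable_diff G mollify_contraction(1)[OF \<rho>])
  have Gv: "(\<lambda>x. ?D x - (\<chi> i. G i x)) \<in> square_integrable lebesgue"
    by (rule square_integrable_vec) (use Gs in simp)
  have "sqnorm (lebesgue_on U) (\<lambda>x. g x - ?D x) \<le> sqnorm lebesgue (\<lambda>x. ?D x - (\<chi> i. G i x))"
    unfolding sqnorm_restrict[OF Um]
  proof (rule sqnorm_mono[OF _ Gv])
    show "(\<lambda>x. if x \<in> U then g x - ?D x else 0) \<in> square_integrable lebesgue"
      using square_integrable_diff[OF w(2)[unfolded L2_eq] square_integrable_lebesgue_on[OF test_function_square_integrable(2)[OF t] Um]]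
      by (simp add: square_integrable_restrict[OF Um])
    have "(\<chi> i. G i x) = g x" if "x \<in> U" for x using that by (simp add: G_def vec_eq_iff)
    then show "AE x in lebesgue. norm (if x \<in> U then g x - ?D x else 0) \<le> norm (?D x - (\<chi> i. G i x))"
      by (auto simp: norm_minus_commute)
  qed
  also have "\<dots> = (\<Sum>i\<in>UNIV. sqnorm lebesgue (\<lambda>x. ?D x $ i - G i x))"
  proof -
    have "(norm (?D x - (\<chi> i. G i x)))\<^sup>2 = (\<Sum>i\<in>UNIV. (norm (?D x $ i - G i x))\<^sup>2)" for x
      unfolding power2_norm_eq_inner inner_vec_def by simp
    then show ?thesis
      unfolding sqnorm_def using square_integrable_norm[OF Gs] by (simp del: real_norm_def)
  qed
  finally have 2: "sqnorm (lebesgue_on U) (\<lambda>x. g x - ?D x) \<le> (\<Sum>i\<in>UNIV. sqnorm lebesgue (\<lambda>x. mollify ?r (G i) x - G i x))"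
    by (simp add: DG)
  show ?thesis
    by (rule exI[of _ ?\<phi>], rule exI[of _ ?D]) (use 1 2 n(2) in \<open>intro conjI t, linarith\<close>)
qed

lemma finite_measure_const_square_integrable:
  assumes "finite_measure M"
  shows "(\<lambda>x. c::real) \<in> square_integrable M" "sqnorm M (\<lambda>x. c) = c\<^sup>2 * measure M (space M)"
proof -
  interpret finite_measure M by fact
  show "(\<lambda>x. c::real) \<in> square_integrable M" by (simp add: square_integrable_def)
  show "sqnorm M (\<lambda>x. c) = c\<^sup>2 * measure M (space M)" by (simp add: sqnorm_def)
qed

text \<open>A weak gradient vanishes where the function does; this is why the limit of the truncations
  below has the gradient \<open>g\<close> cut off on the zero set.\<close>

lemma cutoff_tendsto:
  fixes w :: "real^'n \<Rightarrow> real"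
  assumes U: "open U" "bounded U" and w: "w \<in> L2 U" "g \<in> L2 U" "weak_gradient U w g"
  defines "\<epsilon> \<equiv> \<lambda>n. 1 / real (Suc n)"
  defines "g0 \<equiv> \<lambda>x. if w x = 0 then 0 else g x"
  shows "\<And>n. (\<lambda>x. cutoff (\<epsilon> n) (w x)) \<in> L2 U" "\<And>n. (\<lambda>x. cutoff' (\<epsilon> n) (w x) *\<^sub>R g x) \<in> L2 U"
    "\<And>n. weak_gradient U (\<lambda>x. cutoff (\<epsilon> n) (w x)) (\<lambda>x. cutoff' (\<epsilon> n) (w x) *\<^sub>R g x)"
    "g0 \<in> L2 U"
    "(\<lambda>n. sqnorm (lebesgue_on U) (\<lambda>x. cutoff (\<epsilon> n) (w x) - w x)) \<longlonglongrightarrow> 0"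
    "(\<lambda>n. sqnorm (lebesgue_on U) (\<lambda>x. cutoff' (\<epsilon> n) (w x) *\<^sub>R g x - g0 x)) \<longlonglongrightarrow> 0"
proof -
  have Um: "U \<in> sets lebesgue" using U by simp
  have fin: "finite_measure (lebesgue_on U)" by (rule finite_measure_bounded_open[OF U])
  have \<epsilon>: "\<epsilon> n > 0" for n by (simp add: \<epsilon>_def)
  have \<epsilon>0: "\<epsilon> \<longlonglongrightarrow> 0" unfolding \<epsilon>_def using LIMSEQ_inverse_real_of_nat by (simp add: inverse_eq_divide)
  note [measurable] = L2_measurable[OF w(1)] L2_measurable[OF w(2)]
  note D = cutoff_DERIV[OF \<epsilon>]
  have "continuous_on UNIV (cutoff (\<epsilon> n))" for n
    by (rule DERIV_continuous_on) (rule has_field_derivative_at_within[OF D])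
  then have [measurable]: "cutoff (\<epsilon> n) \<in> borel_measurable borel" for n
    by (rule borel_measurable_continuous_onI)
  have [measurable]: "cutoff' (\<epsilon> n) \<in> borel_measurable borel" for n
    unfolding cutoff'_def[abs_def] by measurable
  have c0: "\<bar>cutoff (\<epsilon> n) s\<bar> \<le> 1 * \<bar>s\<bar>" for n s
  proof -
    have "norm (cutoff (\<epsilon> n) s - cutoff (\<epsilon> n) 0) \<le> 1 * norm (s - 0)"
      by (rule field_differentiable_bound[of UNIV "cutoff (\<epsilon> n)" "cutoff' (\<epsilon> n)"])
         (use D cutoff'_bounds[OF \<epsilon>] in auto)
    then show ?thesis by (simp add: cutoff_def)
  qed
  show w1: "(\<lambda>x. cutoff (\<epsilon> n) (w x)) \<in> L2 U" for n
    unfolding L2_eq by (rule square_integrable_bound[OF w(1)[unfolded L2_eq], where C = 1]) (use c0 in auto)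
  show g1: "(\<lambda>x. cutoff' (\<epsilon> n) (w x) *\<^sub>R g x) \<in> L2 U" for n
    unfolding L2_eq by (rule square_integrable_bounded_mult[OF w(2)[unfolded L2_eq], where C = 1])
      (use cutoff'_bounds[OF \<epsilon>] in auto)
  show "weak_gradient U (\<lambda>x. cutoff (\<epsilon> n) (w x)) (\<lambda>x. cutoff' (\<epsilon> n) (w x) *\<^sub>R g x)" for n
  proof (rule weak_gradient_chain[OF U w D])
    show "cutoff (\<epsilon> n) 0 = 0" by (simp add: cutoff_def)
    show "\<bar>cutoff' (\<epsilon> n) s\<bar> \<le> 1" for s using cutoff'_bounds[OF \<epsilon>, of n s] by simp
    show "\<bar>cutoff' (\<epsilon> n) s - cutoff' (\<epsilon> n) t\<bar> \<le> 2 / \<epsilon> n * \<bar>s - t\<bar>" for s t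
      by (rule cutoff'_Lipschitz[OF \<epsilon>])
  qed
  show g0: "g0 \<in> L2 U"
    unfolding L2_eq
  proof (rule square_integrable_bound[OF w(2)[unfolded L2_eq], where C = 1])
    show "g0 \<in> borel_measurable (lebesgue_on U)" unfolding g0_def by measurable
  qed (auto simp: g0_def)
  have sqc: "sqnorm (lebesgue_on U) (\<lambda>x. \<epsilon> n) = (\<epsilon> n)\<^sup>2 * measure (lebesgue_on U) (space (lebesgue_on U))" for n
    by (rule finite_measure_const_square_integrable(2)[OF fin])
  show "(\<lambda>n. sqnorm (lebesgue_on U) (\<lambda>x. cutoff (\<epsilon> n) (w x) - w x)) \<longlonglongrightarrow> 0"
  proof (rule sqnorm_tendsto_0_bound(2)[where k = "\<lambda>n x. \<epsilon> n" and C = 2])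
    show "(\<lambda>x. \<epsilon> n) \<in> square_integrable (lebesgue_on U)" for n
      by (rule finite_measure_const_square_integrable(1)[OF fin])
    show "(\<lambda>n. sqnorm (lebesgue_on U) (\<lambda>x. \<epsilon> n)) \<longlonglongrightarrow> 0"
      unfolding sqc using tendsto_mult[OF tendsto_power[OF \<epsilon>0, of 2] tendsto_const] by fastforce
    show "norm (cutoff (\<epsilon> n) (w x) - w x) \<le> 2 * norm (\<epsilon> n)" for n x
      using cutoff_approx[OF \<epsilon>, of n "w x"] \<epsilon>[of n] by simp
  qed measurable
  have [measurable]: "g0 \<in> borel_measurable (lebesgue_on U)" by (rule L2_measurable[OF g0])
  have "(\<lambda>n. LINT x|lebesgue_on U. (norm (cutoff' (\<epsilon> n) (w x) *\<^sub>R g x - g0 x))\<^sup>2) \<longlonglongrightarrow> (LINT x|lebesgue_on U. 0)"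
  proof (rule integral_dominated_convergence[where w = "\<lambda>x. (norm (g x))\<^sup>2"])
    show "integrable (lebesgue_on U) (\<lambda>x. (norm (g x))\<^sup>2)"
      using w(2) unfolding L2_eq by (rule square_integrable_norm)
    show "AE x in lebesgue_on U. (\<lambda>n. (norm (cutoff' (\<epsilon> n) (w x) *\<^sub>R g x - g0 x))\<^sup>2) \<longlonglongrightarrow> 0"
    proof (rule AE_I2)
      fix x
      have "(\<lambda>n. cutoff' (\<epsilon> n) (w x)) \<longlonglongrightarrow> (if w x = 0 then 0 else 1)"
      proof (cases "w x = 0")
        case True
        then show ?thesis using cutoff'_zero[of 0] \<epsilon> by (simp add: less_imp_le)
      next
        case False
        have "(\<lambda>n. 1 - (\<epsilon> n / max \<bar>w x\<bar> (\<epsilon> n))\<^sup>2) \<longlonglongrightarrow> 1 - (0 / max \<bar>w x\<bar> 0)\<^sup>2"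
          by (intro tendsto_intros \<epsilon>0) (use False in simp)
        then show ?thesis using False by (simp add: cutoff'_def)
      qed
      then have "(\<lambda>n. (norm (cutoff' (\<epsilon> n) (w x) *\<^sub>R g x - g0 x))\<^sup>2)
          \<longlonglongrightarrow> (norm ((if w x = 0 then 0 else 1) *\<^sub>R g x - g0 x))\<^sup>2"
        by (intro tendsto_intros)
      then show "(\<lambda>n. (norm (cutoff' (\<epsilon> n) (w x) *\<^sub>R g x - g0 x))\<^sup>2) \<longlonglongrightarrow> 0"
        by (simp add: g0_def split: if_splits)
    qed
    show "AE x in lebesgue_on U. norm ((norm (cutoff' (\<epsilon> n) (w x) *\<^sub>R g x - g0 x))\<^sup>2) \<le> (norm (g x))\<^sup>2" for n
    proof (rule AE_I2)
      fix x
      have "norm (cutoff' (\<epsilon> n) (w x) *\<^sub>R g x - g0 x) \<le> norm (g x)"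
      proof (cases "w x = 0")
        case True
        then show ?thesis using cutoff'_zero[of 0 "\<epsilon> n"] \<epsilon>[of n] by (simp add: g0_def)
      next
        case False
        have "cutoff' (\<epsilon> n) (w x) *\<^sub>R g x - g0 x = (cutoff' (\<epsilon> n) (w x) - 1) *\<^sub>R g x"
          using False by (simp add: g0_def scaleR_diff_left)
        moreover have "\<bar>cutoff' (\<epsilon> n) (w x) - 1\<bar> \<le> 1" using cutoff'_bounds[OF \<epsilon>, of n "w x"] by simp
        ultimately show ?thesis using mult_right_mono[of "\<bar>cutoff' (\<epsilon> n) (w x) - 1\<bar>" 1 "norm (g x)"] by simp
      qed
      then show "norm ((norm (cutoff' (\<epsilon> n) (w x) *\<^sub>R g x - g0 x))\<^sup>2) \<le> (norm (g x))\<^sup>2"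
        by (simp add: power_mono)
    qed
  qed measurable
  then show "(\<lambda>n. sqnorm (lebesgue_on U) (\<lambda>x. cutoff' (\<epsilon> n) (w x) *\<^sub>R g x - g0 x)) \<longlonglongrightarrow> 0"
    by (simp add: sqnorm_def)
qed

lemma square_integrable_indicator:
  fixes f :: "real^'n \<Rightarrow> 'b::euclidean_space"
  assumes "f \<in> L2 U" "closed K"
  shows "(\<lambda>x. if x \<in> K then f x else 0) \<in> L2 U"
  unfolding L2_eq
proof (rule square_integrable_bound[OF assms(1)[unfolded L2_eq], where C = 1])
  have "(indicator K :: real^'n \<Rightarrow> real) \<in> borel_measurable lebesgue"
    by (rule borel_measurable_indicator) (use assms(2) in simp)
  then have "(indicator K :: real^'n \<Rightarrow> real) \<in> borel_measurable (lebesgue_on U)" by (rule measurable_restrict_space1)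
  then have "(\<lambda>x. indicator K x *\<^sub>R f x) \<in> borel_measurable (lebesgue_on U)"
    using L2_measurable[OF assms(1)] by measurable
  moreover have "(\<lambda>x. indicator K x *\<^sub>R f x) = (\<lambda>x. if x \<in> K then f x else 0)"
    by (auto simp: indicator_def)
  ultimately show "(\<lambda>x. if x \<in> K then f x else 0) \<in> borel_measurable (lebesgue_on U)" by simp
qed auto

text \<open>Near the boundary the continuous representative is below any given height in absolute
  value, so its truncation vanishes outside a compact subset of \<open>U\<close> and can be
  mollified; then the height tends to zero.\<close>

lemma zero_trace_imp_H10:
  fixes w :: "real^'n \<Rightarrow> real"
  assumes U: "open U" "bounded U" and "w \<in> H1 U"
    and v: "AE x in lebesgue_on U. v x = w x" "open N" "frontier U \<subseteq> N"
      "continuous_on (N \<inter> closure U) v" "\<And>x. x \<in> frontier U \<Longrightarrow> v x = 0"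
  shows "w \<in> H10 U"
proof -
  have Um: "U \<in> sets lebesgue" using U by simp
  define \<epsilon> where "\<epsilon> n = 1 / real (Suc n)" for n
  have \<epsilon>: "\<epsilon> n > 0" for n by (simp add: \<epsilon>_def)
  obtain g where w: "w \<in> L2 U" "g \<in> L2 U" "weak_gradient U w g" using H1_grad[OF assms(3)] by blast
  define g0 where "g0 x = (if w x = 0 then 0 else g x)" for x
  define wn gn where "wn n x = cutoff (\<epsilon> n) (w x)" and "gn n x = cutoff' (\<epsilon> n) (w x) *\<^sub>R g x" for n x
  have wn: "wn n \<in> L2 U" and gn: "gn n \<in> L2 U" and wg: "weak_gradient U (wn n) (gn n)" and g0: "g0 \<in> L2 U" for n
    using cutoff_tendsto(1-4)[OF U w] by (simp_all add: wn_def[abs_def] gn_def[abs_def] g0_def[abs_def] \<epsilon>_def)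
  have limw: "(\<lambda>n. sqnorm (lebesgue_on U) (\<lambda>x. wn n x - w x)) \<longlonglongrightarrow> 0"
    using cutoff_tendsto(5)[OF U w] by (simp add: wn_def \<epsilon>_def)
  have limg: "(\<lambda>n. sqnorm (lebesgue_on U) (\<lambda>x. gn n x - g0 x)) \<longlonglongrightarrow> 0"
    using cutoff_tendsto(6)[OF U w] by (simp add: gn_def g0_def \<epsilon>_def)
  \<comment> \<open>The truncations converge to \<open>w\<close> while their gradients converge to
    \<open>g0\<close>, so \<open>g0\<close> is a weak gradient of \<open>w\<close> and the one to be
    approximated below.\<close>
  have wg0: "weak_gradient U w g0" by (rule weak_gradient_limit[OF Um wn gn wg w(1) g0 limw limg])
  have approx: "\<exists>\<phi> D. test_function U \<phi> D \<and>
     sqnorm (lebesgue_on U) (\<lambda>x. wn n x - \<phi> x) + sqnorm (lebesgue_on U) (\<lambda>x. gn n x - D x) < e" if e: "e > 0" for n e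
  proof -
    have "openin (top_of_set (N \<inter> closure U)) ((N \<inter> closure U) \<inter> v -` {- \<epsilon> n<..<\<epsilon> n})"
      by (rule continuous_openin_preimage_gen[OF v(4)]) simp
    then obtain A where A: "open A" "(N \<inter> closure U) \<inter> v -` {- \<epsilon> n<..<\<epsilon> n} = (N \<inter> closure U) \<inter> A"
      unfolding openin_open by blast
    \<comment> \<open>What remains of the closure after removing the relatively open set in
      \<open>N\<close> where |v| is below the height; the boundary lies in the removed set.\<close>
    define K where "K = closure U \<inter> - (A \<inter> N)"
    have Kc: "compact K" unfolding K_def
      by (intro compact_Int_closed) (use U(2) A(1) v(2) in \<open>auto simp: compact_closure closed_Compl\<close>)
    have KU: "K \<subseteq> U"
    proof
      fix x assume x: "x \<in> K"
      show "x \<in> U"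
      proof (rule ccontr)
        assume "x \<notin> U"
        then have "x \<in> frontier U" using x U(1) by (auto simp: K_def frontier_def interior_open)
        then have "x \<in> (N \<inter> closure U) \<inter> v -` {- \<epsilon> n<..<\<epsilon> n}"
          using v(3,5) \<epsilon>[of n] x by (auto simp: K_def)
        then show False using A(2) x by (auto simp: K_def)
      qed
    qed
    have small: "\<bar>v x\<bar> \<le> \<epsilon> n" if "x \<in> U" "x \<notin> K" for x
    proof -
      have "x \<in> closure U" using that(1) closure_subset by blast
      then have "x \<in> (N \<inter> closure U) \<inter> A" using that by (auto simp: K_def)
      then have "v x \<in> {- \<epsilon> n<..<\<epsilon> n}" using A(2) by blast
      then show ?thesis by auto
    qed
    have aeK: "AE x in lebesgue_on U. x \<notin> K \<longrightarrow> wn n x = 0 \<and> gn n x = 0"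
      using v(1) AE_space[of "lebesgue_on U"]
    proof eventually_elim
      case (elim x)
      then show ?case
        using small[of x] cutoff_zero[of "w x" "\<epsilon> n"] cutoff'_zero[of "w x" "\<epsilon> n"] \<epsilon>[of n] by (auto simp: wn_def gn_def)
    qed
    \<comment> \<open>Off \<open>K\<close> the truncated function vanishes only almost everywhere,
      so it is replaced by a version that vanishes there everywhere.\<close>
    have 1: "(\<lambda>x. if x \<in> K then wn n x else 0) \<in> L2 U" "(\<lambda>x. if x \<in> K then gn n x else 0) \<in> L2 U"
      using square_integrable_indicator[OF wn] square_integrable_indicator[OF gn] compact_imp_closed[OF Kc] by blast+
    have ae: "AE x in lebesgue_on U. wn n x = (if x \<in> K then wn n x else 0)"
      "AE x in lebesgue_on U. gn n x = (if x \<in> K then gn n x else 0)"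
      using aeK by (eventually_elim; simp)+
    have 2: "weak_gradient U (\<lambda>x. if x \<in> K then wn n x else 0) (\<lambda>x. if x \<in> K then gn n x else 0)"
      by (rule weak_gradient_cong_AE[OF wg wn 1(1) gn 1(2) ae Um])
    obtain \<phi> D where t: "test_function U \<phi> D"
      "sqnorm (lebesgue_on U) (\<lambda>x. (if x \<in> K then wn n x else 0) - \<phi> x)
       + sqnorm (lebesgue_on U) (\<lambda>x. (if x \<in> K then gn n x else 0) - D x) < e"
      using compact_support_H10_approx[OF U 1 2 Kc KU _ _ e] by auto
    note tL = test_function_weak_gradient(1,2)[OF t(1) Um]
    have ae1: "AE x in lebesgue_on U. wn n x - \<phi> x = (if x \<in> K then wn n x else 0) - \<phi> x"
      using ae(1)
    proof eventually_elim
      case (elim x)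
      show ?case by (rule arg_cong2[where f = minus, OF elim refl])
    qed
    have ae2: "AE x in lebesgue_on U. gn n x - D x = (if x \<in> K then gn n x else 0) - D x"
      using ae(2)
    proof eventually_elim
      case (elim x)
      show ?case by (rule arg_cong2[where f = minus, OF elim refl])
    qed
    have "sqnorm (lebesgue_on U) (\<lambda>x. wn n x - \<phi> x) = sqnorm (lebesgue_on U) (\<lambda>x. (if x \<in> K then wn n x else 0) - \<phi> x)"
      by (rule sqnorm_AE_cong[OF borel_measurable_diff[OF L2_measurable[OF wn] L2_measurable[OF tL(1)]]
            borel_measurable_diff[OF L2_measurable[OF 1(1)] L2_measurable[OF tL(1)]]])
         (rule ae1)
    moreover have "sqnorm (lebesgue_on U) (\<lambda>x. gn n x - D x) = sqnorm (lebesgue_on U) (\<lambda>x. (if x \<in> K then gn n x else 0) - D x)"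
      by (rule sqnorm_AE_cong[OF borel_measurable_diff[OF L2_measurable[OF gn] L2_measurable[OF tL(2)]]
            borel_measurable_diff[OF L2_measurable[OF 1(2)] L2_measurable[OF tL(2)]]])
         (rule ae2)
    ultimately show ?thesis using t by (intro exI[of _ \<phi>] exI[of _ D]) simp
  qed
  show ?thesis
    unfolding H10_iff[OF U w(1) g0 wg0]
  proof (intro allI impI)
    fix e :: real assume "e > 0"
    \<comment> \<open>With the factors 2 of the triangle inequality the total stays below 6/8 of
      e.\<close>
    then have e8: "e / 8 > 0" by simp
    have "\<forall>\<^sub>F n in sequentially. sqnorm (lebesgue_on U) (\<lambda>x. wn n x - w x) < e / 8 \<and> sqnorm (lebesgue_on U) (\<lambda>x. gn n x - g0 x) < e / 8"
      using order_tendstoD(2)[OF limw e8] order_tendstoD(2)[OF limg e8] by (rule eventually_conj)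
    then obtain n where n: "sqnorm (lebesgue_on U) (\<lambda>x. wn n x - w x) < e / 8" "sqnorm (lebesgue_on U) (\<lambda>x. gn n x - g0 x) < e / 8"
      using eventually_happens trivial_limit_sequentially by blast
    have n': "sqnorm (lebesgue_on U) (\<lambda>x. w x - wn n x) < e / 8" "sqnorm (lebesgue_on U) (\<lambda>x. g0 x - gn n x) < e / 8"
      using n by (simp_all add: sqnorm_def norm_minus_commute power2_commute)
    obtain \<phi> D where t: "test_function U \<phi> D"
      "sqnorm (lebesgue_on U) (\<lambda>x. wn n x - \<phi> x) + sqnorm (lebesgue_on U) (\<lambda>x. gn n x - D x) < e / 8"
      using approx[OF e8] by blast
    note tL = test_function_weak_gradient(1,2)[OF t(1) Um]
    note s = w(1)[unfolded L2_eq] wn[unfolded L2_eq] tL(1)[unfolded L2_eq] g0[unfolded L2_eq] gn[unfolded L2_eq] tL(2)[unfolded L2_eq]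
    have "sqnorm (lebesgue_on U) (\<lambda>x. w x - \<phi> x) + sqnorm (lebesgue_on U) (\<lambda>x. g0 x - D x) < e"
      using sqnorm_triangle_le[OF s(1) s(2)[of n] s(3)] sqnorm_triangle_le[OF s(4) s(5)[of n] s(6)] n' t(2) \<open>e > 0\<close> by linarith
    then show "\<exists>\<phi> D. test_function U \<phi> D \<and>
        sqnorm (lebesgue_on U) (\<lambda>x. w x - \<phi> x) + sqnorm (lebesgue_on U) (\<lambda>x. g0 x - D x) < e"
      using t(1) by blast
  qed
qed

section \<open>Radial functions on star-shaped bodies\<close>

text \<open>A convex body \<open>B\<close> seen from an interior point \<open>ctr\<close>, with its boundary covered by finitely many
  convex pieces. The gauge \<open>\<xi>\<close> of \<open>B\<close> about \<open>ctr\<close> is the radial coordinate; it is linear on the sector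
  over each piece, with gradient \<open>nrm L\<close>.\<close>

locale star_body =
  fixes B :: "(real^'n) set" and ctr :: "real^'n" and Ls :: "(real^'n) set set"
  assumes convex: "convex B" and compact: "compact B" and center: "ctr \<in> interior B"
    and finite: "finite Ls" and cover: "\<Union>Ls = frontier B"
    and piece: "\<And>L. L \<in> Ls \<Longrightarrow> convex L \<and> compact L \<and> L \<noteq> {}"
begin

text \<open>An outer normal of a supporting hyperplane that contains \<open>L\<close>, scaled so
  that this hyperplane has height 1 over the center.\<close>

definition nrm :: "(real^'n) set \<Rightarrow> real^'n" where
  "nrm L = (SOME n. (\<forall>b\<in>L. n \<bullet> (b - ctr) = 1) \<and> (\<forall>x\<in>B. n \<bullet> (x - ctr) \<le> 1))"

text \<open>A maximum of finitely many linear functions, hence Lipschitz and positively homogeneous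
  about the center; \<open>body_iff\<close> identifies it as the gauge.\<close>

definition \<xi> :: "real^'n \<Rightarrow> real" where
  "\<xi> x = Max ((\<lambda>L. nrm L \<bullet> (x - ctr)) ` Ls)"

text \<open>Central projection onto the boundary. At the center, where \<xi> is 0, division by zero
  makes the value \<open>ctr\<close>.\<close>

definition proj :: "real^'n \<Rightarrow> real^'n" where
  "proj x = ctr + (1 / \<xi> x) *\<^sub>R (x - ctr)"

definition sec :: "(real^'n) set \<Rightarrow> (real^'n) set" where
  "sec L = convex hull (insert ctr L)"

section \<open>Supporting normals, gauge and central projection\<close>

lemma frontier_subset: "frontier B \<subseteq> B"
  using compact by (simp add: compact_imp_closed frontier_subset_closed)

lemma piece_subset: "L \<in> Ls \<Longrightarrow> L \<subseteq> frontier B" "L \<in> Ls \<Longrightarrow> L \<subseteq> B"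
  using cover frontier_subset by auto

text \<open>A hyperplane supporting \<open>B\<close> at a relative interior point p of
  \<open>L\<close> contains \<open>L\<close>: a segment from any b in \<open>L\<close> can be
  prolonged beyond p within \<open>L\<close>, so b cannot lie strictly on the inner side.\<close>

lemma normal_exists:
  assumes "L \<in> Ls"
  shows "\<exists>n. (\<forall>b\<in>L. n \<bullet> (b - ctr) = 1) \<and> (\<forall>x\<in>B. n \<bullet> (x - ctr) \<le> 1)"
proof -
  have L: "convex L" "L \<noteq> {}" using piece[OF assms] by auto
  then obtain p where p: "p \<in> rel_interior L" using rel_interior_eq_empty by blast
  then have pL: "p \<in> L" using rel_interior_subset by blast
  have ri: "rel_interior B = interior B" using center rel_interior_nonempty_interior by blast
  have "p \<in> B" "p \<notin> rel_interior B"
    using pL piece_subset[OF assms] by (auto simp: ri frontier_def)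
  then obtain a where a: "a \<noteq> 0" "\<And>y. y \<in> B \<Longrightarrow> a \<bullet> p \<le> a \<bullet> y" "\<And>y. y \<in> rel_interior B \<Longrightarrow> a \<bullet> p < a \<bullet> y"
    using supporting_hyperplane_rel_boundary[OF convex] by blast
  have aO: "a \<bullet> p < a \<bullet> ctr" using a(3) center ri by blast
  have eq: "a \<bullet> b = a \<bullet> p" if b: "b \<in> L" for b
  proof (rule ccontr)
    assume "a \<bullet> b \<noteq> a \<bullet> p"
    then have lt: "a \<bullet> p < a \<bullet> b" using a(2)[of b] b piece_subset[OF assms] by force
    obtain e where e: "e > 1" "(1 - e) *\<^sub>R b + e *\<^sub>R p \<in> L"
      using p b convex_rel_interior_iff[OF L] by blast
    have "a \<bullet> p \<le> a \<bullet> ((1 - e) *\<^sub>R b + e *\<^sub>R p)" using a(2) e(2) piece_subset[OF assms] by blast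
    then have "(e - 1) * (a \<bullet> b) \<le> (e - 1) * (a \<bullet> p)" by (simp add: inner_add_right algebra_simps)
    then show False using e(1) lt by simp
  qed
  \<comment> \<open>\<open>a\<close> points into the body, hence the minus sign; the factor makes
    the height of the hyperplane 1.\<close>
  define n where "n = (1 / (a \<bullet> ctr - a \<bullet> p)) *\<^sub>R (- a)"
  have "n \<bullet> (x - ctr) = (a \<bullet> ctr - a \<bullet> x) / (a \<bullet> ctr - a \<bullet> p)" for x
    by (simp add: n_def inner_diff_right diff_divide_distrib)
  then show ?thesis using eq a(2) aO by (intro exI[of _ n]) auto
qed

lemma nrm_eq: "L \<in> Ls \<Longrightarrow> b \<in> L \<Longrightarrow> nrm L \<bullet> (b - ctr) = 1"
  and nrm_le: "L \<in> Ls \<Longrightarrow> x \<in> B \<Longrightarrow> nrm L \<bullet> (x - ctr) \<le> 1"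
  using someI_ex[OF normal_exists] unfolding nrm_def[symmetric] by blast+

lemma Ls_nonempty: "Ls \<noteq> {}"
proof -
  have "B \<noteq> UNIV" using compact compact_imp_bounded not_bounded_UNIV by blast
  moreover have "B \<noteq> {}" using center interior_subset by blast
  ultimately show ?thesis using cover frontier_eq_empty[of B] by auto
qed

lemma \<xi>_ge: "L \<in> Ls \<Longrightarrow> nrm L \<bullet> (x - ctr) \<le> \<xi> x"
  unfolding \<xi>_def using finite by (intro Max_ge) auto

lemma \<xi>_attained: "\<exists>L\<in>Ls. \<xi> x = nrm L \<bullet> (x - ctr)"
proof -
  have "\<xi> x \<in> (\<lambda>L. nrm L \<bullet> (x - ctr)) ` Ls"
    unfolding \<xi>_def by (rule Max_in) (use finite Ls_nonempty in auto)
  then show ?thesis by (elim imageE) blast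
qed

text \<open>On the cone over \<open>L\<close> no other normal exceeds that of \<open>L\<close>,
  because all of them are at most 1 on \<open>B\<close>.\<close>

lemma \<xi>_ray:
  assumes "L \<in> Ls" "b \<in> L" "s \<ge> 0"
  shows "\<xi> (ctr + s *\<^sub>R (b - ctr)) = s" "nrm L \<bullet> ((ctr + s *\<^sub>R (b - ctr)) - ctr) = s"
proof -
  show 1: "nrm L \<bullet> ((ctr + s *\<^sub>R (b - ctr)) - ctr) = s" using nrm_eq[OF assms(1,2)] by simp
  obtain L' where L': "L' \<in> Ls" "\<xi> (ctr + s *\<^sub>R (b - ctr)) = nrm L' \<bullet> ((ctr + s *\<^sub>R (b - ctr)) - ctr)"
    using \<xi>_attained by blast
  note L'(2)
  also have "nrm L' \<bullet> ((ctr + s *\<^sub>R (b - ctr)) - ctr) = s * (nrm L' \<bullet> (b - ctr))" by simp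
  also have "\<dots> \<le> s * 1" using nrm_le[OF L'(1), of b] piece_subset[OF assms(1)] assms(2,3)
    by (intro mult_left_mono) auto
  finally show "\<xi> (ctr + s *\<^sub>R (b - ctr)) = s" using \<xi>_ge[OF assms(1), of "ctr + s *\<^sub>R (b - ctr)"] 1 by linarith
qed

lemma \<xi>_ray_frontier: "b \<in> frontier B \<Longrightarrow> s \<ge> 0 \<Longrightarrow> \<xi> (ctr + s *\<^sub>R (b - ctr)) = s"
  using \<xi>_ray(1) cover by blast

lemma \<xi>_homogeneous: "t \<ge> 0 \<Longrightarrow> \<xi> (ctr + t *\<^sub>R y) = t * \<xi> (ctr + y)"
proof -
  assume t: "t \<ge> 0"
  have "(\<lambda>L. nrm L \<bullet> ((ctr + t *\<^sub>R y) - ctr)) ` Ls = (\<lambda>r. t * r) ` ((\<lambda>L. nrm L \<bullet> ((ctr + y) - ctr)) ` Ls)"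
    by (simp add: image_image)
  moreover have "mono (\<lambda>r. t * r)" using t by (simp add: mono_def mult_left_mono)
  ultimately show ?thesis
    unfolding \<xi>_def using mono_Max_commute[of "\<lambda>r. t * r" "(\<lambda>L. nrm L \<bullet> ((ctr + y) - ctr)) ` Ls"] finite Ls_nonempty
    by simp
qed

lemma \<xi>_center: "\<xi> ctr = 0"
  using \<xi>_homogeneous[of 0 0] by simp

lemma ray:
  assumes "x \<noteq> ctr"
  shows "\<xi> x > 0" "proj x \<in> frontier B" "x = ctr + \<xi> x *\<^sub>R (proj x - ctr)"
    "\<xi> x < 1 \<Longrightarrow> x \<in> interior B"
proof -
  have bounded: "bounded B" using compact by (rule compact_imp_bounded)
  obtain d where d: "d > 0" "ctr + d *\<^sub>R (x - ctr) \<in> frontier B"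
    "\<And>e. 0 \<le> e \<Longrightarrow> e < d \<Longrightarrow> ctr + e *\<^sub>R (x - ctr) \<in> interior B"
    using ray_to_frontier[OF bounded center, of "x - ctr"] assms by auto
  have "x = ctr + (1 / d) *\<^sub>R ((ctr + d *\<^sub>R (x - ctr)) - ctr)" using d(1) by simp
  then have \<xi>: "\<xi> x = 1 / d" using \<xi>_ray_frontier[OF d(2), of "1 / d"] d(1) by simp
  then show "\<xi> x > 0" using d(1) by simp
  have p: "proj x = ctr + d *\<^sub>R (x - ctr)" using d(1) by (simp add: proj_def \<xi>)
  then show "proj x \<in> frontier B" using d(2) by simp
  show "x = ctr + \<xi> x *\<^sub>R (proj x - ctr)" using d(1) by (simp add: p \<xi>)
  show "x \<in> interior B" if "\<xi> x < 1"
    using d(3)[of 1] d(1) that by (simp add: \<xi>)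
qed

lemma \<xi>_nonneg: "\<xi> x \<ge> 0"
  using ray(1)[of x] \<xi>_center by (cases "x = ctr") auto

lemma frontier_iff: "x \<in> frontier B \<longleftrightarrow> \<xi> x = 1"
proof
  assume "x \<in> frontier B"
  then show "\<xi> x = 1" using \<xi>_ray_frontier[of x 1] by simp
next
  assume 1: "\<xi> x = 1"
  then have "x \<noteq> ctr" using \<xi>_center by auto
  from ray(2)[OF this] ray(3)[OF this] show "x \<in> frontier B" using 1 by simp
qed

lemma body_iff: "x \<in> B \<longleftrightarrow> \<xi> x \<le> 1"
proof
  assume "x \<in> B"
  then show "\<xi> x \<le> 1" using \<xi>_attained[of x] nrm_le by force
next
  assume le: "\<xi> x \<le> 1"
  show "x \<in> B"
  proof (cases "x = ctr \<or> \<xi> x = 1")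
    case True
    then show ?thesis using center interior_subset frontier_iff frontier_subset by blast
  next
    case False
    then show ?thesis using ray(4)[of x] le interior_subset by force
  qed
qed

lemma interior_iff: "x \<in> interior B \<longleftrightarrow> \<xi> x < 1"
proof -
  have "x \<in> interior B \<longleftrightarrow> x \<in> B \<and> x \<notin> frontier B"
    using frontier_subset interior_subset closure_subset unfolding frontier_def by blast
  then show ?thesis using body_iff frontier_iff by force
qed

lemma frontier_not_center: "b \<in> frontier B \<Longrightarrow> b \<noteq> ctr"
  using frontier_iff \<xi>_center by auto

lemma proj_ray: "b \<in> frontier B \<Longrightarrow> s > 0 \<Longrightarrow> proj (ctr + s *\<^sub>R (b - ctr)) = b"
  by (simp add: proj_def \<xi>_ray_frontier)

lemma proj_scale: "t > 0 \<Longrightarrow> proj (ctr + t *\<^sub>R y) = proj (ctr + y)"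
  by (simp add: proj_def \<xi>_homogeneous)

lemma \<xi>_Lipschitz: obtains C where "C > 0" "\<And>x y. \<bar>\<xi> x - \<xi> y\<bar> \<le> C * norm (x - y)" "\<And>L. L \<in> Ls \<Longrightarrow> norm (nrm L) \<le> C"
proof -
  define C where "C = (\<Sum>L\<in>Ls. norm (nrm L)) + 1"
  have C: "norm (nrm L) \<le> C" if "L \<in> Ls" for L
    using member_le_sum[OF that, of "\<lambda>L. norm (nrm L)"] finite by (simp add: C_def)
  have le: "\<xi> x - \<xi> y \<le> C * norm (x - y)" for x y
  proof -
    obtain L where L: "L \<in> Ls" "\<xi> x = nrm L \<bullet> (x - ctr)" using \<xi>_attained by blast
    have "nrm L \<bullet> (x - ctr) = nrm L \<bullet> (y - ctr) + nrm L \<bullet> (x - y)" by (simp add: inner_diff_right)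
    also have "nrm L \<bullet> (x - y) \<le> norm (nrm L) * norm (x - y)" by (rule norm_cauchy_schwarz)
    also have "\<dots> \<le> C * norm (x - y)" using C[OF L(1)] by (intro mult_right_mono) auto
    finally show ?thesis using L \<xi>_ge[OF L(1), of y] by simp
  qed
  show thesis
  proof (rule that[of C])
    show "C > 0" by (simp add: C_def sum_nonneg add_nonneg_pos)
    show "\<bar>\<xi> x - \<xi> y\<bar> \<le> C * norm (x - y)" for x y
      using le[of x y] le[of y x] by (simp add: norm_minus_commute abs_le_iff)
  qed (rule C)
qed

lemma continuous_\<xi>: "continuous_on A \<xi>"
proof -
  obtain C where "C > 0" "\<And>x y. \<bar>\<xi> x - \<xi> y\<bar> \<le> C * norm (x - y)" "\<And>L. L \<in> Ls \<Longrightarrow> norm (nrm L) \<le> C"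
    using \<xi>_Lipschitz by blast
  then show ?thesis
    by (intro lipschitz_on_continuous_on[of C]) (auto simp: lipschitz_on_def dist_norm dist_real_def)
qed

lemma measurable_\<xi> [measurable]: "\<xi> \<in> borel_measurable borel"
  by (rule borel_measurable_continuous_onI[OF continuous_\<xi>])

lemma measurable_proj [measurable]: "proj \<in> borel_measurable borel"
  unfolding proj_def[abs_def] by measurable

section \<open>Sectors over the pieces\<close>

lemma sec_iff:
  assumes "L \<in> Ls"
  shows "x \<in> sec L \<longleftrightarrow> (\<exists>s b. 0 \<le> s \<and> s \<le> 1 \<and> b \<in> L \<and> x = ctr + s *\<^sub>R (b - ctr))"
proof -
  have "convex hull L = L" "L \<noteq> {}" using piece[OF assms] by (auto simp: convex_hull_eq)
  then have "x \<in> sec L \<longleftrightarrow> (\<exists>b u. x = (1 - u) *\<^sub>R ctr + u *\<^sub>R b \<and> 0 \<le> u \<and> u \<le> 1 \<and> b \<in> L)"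
    unfolding sec_def convex_hull_insert_alt by auto
  moreover have "(1 - u) *\<^sub>R ctr + u *\<^sub>R b = ctr + u *\<^sub>R (b - ctr)" for u b
    by (simp add: algebra_simps)
  ultimately show ?thesis by auto
qed

lemma sec_\<xi>:
  assumes "L \<in> Ls" "x \<in> sec L"
  shows "\<xi> x = nrm L \<bullet> (x - ctr)"
  using assms(2) \<xi>_ray[OF assms(1)] unfolding sec_iff[OF assms(1)] by metis

lemma sec_proj:
  assumes "L \<in> Ls" "x \<noteq> ctr"
  shows "x \<in> sec L \<longleftrightarrow> x \<in> B \<and> proj x \<in> L"
proof
  assume "x \<in> sec L"
  then obtain s b where s: "0 \<le> s" "s \<le> 1" "b \<in> L" "x = ctr + s *\<^sub>R (b - ctr)"
    unfolding sec_iff[OF assms(1)] by blast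
  then have "s > 0" using assms(2) by (cases "s = 0") auto
  moreover have "b \<in> frontier B" using s(3) piece_subset[OF assms(1)] by blast
  ultimately show "x \<in> B \<and> proj x \<in> L" using proj_ray \<xi>_ray_frontier[of b s] s by (auto simp: body_iff)
next
  assume "x \<in> B \<and> proj x \<in> L"
  then show "x \<in> sec L" unfolding sec_iff[OF assms(1)]
    using ray(3)[OF assms(2)] \<xi>_nonneg[of x] body_iff by blast
qed

lemma sec_subset: "L \<in> Ls \<Longrightarrow> sec L \<subseteq> B"
proof
  fix x assume L: "L \<in> Ls" "x \<in> sec L"
  show "x \<in> B"
    using sec_proj[OF L(1), of x] L(2) center interior_subset by (cases "x = ctr") auto
qed

lemma sec_interior_subset: "L \<in> Ls \<Longrightarrow> interior (sec L) \<subseteq> interior B"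
  by (rule interior_mono[OF sec_subset])

lemma sec_convex: "convex (sec L)"
  by (simp add: sec_def)

lemma sec_compact: "L \<in> Ls \<Longrightarrow> compact (sec L)"
  unfolding sec_def using piece by (intro compact_convex_hull compact_insert) blast

text \<open>The apex is not an interior point of the sector: a step from it away from a point b of
  \<open>L\<close> would have negative height, while \<xi> is nonnegative.\<close>

lemma sec_interior_\<xi>_pos:
  assumes "L \<in> Ls" "x \<in> interior (sec L)"
  shows "nrm L \<bullet> (x - ctr) > 0" "x \<noteq> ctr" "proj x \<in> L"
proof -
  have xL: "x \<in> sec L" using assms(2) interior_subset by blast
  obtain b where b: "b \<in> L" using piece[OF assms(1)] by blast
  show "x \<noteq> ctr"
  proof
    assume "x = ctr"
    then obtain e where e: "e > 0" "ball ctr e \<subseteq> sec L" using assms(2) unfolding mem_interior by blast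
    \<comment> \<open>A step backwards from the center, shorter than e/2 whatever the length of b -
      ctr.\<close>
    define y where "y = ctr - (e / (2 * norm (b - ctr) + 1)) *\<^sub>R (b - ctr)"
    have "norm (ctr - y) < e"
    proof -
      have "norm (ctr - y) = e * (norm (b - ctr) / (2 * norm (b - ctr) + 1))" using e(1) by (simp add: y_def)
      also have "\<dots> < e * 1" using e(1) by (intro mult_strict_left_mono) (auto simp: divide_less_eq add_nonneg_pos)
      finally show ?thesis by simp
    qed
    then have "y \<in> sec L" using e(2) by (auto simp: dist_norm)
    then have "\<xi> y = nrm L \<bullet> (y - ctr)" by (rule sec_\<xi>[OF assms(1)])
    also have "\<dots> = - (e / (2 * norm (b - ctr) + 1))" using nrm_eq[OF assms(1) b] by (simp add: y_def)
    also have "\<dots> < 0" using e(1) by (simp add: add_nonneg_pos)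
    finally show False using \<xi>_nonneg[of y] by simp
  qed
  then show "nrm L \<bullet> (x - ctr) > 0" "proj x \<in> L"
    using ray(1)[of x] sec_\<xi>[OF assms(1) xL] sec_proj[OF assms(1), of x] xL by auto
qed

lemma AE_sec:
  "AE x in lebesgue. x \<in> B \<longrightarrow> x \<noteq> ctr \<and> x \<in> interior B \<and> (\<forall>L\<in>Ls. x \<in> sec L \<longrightarrow> x \<in> interior (sec L))"
proof -
  have "negligible ({ctr} \<union> frontier B \<union> (\<Union>L\<in>Ls. frontier (sec L)))"
    using finite negligible_convex_frontier[OF convex] negligible_convex_frontier[OF sec_convex]
    by (intro negligible_Un negligible_Union finite_imageI) auto
  then have "AE x in lebesgue. x \<notin> {ctr} \<union> frontier B \<union> (\<Union>L\<in>Ls. frontier (sec L))"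
    unfolding negligible_iff_null_sets by (rule AE_not_in)
  then show ?thesis
    by eventually_elim (auto simp: frontier_def dest: closure_subset[THEN subsetD])
qed

lemma GDERIV_\<xi>:
  assumes "L \<in> Ls" "x \<in> interior (sec L)"
  shows "GDERIV \<xi> x :> nrm L"
proof (rule GDERIV_transform_open[where S = "interior (sec L)"])
  show "GDERIV (\<lambda>x. nrm L \<bullet> (x - ctr)) x :> nrm L"
    unfolding gderiv_def by (auto intro!: derivative_eq_intros simp: inner_commute)
  show "nrm L \<bullet> (y - ctr) = \<xi> y" if "y \<in> interior (sec L)" for y
    using sec_\<xi>[OF assms(1), of y] interior_subset that by force
qed (use assms in auto)

text \<open>Bounds (x - ctr) / \<xi>, which controls the divisions by \<xi> in the moments
  below.\<close>

lemma \<xi>_norm_bound: obtains C where "C > 0" "\<And>x. norm (x - ctr) \<le> C * \<xi> x"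
proof -
  obtain C where C: "C > 0" "\<forall>x\<in>B. norm (x - ctr) \<le> C"
  proof -
    have "bounded ((\<lambda>x. x - ctr) ` B)"
      using compact_imp_bounded[OF compact] bounded_translation[of B "- ctr"] by (simp add: add.commute[of "- ctr"])
    then show ?thesis using that unfolding bounded_pos by auto
  qed
  have "norm (x - ctr) \<le> C * \<xi> x" for x
  proof (cases "x = ctr")
    case False
    have "norm (x - ctr) = \<xi> x * norm (proj x - ctr)"
      using arg_cong[OF ray(3)[OF False], of "\<lambda>z. norm (z - ctr)"] \<xi>_nonneg[of x] by simp
    also have "\<dots> \<le> \<xi> x * C"
      using C(2) ray(2)[OF False] frontier_subset \<xi>_nonneg[of x] by (intro mult_left_mono) auto
    finally show ?thesis by (simp add: mult.commute)
  qed (simp add: \<xi>_center)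
  then show thesis using that C(1) by blast
qed

text \<open>Each ray is given to the first piece it meets in an enumeration \<open>f\<close> of the
  pieces. The overlapping cones become a Borel partition, so data given piece by piece define one
  measurable function that is homogeneous of degree 0.\<close>

lemma piece_selection:
  obtains A where "\<And>L. A L \<in> sets borel" "\<And>L x. x \<in> A L \<Longrightarrow> L \<in> Ls \<and> x \<noteq> ctr \<and> proj x \<in> L"
    "\<And>x. x \<noteq> ctr \<Longrightarrow> \<exists>!L. x \<in> A L" "\<And>L t y. t > 0 \<Longrightarrow> ctr + t *\<^sub>R y \<in> A L \<longleftrightarrow> ctr + y \<in> A L"
proof -
  obtain f :: "(real^'n) set \<Rightarrow> nat" where f: "inj_on f Ls"
    using finite_imp_inj_to_nat_seg[OF finite] by blast
  define A where "A L = {x. L \<in> Ls \<and> x \<noteq> ctr \<and> proj x \<in> L \<and> (\<forall>L'\<in>Ls. f L' < f L \<longrightarrow> proj x \<notin> L')}" for L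
  have m: "{x. proj x \<in> L} \<in> sets borel" if "L \<in> Ls" for L
  proof -
    have "proj -` L \<inter> space borel \<in> sets borel"
      by (rule measurable_sets[OF measurable_proj borel_closed[OF compact_imp_closed]]) (use piece[OF that] in blast)
    then show ?thesis by (simp add: vimage_def)
  qed
  show thesis
  proof (rule that[of A])
    show "A L \<in> sets borel" for L
    proof (cases "L \<in> Ls")
      case True
      have "A L = ({x. proj x \<in> L} - {ctr}) - (\<Union>L'\<in>{L'\<in>Ls. f L' < f L}. {x. proj x \<in> L'})"
        using True by (auto simp: A_def)
      also have "\<dots> \<in> sets borel"
        using m True finite by (intro sets.Diff sets.finite_UN) auto
      finally show ?thesis .
    qed (simp add: A_def)
    show "L \<in> Ls \<and> x \<noteq> ctr \<and> proj x \<in> L" if "x \<in> A L" for L x using that by (simp add: A_def)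
    show "\<exists>!L. x \<in> A L" if "x \<noteq> ctr" for x
    proof -
      have "\<exists>L. L \<in> Ls \<and> proj x \<in> L" using ray(2)[OF that] cover by blast
      from arg_min_natI[of "\<lambda>L. L \<in> Ls \<and> proj x \<in> L" _ f] this
      obtain L where L: "L \<in> Ls" "proj x \<in> L" "\<And>L'. L' \<in> Ls \<Longrightarrow> proj x \<in> L' \<Longrightarrow> f L \<le> f L'"
        using arg_min_nat_le[of "\<lambda>L. L \<in> Ls \<and> proj x \<in> L" _ f] by blast
      show ?thesis
      proof (rule ex1I[of _ L])
        show "x \<in> A L" using L that unfolding A_def by (auto simp: not_le[symmetric])
        fix L' assume "x \<in> A L'"
        then have L': "L' \<in> Ls" "proj x \<in> L'" "f L' \<le> f L" using L(1,2) by (auto simp: A_def not_less[symmetric])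
        then have "f L' = f L" using L(3)[of L'] by simp
        then show "L' = L" using f L(1) L'(1) by (auto dest: inj_onD)
      qed
    qed
    show "ctr + t *\<^sub>R y \<in> A L \<longleftrightarrow> ctr + y \<in> A L" if "t > 0" for L t y
      using that by (simp add: A_def proj_scale)
  qed
qed

end

section \<open>Translations, dilations and homogeneous coefficients\<close>

lemma lebesgue_integral_dilation:
  fixes f :: "real^'n \<Rightarrow> real"
  assumes "f \<in> borel_measurable lebesgue" "t > 0"
  shows "integral\<^sup>L lebesgue f = t ^ CARD('n) * (LINT x|lebesgue. f (ctr + t *\<^sub>R (x - ctr)))"
proof -
  have *: "(ctr - t *\<^sub>R ctr) + t *\<^sub>R x = ctr + t *\<^sub>R (x - ctr)" for x by (simp add: scaleR_diff_right)
  show ?thesis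
    using lebesgue_integral_affine[of t f "ctr - t *\<^sub>R ctr"] assms unfolding * by simp
qed

text \<open>The integral of q times a translate of \<phi> along v does not depend on the translate.
  Differentiating this at 0 replaces an integration by parts in which q would have to be
  differentiated.\<close>

lemma test_function_translation_invariant:
  fixes q :: "real^'n \<Rightarrow> real"
  assumes t: "test_function U \<phi> D" and q: "continuous_on UNIV q" "\<And>x. \<bar>q x\<bar> \<le> Q" "\<And>x s. q (x + s *\<^sub>R v) = q x"
  shows "(LINT x|lebesgue. q x * (v \<bullet> D x)) = 0"
proof -
  define \<tau> where "\<tau> n = 1 / real (Suc n)" for n
  have \<tau>: "\<tau> n > 0" "\<tau> n \<le> 1" for n by (simp_all add: \<tau>_def)
  obtain R where R: "\<forall>x. x \<notin> cball 0 R \<longrightarrow> \<phi> x = 0 \<and> D x = 0" using test_function_ball[OF t] by blast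
  obtain C where C: "C > 0" "\<forall>x. \<bar>\<phi> x\<bar> \<le> C \<and> norm (D x) \<le> C" using test_function_bounded[OF t] by blast
  have lip: "\<bar>\<phi> x - \<phi> y\<bar> \<le> C * norm (x - y)" for x y
    by (rule bounded_gradient_Lipschitz[OF test_functionD(1)[OF t]]) (use C in blast)
  have Q: "Q \<ge> 0" using q(2)[of 0] by (meson abs_ge_zero order_trans)
  have qm[measurable]: "q \<in> borel_measurable lebesgue" by (rule continuous_imp_lebesgue_measurable[OF q(1)])
  have \<phi>m[measurable]: "\<phi> \<in> borel_measurable lebesgue" "D \<in> borel_measurable lebesgue"
    using test_functionD(2,3)[OF t] by (auto intro: continuous_imp_lebesgue_measurable)
  have int: "integrable lebesgue (\<lambda>x. q x * \<phi> x)"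
  proof (rule bounded_support_integrable(1)[where a = 0 and R = R and C = "Q * C"])
    show "norm (q x * \<phi> x) \<le> Q * C" for x
      using mult_mono[OF q(2)[of x] C(2)[rule_format, THEN conjunct1] Q abs_ge_zero] by (simp add: abs_mult)
  qed (use R in auto)
  have sh: "(\<lambda>x. \<phi> (x + \<tau> n *\<^sub>R v)) \<in> borel_measurable lebesgue" for n
  proof (rule continuous_imp_lebesgue_measurable)
    show "continuous_on UNIV (\<lambda>x. \<phi> (x + \<tau> n *\<^sub>R v))"
      by (rule continuous_on_compose2[OF test_functionD(3)[OF t]]) (auto intro!: continuous_intros)
  qed
  have int2: "integrable lebesgue (\<lambda>x. q x * \<phi> (x + \<tau> n *\<^sub>R v))"
    and eq: "(LINT x|lebesgue. q x * \<phi> (x + \<tau> n *\<^sub>R v)) = (LINT x|lebesgue. q x * \<phi> x)" for n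
  proof -
    have e: "(\<lambda>x. q (x + \<tau> n *\<^sub>R v) * \<phi> (x + \<tau> n *\<^sub>R v)) = (\<lambda>x. q x * \<phi> (x + \<tau> n *\<^sub>R v))"
      by (simp add: q(3))
    show "integrable lebesgue (\<lambda>x. q x * \<phi> (x + \<tau> n *\<^sub>R v))"
      using lebesgue_integrable_affine[of 1 "\<lambda>x. q x * \<phi> x" "\<tau> n *\<^sub>R v"] int e by (simp add: add.commute)
    show "(LINT x|lebesgue. q x * \<phi> (x + \<tau> n *\<^sub>R v)) = (LINT x|lebesgue. q x * \<phi> x)"
      using lebesgue_integral_translation[of "\<lambda>x. q x * \<phi> x" "\<tau> n *\<^sub>R v"] e by simp
  qed
  have "(\<lambda>n. LINT x|lebesgue. q x * ((\<phi> (x + \<tau> n *\<^sub>R v) - \<phi> x) / \<tau> n)) \<longlonglongrightarrow> (LINT x|lebesgue. q x * (v \<bullet> D x))"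
  proof (rule integral_dominated_convergence[where w = "\<lambda>x. (Q * (C * norm v)) * indicator (cball 0 (R + norm v)) x"])
    show "integrable lebesgue (\<lambda>x::real^'n. (Q * (C * norm v)) * indicator (cball 0 (R + norm v)) x)"
      using emeasure_lborel_cball_finite[of "0::real^'n" "R + norm v"]
      by (intro integrable_mult_right integrable_real_indicator) auto
    show "AE x in lebesgue. (\<lambda>n. q x * ((\<phi> (x + \<tau> n *\<^sub>R v) - \<phi> x) / \<tau> n)) \<longlonglongrightarrow> q x * (v \<bullet> D x)"
      unfolding \<tau>_def by (intro AE_I2 tendsto_mult_left GDERIV_difference_quotient test_functionD(1)[OF t])
    show "AE x in lebesgue. norm (q x * ((\<phi> (x + \<tau> n *\<^sub>R v) - \<phi> x) / \<tau> n)) \<le> (Q * (C * norm v)) * indicator (cball 0 (R + norm v)) x" for n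
    proof (rule AE_I2)
      fix x
      have nv: "norm (\<tau> n *\<^sub>R v) \<le> norm v" using \<tau>[of n] by (simp add: mult_left_le_one_le)
      show "norm (q x * ((\<phi> (x + \<tau> n *\<^sub>R v) - \<phi> x) / \<tau> n)) \<le> (Q * (C * norm v)) * indicator (cball 0 (R + norm v)) x"
      proof (cases "x \<in> cball 0 (R + norm v)")
        case True
        have "\<bar>\<phi> (x + \<tau> n *\<^sub>R v) - \<phi> x\<bar> \<le> C * (\<tau> n * norm v)" using lip[of "x + \<tau> n *\<^sub>R v" x] \<tau>(1)[of n] by simp
        then have "\<bar>(\<phi> (x + \<tau> n *\<^sub>R v) - \<phi> x) / \<tau> n\<bar> \<le> C * norm v" using \<tau>(1)[of n] by (simp add: field_simps)
        from mult_mono[OF q(2)[of x] this Q abs_ge_zero] show ?thesis using True by (simp add: abs_mult)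
      next
        case False
        have "norm x \<le> norm (x + \<tau> n *\<^sub>R v) + norm (\<tau> n *\<^sub>R v)" by (metis add_diff_cancel_right' norm_triangle_ineq4)
        moreover have "norm x > R + norm v" using False by simp
        ultimately have "norm (x + \<tau> n *\<^sub>R v) > R" "norm x > R" using nv norm_ge_zero[of v] by linarith+
        then have "x + \<tau> n *\<^sub>R v \<notin> cball 0 R" "x \<notin> cball 0 R" by auto
        then show ?thesis using R False by simp
      qed
    qed
    show "(\<lambda>x. q x * ((\<phi> (x + \<tau> n *\<^sub>R v) - \<phi> x) / \<tau> n)) \<in> borel_measurable lebesgue" for n
      using sh[of n] by measurable
  qed measurable
  moreover have "(LINT x|lebesgue. q x * ((\<phi> (x + \<tau> n *\<^sub>R v) - \<phi> x) / \<tau> n)) = 0" for n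
  proof -
    have "(\<lambda>x. q x * ((\<phi> (x + \<tau> n *\<^sub>R v) - \<phi> x) / \<tau> n)) = (\<lambda>x. (q x * \<phi> (x + \<tau> n *\<^sub>R v) - q x * \<phi> x) / \<tau> n)"
      by (simp add: right_diff_distrib)
    then show ?thesis using Bochner_Integration.integral_diff[OF int2[of n] int] eq[of n] by simp
  qed
  ultimately have "(\<lambda>n::nat. 0::real) \<longlonglongrightarrow> (LINT x|lebesgue. q x * (v \<bullet> D x))" by (simp only:)
  then show ?thesis using LIMSEQ_unique tendsto_const by blast
qed

context star_body
begin

lemma AE_frontier: "AE x in lebesgue. x \<noteq> ctr \<and> \<xi> x \<noteq> 1"
proof -
  have "negligible ({ctr} \<union> frontier B)"
    by (intro negligible_Un negligible_convex_frontier[OF convex]) auto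
  then have "AE x in lebesgue. x \<notin> {ctr} \<union> frontier B"
    unfolding negligible_iff_null_sets by (rule AE_not_in)
  then show ?thesis by eventually_elim (auto simp: frontier_iff)
qed

lemma body_bounded: obtains R where "\<And>x. \<xi> x \<le> 1 \<Longrightarrow> x \<in> cball 0 R"
proof -
  obtain R where "\<forall>x\<in>B. norm x \<le> R" using compact_imp_bounded[OF compact] unfolding bounded_iff by blast
  then show thesis using that body_iff by auto
qed

lemma measurable_\<xi>_lebesgue [measurable]: "\<xi> \<in> borel_measurable lebesgue"
  by (rule continuous_imp_lebesgue_measurable[OF continuous_\<xi>])

definition homogeneous0 :: "(real^'n \<Rightarrow> real) \<Rightarrow> bool" where
  "homogeneous0 \<beta> \<longleftrightarrow> (\<forall>t>0. \<forall>y. \<beta> (ctr + t *\<^sub>R y) = \<beta> (ctr + y))"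

text \<open>Dilation by t < 1 maps the body onto the set \<xi> \<le> t and scales the integral of
  \<beta> by t to the dimension, so mean zero passes to the sublevel sets and then to their
  complements in the body.\<close>

lemma homogeneous0_integral_superlevel:
  assumes \<beta>[measurable]: "\<beta> \<in> borel_measurable borel" and bd: "\<And>x. \<bar>\<beta> x\<bar> \<le> K" and hom: "homogeneous0 \<beta>"
    and mean: "(LINT x|lebesgue. (if \<xi> x \<le> 1 then \<beta> x else 0)) = 0"
  shows "(LINT x|lebesgue. (if \<xi> x \<le> 1 \<and> t < \<xi> x then \<beta> x else 0)) = 0"
proof -
  have \<beta>l[measurable]: "\<beta> \<in> borel_measurable lebesgue" using \<beta> by (simp add: measurable_completion)
  obtain R where R: "\<And>x. \<xi> x \<le> 1 \<Longrightarrow> x \<in> cball 0 R" using body_bounded by blast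
  have K: "K \<ge> 0" using bd[of 0] by (meson abs_ge_zero order_trans)
  have int: "integrable lebesgue (\<lambda>x. if \<xi> x \<le> 1 \<and> P (\<xi> x) then \<beta> x else 0)" if "Measurable.pred borel P" for P
  proof (rule bounded_support_integrable(1)[where a = 0 and R = R and C = K])
    show "(\<lambda>x. if \<xi> x \<le> 1 \<and> P (\<xi> x) then \<beta> x else 0) \<in> borel_measurable lebesgue" using that by measurable
  qed (use R bd K in auto)
  consider "t < 0" | "t \<ge> 1" | "t = 0" | "0 < t" "t < 1" by linarith
  then show ?thesis
  proof cases
    case 1
    then have "t < \<xi> x" for x using \<xi>_nonneg[of x] by linarith
    then show ?thesis using mean by simp
  next
    case 2
    then have "(\<lambda>x. if \<xi> x \<le> 1 \<and> t < \<xi> x then \<beta> x else 0) = (\<lambda>x. 0)" by auto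
    then show ?thesis by simp
  next
    case 3
    have "(LINT x|lebesgue. (if \<xi> x \<le> 1 \<and> t < \<xi> x then \<beta> x else 0)) = (LINT x|lebesgue. (if \<xi> x \<le> 1 then \<beta> x else 0))"
    proof (rule integral_cong_AE)
      show "AE x in lebesgue. (if \<xi> x \<le> 1 \<and> t < \<xi> x then \<beta> x else 0) = (if \<xi> x \<le> 1 then \<beta> x else 0)"
        using AE_frontier by eventually_elim (use 3 ray(1) in auto)
    qed measurable
    then show ?thesis using mean by simp
  next
    case 4
    have "(LINT x|lebesgue. (if \<xi> x \<le> 1 \<and> \<xi> x \<le> t then \<beta> x else 0)) = t ^ CARD('n) *
        (LINT x|lebesgue. (if \<xi> (ctr + t *\<^sub>R (x - ctr)) \<le> 1 \<and> \<xi> (ctr + t *\<^sub>R (x - ctr)) \<le> t then \<beta> (ctr + t *\<^sub>R (x - ctr)) else 0))"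
      by (rule lebesgue_integral_dilation) (use 4 in auto)
    also have "(\<lambda>x. (if \<xi> (ctr + t *\<^sub>R (x - ctr)) \<le> 1 \<and> \<xi> (ctr + t *\<^sub>R (x - ctr)) \<le> t then \<beta> (ctr + t *\<^sub>R (x - ctr)) else 0))
        = (\<lambda>x. if \<xi> x \<le> 1 then \<beta> x else 0)"
    proof (rule ext)
      fix x
      have b: "\<beta> (ctr + t *\<^sub>R (x - ctr)) = \<beta> x" using hom 4 unfolding homogeneous0_def by simp
      have x: "\<xi> (ctr + t *\<^sub>R (x - ctr)) = t * \<xi> x" using \<xi>_homogeneous[of t "x - ctr"] 4 by simp
      have "t * \<xi> x \<le> t * 1 \<longleftrightarrow> \<xi> x \<le> 1" by (rule mult_le_cancel_left_pos[OF 4(1)])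
      then have "t * \<xi> x \<le> 1 \<and> t * \<xi> x \<le> t \<longleftrightarrow> \<xi> x \<le> 1" using 4 by linarith
      then show "(if \<xi> (ctr + t *\<^sub>R (x - ctr)) \<le> 1 \<and> \<xi> (ctr + t *\<^sub>R (x - ctr)) \<le> t then \<beta> (ctr + t *\<^sub>R (x - ctr)) else 0)
          = (if \<xi> x \<le> 1 then \<beta> x else 0)"
        by (simp only: b x)
    qed
    finally have low: "(LINT x|lebesgue. (if \<xi> x \<le> 1 \<and> \<xi> x \<le> t then \<beta> x else 0)) = 0" using mean by simp
    have "(LINT x|lebesgue. (if \<xi> x \<le> 1 then \<beta> x else 0))
        = (LINT x|lebesgue. (if \<xi> x \<le> 1 \<and> \<xi> x \<le> t then \<beta> x else 0) + (if \<xi> x \<le> 1 \<and> t < \<xi> x then \<beta> x else 0))"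
      by (rule Bochner_Integration.integral_cong) auto
    also have "\<dots> = (LINT x|lebesgue. (if \<xi> x \<le> 1 \<and> \<xi> x \<le> t then \<beta> x else 0)) + (LINT x|lebesgue. (if \<xi> x \<le> 1 \<and> t < \<xi> x then \<beta> x else 0))"
      by (rule Bochner_Integration.integral_add) (rule int; measurable)+
    finally show ?thesis using low mean by simp
  qed
qed

text \<open>The positive and negative parts of \<open>\<beta>\<close> have the same distribution along \<open>\<xi>\<close>.\<close>

lemma homogeneous0_radial_integral:
  assumes \<beta>[measurable]: "\<beta> \<in> borel_measurable borel" and bd: "\<And>x. \<bar>\<beta> x\<bar> \<le> K" and hom: "homogeneous0 \<beta>"
    and mean: "(LINT x|lebesgue. (if \<xi> x \<le> 1 then \<beta> x else 0)) = 0"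
    and f[measurable]: "f \<in> borel_measurable borel"
    and fi: "integrable lebesgue (\<lambda>x. if \<xi> x \<le> 1 then f (\<xi> x) else 0)"
  shows "(LINT x|lebesgue. (if \<xi> x \<le> 1 then \<beta> x * f (\<xi> x) else 0)) = 0"
proof -
  have \<beta>l[measurable]: "\<beta> \<in> borel_measurable lebesgue" using \<beta> by (simp add: measurable_completion)
  obtain R where R: "\<And>x. \<xi> x \<le> 1 \<Longrightarrow> x \<in> cball 0 R" using body_bounded by blast
  have K: "K \<ge> 0" using bd[of 0] by (meson abs_ge_zero order_trans)
  define p q where "p x = (if \<xi> x \<le> 1 then max 0 (\<beta> x) else 0)" and "q x = (if \<xi> x \<le> 1 then max 0 (- \<beta> x) else 0)" for x
  have pm[measurable]: "p \<in> borel_measurable lebesgue" "q \<in> borel_measurable lebesgue"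
    unfolding p_def[abs_def] q_def[abs_def] by measurable
  have nn: "p x \<ge> 0" "q x \<ge> 0" for x by (simp_all add: p_def q_def)
  have le: "p x \<le> K" "q x \<le> K" for x using bd[of x] K by (auto simp: p_def q_def)
  have int: "integrable lebesgue (\<lambda>x. p x * indicator {x. t < \<xi> x} x)" "integrable lebesgue (\<lambda>x. q x * indicator {x. t < \<xi> x} x)" for t
  proof -
    show "integrable lebesgue (\<lambda>x. p x * indicator {x. t < \<xi> x} x)"
    proof (rule bounded_support_integrable(1)[where a = 0 and R = R and C = K])
      show "norm (p x * indicator {x. t < \<xi> x} x) \<le> K" for x
        using le(1)[of x] nn(1)[of x] K by (simp add: indicator_def)
      show "p x * indicator {x. t < \<xi> x} x = 0" if "x \<notin> cball 0 R" for x
        using R[of x] that by (auto simp: p_def)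
    qed measurable
    show "integrable lebesgue (\<lambda>x. q x * indicator {x. t < \<xi> x} x)"
    proof (rule bounded_support_integrable(1)[where a = 0 and R = R and C = K])
      show "norm (q x * indicator {x. t < \<xi> x} x) \<le> K" for x
        using le(2)[of x] nn(2)[of x] K by (simp add: indicator_def)
      show "q x * indicator {x. t < \<xi> x} x = 0" if "x \<notin> cball 0 R" for x
        using R[of x] that by (auto simp: q_def)
    qed measurable
  qed
  have em: "emeasure (distr (density lebesgue (\<lambda>x. ennreal (r x))) borel \<xi>) {t<..}
      = ennreal (LINT x|lebesgue. r x * indicator {x. t < \<xi> x} x)"
    if [measurable]: "r \<in> borel_measurable lebesgue" and "\<And>x. r x \<ge> 0" "integrable lebesgue (\<lambda>x. r x * indicator {x. t < \<xi> x} x)" for r t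
  proof -
    have "{x \<in> space lebesgue. t < \<xi> x} \<in> sets lebesgue" by measurable
    then have S: "{x. t < \<xi> x} \<in> sets lebesgue" by simp
    have "emeasure (distr (density lebesgue (\<lambda>x. ennreal (r x))) borel \<xi>) {t<..}
        = emeasure (density lebesgue (\<lambda>x. ennreal (r x))) {x. t < \<xi> x}"
      by (subst emeasure_distr) (auto simp: vimage_def)
    also have "\<dots> = (\<integral>\<^sup>+x. ennreal (r x) * indicator {x. t < \<xi> x} x \<partial>lebesgue)"
      by (rule emeasure_density) (use S in auto)
    also have "\<dots> = (\<integral>\<^sup>+x. ennreal (r x * indicator {x. t < \<xi> x} x) \<partial>lebesgue)"
      by (rule nn_integral_cong) (simp add: indicator_def)
    also have "\<dots> = ennreal (LINT x|lebesgue. r x * indicator {x. t < \<xi> x} x)"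
      by (rule nn_integral_eq_integral) (use that in auto)
    finally show ?thesis .
  qed
  have eqt: "(LINT x|lebesgue. p x * indicator {x. t < \<xi> x} x) = (LINT x|lebesgue. q x * indicator {x. t < \<xi> x} x)" for t
  proof -
    have "(LINT x|lebesgue. p x * indicator {x. t < \<xi> x} x) - (LINT x|lebesgue. q x * indicator {x. t < \<xi> x} x)
        = (LINT x|lebesgue. p x * indicator {x. t < \<xi> x} x - q x * indicator {x. t < \<xi> x} x)"
      by (rule Bochner_Integration.integral_diff[OF int, symmetric])
    also have "\<dots> = (LINT x|lebesgue. (if \<xi> x \<le> 1 \<and> t < \<xi> x then \<beta> x else 0))"
      by (rule Bochner_Integration.integral_cong) (auto simp: p_def q_def indicator_def)
    also have "\<dots> = 0" by (rule homogeneous0_integral_superlevel[OF \<beta> bd hom mean])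
    finally show ?thesis by simp
  qed
  \<comment> \<open>With the positive and with the negative part as density, \<xi> has the same
    finite push-forward measure, since the two agree on all half-lines.\<close>
  have eq: "distr (density lebesgue (\<lambda>x. ennreal (p x))) borel \<xi> = distr (density lebesgue (\<lambda>x. ennreal (q x))) borel \<xi>"
  proof (rule measure_eqI_lessThan)
    fix t
    show "emeasure (distr (density lebesgue (\<lambda>x. ennreal (p x))) borel \<xi>) {t<..} < \<infinity>"
      unfolding em[OF pm(1) nn(1) int(1)] by simp
    show "emeasure (distr (density lebesgue (\<lambda>x. ennreal (p x))) borel \<xi>) {t<..}
        = emeasure (distr (density lebesgue (\<lambda>x. ennreal (q x))) borel \<xi>) {t<..}"
      unfolding em[OF pm(1) nn(1) int(1)] em[OF pm(2) nn(2) int(2)] eqt ..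
  qed simp_all
  have I: "(LINT s|distr (density lebesgue (\<lambda>x. ennreal (r x))) borel \<xi>. f s) = (LINT x|lebesgue. r x * f (\<xi> x))"
    if [measurable]: "r \<in> borel_measurable lebesgue" and "\<And>x. r x \<ge> 0" for r
    using that(2) by (simp add: integral_distr integral_density)
  have "integrable lebesgue (\<lambda>x. p x * f (\<xi> x))" "integrable lebesgue (\<lambda>x. q x * f (\<xi> x))"
  proof -
    have i: "integrable lebesgue (\<lambda>x. K * (if \<xi> x \<le> 1 then f (\<xi> x) else 0))" using fi by simp
    show "integrable lebesgue (\<lambda>x. p x * f (\<xi> x))"
    proof (rule Bochner_Integration.integrable_bound[OF i])
      show "AE x in lebesgue. norm (p x * f (\<xi> x)) \<le> norm (K * (if \<xi> x \<le> 1 then f (\<xi> x) else 0))"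
      proof (rule AE_I2)
        fix x
        show "norm (p x * f (\<xi> x)) \<le> norm (K * (if \<xi> x \<le> 1 then f (\<xi> x) else 0))"
          using mult_right_mono[OF le(1)[of x] abs_ge_zero[of "f (\<xi> x)"]] nn(1)[of x] K
          by (cases "\<xi> x \<le> 1") (auto simp: abs_mult p_def)
      qed
    qed measurable
    show "integrable lebesgue (\<lambda>x. q x * f (\<xi> x))"
    proof (rule Bochner_Integration.integrable_bound[OF i])
      show "AE x in lebesgue. norm (q x * f (\<xi> x)) \<le> norm (K * (if \<xi> x \<le> 1 then f (\<xi> x) else 0))"
      proof (rule AE_I2)
        fix x
        show "norm (q x * f (\<xi> x)) \<le> norm (K * (if \<xi> x \<le> 1 then f (\<xi> x) else 0))"
          using mult_right_mono[OF le(2)[of x] abs_ge_zero[of "f (\<xi> x)"]] nn(2)[of x] K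
          by (cases "\<xi> x \<le> 1") (auto simp: abs_mult q_def)
      qed
    qed measurable
  qed
  then have "(LINT x|lebesgue. p x * f (\<xi> x) - q x * f (\<xi> x)) = (LINT x|lebesgue. p x * f (\<xi> x)) - (LINT x|lebesgue. q x * f (\<xi> x))"
    by (rule Bochner_Integration.integral_diff)
  also have "\<dots> = 0" using I[OF pm(1) nn(1)] I[OF pm(2) nn(2)] eq by simp
  finally have "(LINT x|lebesgue. p x * f (\<xi> x) - q x * f (\<xi> x)) = 0" .
  moreover have "(\<lambda>x. p x * f (\<xi> x) - q x * f (\<xi> x)) = (\<lambda>x. if \<xi> x \<le> 1 then \<beta> x * f (\<xi> x) else 0)"
    by (auto simp: p_def q_def max_def fun_eq_iff)
  ultimately show ?thesis by simp
qed

text \<open>Integration by parts along the rays needs no regularity of \<open>\<beta>\<close> across them: differentiate the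
  dilation identity for \<open>\<integral> \<beta> \<xi>\<^sup>m \<phi>\<close> at dilation factor one.\<close>

lemma radial_integration_by_parts:
  assumes \<beta>[measurable]: "\<beta> \<in> borel_measurable borel" and bd: "\<And>x. \<bar>\<beta> x\<bar> \<le> K" and hom: "homogeneous0 \<beta>"
    and t: "test_function (interior B) \<phi> D"
  shows "(LINT x|lebesgue. \<beta> x * \<xi> x ^ m * ((x - ctr) \<bullet> D x)) = - real (CARD('n) + m) * (LINT x|lebesgue. \<beta> x * \<xi> x ^ m * \<phi> x)"
proof -
  have \<beta>l[measurable]: "\<beta> \<in> borel_measurable lebesgue" using \<beta> by (simp add: measurable_completion)
  have [measurable]: "(\<lambda>x::real^'n. x) \<in> borel_measurable lebesgue"
    by (rule continuous_imp_lebesgue_measurable[OF continuous_on_id])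
  obtain R where R: "\<And>x. \<xi> x \<le> 1 \<Longrightarrow> x \<in> cball 0 R" using body_bounded by blast
  have K: "K \<ge> 0" using bd[of 0] by (meson abs_ge_zero order_trans)
  obtain C where C: "C > 0" "\<forall>x. \<bar>\<phi> x\<bar> \<le> C \<and> norm (D x) \<le> C" using test_function_bounded[OF t] by blast
  obtain E where E: "E > 0" "\<And>x. norm (x - ctr) \<le> E * \<xi> x" using \<xi>_norm_bound by blast
  have lip: "\<bar>\<phi> x - \<phi> y\<bar> \<le> C * norm (x - y)" for x y
    by (rule bounded_gradient_Lipschitz[OF test_functionD(1)[OF t]]) (use C in blast)
  have \<phi>m[measurable]: "\<phi> \<in> borel_measurable lebesgue" "D \<in> borel_measurable lebesgue"
    using test_functionD(2,3)[OF t] by (auto intro: continuous_imp_lebesgue_measurable)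
  have out: "\<phi> x = 0" "D x = 0" if "\<not> \<xi> x \<le> 1" for x
    using test_function_outside[OF t, of x] that interior_iff[of x] by auto
  define N where "N = CARD('n) + m"
  define \<tau> where "\<tau> n = 1 / real (Suc n)" for n
  have \<tau>: "\<tau> n > 0" for n by (simp add: \<tau>_def)
  define h where "h x = \<beta> x * \<xi> x ^ m" for x
  have hm[measurable]: "h \<in> borel_measurable lebesgue" unfolding h_def[abs_def] by measurable
  have hb: "\<bar>h x\<bar> \<le> K" if "\<xi> x \<le> 1" for x
    using mult_mono[OF bd[of x] power_le_one[OF \<xi>_nonneg that, of m] K] \<xi>_nonneg[of x] by (simp add: h_def abs_mult)
  have dil: "x + \<tau> n *\<^sub>R (x - ctr) = ctr + (1 + \<tau> n) *\<^sub>R (x - ctr)" for n x by (simp add: algebra_simps)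
  have \<xi>dil: "\<xi> (x + \<tau> n *\<^sub>R (x - ctr)) = (1 + \<tau> n) * \<xi> x" for n x
    unfolding dil using \<xi>_homogeneous[of "1 + \<tau> n" "x - ctr"] \<tau>[of n] by simp
  \<comment> \<open>Dilations by factors above 1 move outer points further out, so the dilated test
    function vanishes outside the body too.\<close>
  have out2: "\<phi> (x + \<tau> n *\<^sub>R (x - ctr)) = 0" if "\<not> \<xi> x \<le> 1" for x n
  proof (rule out(1))
    have "1 * \<xi> x \<le> (1 + \<tau> n) * \<xi> x" using \<tau>[of n] \<xi>_nonneg[of x] by (intro mult_right_mono) auto
    then show "\<not> \<xi> (x + \<tau> n *\<^sub>R (x - ctr)) \<le> 1" using that unfolding \<xi>dil by linarith
  qed
  have int: "integrable lebesgue (\<lambda>x. h x * \<phi> x)"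
  proof (rule bounded_support_integrable(1)[where a = 0 and R = R and C = "K * C"])
    show "norm (h x * \<phi> x) \<le> K * C" for x
    proof (cases "\<xi> x \<le> 1")
      case True
      show ?thesis
        using mult_mono[OF hb[OF True] C(2)[rule_format, THEN conjunct1] K abs_ge_zero] by (simp add: abs_mult)
    next
      case False
      then show ?thesis using out(1)[OF False] K C(1) by simp
    qed
  qed (use R out in auto)
  have sh: "(\<lambda>x. \<phi> (x + \<tau> n *\<^sub>R (x - ctr))) \<in> borel_measurable lebesgue" for n
  proof (rule continuous_imp_lebesgue_measurable)
    show "continuous_on UNIV (\<lambda>x. \<phi> (x + \<tau> n *\<^sub>R (x - ctr)))"
      by (rule continuous_on_compose2[OF test_functionD(3)[OF t]]) (auto intro!: continuous_intros)
  qed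
  have int2: "integrable lebesgue (\<lambda>x. h x * \<phi> (x + \<tau> n *\<^sub>R (x - ctr)))" for n
  proof (rule bounded_support_integrable(1)[where a = 0 and R = R and C = "K * C"])
    show "norm (h x * \<phi> (x + \<tau> n *\<^sub>R (x - ctr))) \<le> K * C" for x
    proof (cases "\<xi> x \<le> 1")
      case True
      show ?thesis
        using mult_mono[OF hb[OF True] C(2)[rule_format, THEN conjunct1] K abs_ge_zero] by (simp add: abs_mult)
    next
      case False
      then show ?thesis using out2[OF False] K C(1) by simp
    qed
    show "(\<lambda>x. h x * \<phi> (x + \<tau> n *\<^sub>R (x - ctr))) \<in> borel_measurable lebesgue" using sh[of n] by measurable
  qed (use R out2 in auto)
  \<comment> \<open>The Jacobian contributes the dimension to the exponent \<open>N\<close>, the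
    factor \<xi>^m contributes m, and \<beta> is invariant.\<close>
  have scale: "(LINT x|lebesgue. h x * \<phi> x) = (1 + \<tau> n) ^ N * (LINT x|lebesgue. h x * \<phi> (x + \<tau> n *\<^sub>R (x - ctr)))" for n
  proof -
    have "(LINT x|lebesgue. h x * \<phi> x) = (1 + \<tau> n) ^ CARD('n) *
        (LINT x|lebesgue. h (ctr + (1 + \<tau> n) *\<^sub>R (x - ctr)) * \<phi> (ctr + (1 + \<tau> n) *\<^sub>R (x - ctr)))"
      by (rule lebesgue_integral_dilation) (use \<tau>[of n] in auto)
    also have "(\<lambda>x. h (ctr + (1 + \<tau> n) *\<^sub>R (x - ctr)) * \<phi> (ctr + (1 + \<tau> n) *\<^sub>R (x - ctr)))
        = (\<lambda>x. (1 + \<tau> n) ^ m * (h x * \<phi> (x + \<tau> n *\<^sub>R (x - ctr))))"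
    proof (rule ext)
      fix x
      have "\<beta> (ctr + (1 + \<tau> n) *\<^sub>R (x - ctr)) = \<beta> x"
        using hom \<tau>[of n] unfolding homogeneous0_def by simp
      moreover have "\<xi> (ctr + (1 + \<tau> n) *\<^sub>R (x - ctr)) = (1 + \<tau> n) * \<xi> x"
        using \<xi>dil[of x n] unfolding dil .
      ultimately show "h (ctr + (1 + \<tau> n) *\<^sub>R (x - ctr)) * \<phi> (ctr + (1 + \<tau> n) *\<^sub>R (x - ctr))
          = (1 + \<tau> n) ^ m * (h x * \<phi> (x + \<tau> n *\<^sub>R (x - ctr)))"
        by (simp add: h_def dil power_mult_distrib)
    qed
    finally show ?thesis by (simp add: N_def power_add)
  qed
  have lim1: "(\<lambda>n. LINT x|lebesgue. h x * ((\<phi> (x + \<tau> n *\<^sub>R (x - ctr)) - \<phi> x) / \<tau> n)) \<longlonglongrightarrow> (LINT x|lebesgue. h x * ((x - ctr) \<bullet> D x))"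
  proof (rule integral_dominated_convergence[where w = "\<lambda>x. (K * (C * E)) * indicator (cball 0 R) x"])
    show "integrable lebesgue (\<lambda>x::real^'n. (K * (C * E)) * indicator (cball 0 R) x)"
      using emeasure_lborel_cball_finite[of "0::real^'n" R]
      by (intro integrable_mult_right integrable_real_indicator) auto
    show "AE x in lebesgue. (\<lambda>n. h x * ((\<phi> (x + \<tau> n *\<^sub>R (x - ctr)) - \<phi> x) / \<tau> n)) \<longlonglongrightarrow> h x * ((x - ctr) \<bullet> D x)"
      unfolding \<tau>_def by (intro AE_I2 tendsto_mult_left GDERIV_difference_quotient test_functionD(1)[OF t])
    show "AE x in lebesgue. norm (h x * ((\<phi> (x + \<tau> n *\<^sub>R (x - ctr)) - \<phi> x) / \<tau> n)) \<le> (K * (C * E)) * indicator (cball 0 R) x" for n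
    proof (rule AE_I2)
      fix x
      show "norm (h x * ((\<phi> (x + \<tau> n *\<^sub>R (x - ctr)) - \<phi> x) / \<tau> n)) \<le> (K * (C * E)) * indicator (cball 0 R) x"
      proof (cases "\<xi> x \<le> 1")
        case True
        have "\<bar>\<phi> (x + \<tau> n *\<^sub>R (x - ctr)) - \<phi> x\<bar> \<le> C * (\<tau> n * norm (x - ctr))"
          using lip[of "x + \<tau> n *\<^sub>R (x - ctr)" x] \<tau>[of n] by simp
        then have "\<bar>(\<phi> (x + \<tau> n *\<^sub>R (x - ctr)) - \<phi> x) / \<tau> n\<bar> \<le> C * norm (x - ctr)"
          using \<tau>[of n] by (simp add: field_simps)
        also have "\<dots> \<le> C * (E * 1)"
        proof (rule mult_left_mono)
          show "norm (x - ctr) \<le> E * 1"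
            using E(2)[of x] mult_left_mono[OF True less_imp_le[OF E(1)]] by linarith
        qed (use C(1) in simp)
        finally have "\<bar>(\<phi> (x + \<tau> n *\<^sub>R (x - ctr)) - \<phi> x) / \<tau> n\<bar> \<le> C * E" by simp
        from mult_mono[OF hb[OF True] this K abs_ge_zero] show ?thesis using R[OF True] by (simp add: abs_mult)
      next
        case False
        then show ?thesis using out(1)[OF False] out2[OF False] K C(1) E(1) by (simp add: indicator_def)
      qed
    qed
    show "(\<lambda>x. h x * ((\<phi> (x + \<tau> n *\<^sub>R (x - ctr)) - \<phi> x) / \<tau> n)) \<in> borel_measurable lebesgue" for n
      using sh[of n] by measurable
  qed measurable
  define I where "I = (LINT x|lebesgue. h x * \<phi> x)"
  have quot: "(LINT x|lebesgue. h x * ((\<phi> (x + \<tau> n *\<^sub>R (x - ctr)) - \<phi> x) / \<tau> n)) = I * ((inverse ((1 + \<tau> n) ^ N) - 1) / \<tau> n)" for n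
  proof -
    have "(\<lambda>x. h x * ((\<phi> (x + \<tau> n *\<^sub>R (x - ctr)) - \<phi> x) / \<tau> n)) = (\<lambda>x. (h x * \<phi> (x + \<tau> n *\<^sub>R (x - ctr)) - h x * \<phi> x) / \<tau> n)"
      by (simp add: right_diff_distrib)
    then have "(LINT x|lebesgue. h x * ((\<phi> (x + \<tau> n *\<^sub>R (x - ctr)) - \<phi> x) / \<tau> n))
        = ((LINT x|lebesgue. h x * \<phi> (x + \<tau> n *\<^sub>R (x - ctr))) - I) / \<tau> n"
      using Bochner_Integration.integral_diff[OF int2[of n] int] by (simp add: I_def)
    moreover have "(LINT x|lebesgue. h x * \<phi> (x + \<tau> n *\<^sub>R (x - ctr))) = I * inverse ((1 + \<tau> n) ^ N)"
      using scale[of n] \<tau>[of n] by (simp add: I_def field_simps)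
    ultimately show ?thesis by (simp add: algebra_simps)
  qed
  have "((\<lambda>s::real. inverse (s ^ N)) has_real_derivative - real N) (at 1)"
    by (auto intro!: derivative_eq_intros)
  \<comment> \<open>On the real line \<open>GDERIV\<close> is the ordinary derivative, so the same
    difference quotient lemma serves for the scaling factor.\<close>
  then have "GDERIV (\<lambda>s::real. inverse (s ^ N)) 1 :> - real N" by simp
  from GDERIV_difference_quotient[OF this, of 1]
  have "(\<lambda>n. (inverse ((1 + \<tau> n) ^ N) - 1) / \<tau> n) \<longlonglongrightarrow> - real N" by (simp add: \<tau>_def)
  from tendsto_mult_left[OF this, of I] have "(\<lambda>n. LINT x|lebesgue. h x * ((\<phi> (x + \<tau> n *\<^sub>R (x - ctr)) - \<phi> x) / \<tau> n)) \<longlonglongrightarrow> I * (- real N)"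
    unfolding quot .
  with lim1 have "(LINT x|lebesgue. h x * ((x - ctr) \<bullet> D x)) = I * (- real N)" by (rule LIMSEQ_unique)
  then show ?thesis by (simp add: h_def I_def N_def)
qed

end

lemma bounded_measurable_square_integrable:
  fixes f :: "real^'n \<Rightarrow> 'b::euclidean_space"
  assumes "open U" "bounded U" "f \<in> borel_measurable lebesgue" "\<And>x. x \<in> U \<Longrightarrow> norm (f x) \<le> K"
  shows "f \<in> square_integrable (lebesgue_on U)"
  by (rule square_integrable_bounded[OF finite_measure_bounded_open[OF assms(1,2)] measurable_restrict_space1[OF assms(3)], where C = K])
     (use assms(4) in \<open>auto intro: AE_I2\<close>)

lemma H10_approximating_sequence:
  fixes w :: "real^'n \<Rightarrow> real"
  assumes "open U" "bounded U" "w \<in> L2 U" "g \<in> L2 U" "weak_gradient U w g" "w \<in> H10 U"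
  obtains \<phi> D where "\<And>n::nat. test_function U (\<phi> n) (D n)"
    "(\<lambda>n. sqnorm (lebesgue_on U) (\<lambda>x. \<phi> n x - w x)) \<longlonglongrightarrow> 0"
    "(\<lambda>n. sqnorm (lebesgue_on U) (\<lambda>x. D n x - g x)) \<longlonglongrightarrow> 0"
proof -
  define P where "P n p \<longleftrightarrow> test_function U (fst p) (snd p) \<and>
     sqnorm (lebesgue_on U) (\<lambda>x. w x - fst p x) + sqnorm (lebesgue_on U) (\<lambda>x. g x - snd p x) < 1 / real (Suc n)" for n p
  have "\<exists>p. P n p" for n
  proof -
    have "1 / real (Suc n) > 0" by simp
    then obtain \<phi> D where "test_function U \<phi> D"
      "sqnorm (lebesgue_on U) (\<lambda>x. w x - \<phi> x) + sqnorm (lebesgue_on U) (\<lambda>x. g x - D x) < 1 / real (Suc n)"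
      using H10_iff[OF assms(1-5)] assms(6) by blast
    then show ?thesis by (intro exI[of _ "(\<phi>, D)"]) (simp add: P_def)
  qed
  then obtain p where p: "\<And>n. P n (p n)" by metis
  have lim: "(\<lambda>n. 1 / real (Suc n)) \<longlonglongrightarrow> 0" using LIMSEQ_inverse_real_of_nat by (simp add: inverse_eq_divide)
  show thesis
  proof (rule that[of "\<lambda>n. fst (p n)" "\<lambda>n. snd (p n)"])
    show "test_function U (fst (p n)) (snd (p n))" for n using p[of n] by (simp add: P_def)
    have le: "sqnorm (lebesgue_on U) (\<lambda>x. fst (p n) x - w x) \<le> 1 / real (Suc n)"
      "sqnorm (lebesgue_on U) (\<lambda>x. snd (p n) x - g x) \<le> 1 / real (Suc n)" for n
    proof -
      have 1: "sqnorm (lebesgue_on U) (\<lambda>x. fst (p n) x - w x) = sqnorm (lebesgue_on U) (\<lambda>x. w x - fst (p n) x)"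
        "sqnorm (lebesgue_on U) (\<lambda>x. snd (p n) x - g x) = sqnorm (lebesgue_on U) (\<lambda>x. g x - snd (p n) x)"
        by (simp_all add: sqnorm_def norm_minus_commute power2_commute)
      show "sqnorm (lebesgue_on U) (\<lambda>x. fst (p n) x - w x) \<le> 1 / real (Suc n)"
        "sqnorm (lebesgue_on U) (\<lambda>x. snd (p n) x - g x) \<le> 1 / real (Suc n)"
        unfolding 1 using p[of n] sqnorm_nonneg[of "lebesgue_on U" "\<lambda>x. w x - fst (p n) x"]
          sqnorm_nonneg[of "lebesgue_on U" "\<lambda>x. g x - snd (p n) x"] unfolding P_def by linarith+
    qed
    show "(\<lambda>n. sqnorm (lebesgue_on U) (\<lambda>x. fst (p n) x - w x)) \<longlonglongrightarrow> 0"
      by (rule tendsto_sandwich[OF _ _ tendsto_const lim]; intro always_eventually allI le sqnorm_nonneg)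
    show "(\<lambda>n. sqnorm (lebesgue_on U) (\<lambda>x. snd (p n) x - g x)) \<longlonglongrightarrow> 0"
      by (rule tendsto_sandwich[OF _ _ tendsto_const lim]; intro always_eventually allI le sqnorm_nonneg)
  qed
qed

section \<open>Orthogonality of mean-free coefficients to radial functions\<close>

context star_body
begin

lemma interior_open_bounded: "open (interior B)" "bounded (interior B)" "interior B \<in> sets lebesgue"
  using bounded_subset[OF compact_imp_bounded[OF compact] interior_subset] by auto

lemma interior_integral:
  fixes f :: "real^'n \<Rightarrow> real"
  assumes [measurable]: "f \<in> borel_measurable lebesgue"
  shows "(LINT x|lebesgue_on (interior B). f x) = (LINT x|lebesgue. (if \<xi> x \<le> 1 then f x else 0))"
proof -
  have "(LINT x|lebesgue. (if \<xi> x < 1 then f x else 0)) = (LINT x|lebesgue. (if \<xi> x \<le> 1 then f x else 0))"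
  proof (rule integral_cong_AE)
    show "AE x in lebesgue. (if \<xi> x < 1 then f x else 0) = (if \<xi> x \<le> 1 then f x else 0)"
      using AE_frontier by eventually_elim auto
  qed measurable
  then show ?thesis
    by (simp add: lebesgue_on_integral[OF interior_open_bounded(3)] interior_iff)
qed

lemma AE_interior_not_center: "AE x in lebesgue_on (interior B). x \<noteq> ctr"
  using AE_imp_AE_lebesgue_on[OF AE_frontier interior_open_bounded(3)] by eventually_elim simp

text \<open>Integration by parts along the rays is carried over to \<psi> through test functions
  approximating it. What remains is a multiple of the integral of \<beta> times a function of \<xi>,
  which vanishes because \<beta> has mean zero.\<close>

lemma radial_moment:
  fixes \<psi> :: "real^'n \<Rightarrow> real"
  assumes \<beta>[measurable]: "\<beta> \<in> borel_measurable borel" and bd: "\<And>x. \<bar>\<beta> x\<bar> \<le> K" and hom: "homogeneous0 \<beta>"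
    and mean: "(LINT x|lebesgue_on (interior B). \<beta> x) = 0"
    and \<psi>: "\<psi> \<in> L2 (interior B)" "g \<in> L2 (interior B)" "weak_gradient (interior B) \<psi> g" "\<psi> \<in> H10 (interior B)"
    and \<rho>[measurable]: "\<rho> \<in> borel_measurable borel" and rad: "AE x in lebesgue_on (interior B). \<psi> x = \<rho> (\<xi> x)"
  shows "(LINT x|lebesgue_on (interior B). \<beta> x * \<xi> x ^ m * ((x - ctr) \<bullet> g x)) = 0"
proof -
  let ?U = "interior B"
  have \<beta>l[measurable]: "\<beta> \<in> borel_measurable lebesgue" using \<beta> by (simp add: measurable_completion)
  note U = interior_open_bounded
  have K: "K \<ge> 0" using bd[of 0] by (meson abs_ge_zero order_trans)
  obtain E where E: "E > 0" "\<And>x. norm (x - ctr) \<le> E * \<xi> x" using \<xi>_norm_bound by blast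
  obtain \<phi> D where t: "\<And>n::nat. test_function ?U (\<phi> n) (D n)"
    "(\<lambda>n. sqnorm (lebesgue_on ?U) (\<lambda>x. \<phi> n x - \<psi> x)) \<longlonglongrightarrow> 0"
    "(\<lambda>n. sqnorm (lebesgue_on ?U) (\<lambda>x. D n x - g x)) \<longlonglongrightarrow> 0"
    using H10_approximating_sequence[OF U(1,2) \<psi>] by blast
  define k where "k x = \<beta> x * \<xi> x ^ m" for x
  have km[measurable]: "k \<in> borel_measurable lebesgue" unfolding k_def[abs_def] by measurable
  have \<xi>1: "\<xi> x ^ m \<le> 1" "0 \<le> \<xi> x ^ m" if "x \<in> ?U" for x
    using that interior_iff \<xi>_nonneg by (auto intro: power_le_one)
  have kb: "\<bar>k x\<bar> \<le> K" if "x \<in> ?U" for x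
    using mult_mono[OF bd[of x] \<xi>1(1)[OF that] K \<xi>1(2)[OF that]] \<xi>1(2)[OF that] by (simp add: k_def abs_mult)
  have kL: "k \<in> square_integrable (lebesgue_on ?U)"
    by (rule bounded_measurable_square_integrable[OF U(1,2) km]) (use kb in simp)
  have vm: "(\<lambda>x. k x *\<^sub>R (x - ctr)) \<in> borel_measurable lebesgue"
  proof -
    have "(\<lambda>x. x - ctr) \<in> borel_measurable lebesgue"
      by (rule continuous_imp_lebesgue_measurable) (intro continuous_intros)
    then show ?thesis using km by (intro borel_measurable_scaleR)
  qed
  have vL: "(\<lambda>x. k x *\<^sub>R (x - ctr)) \<in> square_integrable (lebesgue_on ?U)"
  proof (rule bounded_measurable_square_integrable[OF U(1,2) vm])
    fix x assume x: "x \<in> ?U"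
    have "E * \<xi> x \<le> E * 1" using x E(1) interior_iff[of x] by (intro mult_left_mono) auto
    then have "norm (x - ctr) \<le> E" using E(2)[of x] by linarith
    from mult_mono[OF kb[OF x] this K norm_ge_zero] show "norm (k x *\<^sub>R (x - ctr)) \<le> K * E" by simp
  qed
  note tL = test_function_weak_gradient(1,2)[OF t(1) U(3), unfolded L2_eq]
  have lim1: "(\<lambda>n. LINT x|lebesgue_on ?U. D n x \<bullet> (k x *\<^sub>R (x - ctr))) \<longlonglongrightarrow> (LINT x|lebesgue_on ?U. g x \<bullet> (k x *\<^sub>R (x - ctr)))"
    by (rule sqnorm_tendsto_inner[OF tL(2) \<psi>(2)[unfolded L2_eq] vL t(3)])
  have lim2: "(\<lambda>n. LINT x|lebesgue_on ?U. \<phi> n x * k x) \<longlonglongrightarrow> (LINT x|lebesgue_on ?U. \<psi> x * k x)"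
    using sqnorm_tendsto_inner[OF tL(1) \<psi>(1)[unfolded L2_eq] kL t(2)] by simp
  have parts: "(LINT x|lebesgue_on ?U. D n x \<bullet> (k x *\<^sub>R (x - ctr))) = - real (CARD('n) + m) * (LINT x|lebesgue_on ?U. \<phi> n x * k x)" for n
  proof -
    have "(LINT x|lebesgue_on ?U. D n x \<bullet> (k x *\<^sub>R (x - ctr))) = (LINT x|lebesgue. \<beta> x * \<xi> x ^ m * ((x - ctr) \<bullet> D n x))"
      unfolding lebesgue_on_integral[OF U(3)]
      by (rule Bochner_Integration.integral_cong)
         (use test_function_outside[OF t(1)] in \<open>auto simp: k_def inner_commute\<close>)
    moreover have "(LINT x|lebesgue_on ?U. \<phi> n x * k x) = (LINT x|lebesgue. \<beta> x * \<xi> x ^ m * \<phi> n x)"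
      unfolding lebesgue_on_integral[OF U(3)]
      by (rule Bochner_Integration.integral_cong)
         (use test_function_outside[OF t(1)] in \<open>auto simp: k_def mult.commute\<close>)
    ultimately show ?thesis using radial_integration_by_parts[OF \<beta> bd hom t(1)[of n], of m] by simp
  qed
  define f where "f s = s ^ m * \<rho> s" for s
  have fm[measurable]: "f \<in> borel_measurable borel" unfolding f_def[abs_def] by measurable
  have \<xi>mL: "(\<lambda>x. \<xi> x ^ m) \<in> square_integrable (lebesgue_on ?U)"
    by (rule bounded_measurable_square_integrable[OF U(1,2), where K = 1]) (use \<xi>1 in auto)
  have "integrable (lebesgue_on ?U) (\<lambda>x. \<psi> x * \<xi> x ^ m)"
    by (rule square_integrable_mult[OF \<psi>(1)[unfolded L2_eq] \<xi>mL])
  then have "integrable (lebesgue_on ?U) (\<lambda>x. f (\<xi> x))"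
  proof (rule integrable_cong_AE_imp)
    show "(\<lambda>x. f (\<xi> x)) \<in> borel_measurable (lebesgue_on ?U)" by (rule measurable_restrict_space1) measurable
    show "AE x in lebesgue_on ?U. \<psi> x * \<xi> x ^ m = f (\<xi> x)"
      using rad by eventually_elim (simp add: f_def)
  qed
  then have "integrable lebesgue (\<lambda>x. if \<xi> x < 1 then f (\<xi> x) else 0)"
    by (simp add: lebesgue_on_integrable_iff[OF U(3)] interior_iff)
  then have fi: "integrable lebesgue (\<lambda>x. if \<xi> x \<le> 1 then f (\<xi> x) else 0)"
  proof (rule integrable_cong_AE_imp)
    show "AE x in lebesgue. (if \<xi> x < 1 then f (\<xi> x) else 0) = (if \<xi> x \<le> 1 then f (\<xi> x) else 0)"
      using AE_frontier by eventually_elim auto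
  qed measurable
  have "(LINT x|lebesgue_on ?U. \<psi> x * k x) = (LINT x|lebesgue_on ?U. \<beta> x * f (\<xi> x))"
  proof (rule integral_cong_AE)
    show "(\<lambda>x. \<psi> x * k x) \<in> borel_measurable (lebesgue_on ?U)"
      using square_integrable_mult[OF \<psi>(1)[unfolded L2_eq] kL] by auto
    show "(\<lambda>x. \<beta> x * f (\<xi> x)) \<in> borel_measurable (lebesgue_on ?U)" by (rule measurable_restrict_space1) measurable
    show "AE x in lebesgue_on ?U. \<psi> x * k x = \<beta> x * f (\<xi> x)"
      using rad by eventually_elim (simp add: f_def k_def)
  qed
  also have "\<dots> = (LINT x|lebesgue. (if \<xi> x \<le> 1 then \<beta> x * f (\<xi> x) else 0))"
    by (rule interior_integral) measurable
  also have "\<dots> = 0"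
    by (rule homogeneous0_radial_integral[OF \<beta> bd hom _ fm fi]) (use mean interior_integral[OF \<beta>l] in simp)
  finally have zero: "(LINT x|lebesgue_on ?U. \<psi> x * k x) = 0" .
  have "(\<lambda>n. LINT x|lebesgue_on ?U. D n x \<bullet> (k x *\<^sub>R (x - ctr))) \<longlonglongrightarrow> - real (CARD('n) + m) * 0"
    unfolding parts using tendsto_mult_left[OF lim2[unfolded zero]] by blast
  then have "(LINT x|lebesgue_on ?U. g x \<bullet> (k x *\<^sub>R (x - ctr))) = - real (CARD('n) + m) * 0"
    using lim1 LIMSEQ_unique by blast
  then show ?thesis by (simp add: k_def inner_commute)
qed

text \<open>The quotient of (x - ctr) \<bullet> g by \<xi> is the derivative in the radial
  coordinate. For m > 0 the division lowers the power; for m = 0 the factor 1/\<xi> is expanded into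
  the geometric series of 1 - \<xi>.\<close>

lemma radial_moment_div:
  fixes \<psi> :: "real^'n \<Rightarrow> real"
  assumes \<beta>[measurable]: "\<beta> \<in> borel_measurable borel" and bd: "\<And>x. \<bar>\<beta> x\<bar> \<le> K" and hom: "homogeneous0 \<beta>"
    and mean: "(LINT x|lebesgue_on (interior B). \<beta> x) = 0"
    and \<psi>: "\<psi> \<in> L2 (interior B)" "g \<in> L2 (interior B)" "weak_gradient (interior B) \<psi> g" "\<psi> \<in> H10 (interior B)"
    and \<rho>: "\<rho> \<in> borel_measurable borel" and rad: "AE x in lebesgue_on (interior B). \<psi> x = \<rho> (\<xi> x)"
  shows "(LINT x|lebesgue_on (interior B). \<beta> x * \<xi> x ^ m * (((x - ctr) \<bullet> g x) / \<xi> x)) = 0"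
proof -
  let ?M = "lebesgue_on (interior B)"
  note U = interior_open_bounded
  note moment = radial_moment[OF assms]
  have K: "K \<ge> 0" using bd[of 0] by (meson abs_ge_zero order_trans)
  obtain E where E: "E > 0" "\<And>x. norm (x - ctr) \<le> E * \<xi> x" using \<xi>_norm_bound by blast
  define \<gamma> where "\<gamma> x = (x - ctr) \<bullet> g x" for x
  have \<gamma>0: "\<gamma> ctr = 0" by (simp add: \<gamma>_def)
  have \<gamma>b: "\<bar>\<gamma> x\<bar> \<le> E * \<xi> x * norm (g x)" for x
  proof -
    have "\<bar>\<gamma> x\<bar> \<le> norm (x - ctr) * norm (g x)" unfolding \<gamma>_def by (rule Cauchy_Schwarz_ineq2)
    also have "\<dots> \<le> (E * \<xi> x) * norm (g x)" by (rule mult_right_mono[OF E(2) norm_ge_zero])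
    finally show ?thesis .
  qed
  have \<xi>M[measurable]: "\<xi> \<in> borel_measurable ?M" by (rule measurable_restrict_space1[OF measurable_\<xi>_lebesgue])
  have [measurable]: "\<beta> \<in> borel_measurable ?M"
    by (rule measurable_restrict_space1) (use \<beta> in \<open>simp add: measurable_completion\<close>)
  have gm[measurable]: "g \<in> borel_measurable ?M" by (rule L2_measurable[OF \<psi>(2)])
  have [measurable]: "\<gamma> \<in> borel_measurable ?M"
  proof -
    have "(\<lambda>x. x - ctr) \<in> borel_measurable ?M"
      by (rule measurable_restrict_space1, rule continuous_imp_lebesgue_measurable) (intro continuous_intros)
    then show ?thesis unfolding \<gamma>_def[abs_def] using gm by (rule borel_measurable_inner)
  qed
  have gi: "integrable ?M (\<lambda>x. norm (g x))"
    using square_integrable_imp_integrable[OF finite_measure_bounded_open[OF U(1,2)] \<psi>(2)[unfolded L2_eq]] by simp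
  have \<xi>U: "0 \<le> \<xi> x" "\<xi> x < 1" if "x \<in> space ?M" for x
    using that \<xi>_nonneg interior_iff by auto
  have int: "integrable ?M (\<lambda>x. \<beta> x * \<xi> x ^ m * (1 - \<xi> x) ^ i * \<gamma> x)" for m i
  proof (rule Bochner_Integration.integrable_bound)
    show "integrable ?M (\<lambda>x. (K * E) * norm (g x))" using gi by simp
    show "AE x in ?M. norm (\<beta> x * \<xi> x ^ m * (1 - \<xi> x) ^ i * \<gamma> x) \<le> norm ((K * E) * norm (g x))"
    proof (rule AE_I2)
      fix x assume x: "x \<in> space ?M"
      have "\<bar>\<xi> x ^ m * (1 - \<xi> x) ^ i\<bar> \<le> 1 * 1"
        unfolding abs_mult using \<xi>U[OF x] by (intro mult_mono) (auto simp: power_abs power_le_one)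
      from mult_mono[OF bd[of x] this K] have A: "\<bar>\<beta> x\<bar> * \<bar>\<xi> x ^ m * (1 - \<xi> x) ^ i\<bar> \<le> K" by simp
      have B: "\<bar>\<gamma> x\<bar> \<le> E * norm (g x)"
      proof -
        have "E * \<xi> x * norm (g x) \<le> E * 1 * norm (g x)"
          using \<xi>U[OF x] E(1) by (intro mult_right_mono mult_left_mono) auto
        then show ?thesis using \<gamma>b[of x] by simp
      qed
      have "(\<bar>\<beta> x\<bar> * \<bar>\<xi> x ^ m * (1 - \<xi> x) ^ i\<bar>) * \<bar>\<gamma> x\<bar> \<le> K * (E * norm (g x))"
        by (rule mult_mono[OF A B K abs_ge_zero])
      then show "norm (\<beta> x * \<xi> x ^ m * (1 - \<xi> x) ^ i * \<gamma> x) \<le> norm ((K * E) * norm (g x))"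
        using K E(1) by (simp add: abs_mult mult.assoc)
    qed
  qed measurable
  \<comment> \<open>The vanishing power moments, regrouped in powers of 1 - \<xi>.\<close>
  have pow: "(LINT x|?M. \<beta> x * \<xi> x ^ m * (1 - \<xi> x) ^ i * \<gamma> x) = 0" for m i
  proof (induction i arbitrary: m)
    case 0
    show ?case using moment[of m] by (simp add: \<gamma>_def)
  next
    case (Suc i)
    have "(\<lambda>x. \<beta> x * \<xi> x ^ m * (1 - \<xi> x) ^ Suc i * \<gamma> x)
        = (\<lambda>x. \<beta> x * \<xi> x ^ m * (1 - \<xi> x) ^ i * \<gamma> x - \<beta> x * \<xi> x ^ Suc m * (1 - \<xi> x) ^ i * \<gamma> x)"
      by (simp add: algebra_simps)
    then show ?case
      using Bochner_Integration.integral_diff[OF int[of m i] int[of "Suc m" i]] Suc.IH[of m] Suc.IH[of "Suc m"] by simp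
  qed
  show ?thesis
  proof (cases m)
    case (Suc m')
    have "\<beta> x * \<xi> x ^ m * (\<gamma> x / \<xi> x) = \<beta> x * \<xi> x ^ m' * \<gamma> x" for x
      using \<gamma>0 ray(1)[of x] by (cases "x = ctr") (auto simp: Suc)
    then show ?thesis using moment[of m'] by (simp add: \<gamma>_def)
  next
    case 0
    \<comment> \<open>Partial sums of the geometric series; at the center both sides are 0 because
      \<gamma> vanishes there.\<close>
    have eqN: "(1 - (1 - \<xi> x) ^ N) * (\<gamma> x / \<xi> x) = (\<Sum>i<N. (1 - \<xi> x) ^ i) * \<gamma> x" for x N
      using \<gamma>0 ray(1)[of x] one_diff_power_eq[of "1 - \<xi> x" N] by (cases "x = ctr") auto
    have "(\<lambda>N. LINT x|?M. \<beta> x * ((1 - (1 - \<xi> x) ^ N) * (\<gamma> x / \<xi> x))) \<longlonglongrightarrow> (LINT x|?M. \<beta> x * (\<gamma> x / \<xi> x))"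
    proof (rule integral_dominated_convergence[where w = "\<lambda>x. (K * E) * norm (g x)"])
      show "integrable ?M (\<lambda>x. (K * E) * norm (g x))" using gi by simp
      show "AE x in ?M. (\<lambda>N. \<beta> x * ((1 - (1 - \<xi> x) ^ N) * (\<gamma> x / \<xi> x))) \<longlonglongrightarrow> \<beta> x * (\<gamma> x / \<xi> x)"
      proof (rule AE_I2)
        fix x assume x: "x \<in> space ?M"
        show "(\<lambda>N. \<beta> x * ((1 - (1 - \<xi> x) ^ N) * (\<gamma> x / \<xi> x))) \<longlonglongrightarrow> \<beta> x * (\<gamma> x / \<xi> x)"
        proof (cases "x = ctr")
          case False
          have "norm (1 - \<xi> x) < 1" using ray(1)[OF False] \<xi>U(2)[OF x] by simp
          then have p: "(\<lambda>N. (1 - \<xi> x) ^ N) \<longlonglongrightarrow> 0" by (rule LIMSEQ_power_zero)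
          have "(\<lambda>N. \<beta> x * ((1 - (1 - \<xi> x) ^ N) * (\<gamma> x / \<xi> x))) \<longlonglongrightarrow> \<beta> x * ((1 - 0) * (\<gamma> x / \<xi> x))"
            by (rule tendsto_mult_left, rule tendsto_mult_right, rule tendsto_diff[OF tendsto_const p])
          then show ?thesis by simp
        qed (simp add: \<gamma>0)
      qed
      show "AE x in ?M. norm (\<beta> x * ((1 - (1 - \<xi> x) ^ N) * (\<gamma> x / \<xi> x))) \<le> (K * E) * norm (g x)" for N
      proof (rule AE_I2)
        fix x assume x: "x \<in> space ?M"
        have q: "\<bar>\<gamma> x / \<xi> x\<bar> \<le> E * norm (g x)"
        proof (cases "x = ctr")
          case False
          then show ?thesis using \<gamma>b[of x] ray(1)[OF False] by (simp add: field_simps)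
        qed (use E(1) in \<open>simp add: \<gamma>0\<close>)
        have "\<bar>1 - (1 - \<xi> x) ^ N\<bar> \<le> 1"
          using \<xi>U[OF x] power_le_one[of "1 - \<xi> x" N] zero_le_power[of "1 - \<xi> x" N] by simp
        from mult_mono[OF this q] have "\<bar>1 - (1 - \<xi> x) ^ N\<bar> * \<bar>\<gamma> x / \<xi> x\<bar> \<le> 1 * (E * norm (g x))" by simp
        from mult_mono[OF bd[of x] this K] show "norm (\<beta> x * ((1 - (1 - \<xi> x) ^ N) * (\<gamma> x / \<xi> x))) \<le> (K * E) * norm (g x)"
          by (simp add: abs_mult mult.assoc)
      qed
    qed measurable
    moreover have "(LINT x|?M. \<beta> x * ((1 - (1 - \<xi> x) ^ N) * (\<gamma> x / \<xi> x))) = 0" for N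
    proof -
      have "(LINT x|?M. \<beta> x * ((1 - (1 - \<xi> x) ^ N) * (\<gamma> x / \<xi> x)))
          = (LINT x|?M. (\<Sum>i<N. \<beta> x * \<xi> x ^ 0 * (1 - \<xi> x) ^ i * \<gamma> x))"
        unfolding eqN by (simp add: sum_distrib_left sum_distrib_right mult.assoc)
      also have "\<dots> = (\<Sum>i<N. LINT x|?M. \<beta> x * \<xi> x ^ 0 * (1 - \<xi> x) ^ i * \<gamma> x)"
        by (rule Bochner_Integration.integral_sum) (rule int)
      finally show ?thesis by (simp only: pow sum.neutral_const)
    qed
    ultimately have "(\<lambda>N::nat. 0::real) \<longlonglongrightarrow> (LINT x|?M. \<beta> x * (\<gamma> x / \<xi> x))" by (simp only:)
    then have "(LINT x|?M. \<beta> x * (\<gamma> x / \<xi> x)) = 0" using LIMSEQ_unique tendsto_const by blast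
    then show ?thesis using 0 by (simp add: \<gamma>_def)
  qed
qed

text \<open>On the cone over a piece, a radial function is invariant under translations parallel to the piece.\<close>

lemma radial_gradient_parallel:
  fixes \<psi> :: "real^'n \<Rightarrow> real"
  assumes L: "L \<in> Ls"
    and \<psi>: "\<psi> \<in> L2 (interior B)" "g \<in> L2 (interior B)" "weak_gradient (interior B) \<psi> g"
    and \<rho>: "continuous_on {0<..1} \<rho>" and rad: "AE x in lebesgue_on (interior B). \<psi> x = \<rho> (\<xi> x)"
  shows "AE x in lebesgue_on (interior (sec L)). g x = (((x - ctr) \<bullet> g x) / \<xi> x) *\<^sub>R nrm L"
proof -
  let ?U = "interior (sec L)" and ?n = "nrm L"
  note UB = interior_open_bounded
  have sub: "?U \<subseteq> interior B" by (rule sec_interior_subset[OF L])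
  have U: "open ?U" "bounded ?U" "?U \<in> sets lebesgue"
    using bounded_subset[OF UB(2) sub] by auto
  have gU: "g \<in> square_integrable (lebesgue_on ?U)"
    by (rule square_integrable_subset[OF \<psi>(2)[unfolded L2_eq] sub UB(3) U(3)])
  have \<psi>U: "\<psi> \<in> square_integrable (lebesgue_on ?U)"
    by (rule square_integrable_subset[OF \<psi>(1)[unfolded L2_eq] sub UB(3) U(3)])
  have wU: "weak_gradient ?U \<psi> g" by (rule weak_gradient_subset[OF \<psi>(3) sub UB(3) U(3)])
  have radU: "AE x in lebesgue_on ?U. \<psi> x = \<rho> (\<xi> x)" by (rule AE_lebesgue_on_subset[OF rad sub UB(3) U(3)])
  \<comment> \<open>For v parallel to the hyperplane of the piece, the fundamental lemma is applied
    to the derivative of \<psi> along v.\<close>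
  have orth: "AE x in lebesgue_on ?U. v \<bullet> g x = 0" if v: "v \<bullet> ?n = 0" for v
  proof (rule integral_test_functions_eq_0_imp_AE[OF U(1,2)])
    have vi: "v \<bullet> g x = (\<Sum>i\<in>UNIV. v $ i * g x $ i)" for x by (simp add: inner_vec_def)
    show "(\<lambda>x. v \<bullet> g x) \<in> square_integrable (lebesgue_on ?U)"
    proof (rule square_integrable_bound[OF gU, where C = "norm v"])
      show "(\<lambda>x. v \<bullet> g x) \<in> borel_measurable (lebesgue_on ?U)"
        using square_integrable_measurable[OF gU] by measurable
    qed (simp add: Cauchy_Schwarz_ineq2)
    fix \<phi> D assume t: "test_function ?U \<phi> D"
    note tL = test_function_weak_gradient(1,2)[OF t U(3), unfolded L2_eq]
    let ?K = "closure {x. \<phi> x \<noteq> 0}"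
    \<comment> \<open>On the support of the test function the height stays above some \<delta>, so
      the argument of the profile can be clamped to [\<delta>, 1]; the clamped profile is bounded
      and continuous on the whole line.\<close>
    obtain \<delta> where \<delta>: "0 < \<delta>" "\<delta> \<le> 1" "\<And>x. x \<in> ?K \<Longrightarrow> \<delta> \<le> ?n \<bullet> (x - ctr)"
    proof (cases "?K = {}")
      case False
      have "continuous_on ?K (\<lambda>x. ?n \<bullet> (x - ctr))" by (intro continuous_intros)
      then obtain x0 where x0: "x0 \<in> ?K" "\<And>x. x \<in> ?K \<Longrightarrow> ?n \<bullet> (x0 - ctr) \<le> ?n \<bullet> (x - ctr)"
        using continuous_attains_inf[OF test_functionD(4)[OF t] False] by blast
      have "?n \<bullet> (x0 - ctr) > 0" using sec_interior_\<xi>_pos(1)[OF L] test_functionD(5)[OF t] x0(1) by blast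
      then show ?thesis using that[of "min 1 (?n \<bullet> (x0 - ctr))"] x0(2) by force
    qed (use that[of 1] in auto)
    define r where "r s = \<rho> (max \<delta> (min 1 s))" for s
    have rc: "continuous_on UNIV r" unfolding r_def[abs_def]
      by (rule continuous_on_compose2[OF \<rho>]) (use \<delta> in \<open>auto intro!: continuous_intros\<close>)
    have rb: "\<exists>Q. \<forall>s. \<bar>r s\<bar> \<le> Q"
    proof -
      have "{\<delta>..1} \<subseteq> {0<..1}" using \<delta>(1) by auto
      then have "compact (\<rho> ` {\<delta>..1})"
        by (intro compact_continuous_image continuous_on_subset[OF \<rho>] compact_Icc)
      then have "bounded (\<rho> ` {\<delta>..1})" by (rule compact_imp_bounded)
      then obtain Q where "\<forall>y\<in>\<rho> ` {\<delta>..1}. norm y \<le> Q" unfolding bounded_iff ..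
      then have Q: "\<bar>\<rho> s\<bar> \<le> Q" if "s \<in> {\<delta>..1}" for s using that by simp
      have "max \<delta> (min 1 s) \<in> {\<delta>..1}" for s using \<delta> by auto
      then have "\<bar>r s\<bar> \<le> Q" for s unfolding r_def by (rule Q)
      then show ?thesis by blast
    qed
    then obtain Q where Q: "\<And>s. \<bar>r s\<bar> \<le> Q" by blast
    define q where "q x = r (?n \<bullet> (x - ctr))" for x
    have qc: "continuous_on UNIV q" unfolding q_def[abs_def]
      by (rule continuous_on_compose2[OF rc]) (auto intro!: continuous_intros)
    have inv: "q (x + s *\<^sub>R v) = q x" for x s
    proof -
      have "?n \<bullet> (x + s *\<^sub>R v - ctr) = ?n \<bullet> (x - ctr)" using v by (simp add: inner_diff_right inner_add_right inner_commute[of v])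
      then show ?thesis by (simp add: q_def)
    qed
    have "(LINT x|lebesgue. q x * (v \<bullet> D x)) = 0"
      by (rule test_function_translation_invariant[OF t qc _ inv, where Q = Q]) (simp add: q_def Q)
    also have "(LINT x|lebesgue. q x * (v \<bullet> D x)) = (LINT x|lebesgue_on ?U. q x * (v \<bullet> D x))"
      unfolding lebesgue_on_integral[OF U(3)]
      by (rule Bochner_Integration.integral_cong) (use test_function_outside[OF t] in auto)
    also have "\<dots> = (LINT x|lebesgue_on ?U. \<psi> x * (v \<bullet> D x))"
    proof (rule integral_cong_AE)
      have Dm: "(\<lambda>x. v \<bullet> D x) \<in> borel_measurable (lebesgue_on ?U)"
        using square_integrable_measurable[OF tL(2)] by measurable
      show "(\<lambda>x. q x * (v \<bullet> D x)) \<in> borel_measurable (lebesgue_on ?U)"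
        using measurable_restrict_space1[OF continuous_imp_lebesgue_measurable[OF qc]] Dm
        by (intro borel_measurable_times)
      show "(\<lambda>x. \<psi> x * (v \<bullet> D x)) \<in> borel_measurable (lebesgue_on ?U)"
        using square_integrable_measurable[OF \<psi>U] Dm by (intro borel_measurable_times)
      show "AE x in lebesgue_on ?U. q x * (v \<bullet> D x) = \<psi> x * (v \<bullet> D x)"
        using radU AE_space[of "lebesgue_on ?U"]
      proof eventually_elim
        case (elim x)
        then have x: "x \<in> ?U" "x \<in> sec L" using interior_subset by auto
        show ?case
        proof (cases "x \<in> ?K")
          case True
          have "\<xi> x = ?n \<bullet> (x - ctr)" by (rule sec_\<xi>[OF L x(2)])
          moreover have "\<xi> x \<le> 1" using sec_subset[OF L] x(2) body_iff by blast
          ultimately have "q x = \<rho> (\<xi> x)" using \<delta>(3)[OF True] by (simp add: q_def r_def)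
          then show ?thesis using elim(1) by simp
        next
          case False
          from test_function_zero(2)[OF t False] show ?thesis by simp
        qed
      qed
    qed
    finally have z: "(LINT x|lebesgue_on ?U. \<psi> x * (v \<bullet> D x)) = 0" .
    have "(LINT x|lebesgue_on ?U. \<psi> x * (v \<bullet> D x)) = (LINT x|lebesgue_on ?U. (\<Sum>i\<in>UNIV. v $ i * (\<psi> x * D x $ i)))"
      by (simp add: inner_vec_def sum_distrib_left mult.left_commute)
    also have "\<dots> = (\<Sum>i\<in>UNIV. LINT x|lebesgue_on ?U. v $ i * (\<psi> x * D x $ i))"
      by (rule Bochner_Integration.integral_sum)
         (intro integrable_mult_right integrable_mult_test_function(2)[OF t \<psi>U U(3)])
    also have "\<dots> = (\<Sum>i\<in>UNIV. - (LINT x|lebesgue_on ?U. v $ i * (g x $ i * \<phi> x)))"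
      using wU t unfolding weak_gradient_def by (intro sum.cong refl) simp
    also have "\<dots> = - (\<Sum>i\<in>UNIV. LINT x|lebesgue_on ?U. v $ i * (g x $ i * \<phi> x))"
      by (rule sum_negf)
    also have "(\<Sum>i\<in>UNIV. LINT x|lebesgue_on ?U. v $ i * (g x $ i * \<phi> x)) = (LINT x|lebesgue_on ?U. (\<Sum>i\<in>UNIV. v $ i * (g x $ i * \<phi> x)))"
      by (rule Bochner_Integration.integral_sum[symmetric])
         (intro integrable_mult_right integrable_mult_test_function(1)[OF t square_integrable_nth[OF gU] U(3)])
    also have "\<dots> = (LINT x|lebesgue_on ?U. (v \<bullet> g x) * \<phi> x)"
      by (simp add: inner_vec_def sum_distrib_right mult.assoc)
    finally show "(LINT x|lebesgue_on ?U. (v \<bullet> g x) * \<phi> x) = 0" using z by simp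
  qed
  have nn: "?n \<noteq> 0"
  proof
    assume "?n = 0"
    moreover obtain b where "b \<in> L" using piece[OF L] by blast
    ultimately show False using nrm_eq[OF L, of b] by simp
  qed
  \<comment> \<open>These finitely many vectors span the orthogonal complement of the normal n: they
    are |n|^2 times the projections of the unit vectors.\<close>
  define v where "v i = (?n \<bullet> ?n) *\<^sub>R axis i 1 - (?n $ i) *\<^sub>R ?n" for i
  have "AE x in lebesgue_on ?U. v i \<bullet> g x = 0" for i
    by (rule orth) (simp add: v_def inner_diff_left inner_axis' mult.commute)
  then have "AE x in lebesgue_on ?U. \<forall>i. v i \<bullet> g x = 0" by (simp add: AE_all_countable)
  then show ?thesis
    using AE_space[of "lebesgue_on ?U"]
  proof eventually_elim
    case (elim x)
    then have x: "x \<in> ?U" "x \<in> sec L" using interior_subset by auto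
    have \<xi>: "\<xi> x = ?n \<bullet> (x - ctr)" "\<xi> x > 0"
      using sec_\<xi>[OF L x(2)] sec_interior_\<xi>_pos(1)[OF L x(1)] by auto
    have "(?n \<bullet> ?n) * g x $ i = (?n $ i) * (?n \<bullet> g x)" for i
      using elim(1)[rule_format, of i] by (simp add: v_def inner_diff_left inner_axis')
    then have 1: "(?n \<bullet> ?n) *\<^sub>R g x = (?n \<bullet> g x) *\<^sub>R ?n" by (simp add: vec_eq_iff mult.commute)
    have n2: "?n \<bullet> ?n > 0" using nn by simp
    \<comment> \<open>Pairing with x - ctr determines the remaining scalar, since the normal pairs
      with x - ctr to \<xi>.\<close>
    have "(?n \<bullet> ?n) * ((x - ctr) \<bullet> g x) = (?n \<bullet> g x) * \<xi> x"
      using arg_cong[OF 1, of "\<lambda>z. (x - ctr) \<bullet> z"] by (simp add: \<xi>(1) inner_commute)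
    then have 2: "?n \<bullet> g x = (?n \<bullet> ?n) * (((x - ctr) \<bullet> g x) / \<xi> x)" using \<xi>(2) by (simp add: field_simps)
    have "(?n \<bullet> ?n) *\<^sub>R g x = (?n \<bullet> ?n) *\<^sub>R ((((x - ctr) \<bullet> g x) / \<xi> x) *\<^sub>R ?n)"
      unfolding 1 2 by simp
    then have "g x = (((x - ctr) \<bullet> g x) / \<xi> x) *\<^sub>R ?n \<or> ?n \<bullet> ?n = 0"
      by (simp only: scaleR_cancel_left)
    then show ?case using n2 by (metis less_irrefl)
  qed
qed

end

section \<open>Ray expansions of finite element functions\<close>

definition C1 :: "('a::euclidean_space \<Rightarrow> real) \<Rightarrow> bool" where
  "C1 f \<longleftrightarrow> (\<exists>D. (\<forall>x. GDERIV f x :> D x) \<and> continuous_on UNIV D)"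

lemma C1_const: "C1 (\<lambda>x. c)"
  unfolding C1_def using GDERIV_const by (intro exI[of _ "\<lambda>x. 0"]) auto

lemma C1_continuous: "C1 f \<Longrightarrow> continuous_on A f"
  unfolding C1_def using GDERIV_continuous_on by blast

lemma C1_affine: "C1 (\<lambda>x. c \<bullet> (x - a))"
  unfolding C1_def gderiv_def
  by (rule exI[of _ "\<lambda>x. c"]) (auto intro!: derivative_eq_intros simp: inner_commute)

lemma C1_add: "C1 f \<Longrightarrow> C1 g \<Longrightarrow> C1 (\<lambda>x. f x + g x)"
proof -
  assume "C1 f" "C1 g"
  then obtain D E where D: "\<forall>x. GDERIV f x :> D x" "continuous_on UNIV D" "\<forall>x. GDERIV g x :> E x" "continuous_on UNIV E"
    unfolding C1_def by blast
  show ?thesis unfolding C1_def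
    by (rule exI[of _ "\<lambda>x. D x + E x"]) (intro conjI allI GDERIV_add continuous_intros D(1,3)[rule_format] D(2,4))
qed

lemma C1_mult: "C1 f \<Longrightarrow> C1 g \<Longrightarrow> C1 (\<lambda>x. f x * g x)"
proof -
  assume fg: "C1 f" "C1 g"
  then obtain D E where D: "\<forall>x. GDERIV f x :> D x" "continuous_on UNIV D" "\<forall>x. GDERIV g x :> E x" "continuous_on UNIV E"
    unfolding C1_def by blast
  show ?thesis unfolding C1_def
    by (rule exI[of _ "\<lambda>x. f x *\<^sub>R E x + g x *\<^sub>R D x"])
       (intro conjI allI GDERIV_mult continuous_intros D(1,3)[rule_format] D(2,4) fg[THEN C1_continuous])
qed

lemma C1_sum: "(\<And>i. i \<in> A \<Longrightarrow> C1 (f i)) \<Longrightarrow> C1 (\<lambda>x. \<Sum>i\<in>A. f i x)"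
  by (induction A rule: infinite_finite_induct) (simp_all add: C1_const C1_add)

lemma C1_power: "C1 f \<Longrightarrow> C1 (\<lambda>x. f x ^ n)"
  by (induction n) (simp_all add: C1_const C1_mult)

lemma C1_prod: "(\<And>i. i \<in> A \<Longrightarrow> C1 (f i)) \<Longrightarrow> C1 (\<lambda>x. \<Prod>i\<in>A. f i x)"
  by (induction A rule: infinite_finite_induct) (simp_all add: C1_const C1_mult)

lemma C1_nth: "C1 (\<lambda>x::real^'n. x $ i)"
  using C1_affine[of "axis i 1 :: real^'n" 0] by (simp add: inner_axis' inner_real_def)

lemma poly_space_C1: "p \<in> poly_space A \<Longrightarrow> C1 p"
  unfolding poly_space_def
  by (auto intro!: C1_sum C1_mult C1_const C1_prod C1_power C1_nth)

lemma poly_space_zero: "(\<lambda>x. 0) \<in> poly_space A"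
  unfolding poly_space_def by (intro CollectI exI[of _ "\<lambda>e. 0"]) simp

lemma poly_space_add: "p \<in> poly_space A \<Longrightarrow> q \<in> poly_space A \<Longrightarrow> (\<lambda>x. p x + q x) \<in> poly_space A"
proof -
  assume "p \<in> poly_space A" "q \<in> poly_space A"
  then obtain c d where "p = (\<lambda>x. \<Sum>e\<in>A. c e * (\<Prod>i\<in>UNIV. x $ i ^ e i))" "q = (\<lambda>x. \<Sum>e\<in>A. d e * (\<Prod>i\<in>UNIV. x $ i ^ e i))"
    unfolding poly_space_def by blast
  then show ?thesis unfolding poly_space_def
    by (intro CollectI exI[of _ "\<lambda>e. c e + d e"]) (simp add: distrib_right sum.distrib)
qed

lemma poly_space_scale: "p \<in> poly_space A \<Longrightarrow> (\<lambda>x. r * p x) \<in> poly_space A"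
proof -
  assume "p \<in> poly_space A"
  then obtain c where "p = (\<lambda>x. \<Sum>e\<in>A. c e * (\<Prod>i\<in>UNIV. x $ i ^ e i))"
    unfolding poly_space_def by blast
  then show ?thesis unfolding poly_space_def
    by (intro CollectI exI[of _ "\<lambda>e. r * c e"]) (simp add: sum_distrib_left mult.assoc)
qed

lemma poly_space_sum: "(\<And>i. i \<in> I \<Longrightarrow> p i \<in> poly_space A) \<Longrightarrow> (\<lambda>x. \<Sum>i\<in>I. p i x) \<in> poly_space A"
  by (induction I rule: infinite_finite_induct) (simp_all add: poly_space_zero poly_space_add)

lemma poly_space_monomial:
  assumes "finite A" "e \<in> A"
  shows "(\<lambda>x. \<Prod>i\<in>UNIV. x $ i ^ e i) \<in> poly_space A"
  unfolding poly_space_def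
  using assms by (intro CollectI exI[of _ "\<lambda>e'. if e' = e then 1 else 0"]) (simp add: if_distrib[of "\<lambda>t. t * _"] cong: if_cong)

lemma finite_exponents: "finite {e :: 'n::finite \<Rightarrow> nat. \<forall>i. e i \<le> k}"
  using finite_set_of_finite_funs[of "UNIV :: 'n set" "{..k}" undefined] by simp

lemma finite_Pk_exponents: "finite {e :: 'n::finite \<Rightarrow> nat. (\<Sum>i\<in>UNIV. e i) \<le> k}"
proof (rule finite_subset[OF _ finite_exponents[of k]])
  show "{e :: 'n \<Rightarrow> nat. (\<Sum>i\<in>UNIV. e i) \<le> k} \<subseteq> {e. \<forall>i. e i \<le> k}"
  proof safe
    fix e :: "'n \<Rightarrow> nat" and i assume "(\<Sum>i\<in>UNIV. e i) \<le> k"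
    moreover have "e i \<le> (\<Sum>i\<in>UNIV. e i)" by (rule member_le_sum) auto
    ultimately show "e i \<le> k" by (rule order_trans[rotated])
  qed
qed

lemma Pk_monomial: "(\<Sum>i\<in>UNIV. e i) \<le> k \<Longrightarrow> (\<lambda>x::real^'n. \<Prod>i\<in>UNIV. x $ i ^ e i) \<in> Pk k"
  unfolding Pk_def by (rule poly_space_monomial[OF finite_Pk_exponents]) simp

lemma PkE:
  assumes "p \<in> Pk k"
  obtains c where "p = (\<lambda>x. \<Sum>e\<in>{e. (\<Sum>i\<in>UNIV. e i) \<le> k}. c e * (\<Prod>i\<in>UNIV. x $ i ^ e i))"
  using assms unfolding Pk_def poly_space_def by blast

lemma Pk_mono: "p \<in> Pk m \<Longrightarrow> m \<le> k \<Longrightarrow> (p :: real^'n \<Rightarrow> real) \<in> Pk k"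
proof -
  assume p: "p \<in> Pk m" and mk: "m \<le> k"
  obtain c where "p = (\<lambda>x. \<Sum>e\<in>{e. (\<Sum>i\<in>UNIV. e i) \<le> m}. c e * (\<Prod>i\<in>UNIV. x $ i ^ e i))" using PkE[OF p] by blast
  moreover have "(\<lambda>x::real^'n. \<Sum>e\<in>{e. (\<Sum>i\<in>UNIV. e i) \<le> m}. c e * (\<Prod>i\<in>UNIV. x $ i ^ e i)) \<in> Pk k"
    unfolding Pk_def using mk
    by (intro poly_space_sum poly_space_scale poly_space_monomial[OF finite_Pk_exponents]) auto
  ultimately show ?thesis by simp
qed

lemma Pk_lincomb: "p \<in> Pk k \<Longrightarrow> q \<in> Pk k \<Longrightarrow> (\<lambda>x. a * p x + b * q x) \<in> Pk k"
  unfolding Pk_def by (intro poly_space_add poly_space_scale)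

lemma Pk_mult_nth:
  fixes p :: "real^'n \<Rightarrow> real"
  assumes "p \<in> Pk m"
  shows "(\<lambda>x. x $ i * p x) \<in> Pk (Suc m)"
proof -
  obtain c where p: "p = (\<lambda>x. \<Sum>e\<in>{e. (\<Sum>i\<in>UNIV. e i) \<le> m}. c e * (\<Prod>i\<in>UNIV. x $ i ^ e i))" using PkE[OF assms] by blast
  have mono: "x $ i * (\<Prod>j\<in>UNIV. x $ j ^ e j) = (\<Prod>j\<in>UNIV. x $ j ^ (e j + (if j = i then 1 else 0)))"
    for x :: "real^'n" and e
    by (simp add: power_add prod.distrib if_distrib[of "\<lambda>n. _ ^ n"] mult.commute cong: if_cong)
  have "(\<lambda>x. x $ i * p x) = (\<lambda>x. \<Sum>e\<in>{e. (\<Sum>i\<in>UNIV. e i) \<le> m}. c e * (\<Prod>j\<in>UNIV. x $ j ^ (e j + (if j = i then 1 else 0))))"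
    unfolding p mono[symmetric] by (simp add: sum_distrib_left mult.left_commute)
  also have "\<dots> \<in> Pk (Suc m)"
    unfolding Pk_def
    by (intro poly_space_sum poly_space_scale poly_space_monomial[OF finite_Pk_exponents]) (auto simp: sum.distrib)
  finally show ?thesis .
qed

text \<open>\<Phi> stands for a polynomial read off at the fraction \<xi> of the way from the center
  to b.\<close>

definition ray_expansion :: "nat \<Rightarrow> (real \<Rightarrow> real^'n \<Rightarrow> real) \<Rightarrow> bool" where
  "ray_expansion m \<Phi> \<longleftrightarrow> (\<exists>\<beta>. (\<forall>j. \<beta> j \<in> Pk m) \<and> (\<forall>\<xi> b. \<Phi> \<xi> b = (\<Sum>j\<le>m. \<xi> ^ j * \<beta> j b)))"

lemma ray_expansion_mono:
  assumes "ray_expansion m \<Phi>" "m \<le> k"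
  shows "ray_expansion k \<Phi>"
proof -
  obtain \<beta> where \<beta>: "\<And>j. \<beta> j \<in> Pk m" "\<And>\<xi> b. \<Phi> \<xi> b = (\<Sum>j\<le>m. \<xi> ^ j * \<beta> j b)"
    using assms(1) unfolding ray_expansion_def by blast
  define \<gamma> where "\<gamma> j = (if j \<le> m then \<beta> j else (\<lambda>b. 0))" for j
  have "\<gamma> j \<in> Pk k" for j
    using Pk_mono[OF \<beta>(1) assms(2)] poly_space_zero unfolding Pk_def by (auto simp: \<gamma>_def)
  moreover have "\<Phi> \<xi> b = (\<Sum>j\<le>k. \<xi> ^ j * \<gamma> j b)" for \<xi> b
    unfolding \<beta>(2) using assms(2) by (intro sum.mono_neutral_cong_left) (auto simp: \<gamma>_def)
  ultimately show ?thesis unfolding ray_expansion_def by blast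
qed

lemma ray_expansion_const: "ray_expansion 0 (\<lambda>\<xi> b. c)"
proof -
  have "(\<lambda>b::real^'n. c * (\<Prod>i\<in>UNIV. b $ i ^ 0)) \<in> Pk 0"
    unfolding Pk_def by (intro poly_space_scale poly_space_monomial[OF finite_Pk_exponents]) simp
  then show ?thesis unfolding ray_expansion_def by (intro exI[of _ "\<lambda>j b. c"]) simp
qed

lemma ray_expansion_lincomb:
  assumes "ray_expansion m \<Phi>" "ray_expansion m \<Psi>"
  shows "ray_expansion m (\<lambda>\<xi> b. r * \<Phi> \<xi> b + s * \<Psi> \<xi> b)"
proof -
  obtain \<beta> \<gamma> where "\<And>j. \<beta> j \<in> Pk m" "\<And>\<xi> b. \<Phi> \<xi> b = (\<Sum>j\<le>m. \<xi> ^ j * \<beta> j b)"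
    "\<And>j. \<gamma> j \<in> Pk m" "\<And>\<xi> b. \<Psi> \<xi> b = (\<Sum>j\<le>m. \<xi> ^ j * \<gamma> j b)"
    using assms unfolding ray_expansion_def by blast
  then show ?thesis unfolding ray_expansion_def
    by (intro exI[of _ "\<lambda>j b. r * \<beta> j b + s * \<gamma> j b"])
       (auto simp: sum_distrib_left sum.distrib algebra_simps intro!: Pk_lincomb)
qed

text \<open>A coordinate of o' + \<xi> (b - o') is affine in \<xi> and in b, so the product raises
  both the power of \<xi> and the degree in b by at most one.\<close>

lemma ray_expansion_mult_nth:
  assumes "ray_expansion m \<Phi>"
  shows "ray_expansion (Suc m) (\<lambda>\<xi> b. (o' + \<xi> *\<^sub>R (b - o')) $ i * \<Phi> \<xi> b)"
proof -
  obtain \<beta> where \<beta>: "\<And>j. \<beta> j \<in> Pk m" "\<And>\<xi> b. \<Phi> \<xi> b = (\<Sum>j\<le>m. \<xi> ^ j * \<beta> j b)"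
    using assms unfolding ray_expansion_def by blast
  have "(\<lambda>b. 1 * (b $ i * \<beta> j b) + (- (o' $ i)) * \<beta> j b) \<in> Pk (Suc m)" for j
    by (intro Pk_lincomb Pk_mult_nth \<beta>(1) Pk_mono[OF \<beta>(1)]) simp
  then have 1: "(\<lambda>b. (b $ i - o' $ i) * \<beta> j b) \<in> Pk (Suc m)" for j by (simp add: left_diff_distrib)
  have 2: "(\<lambda>b. o' $ i * \<beta> j b) \<in> Pk (Suc m)" for j
    using Pk_lincomb[where a = "o' $ i" and b = 0, OF Pk_mono[OF \<beta>(1)[of j]] Pk_mono[OF \<beta>(1)[of j]], of "Suc m"] by simp
  have z: "(\<lambda>b. 0) \<in> Pk (Suc m)" unfolding Pk_def by (rule poly_space_zero)
  \<comment> \<open>The parts from the constant and from the linear term in \<xi>; the latter is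
    shifted by one power, which leaves 0 at index 0.\<close>
  define \<gamma> \<delta> where "\<gamma> j b = (if j \<le> m then o' $ i * \<beta> j b else 0)"
    and "\<delta> j b = (case j of 0 \<Rightarrow> 0 | Suc j' \<Rightarrow> (b $ i - o' $ i) * \<beta> j' b)" for j b
  have \<gamma>: "\<gamma> j \<in> Pk (Suc m)" for j using 2 z by (cases "j \<le> m") (simp_all add: \<gamma>_def[abs_def])
  have \<delta>: "\<delta> j \<in> Pk (Suc m)" for j using 1 z by (cases j) (simp_all add: \<delta>_def[abs_def])
  have "(o' + \<xi> *\<^sub>R (b - o')) $ i * \<Phi> \<xi> b = (\<Sum>j\<le>Suc m. \<xi> ^ j * (1 * \<gamma> j b + 1 * \<delta> j b))" for \<xi> b
  proof -
    have "(\<Sum>j\<le>Suc m. \<xi> ^ j * \<gamma> j b) = (\<Sum>j\<le>m. \<xi> ^ j * (o' $ i * \<beta> j b))"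
      by (simp add: \<gamma>_def)
    moreover have "(\<Sum>j\<le>Suc m. \<xi> ^ j * \<delta> j b) = (\<Sum>j\<le>m. \<xi> ^ Suc j * ((b $ i - o' $ i) * \<beta> j b))"
      unfolding sum.atMost_Suc_shift by (simp add: \<delta>_def)
    moreover have "(o' + \<xi> *\<^sub>R (b - o')) $ i * \<Phi> \<xi> b
        = (\<Sum>j\<le>m. \<xi> ^ j * (o' $ i * \<beta> j b)) + (\<Sum>j\<le>m. \<xi> ^ Suc j * ((b $ i - o' $ i) * \<beta> j b))"
    proof -
      define d where "d = b $ i - o' $ i"
      have "(o' + \<xi> *\<^sub>R (b - o')) $ i = o' $ i + \<xi> * d" by (simp add: d_def)
      moreover have "o' $ i * (\<Sum>j\<le>m. \<xi> ^ j * \<beta> j b) = (\<Sum>j\<le>m. \<xi> ^ j * (o' $ i * \<beta> j b))"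
        by (simp add: sum_distrib_left mult.left_commute)
      moreover have "\<xi> * d * (\<Sum>j\<le>m. \<xi> ^ j * \<beta> j b) = (\<Sum>j\<le>m. \<xi> ^ Suc j * (d * \<beta> j b))"
        by (simp add: sum_distrib_left mult.assoc mult.left_commute)
      ultimately show ?thesis unfolding \<beta>(2) d_def[symmetric] by (simp only: distrib_right)
    qed
    ultimately show ?thesis by (simp only: mult_1 distrib_left sum.distrib)
  qed
  then show ?thesis unfolding ray_expansion_def
    by (intro exI[of _ "\<lambda>j b. 1 * \<gamma> j b + 1 * \<delta> j b"] conjI allI Pk_lincomb \<gamma> \<delta>)
qed

lemma ray_expansion_monomial:
  assumes "finite I"
  shows "ray_expansion (\<Sum>i\<in>I. e i) (\<lambda>\<xi> b. \<Prod>i\<in>I. (o' + \<xi> *\<^sub>R (b - o')) $ i ^ e i)"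
  using assms
proof (induction I)
  case (insert i I)
  have "ray_expansion (n + (\<Sum>i\<in>I. e i)) (\<lambda>\<xi> b. (o' + \<xi> *\<^sub>R (b - o')) $ i ^ n * (\<Prod>i\<in>I. (o' + \<xi> *\<^sub>R (b - o')) $ i ^ e i))" for n
  proof (induction n)
    case (Suc n)
    from ray_expansion_mult_nth[OF Suc, of o' i] show ?case by (simp only: power_Suc mult.assoc add_Suc)
  qed (use insert.IH in simp)
  from this[of "e i"] show ?case using insert.hyps by simp
qed (use ray_expansion_const[of 1] in simp)

lemma Pk_ray_expansion:
  assumes "p \<in> Pk k"
  shows "ray_expansion k (\<lambda>\<xi> b. p (o' + \<xi> *\<^sub>R (b - o')))"
proof -
  obtain c where p: "p = (\<lambda>x. \<Sum>e\<in>{e. (\<Sum>i\<in>UNIV. e i) \<le> k}. c e * (\<Prod>i\<in>UNIV. x $ i ^ e i))" using PkE[OF assms] by blast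
  have "ray_expansion k (\<lambda>\<xi> b. \<Sum>e\<in>E. c e * (\<Prod>i\<in>UNIV. (o' + \<xi> *\<^sub>R (b - o')) $ i ^ e i))"
    if "finite E" "E \<subseteq> {e. (\<Sum>i\<in>UNIV. e i) \<le> k}" for E
    using that
  proof (induction E)
    case empty
    show ?case using ray_expansion_mono[OF ray_expansion_const[of 0], of k] by simp
  next
    case (insert e E)
    have "ray_expansion k (\<lambda>\<xi> b. \<Prod>i\<in>UNIV. (o' + \<xi> *\<^sub>R (b - o')) $ i ^ e i)"
      by (rule ray_expansion_mono[OF ray_expansion_monomial]) (use insert.prems in auto)
    from ray_expansion_lincomb[OF this insert.IH, of "c e" 1] insert show ?case by simp
  qed
  from this[OF finite_Pk_exponents subset_refl] show ?thesis unfolding p .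
qed

lemma FE_expansion_Simplicial:
  fixes L :: "(real^'n) set"
  assumes "w \<in> FE_local Simplicial k S L"
  shows "\<exists>\<beta> c. (\<forall>j\<le>k. \<beta> j \<in> Vk Simplicial k L \<and> C1 (\<beta> j)) \<and> (\<forall>b. \<beta> 0 b = c) \<and>
    (AE x in lebesgue_on (sector S L). \<forall>\<xi>\<in>{0<..1}. \<forall>b\<in>L. x = duffy_point S \<xi> b \<longrightarrow> w x = (\<Sum>j\<le>k. \<xi> ^ j * \<beta> j b))"
proof -
  obtain p where p: "p \<in> Pk k" "AE x in lebesgue_on (sector S L). w x = p x"
    using assms by (auto simp: FE_local_def)
  obtain \<beta> where \<beta>: "\<And>j. \<beta> j \<in> Pk k"
    "\<And>\<xi> b. p (center S + \<xi> *\<^sub>R (b - center S)) = (\<Sum>j\<le>k. \<xi> ^ j * \<beta> j b)"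
    using Pk_ray_expansion[OF p(1), of "center S"] unfolding ray_expansion_def by blast
  \<comment> \<open>At \<xi> = 0 every ray is at the scaling center, so \<beta> 0 is the value
    there.\<close>
  have "\<beta> 0 b = p (center S)" for b
  proof -
    have "(\<Sum>j\<le>k. 0 ^ j * \<beta> j b) = (\<Sum>j\<le>k. if j = 0 then \<beta> j b else 0)"
      by (rule sum.cong) (auto simp: power_0_left)
    then show ?thesis using \<beta>(2)[of 0 b] by simp
  qed
  moreover have "\<beta> j \<in> Vk Simplicial k L" "C1 (\<beta> j)" for j
    using \<beta>(1)[of j] poly_space_C1[of "\<beta> j"] by (auto simp: Vk_def Pk_def)
  moreover have "AE x in lebesgue_on (sector S L). \<forall>\<xi>\<in>{0<..1}. \<forall>b\<in>L. x = duffy_point S \<xi> b \<longrightarrow> w x = (\<Sum>j\<le>k. \<xi> ^ j * \<beta> j b)"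
    using p(2) by eventually_elim (auto simp: duffy_point_def \<beta>(2))
  ultimately show ?thesis by blast
qed

lemma ref_pyramid_point:
  assumes "0 \<le> s" "s \<le> 1" "0 \<le> t" "t \<le> 1" "0 \<le> \<xi>" "\<xi> \<le> (1::real)"
  shows "vector [\<xi> * s, \<xi> * t, 1 - \<xi>] \<in> ref_pyramid"
proof -
  have c: "convex ref_pyramid" by (simp add: ref_pyramid_def)
  have v: "vector [0,0,1] \<in> ref_pyramid" "vector [0,0,0] \<in> ref_pyramid" "vector [1,0,0] \<in> ref_pyramid"
    "vector [1,1,0] \<in> ref_pyramid" "vector [0,1,0] \<in> ref_pyramid"
    unfolding ref_pyramid_def by (auto intro: hull_inc)
  have comb: "(1 - r) *\<^sub>R x + r *\<^sub>R y \<in> ref_pyramid" if "x \<in> ref_pyramid" "y \<in> ref_pyramid" "0 \<le> r" "r \<le> 1" for x y r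
    using c that unfolding convex_alt by blast
  note vec = vec_eq_iff forall_3 vector_3
  have "(1 - s) *\<^sub>R vector [0,0,0] + s *\<^sub>R vector [1,0,0] = (vector [s, 0, 0] :: real^3)" by (simp add: vec)
  with comb[OF v(2,3) assms(1,2)] have 1: "vector [s, 0, 0] \<in> ref_pyramid" by (simp only:)
  have "(1 - s) *\<^sub>R vector [0,1,0] + s *\<^sub>R vector [1,1,0] = (vector [s, 1, 0] :: real^3)" by (simp add: vec)
  with comb[OF v(5,4) assms(1,2)] have 2: "vector [s, 1, 0] \<in> ref_pyramid" by (simp only:)
  have "(1 - t) *\<^sub>R vector [s,0,0] + t *\<^sub>R vector [s,1,0] = (vector [s, t, 0] :: real^3)"
    by (simp add: vec algebra_simps)
  with comb[OF 1 2 assms(3,4)] have 3: "vector [s, t, 0] \<in> ref_pyramid" by (simp only:)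
  have "(1 - \<xi>) *\<^sub>R vector [0,0,1] + \<xi> *\<^sub>R vector [s,t,0] = (vector [\<xi> * s, \<xi> * t, 1 - \<xi>] :: real^3)"
    by (simp add: vec)
  with comb[OF v(1) 3 assms(5,6)] show ?thesis by (simp only:)
qed

text \<open>In the infinite pyramid z = (1 - \<xi>) / \<xi> on the level \<xi>, so z^l / (1 + z)^k
  is this product; its expansion has no constant term unless l = k.\<close>

lemma one_minus_power_expansion:
  obtains a :: "nat \<Rightarrow> nat \<Rightarrow> real"
  where "\<And>l \<xi>. l \<le> k \<Longrightarrow> (1 - \<xi>) ^ l * \<xi> ^ (k - l) = (\<Sum>j\<le>k. \<xi> ^ j * a l j)" "\<And>l. l < k \<Longrightarrow> a l 0 = 0"
proof -
  define P :: "nat \<Rightarrow> real poly" where "P l = [:1, -1:] ^ l * [:0, 1:] ^ (k - l)" for l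
  have deg: "degree (P l) \<le> k" if "l \<le> k" for l
  proof -
    have "degree (P l) \<le> degree ([:1, -1:] ^ l :: real poly) + degree ([:0, 1:] ^ (k - l) :: real poly)"
      unfolding P_def by (rule degree_mult_le)
    also have "\<dots> \<le> 1 * l + 1 * (k - l)"
      by (rule add_mono; rule order_trans[OF degree_power_le]; simp)
    finally show ?thesis using that by simp
  qed
  have ev: "poly (P l) \<xi> = (1 - \<xi>) ^ l * \<xi> ^ (k - l)" for l \<xi> by (simp add: P_def)
  show thesis
  proof (rule that[of "\<lambda>l j. coeff (P l) j"])
    fix l \<xi> assume l: "l \<le> k"
    have "poly (P l) \<xi> = (\<Sum>j\<le>degree (P l). coeff (P l) j * \<xi> ^ j)" by (rule poly_altdef)
    also have "\<dots> = (\<Sum>j\<le>k. coeff (P l) j * \<xi> ^ j)"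
      using deg[OF l] by (intro sum.mono_neutral_left) (auto simp: coeff_eq_0)
    finally show "(1 - \<xi>) ^ l * \<xi> ^ (k - l) = (\<Sum>j\<le>k. \<xi> ^ j * coeff (P l) j)"
      by (simp add: ev mult.commute)
  next
    fix l assume "l < k"
    then show "coeff (P l) 0 = 0" using ev[of l 0] by (simp add: poly_0_coeff_0)
  qed
qed

text \<open>The coordinates in the plane of the parallelogram are extended to affine functions on
  the whole space, so that coefficients built from them are smooth everywhere.\<close>

lemma parallelogram_coordinates:
  assumes "parallelogram a e f L"
  obtains n1 n2 where "\<And>s t. n1 \<bullet> ((a + s *\<^sub>R e + t *\<^sub>R f) - a) = s" "\<And>s t. n2 \<bullet> ((a + s *\<^sub>R e + t *\<^sub>R f) - a) = t"
proof -
  have ef: "e \<noteq> f" "independent {e, f}" using assms by (auto simp: parallelogram_def)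
  have "\<exists>n. n \<bullet> e = u \<and> n \<bullet> f = v" for u v :: real
  proof -
    obtain h where h: "linear h" "\<forall>x\<in>{e, f}. h x = (if x = e then u else v)"
      using linear_independent_extend[OF ef(2), of "\<lambda>x. if x = e then u else v"] by blast
    have hx: "(\<Sum>i\<in>Basis. h i *\<^sub>R i) \<bullet> x = h x" for x
    proof -
      have "h x = h (\<Sum>i\<in>Basis. (x \<bullet> i) *\<^sub>R i)" by (simp add: euclidean_representation)
      also have "\<dots> = (\<Sum>i\<in>Basis. (x \<bullet> i) * h i)" by (simp add: linear_sum[OF h(1)] linear_cmul[OF h(1)])
      also have "\<dots> = (\<Sum>i\<in>Basis. h i *\<^sub>R i) \<bullet> x" by (simp add: inner_sum_left inner_commute[of x] mult.commute)
      finally show ?thesis ..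
    qed
    have "h e = u" "h f = v" using h(2) ef(1) by auto
    then show ?thesis by (intro exI[of _ "\<Sum>i\<in>Basis. h i *\<^sub>R i"]) (simp only: hx)
  qed
  note ex = this
  obtain n1 where n1: "n1 \<bullet> e = 1 \<and> n1 \<bullet> f = 0" using ex[of 1 0] ..
  obtain n2 where n2: "n2 \<bullet> e = 0 \<and> n2 \<bullet> f = 1" using ex[of 0 1] ..
  note n = n1[THEN conjunct1] n1[THEN conjunct2] n2[THEN conjunct1] n2[THEN conjunct2]
  show thesis
    by (rule that[of n1 n2]) (simp_all add: inner_add_right inner_diff_right n)
qed

text \<open>With the apex at the scaling center, the height in the reference pyramid is 1 - \<xi>.
  \<open>S_infty\<close> maps lines parallel to the z-axis to rays through the apex, so x and y are
  constant along a ray and the rational dependence on z becomes polynomial in \<xi>.\<close>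

lemma FE_expansion_Pyramidal:
  fixes L :: "(real^'n) set"
  assumes "w \<in> FE_local Pyramidal k S L" "k \<ge> 1"
  shows "\<exists>\<beta> c. (\<forall>j\<le>k. \<beta> j \<in> Vk Pyramidal k L \<and> C1 (\<beta> j)) \<and> (\<forall>b. \<beta> 0 b = c) \<and>
    (AE x in lebesgue_on (sector S L). \<forall>\<xi>\<in>{0<..1}. \<forall>b\<in>L. x = duffy_point S \<xi> b \<longrightarrow> w x = (\<Sum>j\<le>k. \<xi> ^ j * \<beta> j b))"
proof -
  obtain a e f u v where par: "parallelogram a e f L" and u: "u \<in> ref_pyramid_space k"
    and v': "\<forall>p\<in>ref_pyramid. v (a + p $ 1 *\<^sub>R e + p $ 2 *\<^sub>R f + p $ 3 *\<^sub>R (center S - a)) = u p"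
    and ae: "AE x in lebesgue_on (sector S L). w x = v x"
    using assms(1) unfolding FE_local_def by auto
  note v = v'[rule_format]
  define E where "E = {m :: 3 \<Rightarrow> nat. m 1 \<le> k \<and> m 2 \<le> k \<and> m 3 \<le> k - 1}"
  have E3: "m 3 \<le> k" if "m \<in> E" for m
  proof -
    have "m 3 \<le> k - 1" using that by (simp add: E_def)
    then show ?thesis by linarith
  qed
  obtain c0 q where q: "q \<in> poly_space E" and uq: "\<forall>s. 0 \<le> s $ 1 \<and> s $ 1 \<le> 1 \<and> 0 \<le> s $ 2 \<and> s $ 2 \<le> 1 \<and> 0 \<le> s $ 3 \<longrightarrow>
        u (S_infty s) = c0 * (s $ 3 ^ k / (1 + s $ 3) ^ k) + q s / (1 + s $ 3) ^ k"
    using u unfolding ref_pyramid_space_def E_def by blast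
  obtain c where c: "q = (\<lambda>x. \<Sum>m\<in>E. c m * (\<Prod>i\<in>UNIV. x $ i ^ m i))"
    using q unfolding poly_space_def by blast
  obtain \<alpha> :: "nat \<Rightarrow> nat \<Rightarrow> real" where \<alpha>: "\<And>l \<xi>. l \<le> k \<Longrightarrow> (1 - \<xi>) ^ l * \<xi> ^ (k - l) = (\<Sum>j\<le>k. \<xi> ^ j * \<alpha> l j)"
    "\<And>l. l < k \<Longrightarrow> \<alpha> l 0 = 0"
    using one_minus_power_expansion[of k] by blast
  obtain n1 n2 where n: "\<And>s t. n1 \<bullet> ((a + s *\<^sub>R e + t *\<^sub>R f) - a) = s" "\<And>s t. n2 \<bullet> ((a + s *\<^sub>R e + t *\<^sub>R f) - a) = t"
    using parallelogram_coordinates[OF par] by blast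
  define \<beta> where "\<beta> j b = c0 * \<alpha> k j + (\<Sum>m\<in>E. (c m * \<alpha> (m 3) j) * ((n1 \<bullet> (b - a)) ^ m 1 * (n2 \<bullet> (b - a)) ^ m 2))" for j b
  have C: "C1 (\<beta> j)" for j unfolding \<beta>_def[abs_def]
    by (intro C1_add C1_const C1_sum C1_mult C1_power C1_affine)
  have V: "\<beta> j \<in> Vk Pyramidal k L" for j
  proof -
    \<comment> \<open>The coefficient in the two plane coordinates: the exponents of x and y
      survive, that of z has gone into the powers of \<xi>.\<close>
    define Q where "Q s = c0 * \<alpha> k j * (\<Prod>i\<in>UNIV. s $ i ^ (0::nat))
        + (\<Sum>m\<in>E. (c m * \<alpha> (m 3) j) * (\<Prod>i\<in>UNIV. s $ i ^ (if i = 1 then m 1 else m 2)))" for s :: "real^2"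
    have "Q \<in> poly_space {m. \<forall>i. m i \<le> k}" unfolding Q_def[abs_def]
      by (intro poly_space_add poly_space_sum poly_space_scale poly_space_monomial[OF finite_exponents])
         (auto simp: E_def)
    moreover have "\<beta> j (a + s $ 1 *\<^sub>R e + s $ 2 *\<^sub>R f) = Q s" for s
      unfolding \<beta>_def Q_def n by (simp add: UNIV_2)
    ultimately have "\<exists>q\<in>poly_space {m. \<forall>i. m i \<le> k}. \<forall>s\<in>cbox (0::real^2) 1. \<beta> j (a + s $ 1 *\<^sub>R e + s $ 2 *\<^sub>R f) = q s"
      by (intro bexI[of _ Q]) simp_all
    then show ?thesis unfolding Vk_def sector_type.case mem_Collect_eq
      by (intro exI[of _ a] exI[of _ e] exI[of _ f] conjI par)
  qed
  have "\<beta> 0 b = c0 * \<alpha> k 0" for b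
  proof -
    \<comment> \<open>For k at least 1, exponents up to k - 1 are strictly below k, so only the apex
      function z^k / (1 + z)^k contributes to the constant term.\<close>
    have "\<alpha> (m 3) 0 = 0" if "m \<in> E" for m
    proof (rule \<alpha>(2))
      have "m 3 \<le> k - 1" using that by (simp add: E_def)
      then show "m 3 < k" using assms(2) by linarith
    qed
    then have "(\<Sum>m\<in>E. (c m * \<alpha> (m 3) 0) * ((n1 \<bullet> (b - a)) ^ m 1 * (n2 \<bullet> (b - a)) ^ m 2)) = 0"
      by (intro sum.neutral) simp
    then show ?thesis by (simp only: \<beta>_def add_0_right)
  qed
  moreover have "AE x in lebesgue_on (sector S L). \<forall>\<xi>\<in>{0<..1}. \<forall>b\<in>L. x = duffy_point S \<xi> b \<longrightarrow> w x = (\<Sum>j\<le>k. \<xi> ^ j * \<beta> j b)"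
    using ae
  proof eventually_elim
    case (elim x)
    show ?case
    proof (intro ballI impI)
      fix \<xi> :: real and b assume \<xi>: "\<xi> \<in> {0<..1}" and b: "b \<in> L" and x: "x = duffy_point S \<xi> b"
      obtain s :: "real^2" where s: "s \<in> cbox 0 1" "b = a + s $ 1 *\<^sub>R e + s $ 2 *\<^sub>R f"
        using b par unfolding parallelogram_def by blast
      have s01: "0 \<le> s $ 1" "s $ 1 \<le> 1" "0 \<le> s $ 2" "s $ 2 \<le> 1"
        using s(1) by (auto simp: mem_box_cart)
      \<comment> \<open>The third coordinate of the point that \<open>S_infty\<close> maps to height
        1 - \<xi>.\<close>
      define z where "z = (1 - \<xi>) / \<xi>"
      have z: "z \<ge> 0" "1 + z = 1 / \<xi>" "z * \<xi> = 1 - \<xi>" using \<xi> by (auto simp: z_def field_simps)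
      define p :: "real^3" where "p = vector [\<xi> * s $ 1, \<xi> * s $ 2, 1 - \<xi>]"
      define t :: "real^3" where "t = vector [s $ 1, s $ 2, z]"
      have tp: "S_infty t = p"
        unfolding S_infty_def t_def p_def vector_3 z(2) using z(3) by (simp add: mult.commute)
      have "p \<in> ref_pyramid" unfolding p_def by (rule ref_pyramid_point) (use s01 \<xi> in auto)
      then have "v (a + p $ 1 *\<^sub>R e + p $ 2 *\<^sub>R f + p $ 3 *\<^sub>R (center S - a)) = u p" by (rule v)
      moreover have "a + p $ 1 *\<^sub>R e + p $ 2 *\<^sub>R f + p $ 3 *\<^sub>R (center S - a) = x"
        unfolding x s(2) duffy_point_def p_def vector_3 by (simp add: algebra_simps)
      ultimately have "w x = u (S_infty t)" using elim tp by simp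
      also have "\<dots> = c0 * (z ^ k / (1 + z) ^ k) + q t / (1 + z) ^ k"
        using uq[rule_format, of t] s01 z(1) by (simp add: t_def)
      also have "z ^ k / (1 + z) ^ k = (1 - \<xi>) ^ k * \<xi> ^ (k - k)"
        unfolding z(2) by (simp add: power_divide[symmetric] z(3))
      also have "q t / (1 + z) ^ k = (\<Sum>m\<in>E. c m * ((s $ 1) ^ m 1 * (s $ 2) ^ m 2) * ((1 - \<xi>) ^ m 3 * \<xi> ^ (k - m 3)))"
      proof -
        have "c m * (\<Prod>i\<in>UNIV. t $ i ^ m i) / (1 + z) ^ k = c m * ((s $ 1) ^ m 1 * (s $ 2) ^ m 2) * ((1 - \<xi>) ^ m 3 * \<xi> ^ (k - m 3))"
          if "m \<in> E" for m
        proof -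
          have m3: "m 3 \<le> k" by (rule E3[OF that])
          have "z ^ m 3 / (1 + z) ^ k = z ^ m 3 * \<xi> ^ k"
            unfolding z(2) power_one_over by simp
          also have "\<xi> ^ k = \<xi> ^ m 3 * \<xi> ^ (k - m 3)"
            unfolding power_add[symmetric] le_add_diff_inverse[OF m3] ..
          also have "z ^ m 3 * (\<xi> ^ m 3 * \<xi> ^ (k - m 3)) = (z * \<xi>) ^ m 3 * \<xi> ^ (k - m 3)"
            by (simp only: power_mult_distrib mult.assoc)
          finally have zz: "z ^ m 3 / (1 + z) ^ k = (1 - \<xi>) ^ m 3 * \<xi> ^ (k - m 3)"
            unfolding z(3) .
          have t123: "t $ 1 = s $ 1" "t $ 2 = s $ 2" "t $ 3 = z" by (simp_all add: t_def)
          have pr: "(\<Prod>i\<in>UNIV. t $ i ^ m i) = ((s $ 1) ^ m 1 * (s $ 2) ^ m 2) * z ^ m 3"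
            unfolding UNIV_3 t123[symmetric] by (simp add: mult.assoc)
          have assoc: "x * (y * w) / r = x * y * (w / r)" for x y w r :: real by simp
          show ?thesis unfolding pr assoc zz ..
        qed
        then show ?thesis unfolding c sum_divide_distrib by (intro sum.cong refl)
      qed
      also have "c0 * ((1 - \<xi>) ^ k * \<xi> ^ (k - k)) + (\<Sum>m\<in>E. c m * ((s $ 1) ^ m 1 * (s $ 2) ^ m 2) * ((1 - \<xi>) ^ m 3 * \<xi> ^ (k - m 3)))
          = (\<Sum>j\<le>k. \<xi> ^ j * \<beta> j b)"
      proof -
        have "(\<Sum>m\<in>E. c m * ((s $ 1) ^ m 1 * (s $ 2) ^ m 2) * ((1 - \<xi>) ^ m 3 * \<xi> ^ (k - m 3)))
            = (\<Sum>m\<in>E. c m * ((s $ 1) ^ m 1 * (s $ 2) ^ m 2) * (\<Sum>j\<le>k. \<xi> ^ j * \<alpha> (m 3) j))"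
          by (intro sum.cong refl arg_cong2[where f = times] \<alpha>(1) E3)
        also have "\<dots> = (\<Sum>m\<in>E. \<Sum>j\<le>k. \<xi> ^ j * (c m * \<alpha> (m 3) j * ((s $ 1) ^ m 1 * (s $ 2) ^ m 2)))"
          unfolding sum_distrib_left by (intro sum.cong refl) (simp only: mult_ac)
        also have "\<dots> = (\<Sum>j\<le>k. \<xi> ^ j * (\<Sum>m\<in>E. c m * \<alpha> (m 3) j * ((s $ 1) ^ m 1 * (s $ 2) ^ m 2)))"
          unfolding sum_distrib_left by (rule sum.swap)
        finally have 1: "(\<Sum>m\<in>E. c m * ((s $ 1) ^ m 1 * (s $ 2) ^ m 2) * ((1 - \<xi>) ^ m 3 * \<xi> ^ (k - m 3)))
            = (\<Sum>j\<le>k. \<xi> ^ j * (\<Sum>m\<in>E. c m * \<alpha> (m 3) j * ((s $ 1) ^ m 1 * (s $ 2) ^ m 2)))" .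
        have 2: "c0 * ((1 - \<xi>) ^ k * \<xi> ^ (k - k)) = (\<Sum>j\<le>k. \<xi> ^ j * (c0 * \<alpha> k j))"
          unfolding \<alpha>(1)[OF order_refl] by (simp add: sum_distrib_left mult.left_commute)
        show ?thesis unfolding 1 2 \<beta>_def s(2) n by (simp only: distrib_left sum.distrib)
      qed
      finally show "w x = (\<Sum>j\<le>k. \<xi> ^ j * \<beta> j b)" .
    qed
  qed
  ultimately show ?thesis using C V by blast
qed

lemma FE_expansion:
  fixes L :: "(real^'n) set"
  assumes "w \<in> FE_local \<tau> k S L" "k \<ge> 1"
  shows "\<exists>\<beta> c. (\<forall>j\<le>k. \<beta> j \<in> Vk \<tau> k L \<and> C1 (\<beta> j)) \<and> (\<forall>b. \<beta> 0 b = c) \<and>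
    (AE x in lebesgue_on (sector S L). \<forall>\<xi>\<in>{0<..1}. \<forall>b\<in>L. x = duffy_point S \<xi> b \<longrightarrow> w x = (\<Sum>j\<le>k. \<xi> ^ j * \<beta> j b))"
proof (cases \<tau>)
  case Simplicial
  show ?thesis using FE_expansion_Simplicial[OF assms(1)[unfolded Simplicial]] unfolding Simplicial .
next
  case Pyramidal
  show ?thesis using FE_expansion_Pyramidal[OF assms(1)[unfolded Pyramidal] assms(2)] unfolding Pyramidal .
qed

section \<open>Polytopal meshes\<close>

lemma parallelogram_properties:
  assumes "parallelogram a e f L"
  shows "polytope L" "L \<noteq> {}" "aff_dim L \<ge> 2"
proof -
  have ef: "e \<noteq> f" "independent {e, f}" and L: "L = (\<lambda>s::real^2. a + s $ 1 *\<^sub>R e + s $ 2 *\<^sub>R f) ` cbox 0 1"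
    using assms by (auto simp: parallelogram_def)
  define h where "h s = s $ 1 *\<^sub>R e + s $ 2 *\<^sub>R f" for s :: "real^2"
  have lin: "linear h" by (rule linearI) (simp_all add: h_def algebra_simps)
  have Lh: "L = (+) a ` (h ` cbox 0 1)" by (simp add: L h_def image_image add.assoc)
  then show "polytope L"
    using polytope_linear_image[OF lin polytope_interval] by (simp only: polytope_translation_eq)
  show "L \<noteq> {}" unfolding L by (simp add: interval_ne_empty_cart)
  have mem: "a + u *\<^sub>R e + v *\<^sub>R f \<in> L" if "u \<in> {0..1}" "v \<in> {0..1}" for u v
  proof -
    have "vector [u, v] \<in> cbox (0::real^2) 1" using that by (simp add: mem_box_cart forall_2 vector_2)
    then have "(\<lambda>s::real^2. a + s $ 1 *\<^sub>R e + s $ 2 *\<^sub>R f) (vector [u, v]) \<in> L" unfolding L by (rule imageI)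
    then show ?thesis by (simp add: vector_2)
  qed
  have sub: "{a + f, a + e, a} \<subseteq> L" using mem[of 0 1] mem[of 1 0] mem[of 0 0] by simp
  have e0: "e \<noteq> 0" using ef(2) dependent_zero by blast
  have "f \<notin> span {e}" using ef independent_insert[of f "{e}"] by (simp add: insert_commute)
  have 1: "aff_dim {a + e, a} = 1" using e0 by (subst aff_dim_insert) simp
  have "a + f \<notin> affine hull {a + e, a}"
  proof
    assume "a + f \<in> affine hull {a + e, a}"
    then obtain u v where uv: "a + f = u *\<^sub>R (a + e) + v *\<^sub>R a" "u + v = 1"
      unfolding affine_hull_2 by auto
    have "a + f = (u + v) *\<^sub>R a + u *\<^sub>R e" unfolding uv(1) by (simp add: algebra_simps)
    then have "f = u *\<^sub>R e" using uv(2) by simp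
    then show False using \<open>f \<notin> span {e}\<close> by (simp add: span_base span_scale)
  qed
  then have "aff_dim {a + f, a + e, a} = 2" using 1 by (subst aff_dim_insert) simp
  then show "aff_dim L \<ge> 2" using aff_dim_subset[OF sub] by simp
qed

lemma facet_shape_properties:
  fixes L :: "(real^'n) set"
  assumes "facet_shape \<tau> L" "CARD('n) \<ge> 2"
  shows "convex L" "compact L" "L \<noteq> {}" "aff_dim L \<ge> int CARD('n) - 1" "polytope L"
proof -
  have "polytope L \<and> L \<noteq> {} \<and> aff_dim L \<ge> int CARD('n) - 1"
  proof (cases \<tau>)
    case Simplicial
    then have s: "(int CARD('n) - 1) simplex L" using assms(1) by (simp add: facet_shape_def)
    then have "polytope L" "aff_dim L = int CARD('n) - 1"
      by (auto intro: simplex_imp_polytope aff_dim_simplex)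
    moreover from this have "L \<noteq> {}" using assms(2) by (auto simp: aff_dim_empty)
    ultimately show ?thesis by simp
  next
    case Pyramidal
    then obtain a e f where "CARD('n) = 3" "parallelogram a e f L" using assms(1) by (auto simp: facet_shape_def)
    then show ?thesis using parallelogram_properties[of a e f L] by simp
  qed
  then show "convex L" "compact L" "L \<noteq> {}" "aff_dim L \<ge> int CARD('n) - 1" "polytope L"
    by (auto intro: polytope_imp_convex polytope_imp_compact)
qed

text \<open>The center is interior: on the boundary it would lie in a facet with more than one
  point, and the segment to another point of that facet would stay in the boundary, against
  visibility.\<close>

lemma S_element_star_body:
  fixes S :: "'n::finite S_element"
  assumes S: "is_S_element \<tau> S" and n: "CARD('n) \<ge> 2"
  shows "star_body (body S) (center S) (facets S)"
proof -
  note d = S[unfolded is_S_element_def]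
  have fs: "facet_shape \<tau> L" if "L \<in> facets S" for L using d that by blast
  note F = facet_shape_properties[OF fs n]
  show ?thesis
  proof
    show "convex (body S)" "compact (body S)" using d polytope_imp_convex polytope_imp_compact by blast+
    show "finite (facets S)" "\<Union>(facets S) = frontier (body S)" using d by blast+
    show "convex L \<and> compact L \<and> L \<noteq> {}" if "L \<in> facets S" for L using F[OF that] by blast
    show "center S \<in> interior (body S)"
    proof (rule ccontr)
      assume "center S \<notin> interior (body S)"
      then have "center S \<in> frontier (body S)" using d closure_subset unfolding frontier_def by blast
      then obtain L where L: "L \<in> facets S" "center S \<in> L" using d by blast
      have "L \<noteq> {center S}"
      proof
        assume "L = {center S}"
        then have "aff_dim L = 0" by simp
        then show False using F(4)[OF L(1)] n by simp
      qed
      then obtain x where x: "x \<in> L" "x \<noteq> center S" using L(2) by blast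
      have Lf: "L \<subseteq> frontier (body S)" using d L(1) by blast
      have "midpoint (center S) x \<in> open_segment (center S) x" using x(2) by simp
      moreover have "open_segment (center S) x \<subseteq> interior (body S)" using d x(1) Lf by blast
      moreover have "open_segment (center S) x \<subseteq> L"
        using F(1)[OF L(1)] L(2) x(1) open_closed_segment convex_contains_segment by blast
      ultimately show False using Lf unfolding frontier_def by blast
    qed
  qed
qed

context star_body
begin

text \<open>The apex lies off the hyperplane of the piece, so coning raises the dimension by one.
  That the sector is the closure of its interior lets continuity carry almost everywhere identities
  up to the facet.\<close>

lemma sec_full_dimensional:
  assumes L: "L \<in> Ls" and d: "aff_dim L \<ge> int CARD('n) - 1"
  shows "closure (interior (sec L)) = sec L" "interior (sec L) \<noteq> {}"
proof -
  have "affine hull L \<subseteq> {x. nrm L \<bullet> x = 1 + nrm L \<bullet> ctr}"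
  proof (rule hull_minimal)
    show "L \<subseteq> {x. nrm L \<bullet> x = 1 + nrm L \<bullet> ctr}" using nrm_eq[OF L] by (force simp: inner_diff_right)
    show "affine {x. nrm L \<bullet> x = 1 + nrm L \<bullet> ctr}" by (rule affine_hyperplane)
  qed
  then have "ctr \<notin> affine hull L" by auto
  then have "aff_dim (sec L) = aff_dim L + 1"
    unfolding sec_def aff_dim_convex_hull by (simp add: aff_dim_insert)
  moreover have "aff_dim (sec L) \<le> int CARD('n)" using aff_dim_le_DIM[of "sec L"] by simp
  ultimately have "aff_dim (sec L) = int DIM(real^'n)" using d by simp
  then have ri: "rel_interior (sec L) = interior (sec L)" by (rule interior_rel_interior)
  show cl: "closure (interior (sec L)) = sec L"
    using convex_closure_rel_interior[OF sec_convex[of L]] sec_compact[OF L] ri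
    by (simp add: compact_imp_closed closure_closed)
  have "ctr \<in> sec L" unfolding sec_def by (rule hull_inc) simp
  then show "interior (sec L) \<noteq> {}" using cl by auto
qed

end

text \<open>If the values differed at x, they would differ on a relatively open set, which meets
  \<open>U\<close> in a nonempty open set, and such a set is not null. The neighbourhood
  \<open>N\<close> admits singularities away from x.\<close>

lemma continuous_AE_eq:
  fixes f g :: "real^'n \<Rightarrow> real"
  assumes U: "open U" and ae: "AE x in lebesgue_on U. f x = g x" and N: "open N"
    and f: "continuous_on (N \<inter> closure U) f" and g: "continuous_on (N \<inter> closure U) g"
    and x: "x \<in> N" "x \<in> closure U"
  shows "f x = g x"
proof (rule ccontr)
  assume ne: "f x \<noteq> g x"
  have "openin (top_of_set (N \<inter> closure U)) ((N \<inter> closure U) \<inter> (\<lambda>y. f y - g y) -` (- {0}))"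
    by (rule continuous_openin_preimage_gen) (use f g in \<open>auto intro!: continuous_intros\<close>)
  then obtain A where A: "open A" "(N \<inter> closure U) \<inter> (\<lambda>y. f y - g y) -` (- {0}) = (N \<inter> closure U) \<inter> A"
    unfolding openin_open by blast
  have "x \<in> (N \<inter> closure U) \<inter> A" using ne x by (subst A(2)[symmetric]) simp
  then have "x \<in> A \<inter> N" by blast
  moreover have "open (A \<inter> N)" using A(1) N by (rule open_Int)
  ultimately have "(A \<inter> N) \<inter> U \<noteq> {}" using x(2) by (metis open_Int_closure_eq_empty disjoint_iff)
  moreover have "open ((A \<inter> N) \<inter> U)" using A(1) N U by blast
  ultimately have "\<not> negligible ((A \<inter> N) \<inter> U)" using open_not_negligible by blast
  moreover have "AE y in lebesgue. y \<notin> (A \<inter> N) \<inter> U"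
  proof -
    have "AE y in lebesgue. y \<in> U \<longrightarrow> f y = g y"
      using ae U by (simp add: AE_restrict_space_iff)
    then show ?thesis
    proof eventually_elim
      case (elim y)
      show ?case
      proof
        assume y: "y \<in> (A \<inter> N) \<inter> U"
        then have "y \<in> (N \<inter> closure U) \<inter> A" using closure_subset by blast
        then have "y \<in> (\<lambda>y. f y - g y) -` (- {0})" using A(2) by blast
        then show False using elim y by simp
      qed
    qed
  qed
  then have "(A \<inter> N) \<inter> U \<in> null_sets lebesgue"
    using A(1) N U by (subst (asm) AE_iff_null_sets[symmetric]) auto
  ultimately show False by (simp add: negligible_iff_null_sets)
qed

section \<open>Boundary pieces of full dimension\<close>

context star_body
begin

lemma piece_hyperplane: "L \<in> Ls \<Longrightarrow> L \<subseteq> {x. nrm L \<bullet> x = 1 + nrm L \<bullet> ctr}"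
  using nrm_eq by (force simp: inner_diff_right)

lemma nrm_nonzero: "L \<in> Ls \<Longrightarrow> nrm L \<noteq> 0"
proof
  assume L: "L \<in> Ls" and "nrm L = 0"
  moreover obtain b where "b \<in> L" using piece[OF L] by blast
  ultimately show False using nrm_eq[OF L, of b] by simp
qed

lemma piece_aff_dim: "L \<in> Ls \<Longrightarrow> aff_dim L \<le> int CARD('n) - 1"
  using aff_dim_subset[OF piece_hyperplane] aff_dim_hyperplane[OF nrm_nonzero] by fastforce

lemma affine_hull_piece:
  assumes L: "L \<in> Ls" and d: "aff_dim L \<ge> int CARD('n) - 1"
  shows "affine hull L = {x. nrm L \<bullet> x = 1 + nrm L \<bullet> ctr}"
proof (rule affine_dim_equal)
  show "affine {x. nrm L \<bullet> x = 1 + nrm L \<bullet> ctr}" by (rule affine_hyperplane)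
  show "affine hull L \<noteq> {}" using piece[OF L] by simp
  show "affine hull L \<subseteq> {x. nrm L \<bullet> x = 1 + nrm L \<bullet> ctr}"
    by (rule hull_minimal[OF piece_hyperplane[OF L]]) (rule affine_hyperplane)
  show "aff_dim (affine hull L) = aff_dim {x. nrm L \<bullet> x = 1 + nrm L \<bullet> ctr}"
    using piece_aff_dim[OF L] d aff_dim_hyperplane[OF nrm_nonzero[OF L], of "1 + nrm L \<bullet> ctr"] by simp
qed simp

text \<open>Near a relative interior point of a piece of full dimension, central projection onto its
  hyperplane lands in the piece, so every point not beyond the hyperplane belongs to the
  sector.\<close>

lemma half_ball:
  assumes L: "L \<in> Ls" and d: "aff_dim L \<ge> int CARD('n) - 1" and q: "q \<in> rel_interior L"
  obtains \<delta> where "\<delta> > 0" "\<And>z. dist q z < \<delta> \<Longrightarrow> nrm L \<bullet> (z - ctr) \<le> 1 \<Longrightarrow> z \<in> B"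
proof -
  let ?n = "nrm L"
  have qL: "q \<in> L" using q rel_interior_subset by blast
  obtain e where e: "e > 0" "ball q e \<inter> affine hull L \<subseteq> L" using q unfolding mem_rel_interior_ball by blast
  \<comment> \<open>Central projection from \<open>ctr\<close> onto the hyperplane of height 1; it
    fixes q.\<close>
  define h where "h z = ctr + (1 / (?n \<bullet> (z - ctr))) *\<^sub>R (z - ctr)" for z
  have nq: "?n \<bullet> (q - ctr) = 1" by (rule nrm_eq[OF L qL])
  have hq: "h q = q" by (simp add: h_def nq)
  have "isCont h q" unfolding h_def[abs_def] by (intro continuous_intros) (simp add: nq)
  then obtain d1 where d1: "d1 > 0" "\<And>z. dist z q < d1 \<Longrightarrow> dist (h z) (h q) < e"
    using e(1) unfolding continuous_at_eps_delta by metis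
  have "isCont (\<lambda>z. ?n \<bullet> (z - ctr)) q" by (intro continuous_intros)
  then obtain d2 where d2: "d2 > 0" "\<And>z. dist z q < d2 \<Longrightarrow> dist (?n \<bullet> (z - ctr)) (?n \<bullet> (q - ctr)) < 1"
    unfolding continuous_at_eps_delta by (metis zero_less_one)
  show thesis
  proof (rule that[of "min d1 d2"])
    show "min d1 d2 > 0" using d1 d2 by simp
    fix z assume z: "dist q z < min d1 d2" "?n \<bullet> (z - ctr) \<le> 1"
    have pos: "?n \<bullet> (z - ctr) > 0" using d2(2)[of z] z(1) nq by (simp add: dist_commute dist_real_def)
    have hz: "h z \<in> ball q e" using d1(2)[of z] z(1) by (simp add: dist_commute hq)
    have "?n \<bullet> (h z - ctr) = 1" using pos by (simp add: h_def)
    then have "h z \<in> affine hull L" unfolding affine_hull_piece[OF L d] by (simp add: inner_diff_right)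
    then have "h z \<in> L" using hz e(2) by blast
    moreover have "z = ctr + (?n \<bullet> (z - ctr)) *\<^sub>R (h z - ctr)" using pos by (simp add: h_def)
    ultimately have "z \<in> sec L" unfolding sec_iff[OF L] using pos z(2) by (meson less_imp_le)
    then show "z \<in> B" using sec_subset[OF L] by blast
  qed
qed

end

text \<open>Joining a set of codimension two to one point gives a null set. A segment from y to a
  point outside this hull can meet \<open>F\<close> only in y.\<close>

lemma negligible_affine_hull_insert:
  fixes F :: "(real^'n) set"
  assumes "aff_dim F \<le> int CARD('n) - 2"
  shows "negligible (affine hull (insert y F))"
proof -
  have "aff_dim (affine hull (insert y F)) \<le> aff_dim F + 1" by (simp add: aff_dim_insert)
  then have "interior (affine hull (insert y F)) = {}" using assms by (intro low_dim_interior) auto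
  then show ?thesis using negligible_convex_interior affine_imp_convex affine_affine_hull by blast
qed

locale polytopal_mesh =
  fixes \<Omega> :: "(real^'n::finite) set" and \<tau> :: sector_type and T :: "'n S_element set"
  assumes mesh: "S_mesh \<Omega> \<tau> T" and dimension: "CARD('n) \<ge> 2"
begin

section \<open>The domain of a mesh and its facets\<close>

lemma finite_T: "finite T" and element: "S \<in> T \<Longrightarrow> is_S_element \<tau> S"
  and disjoint: "S \<in> T \<Longrightarrow> S' \<in> T \<Longrightarrow> S \<noteq> S' \<Longrightarrow> interior (body S) \<inter> interior (body S') = {}"
  and domain: "\<Omega> = interior (\<Union>S\<in>T. body S)" and conforming: "conforming_facets (mesh_facets T)"
  using mesh unfolding S_mesh_def by blast+

lemma star: "S \<in> T \<Longrightarrow> star_body (body S) (center S) (facets S)"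
  by (rule S_element_star_body[OF element dimension])

lemma facet: 
  assumes "L \<in> mesh_facets T"
  shows "convex L" "compact L" "L \<noteq> {}" "aff_dim L \<ge> int CARD('n) - 1" "polytope L"
proof -
  have "facet_shape \<tau> L" using assms element unfolding mesh_facets_def is_S_element_def by blast
  from facet_shape_properties[OF this dimension]
  show "convex L" "compact L" "L \<noteq> {}" "aff_dim L \<ge> int CARD('n) - 1" "polytope L" by blast+
qed

lemma mesh_facetI: "S \<in> T \<Longrightarrow> L \<in> facets S \<Longrightarrow> L \<in> mesh_facets T"
  unfolding mesh_facets_def by blast

lemma body_closed: "S \<in> T \<Longrightarrow> compact (body S)"
  using star star_body.compact by blast

lemma union_closed: "closed (\<Union>S\<in>T. body S)" "bounded (\<Union>S\<in>T. body S)"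
  using finite_T body_closed by (auto intro!: compact_imp_closed compact_imp_bounded closed_UN bounded_UN)

lemma domain_open_bounded: "open \<Omega>" "bounded \<Omega>" "\<Omega> \<in> sets lebesgue"
  using union_closed(2) bounded_subset[OF _ interior_subset] by (auto simp: domain)

lemma interior_body_subset: "S \<in> T \<Longrightarrow> interior (body S) \<subseteq> \<Omega>"
  unfolding domain by (rule interior_mono) blast

lemma body_closure_interior: "S \<in> T \<Longrightarrow> closure (interior (body S)) = body S"
  using star[of S] star_body.convex star_body.compact star_body.center convex_closure_interior
  by (metis compact_imp_closed closure_closed empty_iff)

lemma body_subset: "S \<in> T \<Longrightarrow> body S \<subseteq> closure \<Omega>"
  using closure_mono[OF interior_body_subset] body_closure_interior by blast

lemma closure_domain: "closure \<Omega> \<subseteq> (\<Union>S\<in>T. body S)"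
  unfolding domain by (rule closure_minimal[OF interior_subset union_closed(1)])

lemma facet_subset: "L \<in> mesh_facets T \<Longrightarrow> L \<subseteq> closure \<Omega>"
proof -
  assume "L \<in> mesh_facets T"
  then obtain S where S: "S \<in> T" "L \<in> facets S" unfolding mesh_facets_def by blast
  then show "L \<subseteq> closure \<Omega>" using star_body.piece_subset(2)[OF star[OF S(1)] S(2)] body_subset[OF S(1)] by blast
qed

lemma frontier_bodyE:
  assumes "S \<in> T" "x \<in> body S" "x \<notin> interior (body S)"
  obtains L where "L \<in> facets S" "x \<in> L"
proof -
  have "x \<in> frontier (body S)" using assms(2,3) closure_subset unfolding frontier_def by blast
  then show thesis using that star_body.cover[OF star[OF assms(1)]] by blast
qed

lemma finite_facets: "finite (mesh_facets T)"
  unfolding mesh_facets_def using finite_T star_body.finite[OF star] by blast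

text \<open>Points just beyond the facet along its normal are in \<Omega> but not in this body, so p
  is a limit of points of the other bodies and lies in one of them, on its boundary. Conformity then
  matches the facets.\<close>

lemma interior_facet_shared:
  assumes S: "S \<in> T" "L \<in> facets S" and p: "p \<in> rel_interior L" "p \<in> \<Omega>"
  shows "\<exists>S'\<in>T. S' \<noteq> S \<and> L \<in> facets S'"
proof -
  interpret star_body "body S" "center S" "facets S" by (rule star[OF S(1)])
  have pL: "p \<in> L" using p(1) rel_interior_subset by blast
  let ?n = "nrm L"
  let ?C = "\<Union>S'\<in>T - {S}. body S'"
  have "closed ?C" using finite_T body_closed by (auto intro!: closed_UN compact_imp_closed)
  moreover have "(\<lambda>m. p + (1 / real (Suc m)) *\<^sub>R ?n) \<longlonglongrightarrow> p"
  proof -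
    have "(\<lambda>m. 1 / real (Suc m)) \<longlonglongrightarrow> 0" using LIMSEQ_inverse_real_of_nat by (simp add: inverse_eq_divide)
    from tendsto_add[OF tendsto_const[of p] tendsto_scaleR[OF this tendsto_const[of ?n]]] show ?thesis by simp
  qed
  moreover from this have "\<forall>\<^sub>F m in sequentially. p + (1 / real (Suc m)) *\<^sub>R ?n \<in> \<Omega>"
    using topological_tendstoD[OF _ domain_open_bounded(1) p(2)] by blast
  then have "\<forall>\<^sub>F m in sequentially. p + (1 / real (Suc m)) *\<^sub>R ?n \<in> ?C"
  proof eventually_elim
    case (elim m)
    have "?n \<bullet> ((p + (1 / real (Suc m)) *\<^sub>R ?n) - center S) = 1 + (1 / real (Suc m)) * (?n \<bullet> ?n)"
      using nrm_eq[OF S(2) pL] by (simp add: inner_diff_right inner_add_right)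
    also have "\<dots> > 1" using nrm_nonzero[OF S(2)] by simp
    finally have "p + (1 / real (Suc m)) *\<^sub>R ?n \<notin> body S" using nrm_le[OF S(2)] not_less by blast
    moreover have "p + (1 / real (Suc m)) *\<^sub>R ?n \<in> (\<Union>S\<in>T. body S)"
      by (rule subsetD[OF subset_trans[OF closure_subset closure_domain] elim])
    ultimately show ?case by blast
  qed
  ultimately have "p \<in> ?C" by (intro Lim_in_closed_set[OF _ _ trivial_limit_sequentially])
  then obtain S' where S': "S' \<in> T" "S' \<noteq> S" "p \<in> body S'" by blast
  have "p \<notin> interior (body S')"
  proof
    assume i: "p \<in> interior (body S')"
    have "p \<in> closure (interior (body S))" using pL piece_subset(2)[OF S(2)] body_closure_interior[OF S(1)] by blast
    then have "interior (body S') \<inter> interior (body S) \<noteq> {}"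
      using i open_Int_closure_eq_empty[OF open_interior, of "body S'" "interior (body S)"] by blast
    then show False using disjoint[OF S'(1) S(1) S'(2)] by blast
  qed
  then obtain L' where L': "L' \<in> facets S'" "p \<in> L'" using frontier_bodyE[OF S'(1,3)] by blast
  have m: "L \<in> mesh_facets T" "L' \<in> mesh_facets T" using mesh_facetI S L'(1) S'(1) by blast+
  have face: "(L \<inter> L') face_of L" "(L \<inter> L') face_of L'" using conforming m unfolding conforming_facets_def by blast+
  \<comment> \<open>A face that meets the relative interior of \<open>L\<close> is all of
    \<open>L\<close>.\<close>
  have "L \<subseteq> L \<inter> L'" by (rule subset_of_face_of[OF face(1) subset_refl]) (use p(1) pL L'(2) in blast)
  then have "L face_of L'" using face(2) by (simp add: inf_absorb1 le_infI2 inf.absorb_iff1)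
  \<comment> \<open>A proper face would have smaller dimension, but both sets have codimension
    one.\<close>
  then have "L = L'"
    using face_of_aff_dim_lt[OF facet(1)[OF m(2)]] facet(4)[OF m(1)] star_body.piece_aff_dim[OF star[OF S'(1)] L'(1)] by fastforce
  then show ?thesis using S' L'(1) by blast
qed

text \<open>Each body contains the half of a small ball on its own side of the hyperplane. The sides
  are opposite because the interiors are disjoint, so the halves fill the ball.\<close>

lemma shared_facet_interior:
  assumes S: "S \<in> T" "L \<in> facets S" and S': "S' \<in> T" "L \<in> facets S'" "S' \<noteq> S" and q: "q \<in> rel_interior L"
  shows "q \<in> \<Omega>"
proof -
  interpret A: star_body "body S" "center S" "facets S" by (rule star[OF S(1)])
  interpret A': star_body "body S'" "center S'" "facets S'" by (rule star[OF S'(1)])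
  have d: "aff_dim L \<ge> int CARD('n) - 1" by (rule facet(4)[OF mesh_facetI[OF S]])
  have qL: "q \<in> L" using q rel_interior_subset by blast
  obtain \<delta> where \<delta>: "\<delta> > 0" "\<And>z. dist q z < \<delta> \<Longrightarrow> A.nrm L \<bullet> (z - center S) \<le> 1 \<Longrightarrow> z \<in> body S"
    using A.half_ball[OF S(2) d q] by blast
  obtain \<delta>' where \<delta>': "\<delta>' > 0" "\<And>z. dist q z < \<delta>' \<Longrightarrow> A'.nrm L \<bullet> (z - center S') \<le> 1 \<Longrightarrow> z \<in> body S'"
    using A'.half_ball[OF S'(2) d q] by blast
  have n: "A.nrm L \<bullet> (q - center S) = 1" "A'.nrm L \<bullet> (q - center S') = 1"
    using A.nrm_eq[OF S(2) qL] A'.nrm_eq[OF S'(2) qL] by auto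
  have "ball q (min \<delta> \<delta>') \<subseteq> body S \<union> body S'"
  proof
    fix z assume z: "z \<in> ball q (min \<delta> \<delta>')"
    show "z \<in> body S \<union> body S'"
    proof (rule ccontr)
      assume "\<not> ?thesis"
      then have gt: "A.nrm L \<bullet> (z - center S) > 1" "A'.nrm L \<bullet> (z - center S') > 1"
        using \<delta>(2)[of z] \<delta>'(2)[of z] z by force+
      \<comment> \<open>If z lies beyond both hyperplanes, its mirror image in q lies strictly on
        the inner side of both, so this open subset of both bodies would be nonempty.\<close>
      define W where "W = ball q (min \<delta> \<delta>') \<inter> {y. A.nrm L \<bullet> (y - center S) < 1} \<inter> {y. A'.nrm L \<bullet> (y - center S') < 1}"
      have "open W" unfolding W_def
        by (intro open_Int open_ball open_Collect_less continuous_intros)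
      moreover have "W \<subseteq> body S" "W \<subseteq> body S'" using \<delta>(2) \<delta>'(2) by (auto simp: W_def)
      ultimately have "W \<subseteq> interior (body S) \<inter> interior (body S')" by (simp add: interior_maximal)
      then have "W = {}" using disjoint[OF S'(1) S(1) S'(3)] by blast
      moreover have "2 *\<^sub>R q - z \<in> W"
      proof -
        have "q - (2 *\<^sub>R q - z) = z - q" by (simp add: scaleR_2)
        then have "dist q (2 *\<^sub>R q - z) = dist q z" by (simp only: dist_norm norm_minus_commute)
        moreover have "v \<bullet> ((2 *\<^sub>R q - z) - c) = 2 * (v \<bullet> (q - c)) - v \<bullet> (z - c)" for v c
          by (simp add: inner_diff_right)
        ultimately show ?thesis using z gt n by (simp add: W_def)
      qed
      ultimately show False by blast
    qed
  qed
  then have "ball q (min \<delta> \<delta>') \<subseteq> (\<Union>S\<in>T. body S)" using S(1) S'(1) by blast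
  then have "ball q (min \<delta> \<delta>') \<subseteq> \<Omega>" unfolding domain by (rule interior_maximal) simp
  then show ?thesis using \<delta>(1) \<delta>'(1) by auto
qed

text \<open>One point of \<open>L\<close> in \<Omega> yields relative interior points in \<Omega>,
  hence an element on the other side, hence the whole relative interior in \<Omega>.\<close>

lemma rel_interior_facet_in_domain:
  assumes L: "L \<in> mesh_facets T" and n: "\<not> L \<subseteq> frontier \<Omega>"
  shows "rel_interior L \<subseteq> \<Omega>"
proof
  fix q assume q: "q \<in> rel_interior L"
  obtain S where S: "S \<in> T" "L \<in> facets S" using L unfolding mesh_facets_def by blast
  obtain x where x: "x \<in> L" "x \<notin> frontier \<Omega>" using n by blast
  then have "x \<in> \<Omega>" using facet_subset[OF L] domain_open_bounded(1) by (auto simp: frontier_def interior_open)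
  moreover have "x \<in> closure (rel_interior L)"
    using x(1) convex_closure_rel_interior[OF facet(1)[OF L]] closure_subset by blast
  ultimately have "\<Omega> \<inter> rel_interior L \<noteq> {}"
    using open_Int_closure_eq_empty[OF domain_open_bounded(1), of "rel_interior L"] by blast
  then obtain p where "p \<in> rel_interior L" "p \<in> \<Omega>" by blast
  from interior_facet_shared[OF S this] obtain S' where "S' \<in> T" "S' \<noteq> S" "L \<in> facets S'" by blast
  with shared_facet_interior[OF S _ _ _ q] show "q \<in> \<Omega>" by blast
qed

text \<open>Otherwise a segment from the exterior to \<open>\<Omega>\<close> that avoids the relative boundaries of the facets
  would be covered by the disjoint open sets \<open>\<Omega>\<close> and the exterior.\<close>

lemma boundary_facet:
  assumes x: "x \<in> frontier \<Omega>"
  shows "\<exists>L\<in>mesh_facets T. x \<in> L \<and> L \<subseteq> frontier \<Omega>"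
proof (rule ccontr)
  assume "\<not> ?thesis"
  then have inner: "rel_interior L \<subseteq> \<Omega>" if "L \<in> mesh_facets T" "x \<in> L" for L
    using rel_interior_facet_in_domain that by blast
  let ?U = "\<Union>S\<in>T. body S"
  have xc: "x \<in> closure \<Omega>" "x \<notin> \<Omega>" using x domain_open_bounded(1) by (auto simp: frontier_def interior_open)
  let ?K = "\<Union>{L \<in> mesh_facets T. x \<notin> L}"
  have "closed ?K" using finite_facets facet(2) by (auto intro!: closed_Union compact_imp_closed)
  then have "open (- ?K)" "x \<in> - ?K" by auto
  \<comment> \<open>Only facets through x meet this ball, and their relative interiors are in
    \<Omega>.\<close>
  then obtain r where r: "r > 0" "ball x r \<subseteq> - ?K" by (meson openE)
  have "\<not> ball x r \<subseteq> ?U"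
  proof
    assume "ball x r \<subseteq> ?U"
    then have "ball x r \<subseteq> \<Omega>" unfolding domain by (rule interior_maximal) simp
    then show False using xc(2) r(1) centre_in_ball[of x r] by blast
  qed
  then obtain y where y: "y \<in> ball x r" "y \<notin> ?U" by blast
  \<comment> \<open>The facets of the mesh facets make up their relative boundaries and have
    codimension two.\<close>
  define FF where "FF = (\<Union>L\<in>mesh_facets T. {F. F facet_of L})"
  have "finite FF" unfolding FF_def using finite_facets finite_polytope_facets[OF facet(5)] by blast
  have neg: "negligible (affine hull (insert y F))" if F: "F \<in> FF" for F
  proof (rule negligible_affine_hull_insert)
    obtain L where L: "L \<in> mesh_facets T" "F facet_of L" using F unfolding FF_def by blast
    then obtain S where S: "S \<in> T" "L \<in> facets S" unfolding mesh_facets_def by blast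
    have "aff_dim F = aff_dim L - 1" using L(2) by (simp add: facet_of_def)
    then show "aff_dim F \<le> int CARD('n) - 2" using star_body.piece_aff_dim[OF star[OF S(1)] S(2)] by simp
  qed
  let ?Z = "\<Union>F\<in>FF. affine hull (insert y F)"
  have "negligible ?Z" using \<open>finite FF\<close> neg by (intro negligible_Union finite_imageI) auto
  have "open (ball x r \<inter> \<Omega>)" using domain_open_bounded(1) by blast
  moreover have "ball x r \<inter> \<Omega> \<noteq> {}"
    using xc(1) r(1) open_Int_closure_eq_empty[OF open_ball, of x r \<Omega>] by (metis centre_in_ball disjoint_iff)
  ultimately have "\<not> negligible (ball x r \<inter> \<Omega>)" using open_not_negligible by blast
  then have "\<not> ball x r \<inter> \<Omega> \<subseteq> ?Z" using \<open>negligible ?Z\<close> negligible_subset by blast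
  then obtain z where z: "z \<in> ball x r" "z \<in> \<Omega>" "z \<notin> ?Z" by blast
  have seg: "closed_segment y z \<subseteq> ball x r"
    using y(1) z(1) convex_ball convex_contains_segment by blast
  have "closed_segment y z \<subseteq> \<Omega> \<union> - ?U"
  proof
    fix w assume w: "w \<in> closed_segment y z"
    show "w \<in> \<Omega> \<union> - ?U"
    proof (cases "w \<in> ?U")
      case True
      then obtain S where S: "S \<in> T" "w \<in> body S" by blast
      show ?thesis
      proof (cases "w \<in> interior (body S)")
        case True
        then show ?thesis using interior_body_subset[OF S(1)] by blast
      next
        case False
        then obtain L where L: "L \<in> facets S" "w \<in> L" using frontier_bodyE[OF S] by blast
        have Lm: "L \<in> mesh_facets T" by (rule mesh_facetI[OF S(1) L(1)])
        have "x \<in> L" using r(2) seg w L(2) Lm by blast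
        have "w \<in> rel_interior L"
        proof (rule ccontr)
          assume "w \<notin> rel_interior L"
          then have "w \<in> rel_frontier L" using L(2) closure_subset unfolding rel_frontier_def by blast
          then obtain F where F: "F facet_of L" "w \<in> F"
            using rel_frontier_of_polyhedron[OF polytope_imp_polyhedron[OF facet(5)[OF Lm]]] by blast
          then have FF: "F \<in> FF" using Lm unfolding FF_def by blast
          obtain t where t: "0 \<le> t" "t \<le> 1" "w = (1 - t) *\<^sub>R y + t *\<^sub>R z" using w unfolding closed_segment_def by blast
          have "t \<noteq> 0" using t(3) y(2) \<open>w \<in> ?U\<close> by auto
          \<comment> \<open>Solving for z puts it in the affine hull of y and \<open>F\<close>,
            which its choice excludes; t is not 0 because y lies in no body.\<close>
          then have "z = (1 - 1 / t) *\<^sub>R y + (1 / t) *\<^sub>R w" by (simp add: t(3) algebra_simps)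
          moreover have "(1 - 1 / t) *\<^sub>R y + (1 / t) *\<^sub>R w \<in> affine hull (insert y F)"
            by (rule mem_affine[OF affine_affine_hull]) (use F(2) in \<open>auto intro: hull_inc\<close>)
          ultimately show False using z(3) FF by blast
        qed
        then show ?thesis using inner[OF Lm \<open>x \<in> L\<close>] by blast
      qed
    qed blast
  qed
  moreover have "\<Omega> \<inter> - ?U = {}" unfolding domain using interior_subset by blast
  moreover have "open (- ?U)" using union_closed(1) unfolding open_closed double_complement .
  ultimately have "\<Omega> \<inter> closed_segment y z = {} \<or> - ?U \<inter> closed_segment y z = {}"
    by (intro connectedD[OF connected_segment domain_open_bounded(1)]) blast+
  moreover have "z \<in> \<Omega> \<inter> closed_segment y z" using z(2) by (rule IntI) (rule ends_in_segment)
  moreover have "y \<in> - ?U \<inter> closed_segment y z" by (rule IntI[OF iffD2[OF Compl_iff y(2)]]) (rule ends_in_segment)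
  ultimately show False by (elim disjE) (simp_all only: empty_iff)
qed

lemma frontier_subset_skeleton: "frontier \<Omega> \<subseteq> skeleton T"
  using boundary_facet unfolding skeleton_def by blast

end

section \<open>Radial corrections of finite element functions\<close>

lemma AE_lebesgue_on_iff:
  "V \<in> sets lebesgue \<Longrightarrow> (AE x in lebesgue_on V. P x) \<longleftrightarrow> (AE x in lebesgue. x \<in> V \<longrightarrow> P x)"
  by (rule AE_restrict_space_iff) simp

lemma continuous_bounded_L2:
  fixes f :: "real^'n \<Rightarrow> 'b::euclidean_space"
  assumes "open U" "bounded U" "continuous_on U f" "\<And>x. x \<in> U \<Longrightarrow> norm (f x) \<le> K"
  shows "f \<in> L2 U"
  unfolding L2_eq
proof (rule square_integrable_bounded[OF finite_measure_bounded_open[OF assms(1,2)], where C = K])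
  show "f \<in> borel_measurable (lebesgue_on U)"
    by (rule continuous_imp_measurable_on_sets_lebesgue[OF assms(3)]) (use assms(1) in simp)
  show "AE x in lebesgue_on U. norm (f x) \<le> K"
    by (rule AE_I2) (use assms(4) in \<open>simp add: space_restrict_space\<close>)
qed

section \<open>Gradients on the cones over the pieces\<close>

context star_body
begin

text \<open>\<open>hgt\<close> and \<open>cproj\<close> agree with \<xi> and \<open>proj\<close> on
  the sector over \<open>L\<close>, but are given by one smooth formula where the height is
  positive, so they can be differentiated there.\<close>

definition hgt :: "(real^'n) set \<Rightarrow> real^'n \<Rightarrow> real" where
  "hgt L x = nrm L \<bullet> (x - ctr)"

definition cproj :: "(real^'n) set \<Rightarrow> real^'n \<Rightarrow> real^'n" where
  "cproj L x = ctr + (1 / hgt L x) *\<^sub>R (x - ctr)"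

text \<open>What is left of the gradient of \<xi>^(j+1) f(b) after taking out \<xi>^j. The
  subtracted inner product removes the derivative of f along the ray, as motion along the ray does
  not change the projected point.\<close>

definition cone_grad :: "(real^'n) set \<Rightarrow> nat \<Rightarrow> (real^'n \<Rightarrow> real) \<Rightarrow> (real^'n \<Rightarrow> real^'n) \<Rightarrow> real^'n \<Rightarrow> real^'n" where
  "cone_grad L j f D b = (real (Suc j) * f b - D b \<bullet> (b - ctr)) *\<^sub>R nrm L + D b"

lemma sector_coordinates:
  assumes "L \<in> Ls" "x \<in> sec L"
  shows "hgt L x = \<xi> x" "cproj L x = proj x"
  using sec_\<xi>[OF assms] by (auto simp: hgt_def cproj_def proj_def)

lemma hgt_pos: "L \<in> Ls \<Longrightarrow> x \<in> interior (sec L) \<Longrightarrow> hgt L x > 0"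
  unfolding hgt_def by (rule sec_interior_\<xi>_pos(1))

lemma continuous_hgt: "continuous_on A (hgt L)"
  unfolding hgt_def[abs_def] by (intro continuous_intros)

lemma continuous_cproj: "(\<And>x. x \<in> A \<Longrightarrow> hgt L x \<noteq> 0) \<Longrightarrow> continuous_on A (cproj L)"
  unfolding cproj_def[abs_def] by (intro continuous_intros continuous_hgt) auto

lemma GDERIV_cone:
  assumes h: "hgt L x > 0" and f: "GDERIV f (cproj L x) :> D (cproj L x)"
  shows "GDERIV (\<lambda>x. hgt L x ^ Suc j * f (cproj L x)) x :> hgt L x ^ j *\<^sub>R cone_grad L j f D (cproj L x)"
proof -
  let ?l = "hgt L x" and ?b = "cproj L x"
  have 1: "(hgt L has_derivative (\<lambda>y. nrm L \<bullet> y)) (at x)"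
    unfolding hgt_def[abs_def] by (auto intro!: derivative_eq_intros)
  have "((\<lambda>x. 1 / hgt L x) has_derivative (\<lambda>y. - (nrm L \<bullet> y) / ?l\<^sup>2)) (at x)"
    using h by (auto intro!: derivative_eq_intros 1 simp: power2_eq_square field_simps)
  from has_derivative_add[OF has_derivative_const[of ctr] has_derivative_scaleR[OF this
      has_derivative_diff[OF has_derivative_ident has_derivative_const[of ctr]]]]
  have 2: "(cproj L has_derivative (\<lambda>y. (1 / ?l) *\<^sub>R y - ((nrm L \<bullet> y) / ?l\<^sup>2) *\<^sub>R (x - ctr))) (at x)"
    unfolding cproj_def[abs_def] by (rule has_derivative_eq_rhs) (simp add: fun_eq_iff)
  have 3: "((\<lambda>x. f (cproj L x)) has_derivative
      (\<lambda>y. ((1 / ?l) *\<^sub>R y - ((nrm L \<bullet> y) / ?l\<^sup>2) *\<^sub>R (x - ctr)) \<bullet> D ?b)) (at x)"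
    by (rule has_derivative_compose[OF 2 f[unfolded gderiv_def]])
  have 4: "((\<lambda>x. hgt L x ^ Suc j) has_derivative (\<lambda>y. real (Suc j) * (nrm L \<bullet> y) * ?l ^ j)) (at x)"
    by (rule has_derivative_eq_rhs[OF has_derivative_power[OF 1, of "Suc j"]]) (simp add: fun_eq_iff)
  have b: "?b - ctr = (1 / ?l) *\<^sub>R (x - ctr)" by (simp add: cproj_def)
  show ?thesis
    unfolding gderiv_def
  proof (rule has_derivative_eq_rhs[OF has_derivative_mult[OF 4 3]], rule ext)
    fix y
    define d e m where "d = (x - ctr) \<bullet> D ?b" and "e = y \<bullet> D ?b" and "m = nrm L \<bullet> y"
    have "y \<bullet> (?l ^ j *\<^sub>R cone_grad L j f D ?b) = ?l ^ j * ((real (Suc j) * f ?b - d / ?l) * m + e)"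
      unfolding cone_grad_def b d_def e_def m_def by (simp add: inner_add_right inner_commute)
    moreover have "((1 / ?l) *\<^sub>R y - ((nrm L \<bullet> y) / ?l\<^sup>2) *\<^sub>R (x - ctr)) \<bullet> D ?b = e / ?l - m / ?l\<^sup>2 * d"
      unfolding d_def e_def m_def by (simp add: inner_diff_left)
    moreover have "?l ^ Suc j * (e / ?l - m / ?l\<^sup>2 * d) + real (Suc j) * m * ?l ^ j * f ?b
        = ?l ^ j * ((real (Suc j) * f ?b - d / ?l) * m + e)"
      using h by (simp add: field_simps power2_eq_square)
    ultimately show "?l ^ Suc j * (((1 / ?l) *\<^sub>R y - ((nrm L \<bullet> y) / ?l\<^sup>2) *\<^sub>R (x - ctr)) \<bullet> D ?b) +
        real (Suc j) * (nrm L \<bullet> y) * ?l ^ j * f ?b = y \<bullet> (?l ^ j *\<^sub>R cone_grad L j f D ?b)"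
      by (simp only: m_def)
  qed
qed

lemma continuous_cone_grad:
  assumes "continuous_on UNIV f" "continuous_on UNIV D"
  shows "continuous_on UNIV (cone_grad L j f D)"
  unfolding cone_grad_def[abs_def] by (intro continuous_intros assms)

lemma bounded_on_pieces:
  fixes k :: nat
  assumes "\<And>L j. L \<in> Ls \<Longrightarrow> j < k \<Longrightarrow> continuous_on UNIV (H L j :: real^'n \<Rightarrow> 'b::real_normed_vector)"
  obtains K where "K \<ge> 0" "\<And>L j b. L \<in> Ls \<Longrightarrow> j < k \<Longrightarrow> b \<in> L \<Longrightarrow> norm (H L j b) \<le> (K::real)"
proof -
  have "compact (H L j ` L)" if "L \<in> Ls" "j < k" for L j
    using compact_continuous_image[OF continuous_on_subset[OF assms[OF that] subset_UNIV]] piece[OF that(1)] by blast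
  then have "bounded (\<Union>L\<in>Ls. \<Union>j<k. H L j ` L)" using finite by (intro bounded_UN ballI compact_imp_bounded) auto
  from iffD1[OF bounded_iff this] obtain K where K: "\<forall>y\<in>(\<Union>L\<in>Ls. \<Union>j<k. H L j ` L). norm y \<le> K" ..
  show thesis
  proof (rule that[of "max 0 K"])
    fix L j b assume "L \<in> Ls" "j < k" "b \<in> L"
    then have "H L j b \<in> (\<Union>L\<in>Ls. \<Union>j<k. H L j ` L)" by blast
    from bspec[OF K this] show "norm (H L j b) \<le> max 0 K" by simp
  qed simp
qed

text \<open>The constant \<open>f 0\<close> has no gradient, and every other term carries a factor
  \<xi> that cancels the 1/\<xi> from the projection. The classical gradient is thus bounded and
  equals the given weak one by uniqueness.\<close>

lemma sector_gradient:
  fixes w :: "real^'n \<Rightarrow> real"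
  assumes L: "L \<in> Ls" and D: "\<And>j x. j \<le> k \<Longrightarrow> GDERIV (f j) x :> D j x" "\<And>j. j \<le> k \<Longrightarrow> continuous_on UNIV (D j)"
    and f0: "\<And>b. f 0 b = c"
    and w: "w \<in> L2 (interior (sec L))" "g \<in> L2 (interior (sec L))" "weak_gradient (interior (sec L)) w g"
      "AE x in lebesgue_on (interior (sec L)). w x = (\<Sum>j\<le>k. \<xi> x ^ j * f j (proj x))"
  shows "AE x in lebesgue_on (interior (sec L)).
    g x = (\<Sum>j<k. \<xi> x ^ j *\<^sub>R cone_grad L j (f (Suc j)) (D (Suc j)) (proj x))"
proof -
  let ?V = "interior (sec L)"
  define W where "W x = c + (\<Sum>j<k. hgt L x ^ Suc j * f (Suc j) (cproj L x))" for x
  define G where "G x = (\<Sum>j<k. hgt L x ^ j *\<^sub>R cone_grad L j (f (Suc j)) (D (Suc j)) (cproj L x))" for x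
  have V: "open ?V" "bounded ?V" "?V \<in> sets lebesgue"
    using bounded_subset[OF compact_imp_bounded[OF sec_compact[OF L]] interior_subset] by auto
  have GD: "GDERIV W x :> G x" if x: "x \<in> ?V" for x
  proof -
    have "((\<lambda>x. \<Sum>j<k. hgt L x ^ Suc j * f (Suc j) (cproj L x)) has_derivative
        (\<lambda>y. \<Sum>j<k. y \<bullet> (hgt L x ^ j *\<^sub>R cone_grad L j (f (Suc j)) (D (Suc j)) (cproj L x)))) (at x)"
      by (rule has_derivative_sum, rule GDERIV_cone[unfolded gderiv_def, OF hgt_pos[OF L x]])
        (use D(1)[unfolded gderiv_def] in auto)
    from has_derivative_add[OF has_derivative_const[of c] this] show ?thesis
      unfolding gderiv_def W_def[abs_def] G_def by (simp add: inner_sum_right)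
  qed
  have fc: "continuous_on UNIV (f j)" if "j \<le> k" for j
    by (rule GDERIV_continuous_on) (rule D(1)[OF that])
  have cg: "continuous_on UNIV (cone_grad L j (f (Suc j)) (D (Suc j)))" if "j < k" for j L
    using that by (intro continuous_cone_grad fc D(2)) auto
  have cp: "continuous_on ?V (cproj L)" by (rule continuous_cproj) (use hgt_pos[OF L] in force)
  have Gc: "continuous_on ?V G"
    unfolding G_def[abs_def]
    by (intro continuous_on_sum continuous_on_scaleR continuous_on_power continuous_hgt
        continuous_on_compose2[OF cg cp]) auto
  have Wc: "continuous_on ?V W"
    unfolding W_def[abs_def]
    by (intro continuous_on_add continuous_on_const continuous_on_sum continuous_on_mult continuous_on_power continuous_hgt
        continuous_on_compose2[OF fc cp]) auto
  obtain K where K: "\<And>L j b. L \<in> Ls \<Longrightarrow> j < k \<Longrightarrow> b \<in> L \<Longrightarrow> norm (cone_grad L j (f (Suc j)) (D (Suc j)) b) \<le> (K::real)"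
    by (rule bounded_on_pieces[of k "\<lambda>L j. cone_grad L j (f (Suc j)) (D (Suc j))", OF cg]) blast+
  have eq: "W x = (\<Sum>j\<le>k. \<xi> x ^ j * f j (proj x))"
    "G x = (\<Sum>j<k. \<xi> x ^ j *\<^sub>R cone_grad L j (f (Suc j)) (D (Suc j)) (proj x))" if "x \<in> ?V" for x
  proof -
    have "x \<in> sec L" using that interior_subset by blast
    note c = sector_coordinates[OF L this]
    show "W x = (\<Sum>j\<le>k. \<xi> x ^ j * f j (proj x))" unfolding W_def c sum.atMost_shift by (simp add: f0)
    show "G x = (\<Sum>j<k. \<xi> x ^ j *\<^sub>R cone_grad L j (f (Suc j)) (D (Suc j)) (proj x))" unfolding G_def c by simp
  qed
  have G2: "G \<in> L2 ?V"
  proof (rule continuous_bounded_L2[OF V(1,2) Gc])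
    fix x assume x: "x \<in> ?V"
    have xi: "0 \<le> \<xi> x" "\<xi> x \<le> 1" using \<xi>_nonneg interior_iff sec_interior_subset[OF L] x by (auto intro: less_imp_le)
    have "norm (G x) \<le> (\<Sum>j<k. norm (\<xi> x ^ j *\<^sub>R cone_grad L j (f (Suc j)) (D (Suc j)) (proj x)))"
      unfolding eq(2)[OF x] by (rule norm_sum)
    also have "\<dots> \<le> (\<Sum>j<k. 1 * K)"
    proof (rule sum_mono)
      fix j assume j: "j \<in> {..<k}"
      have "\<bar>\<xi> x ^ j\<bar> \<le> 1" using xi by (simp add: power_le_one)
      moreover have "norm (cone_grad L j (f (Suc j)) (D (Suc j)) (proj x)) \<le> K"
        using K[of L j "proj x"] L j sec_interior_\<xi>_pos(3)[OF L x] by auto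
      ultimately show "norm (\<xi> x ^ j *\<^sub>R cone_grad L j (f (Suc j)) (D (Suc j)) (proj x)) \<le> 1 * K"
        unfolding norm_scaleR real_norm_def by (rule mult_mono) auto
    qed
    finally show "norm (G x) \<le> (\<Sum>j<k. 1 * K)" .
  qed
  have sp: "AE x in lebesgue_on ?V. x \<in> ?V" by (rule AE_I2) (simp add: space_restrict_space)
  have ae: "AE x in lebesgue_on ?V. W x = w x" using w(4) sp by eventually_elim (simp add: eq)
  have W2: "W \<in> L2 ?V"
    using square_integrable_AE_cong[OF w(1)[unfolded L2_eq] continuous_imp_measurable_on_sets_lebesgue[OF Wc V(3)] ae]
    unfolding L2_eq .
  have "weak_gradient ?V W G" by (rule weak_gradient_C1[OF V(1) GD Gc])
  then have "weak_gradient ?V w G"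
    by (rule weak_gradient_cong_AE[OF _ W2 w(1) G2 G2 ae _ V(3)]) simp
  from weak_gradient_unique[OF V(1,2) w(2,3) G2 this] sp show ?thesis
    by eventually_elim (simp add: eq)
qed

text \<open>Off the center exactly one summand is active, and it depends on x only through the
  projection.\<close>

lemma piecewise_homogeneous:
  fixes f :: "(real^'n) set \<Rightarrow> real^'n \<Rightarrow> real"
  assumes A: "\<And>L. A L \<in> sets borel" "\<And>L x. x \<in> A L \<Longrightarrow> L \<in> Ls \<and> x \<noteq> ctr \<and> proj x \<in> L"
      "\<And>x. x \<noteq> ctr \<Longrightarrow> \<exists>!L. x \<in> A L" "\<And>L t y. t > 0 \<Longrightarrow> ctr + t *\<^sub>R y \<in> A L \<longleftrightarrow> ctr + y \<in> A L"
    and f: "\<And>L. L \<in> Ls \<Longrightarrow> continuous_on UNIV (f L)"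
    and s: "s = (\<lambda>x. \<Sum>L\<in>Ls. indicator (A L) x * f L (proj x))"
  shows "s \<in> borel_measurable borel" "\<exists>K. \<forall>x. \<bar>s x\<bar> \<le> K" "homogeneous0 s"
    "integrable (lebesgue_on (interior B)) s" "\<And>L x. x \<in> A L \<Longrightarrow> s x = f L (proj x)"
proof -
  show m: "s \<in> borel_measurable borel"
    unfolding s
    by (intro borel_measurable_sum borel_measurable_times borel_measurable_indicator A(1)
        measurable_compose[OF measurable_proj borel_measurable_continuous_onI] f)
  obtain K where K: "K \<ge> 0" "\<And>L j b. L \<in> Ls \<Longrightarrow> j < (1::nat) \<Longrightarrow> b \<in> L \<Longrightarrow> norm (f L b) \<le> K"
    by (rule bounded_on_pieces[of 1 "\<lambda>L _. f L", OF f]) blast+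
  have bd: "\<bar>s x\<bar> \<le> (\<Sum>L\<in>Ls. K)" for x
    unfolding s
  proof (rule order_trans[OF sum_abs], rule sum_mono)
    fix L assume L: "L \<in> Ls"
    show "\<bar>indicator (A L) x * f L (proj x)\<bar> \<le> K"
      using K(1) K(2)[OF L, of 0 "proj x"] A(2)[of x L] by (cases "x \<in> A L") auto
  qed
  then show "\<exists>K. \<forall>x. \<bar>s x\<bar> \<le> K" by blast
  show "homogeneous0 s"
    unfolding homogeneous0_def s by (simp add: indicator_def A(4) proj_scale)
  have "s \<in> borel_measurable lebesgue" using m by (simp add: measurable_completion)
  then have "s \<in> square_integrable (lebesgue_on (interior B))"
    by (rule bounded_measurable_square_integrable[OF interior_open_bounded(1,2), where K = "\<Sum>L\<in>Ls. K"]) (use bd in simp)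
  then show "integrable (lebesgue_on (interior B)) s"
    by (rule square_integrable_imp_integrable[OF finite_measure_bounded_open[OF interior_open_bounded(1,2)]])
  fix L x assume x: "x \<in> A L"
  have L: "L \<in> Ls" using A(2)[OF x] by blast
  have "indicator (A L') x * f L' (proj x) = (if L' = L then f L (proj x) else 0)" for L'
  proof (cases "L' = L")
    case False
    then have "x \<notin> A L'" using A(3)[of x] A(2)[OF x] x by blast
    then show ?thesis using False by simp
  qed (use x in simp)
  then show "s x = f L (proj x)" unfolding s using L finite by simp
qed

text \<open>\<open>\<kappa> j\<close> makes the component of \<open>H L j - \<kappa> j *\<^sub>R nrm L\<close> along the gradient of \<open>\<xi>\<close> have mean zero over
  the body.\<close>

lemma mean_zero_coefficients:
  fixes H :: "(real^'n) set \<Rightarrow> nat \<Rightarrow> real^'n \<Rightarrow> real^'n" and k :: nat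
  assumes H: "\<And>L j. L \<in> Ls \<Longrightarrow> j < k \<Longrightarrow> continuous_on UNIV (H L j)"
  shows "\<exists>\<kappa> \<beta>. (\<forall>j<k. \<beta> j \<in> borel_measurable borel \<and> (\<exists>K. \<forall>x. \<bar>\<beta> j x\<bar> \<le> K) \<and> homogeneous0 (\<beta> j) \<and>
      (LINT x|lebesgue_on (interior B). \<beta> j x) = 0) \<and>
    (\<forall>x. x \<noteq> ctr \<longrightarrow> (\<exists>L\<in>Ls. proj x \<in> L \<and> (\<forall>j<k. \<beta> j x = (H L j (proj x) - \<kappa> j *\<^sub>R nrm L) \<bullet> nrm L)))"
proof -
  obtain A where A: "\<And>L. A L \<in> sets borel" "\<And>L x. x \<in> A L \<Longrightarrow> L \<in> Ls \<and> x \<noteq> ctr \<and> proj x \<in> L"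
    "\<And>x. x \<noteq> ctr \<Longrightarrow> \<exists>!L. x \<in> A L" "\<And>L t y. t > 0 \<Longrightarrow> ctr + t *\<^sub>R y \<in> A L \<longleftrightarrow> ctr + y \<in> A L"
    using piece_selection by blast
  define s where "s f = (\<lambda>x. \<Sum>L\<in>Ls. indicator (A L) x * f L (proj x))" for f :: "(real^'n) set \<Rightarrow> real^'n \<Rightarrow> real"
  have s: "s f \<in> borel_measurable borel" "\<exists>K. \<forall>x. \<bar>s f x\<bar> \<le> K" "homogeneous0 (s f)"
      "integrable (lebesgue_on (interior B)) (s f)" "\<And>L x. x \<in> A L \<Longrightarrow> s f x = f L (proj x)"
    if f: "\<And>L. L \<in> Ls \<Longrightarrow> continuous_on UNIV (f L)" for f
    by (rule piecewise_homogeneous[OF A f s_def]; assumption)+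
  define N where "N = s (\<lambda>L b. nrm L \<bullet> nrm L)"
  let ?M = "lebesgue_on (interior B)"
  have Nint: "integrable ?M N" unfolding N_def by (rule s(4)) (auto intro: continuous_intros)
  have Npos: "N x > 0" if x: "x \<noteq> ctr" for x
  proof -
    obtain L where L: "x \<in> A L" using A(3)[OF x] by blast
    have "N x = nrm L \<bullet> nrm L" unfolding N_def by (rule s(5)[OF _ L]) (auto intro: continuous_intros)
    moreover have "nrm L \<noteq> 0" using nrm_nonzero A(2)[OF L] by blast
    ultimately show ?thesis by simp
  qed
  \<comment> \<open>The weight is positive off the center, so a vanishing integral would make the
    constants 0 and 1 agree almost everywhere, which continuity refutes on the nonempty open
    interior.\<close>
  have N0: "integral\<^sup>L ?M N \<noteq> 0"
  proof
    assume 0: "integral\<^sup>L ?M N = 0"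
    have "AE x in ?M. 0 \<le> N x" using AE_interior_not_center by eventually_elim (use Npos in \<open>auto intro: less_imp_le\<close>)
    then have "AE x in ?M. N x = 0" using integral_nonneg_eq_0_iff_AE[OF Nint] 0 by simp
    with AE_interior_not_center have "AE x in ?M. (0::real) = 1"
      by eventually_elim (use Npos in force)
    then have "(\<lambda>_. 0::real) ctr = (\<lambda>_. 1) ctr"
      by (rule continuous_AE_eq[OF interior_open_bounded(1) _ open_UNIV])
        (use center closure_subset in \<open>auto intro: continuous_intros\<close>)
    then show False by simp
  qed
  \<comment> \<open>The mean-zero condition is linear in \<open>\<kappa> j\<close>, and this
    quotient solves it.\<close>
  define \<kappa> where "\<kappa> j = integral\<^sup>L ?M (s (\<lambda>L b. H L j b \<bullet> nrm L)) / integral\<^sup>L ?M N" for j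
  define \<beta> where "\<beta> j = s (\<lambda>L b. (H L j b - \<kappa> j *\<^sub>R nrm L) \<bullet> nrm L)" for j
  have c: "continuous_on UNIV (\<lambda>b. (H L j b - \<kappa> j *\<^sub>R nrm L) \<bullet> nrm L)" "continuous_on UNIV (\<lambda>b. H L j b \<bullet> nrm L)"
    if "L \<in> Ls" "j < k" for L j
    by (intro continuous_intros H that)+
  have "(LINT x|?M. \<beta> j x) = 0" if j: "j < k" for j
  proof -
    have I: "integrable ?M (s (\<lambda>L b. H L j b \<bullet> nrm L))" by (intro s(4) c(2) j)
    have "\<beta> j x = s (\<lambda>L b. H L j b \<bullet> nrm L) x - \<kappa> j * N x" for x
      unfolding \<beta>_def N_def s_def sum_distrib_left sum_subtractf[symmetric]
      by (rule sum.cong) (simp_all add: inner_diff_left right_diff_distrib)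
    then have "(LINT x|?M. \<beta> j x) = integral\<^sup>L ?M (s (\<lambda>L b. H L j b \<bullet> nrm L)) - \<kappa> j * integral\<^sup>L ?M N"
      using Nint I by simp
    then show ?thesis using N0 by (simp add: \<kappa>_def)
  qed
  moreover have "\<beta> j \<in> borel_measurable borel \<and> (\<exists>K. \<forall>x. \<bar>\<beta> j x\<bar> \<le> K) \<and> homogeneous0 (\<beta> j)" if j: "j < k" for j
    unfolding \<beta>_def by (intro conjI s(1,2,3) c(1) j)
  moreover have "\<exists>L\<in>Ls. proj x \<in> L \<and> (\<forall>j<k. \<beta> j x = (H L j (proj x) - \<kappa> j *\<^sub>R nrm L) \<bullet> nrm L)" if x: "x \<noteq> ctr" for x
  proof -
    obtain L where L: "x \<in> A L" using A(3)[OF x] by blast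
    have "\<beta> j x = (H L j (proj x) - \<kappa> j *\<^sub>R nrm L) \<bullet> nrm L" if "j < k" for j
      unfolding \<beta>_def by (rule s(5)[OF _ L]) (rule c(1)[OF _ that])
    then show ?thesis using A(2)[OF L] by blast
  qed
  ultimately show ?thesis by blast
qed

lemma AE_in_sector:
  "AE x in lebesgue_on (interior B). \<forall>L\<in>Ls. proj x \<in> L \<longrightarrow> x \<in> interior (sec L)"
  unfolding AE_lebesgue_on_iff[OF interior_open_bounded(3)]
  using AE_sec
proof eventually_elim
  case (elim x)
  then show ?case using sec_proj interior_subset by blast
qed

lemma AE_sectors:
  assumes "\<And>L. L \<in> Ls \<Longrightarrow> AE x in lebesgue_on (interior (sec L)). P L x"
  shows "AE x in lebesgue_on (interior B). \<forall>L\<in>Ls. proj x \<in> L \<longrightarrow> P L x"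
proof -
  have "AE x in lebesgue. x \<in> interior (sec L) \<longrightarrow> P L x" if "L \<in> Ls" for L
    using assms[OF that] by (subst (asm) AE_lebesgue_on_iff) auto
  then have "AE x in lebesgue. \<forall>L\<in>Ls. x \<in> interior (sec L) \<longrightarrow> P L x" using finite by (intro AE_finite_allI) auto
  from AE_imp_AE_lebesgue_on[OF this interior_open_bounded(3)] AE_in_sector show ?thesis
    by eventually_elim blast
qed

text \<open>The gradient of a radial function is t times \<open>nrm L\<close>, with t its radial
  derivative, so q pairs with it to a sum of terms \<open>\<beta> j x * \<xi> x ^ j * t x\<close>;
  each of them integrates to zero by \<open>radial_moment_div\<close>.\<close>

lemma radial_orthogonality:
  fixes \<psi> :: "real^'n \<Rightarrow> real" and Q :: "(real^'n) set \<Rightarrow> nat \<Rightarrow> real^'n \<Rightarrow> real^'n" and k :: nat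
  assumes \<beta>: "\<And>j. j < k \<Longrightarrow> \<beta> j \<in> borel_measurable borel" "\<And>j. j < k \<Longrightarrow> \<exists>K. \<forall>x. \<bar>\<beta> j x\<bar> \<le> K"
      "\<And>j. j < k \<Longrightarrow> homogeneous0 (\<beta> j)" "\<And>j. j < k \<Longrightarrow> (LINT x|lebesgue_on (interior B). \<beta> j x) = 0"
      "\<And>x. x \<noteq> ctr \<Longrightarrow> \<exists>L\<in>Ls. proj x \<in> L \<and> (\<forall>j<k. \<beta> j x = Q L j (proj x) \<bullet> nrm L)"
    and q: "q \<in> L2 (interior B)"
      "\<And>L. L \<in> Ls \<Longrightarrow> AE x in lebesgue_on (interior (sec L)). q x = (\<Sum>j<k. \<xi> x ^ j *\<^sub>R Q L j (proj x))"
    and \<psi>: "\<psi> \<in> L2 (interior B)" "h \<in> L2 (interior B)" "weak_gradient (interior B) \<psi> h" "\<psi> \<in> H10 (interior B)"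
    and \<sigma>: "continuous_on {0<..1} \<sigma>" and rad: "AE x in lebesgue_on (interior B). \<psi> x = \<sigma> (\<xi> x)"
  shows "(LINT x|lebesgue_on (interior B). q x \<bullet> h x) = 0"
proof -
  let ?M = "lebesgue_on (interior B)"
  define t where "t x = ((x - ctr) \<bullet> h x) / \<xi> x" for x
  \<comment> \<open>Extended by zero to a Borel function on the line; almost everywhere in the
    interior \<xi> takes values where nothing was changed.\<close>
  define \<sigma>' where "\<sigma>' s = (if s \<in> {0<..1} then \<sigma> s else 0)" for s
  have "\<sigma>' \<in> borel_measurable borel"
    unfolding \<sigma>'_def by (rule borel_measurable_continuous_on_if) (use \<sigma> in auto)
  have in_int: "AE x in ?M. x \<in> interior B" by (rule AE_I2) (simp add: space_restrict_space)
  have rad': "AE x in ?M. \<psi> x = \<sigma>' (\<xi> x)"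
    using rad in_int AE_interior_not_center
  proof eventually_elim
    case (elim x)
    have "\<xi> x \<in> {0<..1}" using ray(1)[OF elim(3)] elim(2) interior_iff by (auto intro: less_imp_le)
    then show ?case using elim(1) by (simp add: \<sigma>'_def)
  qed
  obtain C where C: "C > 0" "\<And>x. norm (x - ctr) \<le> C * \<xi> x" using \<xi>_norm_bound by blast
  have int: "integrable ?M (\<lambda>x. \<beta> j x * \<xi> x ^ j * t x)" if j: "j < k" for j
  proof -
    obtain K where K: "\<And>x. \<bar>\<beta> j x\<bar> \<le> K" using \<beta>(2)[OF j] by blast
    have "\<beta> j \<in> borel_measurable lebesgue" using \<beta>(1)[OF j] by (simp add: measurable_completion)
    moreover have "(\<lambda>x. x) \<in> borel_measurable (lebesgue :: (real^'n) measure)"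
      by (rule continuous_imp_lebesgue_measurable) (rule continuous_on_id)
    ultimately have "(\<lambda>x. (\<beta> j x * \<xi> x ^ j / \<xi> x) *\<^sub>R (x - ctr)) \<in> borel_measurable lebesgue"
      using measurable_\<xi>_lebesgue by measurable
    then have "(\<lambda>x. (\<beta> j x * \<xi> x ^ j / \<xi> x) *\<^sub>R (x - ctr)) \<in> square_integrable ?M"
    proof (rule bounded_measurable_square_integrable[OF interior_open_bounded(1,2), where K = "K * 1 * C"])
      fix x assume "x \<in> interior B"
      then have xi: "0 \<le> \<xi> x" "\<xi> x \<le> 1" using \<xi>_nonneg interior_iff by (auto intro: less_imp_le)
      have K0: "0 \<le> K" using K[of x] by linarith
      have "norm ((\<beta> j x * \<xi> x ^ j / \<xi> x) *\<^sub>R (x - ctr)) = \<bar>\<beta> j x\<bar> * \<xi> x ^ j * (norm (x - ctr) / \<xi> x)"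
        using xi by (simp add: abs_mult)
      also have "\<dots> \<le> K * 1 * C"
      proof (intro mult_mono)
        show "norm (x - ctr) / \<xi> x \<le> C" using C(2)[of x] C(1) xi by (cases "\<xi> x = 0") (auto simp: divide_le_eq)
      qed (use K xi K0 in \<open>auto intro: power_le_one\<close>)
      finally show "norm ((\<beta> j x * \<xi> x ^ j / \<xi> x) *\<^sub>R (x - ctr)) \<le> K * 1 * C" .
    qed
    from square_integrable_inner[OF this \<psi>(2)[unfolded L2_eq]]
    show ?thesis by (simp add: t_def)
  qed
  have "(LINT x|?M. q x \<bullet> h x) = (LINT x|?M. (\<Sum>j<k. \<beta> j x * \<xi> x ^ j * t x))"
  proof (rule integral_cong_AE)
    show "(\<lambda>x. q x \<bullet> h x) \<in> borel_measurable ?M" using L2_measurable[OF q(1)] L2_measurable[OF \<psi>(2)] by measurable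
    show "(\<lambda>x. \<Sum>j<k. \<beta> j x * \<xi> x ^ j * t x) \<in> borel_measurable ?M"
      using int by (intro borel_measurable_sum) auto
    have "AE x in ?M. \<forall>L\<in>Ls. proj x \<in> L \<longrightarrow> q x = (\<Sum>j<k. \<xi> x ^ j *\<^sub>R Q L j (proj x))"
      by (rule AE_sectors) (rule q(2))
    moreover have "AE x in ?M. \<forall>L\<in>Ls. proj x \<in> L \<longrightarrow> h x = (((x - ctr) \<bullet> h x) / \<xi> x) *\<^sub>R nrm L"
      by (rule AE_sectors) (rule radial_gradient_parallel[OF _ \<psi>(1,2,3) \<sigma> rad])
    moreover note AE_interior_not_center
    ultimately show "AE x in ?M. q x \<bullet> h x = (\<Sum>j<k. \<beta> j x * \<xi> x ^ j * t x)"
    proof eventually_elim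
      case (elim x)
      obtain L where L: "L \<in> Ls" "proj x \<in> L" "\<And>j. j < k \<Longrightarrow> \<beta> j x = Q L j (proj x) \<bullet> nrm L"
        using \<beta>(5)[OF elim(3)] by blast
      have q: "q x = (\<Sum>j<k. \<xi> x ^ j *\<^sub>R Q L j (proj x))" and h: "h x = t x *\<^sub>R nrm L"
        using elim(1,2) L(1,2) unfolding t_def by blast+
      have "q x \<bullet> h x = (\<Sum>j<k. (\<xi> x ^ j *\<^sub>R Q L j (proj x)) \<bullet> (t x *\<^sub>R nrm L))" unfolding q h inner_sum_left ..
      also have "\<dots> = (\<Sum>j<k. \<beta> j x * \<xi> x ^ j * t x)" by (rule sum.cong) (simp_all add: L(3))
      finally show ?case .
    qed
  qed
  also have "\<dots> = (\<Sum>j<k. LINT x|?M. \<beta> j x * \<xi> x ^ j * t x)"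
    by (rule Bochner_Integration.integral_sum) (use int in blast)
  also have "\<dots> = 0"
  proof (rule sum.neutral, rule ballI)
    fix j assume "j \<in> {..<k}"
    then have j: "j < k" by simp
    obtain K where K: "\<And>x. \<bar>\<beta> j x\<bar> \<le> K" using \<beta>(2)[OF j] by blast
    show "(LINT x|?M. \<beta> j x * \<xi> x ^ j * t x) = 0"
      unfolding t_def
      by (rule radial_moment_div[OF \<beta>(1)[OF j] K \<beta>(3)[OF j] \<beta>(4)[OF j] \<psi> \<open>\<sigma>' \<in> borel_measurable borel\<close> rad'])
  qed
  finally show ?thesis .
qed

text \<open>The trace criterion is used with a neighbourhood that omits the center, where the
  profile may be singular.\<close>

lemma radial_H10:
  assumes "\<psi> \<in> H1 (interior B)" "continuous_on {0<..1} \<sigma>" "\<sigma> 1 = 0"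
    and "AE x in lebesgue_on (interior B). \<psi> x = \<sigma> (\<xi> x)"
  shows "\<psi> \<in> H10 (interior B)"
proof (rule zero_trace_imp_H10[OF interior_open_bounded(1,2) assms(1), where v = "\<lambda>x. \<sigma> (\<xi> x)" and N = "- {ctr}"])
  show "AE x in lebesgue_on (interior B). \<sigma> (\<xi> x) = \<psi> x" using assms(4) by eventually_elim simp
  have fr: "frontier (interior B) \<subseteq> frontier B" by (rule frontier_interior_subset)
  show "frontier (interior B) \<subseteq> - {ctr}" using fr frontier_not_center by blast
  have "closure (interior B) \<subseteq> B" using closure_minimal[OF interior_subset compact_imp_closed[OF compact]] .
  then have "\<xi> x \<in> {0<..1}" if "x \<in> - {ctr} \<inter> closure (interior B)" for x
    using that ray(1)[of x] body_iff by auto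
  then show "continuous_on (- {ctr} \<inter> closure (interior B)) (\<lambda>x. \<sigma> (\<xi> x))"
    by (intro continuous_on_compose2[OF assms(2) continuous_\<xi>]) blast
  show "\<sigma> (\<xi> x) = 0" if "x \<in> frontier (interior B)" for x
    using fr that frontier_iff assms(3) by auto
qed (simp add: open_Compl)

text \<open>The term of index j has derivative \<open>\<kappa> j\<close> s^j on (0,1) and is
  normalised to vanish at 1; the minimum extends it by zero beyond the body.\<close>

definition radial_profile :: "nat \<Rightarrow> (nat \<Rightarrow> real) \<Rightarrow> real \<Rightarrow> real" where
  "radial_profile k \<kappa> s = (\<Sum>j<k. \<kappa> j / real (Suc j) * (min 1 s ^ Suc j - 1))"

text \<open>The choice of sector is immaterial: where interiors of sectors overlap, the normals
  agree as gradients of \<xi>.\<close>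

definition radial_profile_grad :: "nat \<Rightarrow> (nat \<Rightarrow> real) \<Rightarrow> real^'n \<Rightarrow> real^'n" where
  "radial_profile_grad k \<kappa> x =
    (if x \<in> interior B \<and> (\<exists>L\<in>Ls. x \<in> interior (sec L))
     then (\<Sum>j<k. \<kappa> j * \<xi> x ^ j) *\<^sub>R nrm (SOME L. L \<in> Ls \<and> x \<in> interior (sec L)) else 0)"

lemma continuous_radial_profile: "continuous_on A (radial_profile k \<kappa>)"
  unfolding radial_profile_def[abs_def] by (intro continuous_intros)

lemma radial_profile_1: "s \<ge> 1 \<Longrightarrow> radial_profile k \<kappa> s = 0"
  by (simp add: radial_profile_def)

lemma radial_profile_Lipschitz:
  assumes "s \<ge> 0" "t \<ge> 0"
  shows "\<bar>radial_profile k \<kappa> s - radial_profile k \<kappa> t\<bar> \<le> (\<Sum>j<k. \<bar>\<kappa> j\<bar>) * \<bar>s - t\<bar>"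
proof -
  have "radial_profile k \<kappa> s - radial_profile k \<kappa> t
      = (\<Sum>j<k. \<kappa> j / real (Suc j) * (min 1 s ^ Suc j - min 1 t ^ Suc j))"
    unfolding radial_profile_def sum_subtractf[symmetric] by (rule sum.cong) (simp_all add: right_diff_distrib)
  also have "\<bar>\<dots>\<bar> \<le> (\<Sum>j<k. \<bar>\<kappa> j\<bar> * \<bar>s - t\<bar>)"
  proof (rule order_trans[OF sum_abs], rule sum_mono)
    fix j
    have "\<bar>min 1 s ^ Suc j - min 1 t ^ Suc j\<bar> \<le> real (Suc j) * \<bar>min 1 s - min 1 t\<bar>"
      using norm_power_diff[of "min 1 s" "min 1 t" "Suc j"] assms unfolding real_norm_def by auto
    also have "\<dots> \<le> real (Suc j) * \<bar>s - t\<bar>" by (intro mult_left_mono) auto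
    finally have "\<bar>\<kappa> j / real (Suc j)\<bar> * \<bar>min 1 s ^ Suc j - min 1 t ^ Suc j\<bar>
        \<le> \<bar>\<kappa> j / real (Suc j)\<bar> * (real (Suc j) * \<bar>s - t\<bar>)" by (intro mult_left_mono) auto
    also have "\<dots> = \<bar>\<kappa> j\<bar> * \<bar>s - t\<bar>" by (simp add: abs_divide del: of_nat_Suc)
    finally show "\<bar>\<kappa> j / real (Suc j) * (min 1 s ^ Suc j - min 1 t ^ Suc j)\<bar> \<le> \<bar>\<kappa> j\<bar> * \<bar>s - t\<bar>"
      by (simp only: abs_mult)
  qed
  finally show ?thesis by (simp add: sum_distrib_right)
qed

lemma radial_profile_grad_sector:
  assumes "L \<in> Ls" "x \<in> interior (sec L)"
  shows "radial_profile_grad k \<kappa> x = (\<Sum>j<k. \<kappa> j * \<xi> x ^ j) *\<^sub>R nrm L"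
proof -
  define L' where "L' = (SOME L. L \<in> Ls \<and> x \<in> interior (sec L))"
  have "\<exists>L. L \<in> Ls \<and> x \<in> interior (sec L)" using assms by blast
  then have "L' \<in> Ls \<and> x \<in> interior (sec L')" unfolding L'_def by (rule someI_ex)
  then have "nrm L' = nrm L" using GDERIV_unique[OF GDERIV_\<xi> GDERIV_\<xi>[OF assms]] by blast
  moreover have "x \<in> interior B" using sec_interior_subset assms by blast
  ultimately show ?thesis unfolding radial_profile_grad_def L'_def[symmetric] using assms by auto
qed

lemma radial_profile_grad_outside: "x \<notin> interior B \<Longrightarrow> radial_profile_grad k \<kappa> x = 0"
  by (simp add: radial_profile_grad_def)

text \<open>Off a null set, either \<xi> exceeds 1 and the profile vanishes nearby, or x is interior
  to a sector, where \<xi> is linear.\<close>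

lemma AE_GDERIV_radial_profile:
  "AE x in lebesgue. GDERIV (\<lambda>x. radial_profile k \<kappa> (\<xi> x)) x :> radial_profile_grad k \<kappa> x"
  using AE_frontier AE_sec
proof eventually_elim
  case (elim x)
  show ?case
  proof (cases "\<xi> x < 1")
    case False
    then have x: "\<xi> x > 1" using elim(1) by linarith
    have "GDERIV (\<lambda>_. 0) x :> 0" by (simp add: gderiv_def)
    then have "GDERIV (\<lambda>x. radial_profile k \<kappa> (\<xi> x)) x :> 0"
    proof (rule GDERIV_transform_open)
      show "open {y. 1 < \<xi> y}" by (rule open_Collect_less[OF continuous_on_const continuous_\<xi>])
    qed (use x in \<open>auto simp: radial_profile_1\<close>)
    then show ?thesis using x interior_iff by (simp add: radial_profile_grad_outside)
  next
    case True
    then have xB: "x \<in> interior B" "x \<in> B" using interior_iff interior_subset by blast+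
    obtain L where L: "L \<in> Ls" "proj x \<in> L" using ray(2) elim(1) cover by blast
    then have "x \<in> sec L" using sec_proj elim(1) xB(2) by blast
    then have xi: "x \<in> interior (sec L)" using elim(2) xB(2) L(1) by blast
    have g: "(\<xi> has_derivative (\<lambda>h. h \<bullet> nrm L)) (at x)" using GDERIV_\<xi>[OF L(1) xi] unfolding gderiv_def .
    have t: "((\<lambda>y. \<kappa> j / real (Suc j) * (\<xi> y ^ Suc j - 1)) has_derivative (\<lambda>h. h \<bullet> ((\<kappa> j * \<xi> x ^ j) *\<^sub>R nrm L))) (at x)" for j
      by (rule has_derivative_eq_rhs[OF has_derivative_mult_right[OF has_derivative_diff[OF
              has_derivative_power[OF g, of "Suc j"] has_derivative_const]]])
        (simp add: fun_eq_iff field_simps)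
    have "GDERIV (\<lambda>y. \<Sum>j<k. \<kappa> j / real (Suc j) * (\<xi> y ^ Suc j - 1)) x :> (\<Sum>j<k. \<kappa> j * \<xi> x ^ j) *\<^sub>R nrm L"
      using has_derivative_sum[of "{..<k}", OF t] unfolding gderiv_def scaleR_sum_left inner_sum_right .
    then have "GDERIV (\<lambda>x. radial_profile k \<kappa> (\<xi> x)) x :> (\<Sum>j<k. \<kappa> j * \<xi> x ^ j) *\<^sub>R nrm L"
    proof (rule GDERIV_transform_open[OF _ open_interior xB(1)])
      fix y assume "y \<in> interior B"
      then have "\<xi> y < 1" using interior_iff by blast
      then show "(\<Sum>j<k. \<kappa> j / real (Suc j) * (\<xi> y ^ Suc j - 1)) = radial_profile k \<kappa> (\<xi> y)"
        by (simp add: radial_profile_def)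
    qed
    then show ?thesis by (simp add: radial_profile_grad_sector[OF L(1) xi])
  qed
qed

text \<open>Being Lipschitz and bounded on the whole space, the correction has a weak gradient on
  any measurable set, \<Omega> included; this allows corrections of different elements to be
  added.\<close>

lemma radial_profile_weak_gradient:
  shows "continuous_on A (\<lambda>x. radial_profile k \<kappa> (\<xi> x))"
    and "(\<lambda>x. radial_profile k \<kappa> (\<xi> x)) \<in> square_integrable lebesgue"
    and "radial_profile_grad k \<kappa> \<in> square_integrable lebesgue"
    and "U \<in> sets lebesgue \<Longrightarrow> weak_gradient U (\<lambda>x. radial_profile k \<kappa> (\<xi> x)) (radial_profile_grad k \<kappa>)"
proof -
  let ?P = "\<lambda>x. radial_profile k \<kappa> (\<xi> x)" and ?G = "radial_profile_grad k \<kappa>"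
  define M where "M = (\<Sum>j<k. \<bar>\<kappa> j\<bar>)"
  have M: "M \<ge> 0" unfolding M_def by (rule sum_nonneg) simp
  obtain C where C: "C > 0" "\<And>x y. \<bar>\<xi> x - \<xi> y\<bar> \<le> C * norm (x - y)" "\<And>L. L \<in> Ls \<Longrightarrow> norm (nrm L) \<le> C"
    using \<xi>_Lipschitz by blast
  have cont: "continuous_on A ?P" for A
    by (rule continuous_on_compose2[OF continuous_radial_profile[of UNIV] continuous_\<xi>]) simp
  then show "continuous_on A ?P" .
  have lip: "\<bar>?P x - ?P y\<bar> \<le> (M * C) * norm (x - y)" for x y
  proof -
    have "\<bar>?P x - ?P y\<bar> \<le> M * \<bar>\<xi> x - \<xi> y\<bar>" unfolding M_def by (rule radial_profile_Lipschitz[OF \<xi>_nonneg \<xi>_nonneg])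
    also have "\<dots> \<le> M * (C * norm (x - y))" by (rule mult_left_mono[OF C(2) M])
    finally show ?thesis by simp
  qed
  have bd: "\<bar>?P x\<bar> \<le> M" for x
  proof (cases "\<xi> x \<le> 1")
    case True
    then show ?thesis
      using radial_profile_Lipschitz[of "\<xi> x" 1 k \<kappa>] \<xi>_nonneg[of x] mult_left_mono[of "1 - \<xi> x" 1 M] M
      by (simp add: radial_profile_1 M_def[symmetric])
  qed (use M in \<open>simp add: radial_profile_1\<close>)
  have G: "norm (?G x) \<le> M * C" for x
  proof (cases "x \<in> interior B \<and> (\<exists>L\<in>Ls. x \<in> interior (sec L))")
    case True
    then obtain L where L: "L \<in> Ls" "x \<in> interior (sec L)" by blast
    have "\<bar>\<Sum>j<k. \<kappa> j * \<xi> x ^ j\<bar> \<le> M"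
      unfolding M_def
    proof (rule order_trans[OF sum_abs], rule sum_mono)
      fix j
      have xi: "\<xi> x \<le> 1" using True interior_iff[of x] by simp
      have "\<xi> x ^ j \<le> 1" "0 \<le> \<xi> x ^ j" using power_le_one[OF \<xi>_nonneg xi] zero_le_power[OF \<xi>_nonneg] by auto
      then show "\<bar>\<kappa> j * \<xi> x ^ j\<bar> \<le> \<bar>\<kappa> j\<bar>" by (simp add: abs_mult mult_left_le)
    qed
    then show ?thesis
      unfolding radial_profile_grad_sector[OF L] norm_scaleR by (rule mult_mono[OF _ C(3)[OF L(1)] M]) simp
  next
    case False
    then have "?G x = 0" unfolding radial_profile_grad_def by (rule if_not_P)
    then show ?thesis using M C(1) by simp
  qed
  have "?P \<in> L2 (interior B)" by (rule continuous_bounded_L2[OF interior_open_bounded(1,2) cont, where K = M]) (use bd in simp)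
  then have "(\<lambda>x. if x \<in> interior B then ?P x else 0) \<in> square_integrable lebesgue"
    unfolding L2_eq square_integrable_restrict[OF interior_open_bounded(3)] .
  moreover have "(\<lambda>x. if x \<in> interior B then ?P x else 0) = ?P"
    by (rule ext) (use interior_iff in \<open>auto simp: radial_profile_1\<close>)
  ultimately show "?P \<in> square_integrable lebesgue" by simp
  have "?G \<in> square_integrable (lebesgue_on (interior B))"
  proof (rule square_integrable_vec)
    fix i
    show "(\<lambda>x. ?G x $ i) \<in> square_integrable (lebesgue_on (interior B))"
      by (rule bounded_measurable_square_integrable[OF interior_open_bounded(1,2)
            gradient_measurable[OF cont AE_GDERIV_radial_profile], where K = "M * C"])
        (rule order_trans[OF component_le_norm_cart[of "?G _" i, folded real_norm_def] G])
  qed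
  then have "(\<lambda>x. if x \<in> interior B then ?G x else 0) \<in> square_integrable lebesgue"
    unfolding square_integrable_restrict[OF interior_open_bounded(3)] .
  moreover have "(\<lambda>x. if x \<in> interior B then ?G x else 0) = ?G"
    by (rule ext) (auto simp: radial_profile_grad_outside)
  ultimately show "?G \<in> square_integrable lebesgue" by simp
  show "weak_gradient U ?P ?G" if "U \<in> sets lebesgue"
    by (rule weak_gradient_Lipschitz[OF lip bd AE_GDERIV_radial_profile G that])
qed

text \<open>The same coefficients serve for all radial test functions, so the result can be applied
  to the correction itself.\<close>

lemma radial_projection:
  fixes H :: "(real^'n) set \<Rightarrow> nat \<Rightarrow> real^'n \<Rightarrow> real^'n" and k :: nat
  assumes H: "\<And>L j. L \<in> Ls \<Longrightarrow> j < k \<Longrightarrow> continuous_on UNIV (H L j)"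
    and g: "g \<in> L2 (interior B)"
      "\<And>L. L \<in> Ls \<Longrightarrow> AE x in lebesgue_on (interior (sec L)). g x = (\<Sum>j<k. \<xi> x ^ j *\<^sub>R H L j (proj x))"
  shows "\<exists>\<kappa>. \<forall>\<psi> h \<sigma>. \<psi> \<in> L2 (interior B) \<and> h \<in> L2 (interior B) \<and> weak_gradient (interior B) \<psi> h \<and> \<psi> \<in> H10 (interior B) \<and>
    continuous_on {0<..1} \<sigma> \<and> (AE x in lebesgue_on (interior B). \<psi> x = \<sigma> (\<xi> x)) \<longrightarrow>
    (LINT x|lebesgue_on (interior B). (g x - radial_profile_grad k \<kappa> x) \<bullet> h x) = 0"
proof -
  obtain \<kappa> \<beta> where \<beta>: "\<forall>j<k. \<beta> j \<in> borel_measurable borel \<and> (\<exists>K. \<forall>x. \<bar>\<beta> j x\<bar> \<le> K) \<and> homogeneous0 (\<beta> j) \<and>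
      (LINT x|lebesgue_on (interior B). \<beta> j x) = 0"
    "\<forall>x. x \<noteq> ctr \<longrightarrow> (\<exists>L\<in>Ls. proj x \<in> L \<and> (\<forall>j<k. \<beta> j x = (H L j (proj x) - \<kappa> j *\<^sub>R nrm L) \<bullet> nrm L))"
    using mean_zero_coefficients[of k H, OF H] by blast
  have q: "(\<lambda>x. g x - radial_profile_grad k \<kappa> x) \<in> L2 (interior B)"
    unfolding L2_eq
    by (rule square_integrable_diff[OF g(1)[unfolded L2_eq]
          square_integrable_lebesgue_on[OF radial_profile_weak_gradient(3) interior_open_bounded(3)]])
  have ae: "AE x in lebesgue_on (interior (sec L)).
      g x - radial_profile_grad k \<kappa> x = (\<Sum>j<k. \<xi> x ^ j *\<^sub>R (H L j (proj x) - \<kappa> j *\<^sub>R nrm L))" if L: "L \<in> Ls" for L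
  proof -
    have "AE x in lebesgue_on (interior (sec L)). x \<in> interior (sec L)" by (rule AE_I2) (simp add: space_restrict_space)
    with g(2)[OF L] show ?thesis
    proof eventually_elim
      case (elim x)
      show ?case
        unfolding elim(1) radial_profile_grad_sector[OF L elim(2)] scaleR_sum_left sum_subtractf[symmetric]
        by (rule sum.cong) (simp_all add: scaleR_right_diff_distrib mult.commute)
    qed
  qed
  show ?thesis
  proof (intro exI allI impI, elim conjE)
    fix \<psi> h \<sigma>
    assume a: "\<psi> \<in> L2 (interior B)" "h \<in> L2 (interior B)" "weak_gradient (interior B) \<psi> h" "\<psi> \<in> H10 (interior B)"
      "continuous_on {0<..1} \<sigma>" "AE x in lebesgue_on (interior B). \<psi> x = \<sigma> (\<xi> x)"
    show "(LINT x|lebesgue_on (interior B). (g x - radial_profile_grad k \<kappa> x) \<bullet> h x) = 0"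
      by (rule radial_orthogonality[of k \<beta> "\<lambda>L j b. H L j b - \<kappa> j *\<^sub>R nrm L", OF _ _ _ _ _ q ae a])
        (use \<beta> in blast)+
  qed
qed

end

text \<open>Expansions on a ray are compared only near the boundary, for s close to 1; a polynomial
  with infinitely many zeros there still has zero coefficients.\<close>

lemma power_sums_eq_near_1:
  fixes a b :: "nat \<Rightarrow> real"
  assumes "\<delta> > 0" "\<And>s. 1 - \<delta> < s \<Longrightarrow> s < 1 \<Longrightarrow> (\<Sum>j\<le>k. s ^ j * a j) = (\<Sum>j\<le>k. s ^ j * b j)" and j: "j \<le> k"
  shows "a j = b j"
proof (rule ccontr)
  assume "a j \<noteq> b j"
  then have "\<exists>i\<le>k. a i - b i \<noteq> 0" using j by auto
  then have "finite {z. (\<Sum>i\<le>k. (a i - b i) * z ^ i) = 0}" by (rule iffD2[OF polyfun_finite_roots])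
  moreover have "{1 - \<delta><..<1} \<subseteq> {z. (\<Sum>i\<le>k. (a i - b i) * z ^ i) = 0}"
    using assms(2) by (auto simp: right_diff_distrib sum_subtractf mult.commute[of "_ - _"])
  ultimately have "finite {1 - \<delta><..<1}" using finite_subset by blast
  then show False using infinite_Ioo[of "1 - \<delta>" 1] assms(1) by simp
qed

lemma Vk_cong:
  assumes "\<alpha> \<in> Vk \<tau> k L" "\<And>x. x \<in> L \<Longrightarrow> \<alpha>' x = \<alpha> x"
  shows "\<alpha>' \<in> Vk \<tau> k L"
proof (cases \<tau>)
  case Simplicial
  then show ?thesis using assms by (auto simp: Vk_def)
next
  case Pyramidal
  then obtain a e f q where q: "parallelogram a e f L" "q \<in> poly_space {m. \<forall>i. m i \<le> k}"
    "\<forall>s\<in>cbox (0::real^2) 1. \<alpha> (a + s $ 1 *\<^sub>R e + s $ 2 *\<^sub>R f) = q s"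
    using assms(1) unfolding Vk_def by auto
  have "\<forall>s\<in>cbox (0::real^2) 1. \<alpha>' (a + s $ 1 *\<^sub>R e + s $ 2 *\<^sub>R f) = q s"
  proof
    fix s :: "real^2" assume s: "s \<in> cbox 0 1"
    then have "a + s $ 1 *\<^sub>R e + s $ 2 *\<^sub>R f \<in> L" using q(1) unfolding parallelogram_def by blast
    then show "\<alpha>' (a + s $ 1 *\<^sub>R e + s $ 2 *\<^sub>R f) = q s" using q(3) s assms(2) by simp
  qed
  then show ?thesis using Pyramidal q(1,2) unfolding Vk_def by auto
qed

text \<open>Radial corrections enter the Duffy space with the constant trace 1.\<close>

lemma Vk_one:
  assumes "facet_shape \<tau> L"
  shows "(\<lambda>_. 1) \<in> Vk \<tau> k L"
proof (cases \<tau>)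
  case Simplicial
  have "(\<lambda>_. 1) \<in> Pk k" using Pk_monomial[of "\<lambda>_. 0" k] by simp
  then show ?thesis using Simplicial by (auto simp: Vk_def)
next
  case Pyramidal
  then obtain a e f where p: "parallelogram a e f L" using assms by (auto simp: facet_shape_def)
  have "(\<lambda>_. 1) \<in> poly_space {m :: 2 \<Rightarrow> nat. \<forall>i. m i \<le> k}"
    using poly_space_monomial[OF finite_exponents[of k], of "\<lambda>_. 0"] by simp
  then show ?thesis using Pyramidal p unfolding Vk_def by force
qed

section \<open>Finite element functions on one element\<close>

context polytopal_mesh
begin

text \<open>Neighbouring expansions are matched along the ray through a common boundary point: near
  the skeleton the continuous representative v equals both of them, so their coefficients agree at
  that point.\<close>

lemma FE_ray_expansion:
  assumes S: "S \<in> T" and w: "w \<in> FE_space \<Omega> \<tau> k T" and k: "k \<ge> 1"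
    and v: "AE x in lebesgue_on \<Omega>. v x = w x" "open N" "skeleton T \<subseteq> N" "continuous_on (N \<inter> closure \<Omega>) v"
  shows "\<exists>\<beta> D c. (\<forall>L\<in>facets S. \<forall>j\<le>k. \<beta> L j \<in> Vk \<tau> k L \<and> (\<forall>x. GDERIV (\<beta> L j) x :> D L j x) \<and> continuous_on UNIV (D L j)) \<and>
    (\<forall>L\<in>facets S. \<forall>b. \<beta> L 0 b = c L) \<and>
    (\<forall>L\<in>facets S. AE x in lebesgue_on (interior (sector S L)).
        w x = (\<Sum>j\<le>k. star_body.\<xi> (body S) (center S) (facets S) x ^ j * \<beta> L j (star_body.proj (body S) (center S) (facets S) x))) \<and>
    (\<forall>L\<in>facets S. \<forall>L'\<in>facets S. \<forall>b\<in>L \<inter> L'. \<forall>j\<le>k. \<beta> L j b = \<beta> L' j b)"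
proof -
  interpret E: star_body "body S" "center S" "facets S" by (rule star[OF S])
  have sec: "E.sec L = sector S L" for L by (simp add: E.sec_def sector_def)
  have "\<forall>L\<in>facets S. \<exists>\<beta> c. (\<forall>j\<le>k. \<beta> j \<in> Vk \<tau> k L \<and> C1 (\<beta> j)) \<and> (\<forall>b. \<beta> 0 b = c) \<and>
    (AE x in lebesgue_on (sector S L). \<forall>\<xi>\<in>{0<..1}. \<forall>b\<in>L. x = duffy_point S \<xi> b \<longrightarrow> w x = (\<Sum>j\<le>k. \<xi> ^ j * \<beta> j b))"
  proof
    fix L assume "L \<in> facets S"
    then have "w \<in> FE_local \<tau> k S L" using w S unfolding FE_space_def by blast
    from FE_expansion[OF this k] show "\<exists>\<beta> c. (\<forall>j\<le>k. \<beta> j \<in> Vk \<tau> k L \<and> C1 (\<beta> j)) \<and> (\<forall>b. \<beta> 0 b = c) \<and>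
      (AE x in lebesgue_on (sector S L). \<forall>\<xi>\<in>{0<..1}. \<forall>b\<in>L. x = duffy_point S \<xi> b \<longrightarrow> w x = (\<Sum>j\<le>k. \<xi> ^ j * \<beta> j b))" .
  qed
  from bchoice[OF this] obtain \<beta> where \<beta>0: "\<forall>L\<in>facets S. \<exists>c. (\<forall>j\<le>k. \<beta> L j \<in> Vk \<tau> k L \<and> C1 (\<beta> L j)) \<and> (\<forall>b. \<beta> L 0 b = c) \<and>
    (AE x in lebesgue_on (sector S L). \<forall>\<xi>\<in>{0<..1}. \<forall>b\<in>L. x = duffy_point S \<xi> b \<longrightarrow> w x = (\<Sum>j\<le>k. \<xi> ^ j * \<beta> L j b))" ..
  from bchoice[OF this] obtain c where \<beta>: "\<forall>L\<in>facets S. (\<forall>j\<le>k. \<beta> L j \<in> Vk \<tau> k L \<and> C1 (\<beta> L j)) \<and> (\<forall>b. \<beta> L 0 b = c L) \<and>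
    (AE x in lebesgue_on (sector S L). \<forall>\<xi>\<in>{0<..1}. \<forall>b\<in>L. x = duffy_point S \<xi> b \<longrightarrow> w x = (\<Sum>j\<le>k. \<xi> ^ j * \<beta> L j b))" ..
  define D where "D L j = (SOME D. (\<forall>x. GDERIV (\<beta> L j) x :> D x) \<and> continuous_on UNIV D)" for L j
  have D: "(\<forall>x. GDERIV (\<beta> L j) x :> D L j x) \<and> continuous_on UNIV (D L j)" if "L \<in> facets S" "j \<le> k" for L j
  proof -
    have "C1 (\<beta> L j)" using \<beta> that by blast
    then show ?thesis unfolding C1_def D_def by (rule someI_ex)
  qed
  have exp: "AE x in lebesgue_on (interior (sector S L)). w x = (\<Sum>j\<le>k. E.\<xi> x ^ j * \<beta> L j (E.proj x))" if L: "L \<in> facets S" for L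
  proof -
    have m: "sector S L \<in> sets lebesgue" using E.sec_compact[OF L] unfolding sec by (simp add: compact_imp_closed lebesgue_closedin)
    have "AE x in lebesgue_on (sector S L). \<forall>\<xi>\<in>{0<..1}. \<forall>b\<in>L. x = duffy_point S \<xi> b \<longrightarrow> w x = (\<Sum>j\<le>k. \<xi> ^ j * \<beta> L j b)"
      using \<beta> L by blast
    then have "AE x in lebesgue_on (interior (sector S L)). \<forall>\<xi>\<in>{0<..1}. \<forall>b\<in>L. x = duffy_point S \<xi> b \<longrightarrow> w x = (\<Sum>j\<le>k. \<xi> ^ j * \<beta> L j b)"
      by (rule AE_lebesgue_on_subset[OF _ interior_subset m]) simp
    moreover have "AE x in lebesgue_on (interior (sector S L)). x \<in> interior (sector S L)" by (rule AE_I2) (simp add: space_restrict_space)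
    ultimately show ?thesis
    proof eventually_elim
      case (elim x)
      then have x: "x \<in> interior (E.sec L)" unfolding sec by blast
      note xi = E.sec_interior_\<xi>_pos[OF L x]
      have "E.\<xi> x \<in> {0<..1}" using E.ray(1)[OF xi(2)] E.body_iff E.sec_subset[OF L] interior_subset x by auto
      moreover have "x = duffy_point S (E.\<xi> x) (E.proj x)" unfolding duffy_point_def by (rule E.ray(3)[OF xi(2)])
      ultimately show ?case using elim(1) xi(3) by blast
    qed
  qed
  have ray: "\<exists>\<delta>>0. \<forall>s. 1 - \<delta> < s \<and> s < 1 \<longrightarrow> v (center S + s *\<^sub>R (b - center S)) = (\<Sum>j\<le>k. s ^ j * \<beta> L j b)"
    if L: "L \<in> facets S" and b: "b \<in> L" for L b
  proof -
    let ?V = "interior (sector S L)"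
    define W where "W x = (\<Sum>j\<le>k. E.hgt L x ^ j * \<beta> L j (E.cproj L x))" for x
    have cl: "closure ?V = sector S L" using E.sec_full_dimensional(1)[OF L facet(4)[OF mesh_facetI[OF S L]]] unfolding sec .
    have VO: "?V \<subseteq> \<Omega>" using E.sec_interior_subset[OF L] interior_body_subset[OF S] unfolding sec by blast
    have bN: "b \<in> N" using b L S v(3) unfolding skeleton_def mesh_facets_def by blast
    have "AE x in lebesgue_on ?V. v x = w x" by (rule AE_lebesgue_on_subset[OF v(1) VO domain_open_bounded(3)]) simp
    moreover have "AE x in lebesgue_on ?V. x \<in> ?V" by (rule AE_I2) (simp add: space_restrict_space)
    moreover note exp[OF L]
    ultimately have ae: "AE x in lebesgue_on ?V. v x = W x"
    proof eventually_elim
      case (elim x)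
      then have "x \<in> E.sec L" using interior_subset unfolding sec by blast
      then show ?case using elim E.sector_coordinates[OF L] by (simp add: W_def)
    qed
    \<comment> \<open>Positive height keeps away from the center, where \<open>cproj\<close> is
      singular; \<open>N\<close> is where v is continuous.\<close>
    let ?N = "N \<inter> {x. 0 < E.hgt L x}"
    have N: "open ?N" using v(2) by (intro open_Int open_Collect_less continuous_on_const E.continuous_hgt)
    have vc: "continuous_on (?N \<inter> closure ?V) v" by (rule continuous_on_subset[OF v(4)]) (use closure_mono[OF VO] in blast)
    have fc: "continuous_on UNIV (\<beta> L j)" if "j \<le> k" for j
      by (rule GDERIV_continuous_on) (use D[OF L that] in blast)
    have Wc: "continuous_on (?N \<inter> closure ?V) W"
      unfolding W_def
      by (intro continuous_on_sum continuous_on_mult continuous_on_power E.continuous_hgt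
          continuous_on_compose2[OF fc E.continuous_cproj]) auto
    have eq: "v x = W x" if "x \<in> N" "0 < E.hgt L x" "x \<in> sector S L" for x
      by (rule continuous_AE_eq[OF open_interior ae N vc Wc]) (use that cl in auto)
    obtain e where e: "e > 0" "ball b e \<subseteq> N" using v(2) bN by (rule openE)
    have "isCont (\<lambda>s::real. center S + s *\<^sub>R (b - center S)) 1" by (intro continuous_intros)
    then obtain d where d0: "d > 0" "\<forall>s. dist s 1 < d \<longrightarrow>
        dist (center S + s *\<^sub>R (b - center S)) (center S + 1 *\<^sub>R (b - center S)) < e"
      using e(1) unfolding continuous_at_eps_delta by meson
    then have d: "center S + s *\<^sub>R (b - center S) \<in> N" if "dist s 1 < d" for s
      using e(2) that by (auto simp: dist_commute subset_iff)
    show ?thesis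
    proof (intro exI[of _ "min d 1"] conjI allI impI)
      show "min d 1 > 0" using d0(1) by simp
      fix s :: real assume s: "1 - min d 1 < s \<and> s < 1"
      let ?x = "center S + s *\<^sub>R (b - center S)"
      have s0: "0 < s" "s \<le> 1" "dist s 1 < d" using s by (auto simp: dist_real_def)
      have h: "E.hgt L ?x = s" using E.nrm_eq[OF L b] by (simp add: E.hgt_def)
      have "?x \<in> sector S L" using E.sec_iff[OF L] s0 b less_imp_le unfolding sec by blast
      from eq[OF d[OF s0(3)] _ this] have "v ?x = W ?x" using h s0 by simp
      also have "E.cproj L ?x = b" unfolding E.cproj_def h using s0 by simp
      then have "W ?x = (\<Sum>j\<le>k. s ^ j * \<beta> L j b)" unfolding W_def h by simp
      finally show "v ?x = (\<Sum>j\<le>k. s ^ j * \<beta> L j b)" .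
    qed
  qed
  have "\<beta> L j b = \<beta> L' j b" if L: "L \<in> facets S" "L' \<in> facets S" and b: "b \<in> L \<inter> L'" and j: "j \<le> k" for L L' b j
  proof -
    have bb: "b \<in> L" "b \<in> L'" using b by auto
    obtain d where d: "d > 0" "\<forall>s. 1 - d < s \<and> s < 1 \<longrightarrow> v (center S + s *\<^sub>R (b - center S)) = (\<Sum>j\<le>k. s ^ j * \<beta> L j b)"
      using ray[OF L(1) bb(1)] by blast
    obtain d' where d': "d' > 0" "\<forall>s. 1 - d' < s \<and> s < 1 \<longrightarrow> v (center S + s *\<^sub>R (b - center S)) = (\<Sum>j\<le>k. s ^ j * \<beta> L' j b)"
      using ray[OF L(2) bb(2)] by blast
    show ?thesis
    proof (rule power_sums_eq_near_1[where \<delta> = "min d d'" and k = k and a = "\<lambda>j. \<beta> L j b" and b = "\<lambda>j. \<beta> L' j b", OF _ _ j])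
      show "min d d' > 0" using d(1) d'(1) by simp
      fix s assume s: "1 - min d d' < s" "s < 1"
      then have "1 - d < s" "1 - d' < s" by auto
      then show "(\<Sum>j\<le>k. s ^ j * \<beta> L j b) = (\<Sum>j\<le>k. s ^ j * \<beta> L' j b)"
        using d(2)[rule_format, of s] d'(2)[rule_format, of s] s(2) by (metis (no_types, lifting))
    qed
  qed
  then show ?thesis
    by (intro exI[of _ \<beta>] exI[of _ D] exI[of _ c]) (use \<beta> D exp in blast)
qed

lemma Lambda_glue:
  assumes S: "S \<in> T" and \<beta>: "\<And>L. L \<in> facets S \<Longrightarrow> \<beta> L \<in> Vk \<tau> k L" "\<And>L. L \<in> facets S \<Longrightarrow> continuous_on L (\<beta> L)"
    "\<And>L L' b. L \<in> facets S \<Longrightarrow> L' \<in> facets S \<Longrightarrow> b \<in> L \<Longrightarrow> b \<in> L' \<Longrightarrow> \<beta> L b = \<beta> L' b"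
  shows "\<exists>\<alpha>\<in>Lambda \<tau> k (facets S). \<forall>L\<in>facets S. \<forall>b\<in>L. \<alpha> b = \<beta> L b"
proof -
  define \<alpha> where "\<alpha> b = \<beta> (SOME L. L \<in> facets S \<and> b \<in> L) b" for b
  have eq: "\<alpha> b = \<beta> L b" if "L \<in> facets S" "b \<in> L" for L b
  proof -
    have "(SOME L. L \<in> facets S \<and> b \<in> L) \<in> facets S \<and> b \<in> (SOME L. L \<in> facets S \<and> b \<in> L)"
      using someI_ex[of "\<lambda>L. L \<in> facets S \<and> b \<in> L"] that by blast
    then show ?thesis unfolding \<alpha>_def using \<beta>(3)[OF _ that(1) _ that(2)] by blast
  qed
  have "continuous_on (\<Union>L\<in>facets S. L) \<alpha>"
  proof (rule continuous_on_closed_Union)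
    show "finite (facets S)" by (rule star_body.finite[OF star[OF S]])
    fix L assume L: "L \<in> facets S"
    show "closed L" using facet(2)[OF mesh_facetI[OF S L]] by (rule compact_imp_closed)
    show "continuous_on L \<alpha>" using \<beta>(2)[OF L] by (rule continuous_on_eq) (simp add: eq[OF L])
  qed
  moreover have "\<alpha> \<in> Vk \<tau> k L" if "L \<in> facets S" for L by (rule Vk_cong[OF \<beta>(1)[OF that] eq[OF that]])
  ultimately show ?thesis using eq unfolding Lambda_def by auto
qed

end

text \<open>The sum of all element corrections equals the correction of one element only in its
  interior. The boundary is a null set, and the form depends only on the class of the
  gradient.\<close>

lemma SBFEM_local_cong:
  assumes star: "star_body (body S) (center S) (facets S)"
    and f: "f \<in> SBFEM_local \<tau> k S" and f': "f' \<in> H1 (interior (body S))"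
    and eq: "\<And>x. x \<in> interior (body S) \<Longrightarrow> f' x = f x"
  shows "f' \<in> SBFEM_local \<tau> k S"
proof -
  interpret E: star_body "body S" "center S" "facets S" by (rule star)
  let ?U = "interior (body S)"
  have Bm: "body S \<in> sets lebesgue" using E.compact by (simp add: compact_imp_closed lebesgue_closedin)
  have "AE x in lebesgue. x \<in> body S \<longrightarrow> f' x = f x" using E.AE_sec by eventually_elim (use eq in blast)
  then have ae: "AE x in lebesgue_on (body S). f' x = f x" unfolding AE_lebesgue_on_iff[OF Bm] .
  have fd: "f \<in> duffy_space \<tau> k S" and fo: "\<forall>\<psi>\<in>D00_center S. dirichlet_form ?U f \<psi> = 0"
    using f unfolding SBFEM_local_def by auto
  obtain n \<rho> \<alpha> \<psi> where \<psi>: "\<forall>i<(n::nat). continuous_on {0<..1::real} (\<rho> i) \<and> \<alpha> i \<in> Lambda \<tau> k (facets S)"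
    "AE x in lebesgue_on (body S). f x = \<psi> x"
    "\<forall>\<xi>\<in>{0<..1}. \<forall>b\<in>\<Union>(facets S). \<psi> (duffy_point S \<xi> b) = (\<Sum>i<n. \<rho> i \<xi> * \<alpha> i b)"
    using fd unfolding duffy_space_def by blast
  have "AE x in lebesgue_on (body S). f' x = \<psi> x" using ae \<psi>(2) by eventually_elim simp
  then have "f' \<in> duffy_space \<tau> k S" unfolding duffy_space_def using f' \<psi>(1,3) by blast
  moreover have "dirichlet_form ?U f' \<psi> = 0" if "\<psi> \<in> D00_center S" for \<psi>
  proof -
    have "f \<in> H1 ?U" using fd unfolding duffy_space_def by blast
    note f = H1_grad[OF this]
    note f' = H1_grad[OF f']
    have \<psi>: "\<psi> \<in> H1 ?U" using that unfolding D00_center_def radial_form_def by blast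
    note \<psi> = H1_grad[OF \<psi>]
    have "AE x in lebesgue_on ?U. f x = f' x" by (rule AE_I2) (simp add: space_restrict_space eq)
    from weak_gradient_cong_AE[OF f(3,1) f'(1) f(2) f(2) this _ E.interior_open_bounded(3)]
    have "weak_gradient ?U f' (grad ?U f)" by simp
    from dirichlet_form_eq[OF E.interior_open_bounded(1,2) f'(1) f(2) this \<psi>]
      dirichlet_form_eq[OF E.interior_open_bounded(1,2) f \<psi>]
    show ?thesis using fo that by simp
  qed
  ultimately show ?thesis unfolding SBFEM_local_def by blast
qed

section \<open>Corrections on one element and on the whole mesh\<close>

context polytopal_mesh
begin

text \<open>The matched expansions put w - P into the Duffy space. The choice of \<kappa> makes its
  gradient orthogonal to those of all radial functions vanishing on the boundary, P among
  them.\<close>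

lemma element_radial_correction:
  assumes S: "S \<in> T" and w: "w \<in> FE_space \<Omega> \<tau> k T" and k: "k \<ge> 1"
    and v: "AE x in lebesgue_on \<Omega>. v x = w x" "open N" "skeleton T \<subseteq> N" "continuous_on (N \<inter> closure \<Omega>) v"
  shows "\<exists>P G. continuous_on UNIV P \<and> P \<in> square_integrable lebesgue \<and> G \<in> square_integrable lebesgue \<and>
    (\<forall>U\<in>sets lebesgue. weak_gradient U P G) \<and> (\<forall>x. x \<notin> interior (body S) \<longrightarrow> P x = 0 \<and> G x = 0) \<and>
    (\<lambda>x. w x - P x) \<in> SBFEM_local \<tau> k S \<and>
    (LINT x|lebesgue_on (interior (body S)). (grad \<Omega> w x - G x) \<bullet> G x) = 0"
proof -
  interpret E: star_body "body S" "center S" "facets S" by (rule star[OF S])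
  let ?B = "interior (body S)"
  note U = E.interior_open_bounded
  have sec: "E.sec L = sector S L" for L by (simp add: E.sec_def sector_def)
  obtain \<beta> D c where e: "\<forall>L\<in>facets S. \<forall>j\<le>k. \<beta> L j \<in> Vk \<tau> k L \<and> (\<forall>x. GDERIV (\<beta> L j) x :> D L j x) \<and> continuous_on UNIV (D L j)"
    "\<forall>L\<in>facets S. \<forall>b. \<beta> L 0 b = c L"
    "\<forall>L\<in>facets S. AE x in lebesgue_on (interior (sector S L)). w x = (\<Sum>j\<le>k. E.\<xi> x ^ j * \<beta> L j (E.proj x))"
    "\<forall>L\<in>facets S. \<forall>L'\<in>facets S. \<forall>b\<in>L \<inter> L'. \<forall>j\<le>k. \<beta> L j b = \<beta> L' j b"
    using FE_ray_expansion[OF S w k v] by blast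
  have \<beta>c: "continuous_on A (\<beta> L j)" if "L \<in> facets S" "j \<le> k" for A L j
    by (rule GDERIV_continuous_on) (use e(1) that in blast)
  have "w \<in> H1 \<Omega>" using w unfolding FE_space_def by blast
  note wg = H1_grad[OF this]
  have sub: "w \<in> L2 V" "grad \<Omega> w \<in> L2 V" "weak_gradient V w (grad \<Omega> w)" if "V \<subseteq> \<Omega>" "V \<in> sets lebesgue" for V
    using square_integrable_subset[OF wg(1)[unfolded L2_eq] that(1) domain_open_bounded(3) that(2)]
      square_integrable_subset[OF wg(2)[unfolded L2_eq] that(1) domain_open_bounded(3) that(2)]
      weak_gradient_subset[OF wg(3) that(1) domain_open_bounded(3) that(2)]
    unfolding L2_eq by auto
  note wB = sub[OF interior_body_subset[OF S] U(3)]
  define H where "H L j = E.cone_grad L j (\<beta> L (Suc j)) (D L (Suc j))" for L j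
  have H: "continuous_on UNIV (H L j)" if "L \<in> facets S" "j < k" for L j
    unfolding H_def by (rule E.continuous_cone_grad) (use that e(1) in \<open>auto intro!: \<beta>c\<close>)
  have gH: "AE x in lebesgue_on (interior (E.sec L)). grad \<Omega> w x = (\<Sum>j<k. E.\<xi> x ^ j *\<^sub>R H L j (E.proj x))"
    if L: "L \<in> facets S" for L
  proof -
    have VO: "interior (E.sec L) \<subseteq> \<Omega>" using E.sec_interior_subset[OF L] interior_body_subset[OF S] by blast
    have Vm: "interior (E.sec L) \<in> sets lebesgue" by simp
    show ?thesis
      unfolding H_def
    proof (rule E.sector_gradient[OF L _ _ _ sub[OF VO Vm], where c = "c L"])
      show "AE x in lebesgue_on (interior (E.sec L)). w x = (\<Sum>j\<le>k. E.\<xi> x ^ j * \<beta> L j (E.proj x))"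
        unfolding sec using e(3) L by blast
    qed (use e(1,2) L in blast)+
  qed
  obtain \<kappa> where \<kappa>: "\<And>\<psi> h \<sigma>. \<psi> \<in> L2 ?B \<and> h \<in> L2 ?B \<and> weak_gradient ?B \<psi> h \<and> \<psi> \<in> H10 ?B \<and>
    continuous_on {0<..1} \<sigma> \<and> (AE x in lebesgue_on ?B. \<psi> x = \<sigma> (E.\<xi> x)) \<Longrightarrow>
    (LINT x|lebesgue_on ?B. (grad \<Omega> w x - E.radial_profile_grad k \<kappa> x) \<bullet> h x) = 0"
    using E.radial_projection[of k H "grad \<Omega> w", OF H wB(2) gH] by blast
  define P where "P x = E.radial_profile k \<kappa> (E.\<xi> x)" for x
  define G where "G = E.radial_profile_grad k \<kappa>"
  note R = E.radial_profile_weak_gradient[where k = k and \<kappa> = \<kappa>, folded P_def[abs_def] G_def]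
  have P2: "P \<in> L2 ?B" "G \<in> L2 ?B" "weak_gradient ?B P G"
    using square_integrable_lebesgue_on[OF R(2) U(3)] square_integrable_lebesgue_on[OF R(3) U(3)] R(4)[OF U(3)]
    unfolding L2_eq by auto
  have d: "(\<lambda>x. w x - P x) \<in> L2 ?B" "(\<lambda>x. grad \<Omega> w x - G x) \<in> L2 ?B"
    "weak_gradient ?B (\<lambda>x. w x - P x) (\<lambda>x. grad \<Omega> w x - G x)"
    using square_integrable_diff wB(1,2) P2(1,2) weak_gradient_diff[OF wB P2 U(3)] unfolding L2_eq by auto
  have Bm: "body S \<in> sets lebesgue" using E.compact by (simp add: compact_imp_closed lebesgue_closedin)
  have "\<forall>j\<in>{..k}. \<exists>\<alpha>. \<alpha> \<in> Lambda \<tau> k (facets S) \<and> (\<forall>L\<in>facets S. \<forall>b\<in>L. \<alpha> b = \<beta> L j b)"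
  proof
    fix j assume j: "j \<in> {..k}"
    have "\<exists>\<alpha>\<in>Lambda \<tau> k (facets S). \<forall>L\<in>facets S. \<forall>b\<in>L. \<alpha> b = \<beta> L j b"
    proof (rule Lambda_glue[OF S])
      have jk: "j \<le> k" using j by simp
      show "\<beta> L j \<in> Vk \<tau> k L" if "L \<in> facets S" for L using e(1) that jk by blast
      show "continuous_on L (\<beta> L j)" if "L \<in> facets S" for L by (rule \<beta>c[OF that jk])
      show "\<beta> L j b = \<beta> L' j b" if "L \<in> facets S" "L' \<in> facets S" "b \<in> L" "b \<in> L'" for L L' b
        using e(4) that jk by blast
    qed
    then show "\<exists>\<alpha>. \<alpha> \<in> Lambda \<tau> k (facets S) \<and> (\<forall>L\<in>facets S. \<forall>b\<in>L. \<alpha> b = \<beta> L j b)" by blast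
  qed
  from bchoice[OF this] obtain \<alpha> where \<alpha>: "\<And>j. j \<le> k \<Longrightarrow> \<alpha> j \<in> Lambda \<tau> k (facets S)"
    "\<And>j L b. j \<le> k \<Longrightarrow> L \<in> facets S \<Longrightarrow> b \<in> L \<Longrightarrow> \<alpha> j b = \<beta> L j b" by auto
  have one: "(\<lambda>_. 1) \<in> Lambda \<tau> k (facets S)"
    using element[OF S] unfolding Lambda_def is_S_element_def by (auto intro: Vk_one)
  have duffy: "(\<lambda>x. w x - P x) \<in> duffy_space \<tau> k S"
    unfolding duffy_space_def
  proof (intro CollectI conjI exI)
    show "(\<lambda>x. w x - P x) \<in> H1 ?B" by (rule H1I[OF d])
    \<comment> \<open>Summands 0 to k are the powers of \<xi>; summand k + 1 is minus the profile of
      \<open>P\<close>, with the constant trace 1.\<close>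
    let ?\<rho> = "\<lambda>i \<xi>. if i \<le> k then \<xi> ^ i else - E.radial_profile k \<kappa> \<xi>"
    let ?\<alpha> = "\<lambda>i b. if i \<le> k then \<alpha> i b else 1"
    let ?\<psi> = "\<lambda>x. (\<Sum>j\<le>k. E.\<xi> x ^ j * \<alpha> j (E.proj x)) - E.radial_profile k \<kappa> (E.\<xi> x)"
    show "\<forall>i<Suc (Suc k). continuous_on {0<..1} (?\<rho> i) \<and> ?\<alpha> i \<in> Lambda \<tau> k (facets S)"
    proof (intro allI impI)
      fix i assume "i < Suc (Suc k)"
      show "continuous_on {0<..1} (?\<rho> i) \<and> ?\<alpha> i \<in> Lambda \<tau> k (facets S)"
        using \<alpha>(1) one by (cases "i \<le> k") (auto intro!: continuous_intros E.continuous_radial_profile)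
    qed
    have "AE x in lebesgue_on ?B. \<forall>L\<in>facets S. E.proj x \<in> L \<longrightarrow> w x = (\<Sum>j\<le>k. E.\<xi> x ^ j * \<beta> L j (E.proj x))"
      by (rule E.AE_sectors, unfold sec) (use e(3) in blast)
    then have "AE x in lebesgue. x \<in> ?B \<longrightarrow> (\<forall>L\<in>facets S. E.proj x \<in> L \<longrightarrow> w x = (\<Sum>j\<le>k. E.\<xi> x ^ j * \<beta> L j (E.proj x)))"
      unfolding AE_lebesgue_on_iff[OF U(3)] .
    then have "AE x in lebesgue. x \<in> body S \<longrightarrow> w x - P x = ?\<psi> x"
      using E.AE_sec
    proof eventually_elim
      case (elim x)
      show ?case
      proof
        assume x: "x \<in> body S"
        then have x': "x \<in> ?B" "x \<noteq> center S" using elim(2) by blast+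
        obtain L where L: "L \<in> facets S" "E.proj x \<in> L" using E.ray(2)[OF x'(2)] E.cover by blast
        then have "w x = (\<Sum>j\<le>k. E.\<xi> x ^ j * \<beta> L j (E.proj x))" using elim(1) x'(1) by blast
        then show "w x - P x = ?\<psi> x" using \<alpha>(2)[OF _ L] by (simp add: P_def)
      qed
    qed
    then show "AE x in lebesgue_on (body S). w x - P x = ?\<psi> x" unfolding AE_lebesgue_on_iff[OF Bm] .
    show "\<forall>\<xi>\<in>{0<..1}. \<forall>b\<in>\<Union>(facets S). ?\<psi> (duffy_point S \<xi> b) = (\<Sum>i<Suc (Suc k). ?\<rho> i \<xi> * ?\<alpha> i b)"
    proof (intro ballI)
      fix \<xi> b assume xi: "\<xi> \<in> {0<..1::real}" and b: "b \<in> \<Union>(facets S)"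
      then have b': "b \<in> frontier (body S)" using E.cover by blast
      have "E.\<xi> (duffy_point S \<xi> b) = \<xi>" "E.proj (duffy_point S \<xi> b) = b"
        using xi E.\<xi>_ray_frontier[OF b', of \<xi>] E.proj_ray[OF b', of \<xi>] by (auto simp: duffy_point_def)
      then have "?\<psi> (duffy_point S \<xi> b) = (\<Sum>i\<le>k. \<xi> ^ i * \<alpha> i b) - E.radial_profile k \<kappa> \<xi>" by simp
      also have "\<dots> = (\<Sum>i<Suc (Suc k). ?\<rho> i \<xi> * ?\<alpha> i b)"
        by (simp add: lessThan_Suc_atMost)
      finally show "?\<psi> (duffy_point S \<xi> b) = (\<Sum>i<Suc (Suc k). ?\<rho> i \<xi> * ?\<alpha> i b)" .
    qed
  qed
  have orth: "dirichlet_form ?B (\<lambda>x. w x - P x) \<psi> = 0" if \<psi>: "\<psi> \<in> D00_center S" for \<psi>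
  proof -
    obtain C \<rho> where r: "radial_form S C \<rho> \<psi>" "\<rho> 1 = 0" using \<psi> unfolding D00_center_def by blast
    obtain \<psi>' where \<psi>': "\<psi> \<in> H1 ?B" "continuous_on {0<..1} \<rho>" "AE x in lebesgue_on (body S). \<psi> x = \<psi>' x"
      "\<forall>\<xi>\<in>{0<..1}. \<forall>b\<in>\<Union>(facets S). \<psi>' (duffy_point S \<xi> b) = C * \<rho> \<xi>"
      using r(1) unfolding radial_form_def by blast
    have rad: "AE x in lebesgue_on ?B. \<psi> x = C * \<rho> (E.\<xi> x)"
      using AE_lebesgue_on_subset[OF \<psi>'(3) interior_subset Bm U(3)] E.AE_in_sector E.AE_interior_not_center
    proof eventually_elim
      case (elim x)
      obtain L where L: "L \<in> facets S" "E.proj x \<in> L" using E.ray(2)[OF elim(3)] E.cover by blast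
      then have "x \<in> body S" using elim(2) E.sec_subset interior_subset by blast
      then have "E.\<xi> x \<in> {0<..1}" using E.ray(1)[OF elim(3)] E.body_iff by simp
      moreover have "x = duffy_point S (E.\<xi> x) (E.proj x)" unfolding duffy_point_def by (rule E.ray(3)[OF elim(3)])
      ultimately have "\<psi>' x = C * \<rho> (E.\<xi> x)" using \<psi>'(4) L by (metis UnionI)
      then show ?case using elim(1) by simp
    qed
    have c: "continuous_on {0<..1} (\<lambda>s. C * \<rho> s)" by (intro continuous_intros \<psi>'(2))
    have "\<psi> \<in> H10 ?B" by (rule E.radial_H10[OF \<psi>'(1) c _ rad]) (simp add: r(2))
    note h = H1_grad[OF \<psi>'(1)]
    have "(LINT x|lebesgue_on ?B. (grad \<Omega> w x - G x) \<bullet> grad ?B \<psi> x) = 0"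
      unfolding G_def by (rule \<kappa>[where \<sigma> = "\<lambda>s. C * \<rho> s" and \<psi> = \<psi>]) (intro conjI h \<open>\<psi> \<in> H10 ?B\<close> c rad)
    then show ?thesis unfolding dirichlet_form_eq[OF U(1,2) d h] .
  qed
  have radP: "AE x in lebesgue_on ?B. P x = E.radial_profile k \<kappa> (E.\<xi> x)" by (simp add: P_def)
  have "P \<in> H10 ?B"
    by (rule E.radial_H10[OF H1I[OF P2] E.continuous_radial_profile _ radP]) (simp add: E.radial_profile_1)
  then have "(LINT x|lebesgue_on ?B. (grad \<Omega> w x - G x) \<bullet> G x) = 0"
    unfolding G_def
    by (intro \<kappa>[where \<sigma> = "E.radial_profile k \<kappa>" and \<psi> = P] conjI P2[unfolded G_def] E.continuous_radial_profile radP)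
  moreover have "P x = 0 \<and> G x = 0" if "x \<notin> ?B" for x
    using that E.interior_iff by (simp add: P_def G_def E.radial_profile_1 E.radial_profile_grad_outside)
  ultimately show ?thesis
    using R duffy orth unfolding SBFEM_local_def by (intro exI[of _ P] exI[of _ G]) blast
qed

text \<open>Each element correction vanishes together with its gradient outside its open element, so
  the corrections do not interact; their sum is continuous and vanishes on the boundary of
  \<Omega>.\<close>

lemma FE_radial_correction:
  assumes w: "w \<in> FE_space \<Omega> \<tau> k T" and k: "k \<ge> 1"
    and v: "AE x in lebesgue_on \<Omega>. v x = w x" "open N" "skeleton T \<subseteq> N" "continuous_on (N \<inter> closure \<Omega>) v"
  shows "\<exists>P G. continuous_on UNIV P \<and> P \<in> L2 \<Omega> \<and> G \<in> L2 \<Omega> \<and> weak_gradient \<Omega> P G \<and> (\<forall>x\<in>frontier \<Omega>. P x = 0) \<and>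
    (\<lambda>x. w x - P x) \<in> SBFEM_space \<Omega> \<tau> k T \<and> (LINT x|lebesgue_on \<Omega>. (grad \<Omega> w x - G x) \<bullet> G x) = 0"
proof -
  have "\<forall>S\<in>T. \<exists>P. \<exists>G. continuous_on UNIV P \<and> P \<in> square_integrable lebesgue \<and> G \<in> square_integrable lebesgue \<and>
    (\<forall>U\<in>sets lebesgue. weak_gradient U P G) \<and> (\<forall>x. x \<notin> interior (body S) \<longrightarrow> P x = 0 \<and> G x = 0) \<and>
    (\<lambda>x. w x - P x) \<in> SBFEM_local \<tau> k S \<and>
    (LINT x|lebesgue_on (interior (body S)). (grad \<Omega> w x - G x) \<bullet> G x) = 0"
    by (rule ballI) (rule element_radial_correction[OF _ w k v])
  from bchoice[OF this] obtain Q where "\<forall>S\<in>T. \<exists>G. continuous_on UNIV (Q S) \<and> Q S \<in> square_integrable lebesgue \<and> G \<in> square_integrable lebesgue \<and>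
    (\<forall>U\<in>sets lebesgue. weak_gradient U (Q S) G) \<and> (\<forall>x. x \<notin> interior (body S) \<longrightarrow> Q S x = 0 \<and> G x = 0) \<and>
    (\<lambda>x. w x - Q S x) \<in> SBFEM_local \<tau> k S \<and>
    (LINT x|lebesgue_on (interior (body S)). (grad \<Omega> w x - G x) \<bullet> G x) = 0" ..
  from bchoice[OF this] obtain R where QR: "\<forall>S\<in>T. continuous_on UNIV (Q S) \<and> Q S \<in> square_integrable lebesgue \<and> R S \<in> square_integrable lebesgue \<and>
    (\<forall>U\<in>sets lebesgue. weak_gradient U (Q S) (R S)) \<and> (\<forall>x. x \<notin> interior (body S) \<longrightarrow> Q S x = 0 \<and> R S x = 0) \<and>
    (\<lambda>x. w x - Q S x) \<in> SBFEM_local \<tau> k S \<and>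
    (LINT x|lebesgue_on (interior (body S)). (grad \<Omega> w x - R S x) \<bullet> R S x) = 0" ..
  define P where "P x = (\<Sum>S\<in>T. Q S x)" for x
  define G where "G x = (\<Sum>S\<in>T. R S x)" for x
  note \<Omega>m = domain_open_bounded(3)
  have Q2: "Q S \<in> L2 \<Omega>" "R S \<in> L2 \<Omega>" "weak_gradient \<Omega> (Q S) (R S)" if "S \<in> T" for S
    using QR that \<Omega>m square_integrable_lebesgue_on[OF _ \<Omega>m] unfolding L2_eq by blast+
  have P: "P \<in> L2 \<Omega>" "G \<in> L2 \<Omega>"
    using Q2(1,2) unfolding L2_eq P_def[abs_def] G_def[abs_def] by (auto intro: square_integrable_sum)
  have wgP: "weak_gradient \<Omega> P G"
    unfolding P_def[abs_def] G_def[abs_def] by (rule weak_gradient_sum[OF Q2 \<Omega>m]) assumption+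
  have Pc: "continuous_on UNIV P" unfolding P_def[abs_def] by (rule continuous_on_sum) (use QR in blast)
  have zero: "Q S x = 0" "R S x = 0" if "S \<in> T" "x \<notin> interior (body S)" for S x
    using QR that by blast+
  have P0: "P x = 0" if x: "x \<in> frontier \<Omega>" for x
    unfolding P_def
  proof (rule sum.neutral, rule ballI)
    fix S assume S: "S \<in> T"
    have "x \<notin> \<Omega>" using x domain_open_bounded(1) by (simp add: frontier_def interior_open)
    then show "Q S x = 0" using zero(1)[OF S] interior_body_subset[OF S] by blast
  qed
  have local: "P x = Q S x" "G x = R S x" if S: "S \<in> T" and x: "x \<in> interior (body S)" for S x
  proof -
    have "x \<notin> interior (body S')" if "S' \<in> T - {S}" for S' using disjoint[OF S, of S'] that x by blast
    then have "(\<Sum>S'\<in>T - {S}. Q S' x) = 0" "(\<Sum>S'\<in>T - {S}. R S' x) = 0"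
      using zero by (auto intro!: sum.neutral)
    then show "P x = Q S x" "G x = R S x" unfolding P_def G_def by (simp_all add: sum.remove[OF finite_T S])
  qed
  have "w \<in> H1 \<Omega>" using w unfolding FE_space_def by blast
  note wg = H1_grad[OF this]
  have d: "(\<lambda>x. w x - P x) \<in> L2 \<Omega>" "(\<lambda>x. grad \<Omega> w x - G x) \<in> L2 \<Omega>"
    using square_integrable_diff wg(1,2) P unfolding L2_eq by auto
  have wd: "weak_gradient \<Omega> (\<lambda>x. w x - P x) (\<lambda>x. grad \<Omega> w x - G x)" by (rule weak_gradient_diff[OF wg P wgP \<Omega>m])
  have "(\<lambda>x. w x - P x) \<in> SBFEM_local \<tau> k S" if S: "S \<in> T" for S
  proof (rule SBFEM_local_cong[OF star[OF S]])
    show "(\<lambda>x. w x - Q S x) \<in> SBFEM_local \<tau> k S" using QR S by blast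
    have m: "interior (body S) \<in> sets lebesgue" by simp
    note s = square_integrable_subset[OF _ interior_body_subset[OF S] \<Omega>m m]
    show "(\<lambda>x. w x - P x) \<in> H1 (interior (body S))"
      by (rule H1I[OF _ _ weak_gradient_subset[OF wd interior_body_subset[OF S] \<Omega>m m]])
        (use s d in \<open>unfold L2_eq, blast\<close>)+
  qed (simp add: local[OF S])
  then have sb: "(\<lambda>x. w x - P x) \<in> SBFEM_space \<Omega> \<tau> k T"
    unfolding SBFEM_space_def using H1I[OF d wd] by blast
  have "(LINT x|lebesgue_on \<Omega>. (grad \<Omega> w x - G x) \<bullet> G x)
      = (LINT x|lebesgue_on \<Omega>. (\<Sum>S\<in>T. (grad \<Omega> w x - G x) \<bullet> R S x))"
    by (simp only: G_def inner_sum_right)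
  also have "\<dots> = (\<Sum>S\<in>T. LINT x|lebesgue_on \<Omega>. (grad \<Omega> w x - G x) \<bullet> R S x)"
    by (rule Bochner_Integration.integral_sum) (use square_integrable_inner d(2) Q2(2) L2_eq in metis)
  also have "\<dots> = 0"
  proof (rule sum.neutral, rule ballI)
    fix S assume S: "S \<in> T"
    have m: "interior (body S) \<in> sets lebesgue" by simp
    \<comment> \<open>In the interior of \<open>S\<close> the total correction is that of
      \<open>S\<close>, and elsewhere \<open>R S\<close> vanishes, so the integral
      localises.\<close>
    have "(if x \<in> \<Omega> then (grad \<Omega> w x - G x) \<bullet> R S x else 0)
        = (if x \<in> interior (body S) then (grad \<Omega> w x - R S x) \<bullet> R S x else 0)" for x
      using interior_body_subset[OF S] local(2)[OF S, of x] zero(2)[OF S, of x] by (cases "x \<in> interior (body S)") auto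
    then have "(LINT x|lebesgue_on \<Omega>. (grad \<Omega> w x - G x) \<bullet> R S x)
        = (LINT x|lebesgue_on (interior (body S)). (grad \<Omega> w x - R S x) \<bullet> R S x)"
      unfolding lebesgue_on_integral[OF \<Omega>m] lebesgue_on_integral[OF m] by simp
    then show "(LINT x|lebesgue_on \<Omega>. (grad \<Omega> w x - G x) \<bullet> R S x) = 0" using QR S by simp
  qed
  finally show ?thesis using Pc P wgP P0 sb by blast
qed

section \<open>Linearity of the Duffy and SBFEM spaces\<close>

lemma duffy_space_diff:
  assumes "f \<in> duffy_space \<tau>' k S" "g \<in> duffy_space \<tau>' k S" "(\<lambda>x. f x - g x) \<in> H1 (interior (body S))"
  shows "(\<lambda>x. f x - g x) \<in> duffy_space \<tau>' k S"
proof -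
  obtain n \<rho> \<alpha> \<psi> where f: "\<forall>i<(n::nat). continuous_on {0<..1::real} (\<rho> i) \<and> \<alpha> i \<in> Lambda \<tau>' k (facets S)"
    "AE x in lebesgue_on (body S). f x = \<psi> x"
    "\<forall>\<xi>\<in>{0<..1}. \<forall>b\<in>\<Union>(facets S). \<psi> (duffy_point S \<xi> b) = (\<Sum>i<n. \<rho> i \<xi> * \<alpha> i b)"
    using assms(1) unfolding duffy_space_def by blast
  obtain n' \<rho>' \<alpha>' \<psi>' where g: "\<forall>i<(n'::nat). continuous_on {0<..1::real} (\<rho>' i) \<and> \<alpha>' i \<in> Lambda \<tau>' k (facets S)"
    "AE x in lebesgue_on (body S). g x = \<psi>' x"
    "\<forall>\<xi>\<in>{0<..1}. \<forall>b\<in>\<Union>(facets S). \<psi>' (duffy_point S \<xi> b) = (\<Sum>i<n'. \<rho>' i \<xi> * \<alpha>' i b)"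
    using assms(2) unfolding duffy_space_def by blast
  \<comment> \<open>The two families of summands are concatenated, with the sign put into the second
    profiles.\<close>
  let ?\<rho> = "\<lambda>i \<xi>. if i < n then \<rho> i \<xi> else - \<rho>' (i - n) \<xi>"
  let ?\<alpha> = "\<lambda>i b. if i < n then \<alpha> i b else \<alpha>' (i - n) b"
  have 1: "continuous_on {0<..1} (?\<rho> i) \<and> ?\<alpha> i \<in> Lambda \<tau>' k (facets S)" if "i < n + n'" for i
  proof (cases "i < n")
    case False
    then have "i - n < n'" using that by simp
    then show ?thesis using g(1) False by (auto intro!: continuous_on_minus)
  qed (use f(1) in simp)
  have sum_split: "(\<Sum>i<n + n'. h i) = (\<Sum>i<n. h i) + (\<Sum>i<n'. h (n + i))" for h :: "nat \<Rightarrow> real"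
    by (induction n') simp_all
  have 2: "(\<Sum>i<n + n'. ?\<rho> i \<xi> * ?\<alpha> i b) = (\<Sum>i<n. \<rho> i \<xi> * \<alpha> i b) - (\<Sum>i<n'. \<rho>' i \<xi> * \<alpha>' i b)" for \<xi> b
    unfolding sum_split by (simp add: sum_negf)
  have 3: "AE x in lebesgue_on (body S). f x - g x = \<psi> x - \<psi>' x" using f(2) g(2) by eventually_elim simp
  show ?thesis
    unfolding duffy_space_def
  proof (intro CollectI conjI exI)
    show "(\<lambda>x. f x - g x) \<in> H1 (interior (body S))" by (rule assms(3))
    show "\<forall>i<n + n'. continuous_on {0<..1} (?\<rho> i) \<and> ?\<alpha> i \<in> Lambda \<tau>' k (facets S)" using 1 by blast
    show "AE x in lebesgue_on (body S). f x - g x = (\<lambda>x. \<psi> x - \<psi>' x) x" using 3 by simp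
    show "\<forall>\<xi>\<in>{0<..1}. \<forall>b\<in>\<Union>(facets S). (\<lambda>x. \<psi> x - \<psi>' x) (duffy_point S \<xi> b) = (\<Sum>i<n + n'. ?\<rho> i \<xi> * ?\<alpha> i b)"
      unfolding 2 using f(3) g(3) by simp
  qed
qed

lemma SBFEM_space_diff:
  assumes f: "f \<in> SBFEM_space \<Omega> \<tau> k T" and g: "g \<in> SBFEM_space \<Omega> \<tau> k T"
  shows "(\<lambda>x. f x - g x) \<in> SBFEM_space \<Omega> \<tau> k T"
proof -
  have diff: "(\<lambda>x. f x - g x) \<in> L2 U \<and> (\<lambda>x. grad U f x - grad U g x) \<in> L2 U \<and>
      weak_gradient U (\<lambda>x. f x - g x) (\<lambda>x. grad U f x - grad U g x)"
    if "f \<in> H1 U" "g \<in> H1 U" "U \<in> sets lebesgue" for U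
    using weak_gradient_diff[OF H1_grad[OF that(1)] H1_grad[OF that(2)] that(3)]
      square_integrable_diff[OF H1_grad(1)[OF that(1), unfolded L2_eq] H1_grad(1)[OF that(2), unfolded L2_eq]]
      square_integrable_diff[OF H1_grad(2)[OF that(1), unfolded L2_eq] H1_grad(2)[OF that(2), unfolded L2_eq]]
    unfolding L2_eq by blast
  have "(\<lambda>x. f x - g x) \<in> SBFEM_local \<tau> k S" if S: "S \<in> T" for S
  proof -
    interpret E: star_body "body S" "center S" "facets S" by (rule star[OF S])
    let ?U = "interior (body S)"
    note U = E.interior_open_bounded
    have l: "f \<in> SBFEM_local \<tau> k S" "g \<in> SBFEM_local \<tau> k S" using f g S unfolding SBFEM_space_def by blast+
    then have dl: "f \<in> duffy_space \<tau> k S" "g \<in> duffy_space \<tau> k S" unfolding SBFEM_local_def by blast+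
    then have h: "f \<in> H1 ?U" "g \<in> H1 ?U" unfolding duffy_space_def by blast+
    note d = diff[OF h U(3)]
    have "dirichlet_form ?U (\<lambda>x. f x - g x) \<psi> = 0" if "\<psi> \<in> D00_center S" for \<psi>
    proof -
      have "\<psi> \<in> H1 ?U" using that unfolding D00_center_def radial_form_def by blast
      note p = H1_grad[OF this]
      have "dirichlet_form ?U (\<lambda>x. f x - g x) \<psi> = (LINT x|lebesgue_on ?U. (grad ?U f x - grad ?U g x) \<bullet> grad ?U \<psi> x)"
        using dirichlet_form_eq[OF U(1,2) _ _ _ p] d by blast
      also have "\<dots> = (LINT x|lebesgue_on ?U. grad ?U f x \<bullet> grad ?U \<psi> x - grad ?U g x \<bullet> grad ?U \<psi> x)"
        by (simp only: inner_diff_left)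
      also have "\<dots> = dirichlet_form ?U f \<psi> - dirichlet_form ?U g \<psi>"
        unfolding dirichlet_form_def
        by (rule Bochner_Integration.integral_diff)
          (rule square_integrable_inner[OF H1_grad(2)[unfolded L2_eq] p(2)[unfolded L2_eq]], rule h)+
      also have "\<dots> = 0" using l that unfolding SBFEM_local_def by simp
      finally show ?thesis .
    qed
    moreover have "(\<lambda>x. f x - g x) \<in> duffy_space \<tau> k S" by (rule duffy_space_diff[OF dl]) (use d H1I in blast)
    ultimately show ?thesis unfolding SBFEM_local_def by blast
  qed
  moreover have "(\<lambda>x. f x - g x) \<in> H1 \<Omega>"
    using diff[OF _ _ domain_open_bounded(3)] f g H1I unfolding SBFEM_space_def by blast
  ultimately show ?thesis unfolding SBFEM_space_def by blast
qed

end

section \<open>The error estimate\<close>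

text \<open>The function on the right is (a - b) - q - G. Here a - b is orthogonal to q, and its
  cross term with G cancels that of q with G, because the integrals of b \<bullet> G and q \<bullet>
  G are opposite; a sum of three squares remains.\<close>

lemma sqnorm_orthogonal_mono:
  assumes L: "a \<in> square_integrable M" "b \<in> square_integrable M" "q \<in> square_integrable M" "G \<in> square_integrable M"
    and orth: "(LINT x|M. a x \<bullet> q x) = 0" "(LINT x|M. b x \<bullet> q x) = 0" "(LINT x|M. a x \<bullet> G x) = 0"
      "(LINT x|M. (q x + b x) \<bullet> G x) = 0"
  shows "sqnorm M (\<lambda>x. a x - b x) \<le> sqnorm M (\<lambda>x. a x - (q x + b x + G x))"
proof -
  let ?d = "\<lambda>x. a x - b x" and ?r = "\<lambda>x. (-1) *\<^sub>R (q x + G x)"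
  note i = square_integrable_inner
  have d: "?d \<in> square_integrable M" by (rule square_integrable_diff[OF L(1,2)])
  have r: "?r \<in> square_integrable M" by (rule square_integrable_scaleR[OF square_integrable_add[OF L(3,4)]])
  have "(LINT x|M. (q x + b x) \<bullet> G x) = (LINT x|M. q x \<bullet> G x) + (LINT x|M. b x \<bullet> G x)"
    unfolding inner_add_left by (rule Bochner_Integration.integral_add[OF i[OF L(3,4)] i[OF L(2,4)]])
  then have qb: "(LINT x|M. b x \<bullet> G x) = - (LINT x|M. q x \<bullet> G x)" using orth(4) by simp
  have "?d x \<bullet> ?r x = (b x \<bullet> q x + b x \<bullet> G x) - (a x \<bullet> q x + a x \<bullet> G x)" for x
    by (simp add: inner_diff_left inner_diff_right inner_add_right)
  then have "(LINT x|M. ?d x \<bullet> ?r x) = (LINT x|M. b x \<bullet> G x)"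
    using i[OF L(1,3)] i[OF L(1,4)] i[OF L(2,3)] i[OF L(2,4)] orth(1,2,3) by simp
  moreover have "sqnorm M ?r = sqnorm M q + 2 * (LINT x|M. q x \<bullet> G x) + sqnorm M G"
    unfolding sqnorm_scaleR sqnorm_add[OF L(3,4)] by simp
  ultimately have "sqnorm M (\<lambda>x. ?d x + ?r x) = sqnorm M ?d + sqnorm M q + sqnorm M G"
    unfolding sqnorm_add[OF d r] by (simp add: qb)
  moreover have "(\<lambda>x. ?d x + ?r x) = (\<lambda>x. a x - (q x + b x + G x))" by (simp add: fun_eq_iff algebra_simps)
  ultimately show ?thesis using sqnorm_nonneg[of M q] sqnorm_nonneg[of M G] by simp
qed

theorem theorem5p1:
  fixes \<Omega> :: "(real^'n::finite) set"
    and \<tau> :: sector_type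
    and k :: nat
    and T :: "'n S_element set"
    and Dom :: "(real^'n \<Rightarrow> real) set"
    and I :: "(real^'n) set \<Rightarrow> (real^'n \<Rightarrow> real) \<Rightarrow> real^'n \<Rightarrow> real"
    and F PiS :: "(real^'n \<Rightarrow> real) \<Rightarrow> real^'n \<Rightarrow> real"
    and u u\<^sub>D uh g :: "real^'n \<Rightarrow> real"
  assumes "CARD('n) \<in> {2, 3}"
    and "k \<ge> 1"
    and "S_mesh \<Omega> \<tau> T"
    and "trace_interpolant \<Omega> \<tau> k T Dom I"
    and "FE_interpolant \<Omega> \<tau> k T Dom I F"
    and "SBFEM_interpolant \<Omega> \<tau> k T Dom I PiS"
    and "model_solution \<Omega> u\<^sub>D u"
    and "has_trace \<Omega> (skeleton T) u g" and "g \<in> Dom"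
    and "galerkin_SBFEM \<Omega> \<tau> k T I u\<^sub>D uh"
  shows "H1_seminorm \<Omega> (\<lambda>x. u x - uh x) \<le> H1_seminorm \<Omega> (\<lambda>x. u x - F u x)"
proof -
  have "CARD('n) \<ge> 2" using assms(1) by auto
  then interpret polytopal_mesh \<Omega> \<tau> T by (intro polytopal_mesh.intro assms(3))
  note \<Omega> = domain_open_bounded
  have u: "u \<in> H1 \<Omega>" and u_orth: "\<And>v. v \<in> H10 \<Omega> \<Longrightarrow> dirichlet_form \<Omega> u v = 0"
    and u_trace: "has_trace \<Omega> (frontier \<Omega>) u u\<^sub>D"
    using assms(7) unfolding model_solution_def by blast+
  have Fu: "F u \<in> FE_space \<Omega> \<tau> k T" and "has_trace \<Omega> (skeleton T) (F u) (glue T I g)"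
    using assms(5) u assms(8,9) unfolding FE_interpolant_def by blast+
  then obtain v N where v: "AE x in lebesgue_on \<Omega>. v x = F u x" "open N" "skeleton T \<subseteq> N"
      "continuous_on (N \<inter> closure \<Omega>) v" and v_eq: "\<forall>x\<in>skeleton T. v x = glue T I g x"
    unfolding has_trace_def by blast
  obtain P G where P: "continuous_on UNIV P" "P \<in> L2 \<Omega>" "G \<in> L2 \<Omega>" "weak_gradient \<Omega> P G" "\<forall>x\<in>frontier \<Omega>. P x = 0"
    and w: "(\<lambda>x. F u x - P x) \<in> SBFEM_space \<Omega> \<tau> k T"
    and PG: "(LINT x|lebesgue_on \<Omega>. (grad \<Omega> (F u) x - G x) \<bullet> G x) = 0"
    using FE_radial_correction[OF Fu assms(2) v] by blast
  have uh: "uh \<in> SBFEM_space \<Omega> \<tau> k T"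
    and uh_orth: "\<And>v. v \<in> SBFEM_space \<Omega> \<tau> k T \<Longrightarrow> v \<in> H10 \<Omega> \<Longrightarrow> dirichlet_form \<Omega> uh v = 0"
    using assms(10) unfolding galerkin_SBFEM_def by blast+
  obtain gh where gh: "has_trace \<Omega> (frontier \<Omega>) uh gh"
    "\<And>L x. L \<in> mesh_facets T \<Longrightarrow> L \<subseteq> frontier \<Omega> \<Longrightarrow> x \<in> L \<Longrightarrow> gh x = I L u\<^sub>D x"
    using assms(10) unfolding galerkin_SBFEM_def by blast
  obtain vh Nh where vh: "AE x in lebesgue_on \<Omega>. vh x = uh x" "open Nh" "frontier \<Omega> \<subseteq> Nh"
    "continuous_on (Nh \<inter> closure \<Omega>) vh" "\<forall>x\<in>frontier \<Omega>. vh x = gh x"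
    using gh(1) unfolding has_trace_def by blast
  \<comment> \<open>Both are boundary values of continuous representatives of u, and these are
    determined by the class of u.\<close>
  have boundary: "g x = u\<^sub>D x" if x: "x \<in> frontier \<Omega>" for x
  proof -
    obtain v1 N1 where 1: "AE x in lebesgue_on \<Omega>. v1 x = u x" "open N1" "skeleton T \<subseteq> N1"
        "continuous_on (N1 \<inter> closure \<Omega>) v1" "\<forall>x\<in>skeleton T. v1 x = g x"
      using assms(8) unfolding has_trace_def by blast
    obtain v2 N2 where 2: "AE x in lebesgue_on \<Omega>. v2 x = u x" "open N2" "frontier \<Omega> \<subseteq> N2"
        "continuous_on (N2 \<inter> closure \<Omega>) v2" "\<forall>x\<in>frontier \<Omega>. v2 x = u\<^sub>D x"
      using u_trace unfolding has_trace_def by blast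
    have s: "x \<in> skeleton T" using x frontier_subset_skeleton by blast
    have "v1 x = v2 x"
    proof (rule continuous_AE_eq[OF \<Omega>(1)])
      show "AE x in lebesgue_on \<Omega>. v1 x = v2 x" using 1(1) 2(1) by eventually_elim simp
      show "open (N1 \<inter> N2)" using 1(2) 2(2) by (rule open_Int)
      show "continuous_on (N1 \<inter> N2 \<inter> closure \<Omega>) v1" by (rule continuous_on_subset[OF 1(4)]) blast
      show "continuous_on (N1 \<inter> N2 \<inter> closure \<Omega>) v2" by (rule continuous_on_subset[OF 2(4)]) blast
      show "x \<in> N1 \<inter> N2" using s x 1(3) 2(3) by blast
      show "x \<in> closure \<Omega>" using x unfolding frontier_def by blast
    qed
    then show ?thesis using 1(5) 2(5) s x by simp
  qed
  \<comment> \<open>The corrected finite element interpolant minus the Galerkin solution: a test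
    function for both problems once its trace is shown to vanish.\<close>
  define e where "e x = (F u x - P x) - uh x" for x
  have e: "e \<in> SBFEM_space \<Omega> \<tau> k T" unfolding e_def[abs_def] by (rule SBFEM_space_diff[OF w uh])
  then have eH1: "e \<in> H1 \<Omega>" unfolding SBFEM_space_def by blast
  have "e \<in> H10 \<Omega>"
  proof (rule zero_trace_imp_H10[OF \<Omega>(1,2) eH1])
    show "AE x in lebesgue_on \<Omega>. (v x - P x) - vh x = e x" using v(1) vh(1) by eventually_elim (simp add: e_def)
    show "open (N \<inter> Nh)" using v(2) vh(2) by (rule open_Int)
    show "frontier \<Omega> \<subseteq> N \<inter> Nh" using frontier_subset_skeleton v(3) vh(3) by blast
    show "continuous_on (N \<inter> Nh \<inter> closure \<Omega>) (\<lambda>x. (v x - P x) - vh x)"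
      by (intro continuous_on_diff continuous_on_subset[OF v(4)] continuous_on_subset[OF vh(4)]
          continuous_on_subset[OF P(1)]) auto
    fix x assume x: "x \<in> frontier \<Omega>"
    \<comment> \<open>The Galerkin data are prescribed on the facets contained in the boundary, so x
      has to be placed in one of these.\<close>
    then obtain L where L: "L \<in> mesh_facets T" "x \<in> L" "L \<subseteq> frontier \<Omega>" using boundary_facet by blast
    have "v x = glue T I g x" using v_eq x frontier_subset_skeleton by blast
    also have "\<dots> = I L g x" using assms(4,9) L(1,2) unfolding trace_interpolant_def by blast
    also have "\<dots> = I L u\<^sub>D x"
    proof -
      \<comment> \<open>The whole facet lies in the boundary, so \<open>g\<close> and
        \<open>u\<^sub>D\<close> agree on all of it, and the interpolant on \<open>L\<close> depends
        on nothing else.\<close>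
      have "\<forall>y\<in>L. g y = u\<^sub>D y" using boundary L(3) by blast
      then show ?thesis using assms(4) L(1,2) unfolding trace_interpolant_def by blast
    qed
    also have "\<dots> = vh x" using vh(5) gh(2)[OF L(1,3,2)] x by simp
    finally show "(v x - P x) - vh x = 0" using P(5) x by simp
  qed
  have PH10: "P \<in> H10 \<Omega>"
    by (rule zero_trace_imp_H10[OF \<Omega>(1,2) H1I[OF P(2,3,4)], where v = P and N = UNIV])
      (use P(5) continuous_on_subset[OF P(1)] in auto)
  have FH1: "F u \<in> H1 \<Omega>" using Fu unfolding FE_space_def by blast
  have uhH1: "uh \<in> H1 \<Omega>" using uh unfolding SBFEM_space_def by blast
  define a b c where "a = grad \<Omega> u" and "b = grad \<Omega> uh" and "c = grad \<Omega> (F u)"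
  note a = H1_grad[OF u, folded a_def] and b = H1_grad[OF uhH1, folded b_def] and c = H1_grad[OF FH1, folded c_def]
  \<comment> \<open>The weak gradient of e; then q + b is the gradient of the corrected interpolant
    and q + b + G that of \<open>F u\<close>.\<close>
  define q where "q x = (c x - G x) - b x" for x
  note L2d = square_integrable_diff[where M = "lebesgue_on \<Omega>", folded L2_eq]
  have q: "e \<in> L2 \<Omega>" "q \<in> L2 \<Omega>" "weak_gradient \<Omega> e q"
    unfolding e_def[abs_def] q_def[abs_def]
    by (intro L2d a b c P weak_gradient_diff \<Omega>(3))+
  have "(LINT x|lebesgue_on \<Omega>. a x \<bullet> q x) = 0"
    using u_orth[OF \<open>e \<in> H10 \<Omega>\<close>] unfolding dirichlet_form_eq[OF \<Omega>(1,2) a q] .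
  moreover have "(LINT x|lebesgue_on \<Omega>. b x \<bullet> q x) = 0"
    using uh_orth[OF e \<open>e \<in> H10 \<Omega>\<close>] unfolding dirichlet_form_eq[OF \<Omega>(1,2) b q] .
  moreover have "(LINT x|lebesgue_on \<Omega>. a x \<bullet> G x) = 0"
    using u_orth[OF PH10] unfolding dirichlet_form_eq[OF \<Omega>(1,2) a P(2,3,4)] .
  moreover have "(LINT x|lebesgue_on \<Omega>. (q x + b x) \<bullet> G x) = 0" using PG unfolding c_def[symmetric] by (simp add: q_def)
  ultimately have "sqnorm (lebesgue_on \<Omega>) (\<lambda>x. a x - b x) \<le> sqnorm (lebesgue_on \<Omega>) (\<lambda>x. a x - (q x + b x + G x))"
    by (intro sqnorm_orthogonal_mono a(2)[unfolded L2_eq] b(2)[unfolded L2_eq] q(2)[unfolded L2_eq] P(3)[unfolded L2_eq])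
  also have "(\<lambda>x. a x - (q x + b x + G x)) = (\<lambda>x. a x - c x)" by (simp add: q_def)
  finally show ?thesis
    unfolding H1_seminorm_eq[OF \<Omega>(1,2) L2d[OF a(1) b(1)] L2d[OF a(2) b(2)] weak_gradient_diff[OF a b \<Omega>(3)]]
      H1_seminorm_eq[OF \<Omega>(1,2) L2d[OF a(1) c(1)] L2d[OF a(2) c(2)] weak_gradient_diff[OF a c \<Omega>(3)]]
    by (rule real_sqrt_le_mono)
qed

end
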